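(* Let $\Lambda$ be a ring with identity and let $T$ be a tilting complex in $K^b(\mathrm{proj}\text{-}\Lambda)$. Then the functor $\Phi\colon K(\mathrm{Sum}\text{-}T)\to K(\mathrm{Proj}\text{-}\Lambda)$ is the composition $\Phi=\Xi\circ\Theta$ of the two functors $\Theta\colon K(\mathrm{Sum}\text{-}T)\to K_\eta(\mathbb{Z}_+\mathrm{Proj}\text{-}\Lambda)$ and $\Xi\colon K_\eta(\mathbb{Z}_+\mathrm{Proj}\text{-}\Lambda)\to K(\mathrm{Proj}\text{-}\Lambda)$.
   Context: Categories of modules: $\mathrm{Proj}\text{-}\Lambda$ is the category of projective $\Lambda$-modules and $\mathrm{proj}\text{-}\Lambda$ that of finitely generated projective $\Lambda$-modules. $C(-)$, $K(-)$, $K^b(-)$ denote the category of complexes, the homotopy category of unbounded complexes, and the homotopy category of bounded complexes. A tilting complex is an object $T$ of $K^b(\mathrm{proj}\text{-}\Lambda)$ with (i) $\mathrm{Hom}_{K^b(\mathrm{proj}\text{-}\Lambda)}(T,T[n])=0$ for all $n\ne0$, and (ii) $\mathrm{add}\text{-}T$ (the full subcategory of direct summands of finite direct sums of copies of $T$) generates $K^b(\mathrm{proj}\text{-}\Lambda)$ as a triangulated category. $\mathrm{Sum}\text{-}T$ is the full subcategory of $K(\mathrm{Proj}\text{-}\Lambda)$ whose objects are the (arbitrary) direct sums of copies of $T$. The category $\mathbb{Z}_+\mathcal{A}$ (for an additive category $\mathcal{A}$): objects are $\mathbb{Z}$-graded objects $X^\bullet=(X^j)_{j\in\mathbb{Z}}$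 of $\mathcal{A}$; a morphism $f\colon X^\bullet\to Y^\bullet$ is a collection $f=\{f_0,f_1,\dots\}$ with $f_n=(f_n^j\colon X^j\to Y^{j+n})_{j\in\mathbb{Z}}$; composition is $(gf)_n^j=\sum_{k=0}^n g_{n-k}^{j+k}f_k^j$. The automorphism $(1)$ is $(X^\bullet(1))^j=X^{j+1}$, $(f(1))_n^j=f_n^{j+1}$, and $\eta\colon(1)\to\mathrm{Id}$ is $\eta_{X^\bullet}=\{0,\mathrm{Id},0,0,\dots\}$, i.e. its degree-one component $(X^\bullet(1))^j=X^{j+1}\to X^{j+1}$ is the identity. An object of $C(\mathbb{Z}_+\mathcal{A})$ is a bigraded object $X^{\bullet\bullet}$ with morphisms $d_n^{ij}\colon X^{ij}\to X^{i+1,j+n}$ ($n\ge0$) such that $\sum_{p+q=n}d_pd_q=0$ for all $n\ge 0$; a morphism is a collection $f_n^{ij}\colon X^{ij}\to Y^{i,j+n}$ ($n\ge0$) with $\sum_{p+q=n}f_pd_{X,q}=\sum_{p+q=n}d_{Y,p}f_q$ for all $n\ge 0$. The functor $(1)$ and transformation $\eta$ extend termwise to $C(\mathbb{Z}_+\mathcal{A})$. $K_\eta(\mathbb{Z}_+\mathcal{A})$ is the stable category of the Frobenius category $(C(\mathbb{Z}_+\mathcal{A}),\mathcal{E}_\eta)$, where $\mathcal{E}_\eta$ consists of the kernel-cokernel pairs isomorphic to $Y\xrightarrow{\binom01}\mathrm{Con}(f)\xrightarrow{(1\ 0)}X[1]$ for a chain map $f\colon X\to Y$ factoring through $\eta_Y\colon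 Y(1)\to Y$. (Here $(X[1])^n=X^{n+1}$, $d_{X[1]}^n=-d_X^{n+1}$, and $\mathrm{Con}(f)$ has terms $X^{n+1}\oplus Y^n$ and differential $\begin{pmatrix}-d_X^{n+1}&0\\ f^{n+1}&d_Y^n\end{pmatrix}$.) Its objects are those of $C(\mathbb{Z}_+\mathcal{A})$ and its morphisms are chain maps modulo those factoring through an injective object of this Frobenius category. The category $G(\Lambda)$ (Rickard): objects are bigraded objects $X^{**}$ of $\mathrm{Proj}\text{-}\Lambda$ with graded endomorphisms $d_n$ of bidegree $(1-n,n)$ ($n\ge0$) with $\sum_{p+q=n}d_pd_q=0$ for all $n\ge 0$; morphisms are collections $\{\alpha_n\}_{n\ge0}$ of graded maps $\alpha_n$ of bidegree $(-n,n)$ with $\sum_{p+q=n}\alpha_pd_{X,q}=\sum_{p+q=n}d_{Y,p}\alpha_q$ for all $n\ge 0$; composition is $(\alpha\beta)_n=\sum_{p+q=n}\alpha_p\beta_q$. There is an isomorphism of categories $\Psi\colon G(\Lambda)\to C(\mathbb{Z}_+\mathrm{Proj}\text{-}\Lambda)$ given by $(\Psi(X))^{ij}=X^{i-j,j}$, $d_{\Psi(X),n}^{ij}=d_n^{i-j,j}$, $(\Psi(\alpha))_n^{ij}=\alpha_n^{i-j,j}$. Objects of $C(\mathrm{Sum}\text{-}T)$: an object is written $X=(X^{\bullet\bullet},\delta_0,\delta_1)$, where for each $j$ the complex $X^{\bullet,j}$ with differential $\delta_0^{ij}\colon X^{ij}\to X^{i+1,j}$ lies in $\mathrm{Sum}\text{-}T$,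 and $\delta_1^{\bullet,j}\colon X^{\bullet,j}\to X^{\bullet,j+1}$ is a chain map (representing the differential of $X$) such that $\delta_1\delta_1$ is null-homotopic. Morphisms of $C(\mathrm{Sum}\text{-}T)$ are likewise given by families of chain maps $\alpha^{\bullet,j}\colon X^{\bullet,j}\to Y^{\bullet,j}$ representing homotopy classes. The operation $(-)^{**}$ and the functors $\Phi,\Theta$: by results of Rickard, for each object $X$ of $C(\mathrm{Sum}\text{-}T)$ one can choose an object $(X^{**},d_n\colon n\ge0)$ of $G(\Lambda)$ on the bigraded object $X^{\bullet\bullet}$ with $d_0^{ij}=\delta_0^{ij}$ and $d_1^{ij}=(-1)^{i+j}\delta_1^{ij}$, and for each morphism $\alpha\colon X\to Y$ in $C(\mathrm{Sum}\text{-}T)$ a morphism $\{\alpha_n\}\colon X^{**}\to Y^{**}$ in $G(\Lambda)$ with $\alpha_0=\alpha$; fix such choices. $\Phi(X)$ is the total complex of $X^{**}$, with degree-$m$ term $\bigoplus_{p+q=m}X^{pq}$ and differential $\sum_n d_n$, and $\Phi(\alpha)$ is the class in $K(\mathrm{Proj}\text{-}\Lambda)$ of the chain map $\sum_n\alpha_n$; this induces $\Phi$ on $K(\mathrm{Sum}\text{-}T)$. The functor $\Theta$ is induced by $X\mapsto\Psi(X^{**})$, $\alpha\mapsto\Psi(\{\alpha_n\})$. The functor $\Xi$: for an additive category $\mathcal{A}$, it is defined on the objects $X^\bullet$ of $\mathbb{Z}_+\mathcal{A}$ with only finitely many nonzero $X^j$ by $\Xi(X^\bullet)=\bigoplus_jX^j$,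 and for $f=\{f_0,f_1,\dots\}\colon X^\bullet\to Y^\bullet$ the map $\Xi(f)$ is the lower triangular matrix whose component $X^j\to Y^{j+n}$ is $f_n^j$ for $n\ge0$ and whose other components are $0$. If $\mathcal{A}$ admits infinite direct sums, $\Xi\colon\mathbb{Z}_+\mathcal{A}\to\mathcal{A}$ is defined similarly on all of $\mathbb{Z}_+\mathcal{A}$; here this is used for $\mathcal{A}=\mathrm{Proj}\text{-}\Lambda$. It is applied termwise to complexes and induces the functor $\Xi\colon K_\eta(\mathbb{Z}_+\mathrm{Proj}\text{-}\Lambda)\to K(\mathrm{Proj}\text{-}\Lambda)$.
   Formalization: Ξ is not defined on all of K_η(Z_+Proj-Λ), since a lower triangular matrix may have an infinite column; it is taken on the full subcategory of complexes X with, for each i, only finitely many nonzero X^{ij}, which contains the image of Θ. *)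

theory Defs
  imports "HOL-Algebra.Module" "HOL-Library.FuncSet"
begin

section \<open>Modules over a not necessarily commutative ring\<close>

text \<open>Modules are right modules: \<open>r \<odot> x\<close> stands for \<open>x \<cdot> r\<close>. The library locale \<open>module\<close> needs a
  commutative ring, so only its record type is reused (the fields \<open>mult\<close> and \<open>one\<close> play no role).\<close>

locale right_module = R?: ring R + M?: abelian_group M
  for R (structure) and M (structure) +
  assumes smult_closed: "\<lbrakk>r \<in> carrier R; x \<in> carrier M\<rbrakk> \<Longrightarrow> r \<odot>\<^bsub>M\<^esub> x \<in> carrier M"
    and smult_add_ring: "\<lbrakk>r \<in> carrier R; s \<in> carrier R; x \<in> carrier M\<rbrakk>
      \<Longrightarrow> (r \<oplus>\<^bsub>R\<^esub> s) \<odot>\<^bsub>M\<^esub> x = r \<odot>\<^bsub>M\<^esub> x \<oplus>\<^bsub>M\<^esub> s \<odot>\<^bsub>M\<^esub> x"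
    and smult_add: "\<lbrakk>r \<in> carrier R; x \<in> carrier M; y \<in> carrier M\<rbrakk>
      \<Longrightarrow> r \<odot>\<^bsub>M\<^esub> (x \<oplus>\<^bsub>M\<^esub> y) = r \<odot>\<^bsub>M\<^esub> x \<oplus>\<^bsub>M\<^esub> r \<odot>\<^bsub>M\<^esub> y"
    and smult_mult: "\<lbrakk>r \<in> carrier R; s \<in> carrier R; x \<in> carrier M\<rbrakk>
      \<Longrightarrow> (r \<otimes>\<^bsub>R\<^esub> s) \<odot>\<^bsub>M\<^esub> x = s \<odot>\<^bsub>M\<^esub> (r \<odot>\<^bsub>M\<^esub> x)"
    and smult_one: "x \<in> carrier M \<Longrightarrow> \<one>\<^bsub>R\<^esub> \<odot>\<^bsub>M\<^esub> x = x"

definition rmod_hom ::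
  "('r, 'q) ring_scheme \<Rightarrow> ('r, 'm) module \<Rightarrow> ('r, 'n) module \<Rightarrow> ('m \<Rightarrow> 'n) set" where
  "rmod_hom R M N = {f \<in> carrier M \<rightarrow> carrier N.
     (\<forall>x\<in>carrier M. \<forall>y\<in>carrier M. f (x \<oplus>\<^bsub>M\<^esub> y) = f x \<oplus>\<^bsub>N\<^esub> f y) \<and>
     (\<forall>r\<in>carrier R. \<forall>x\<in>carrier M. f (r \<odot>\<^bsub>M\<^esub> x) = r \<odot>\<^bsub>N\<^esub> f x)}"

text \<open>The lifting property. Testing it on modules of the displayed types is no restriction: the free
  module on the set \<open>carrier P\<close> has elements of type \<open>'m \<Rightarrow> 'r\<close>, and lifting the identity along its
  canonical map onto \<open>P\<close> makes \<open>P\<close> a direct summand of a free module, whence the lifting property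
  for all epimorphisms.\<close>

definition projective_module :: "('r, 'q) ring_scheme \<Rightarrow> ('r, 'm) module \<Rightarrow> bool" where
  "projective_module R P \<longleftrightarrow> right_module R P \<and>
     (\<forall>(M :: ('r, 'm \<Rightarrow> 'r) module) (N :: ('r, 'm) module) g f.
        right_module R M \<longrightarrow> right_module R N \<longrightarrow>
        g \<in> rmod_hom R M N \<longrightarrow> g ` carrier M = carrier N \<longrightarrow> f \<in> rmod_hom R P N \<longrightarrow>
        (\<exists>h\<in>rmod_hom R P M. \<forall>x\<in>carrier P. g (h x) = f x))"

definition finitely_generated :: "('r, 'q) ring_scheme \<Rightarrow> ('r, 'm) module \<Rightarrow> bool" where
  "finitely_generated R M \<longleftrightarrow> (\<exists>S. finite S \<and> S \<subseteq> carrier M \<and>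
     (\<forall>x\<in>carrier M. \<exists>c\<in>S \<rightarrow> carrier R. x = (\<Oplus>\<^bsub>M\<^esub>s\<in>S. c s \<odot>\<^bsub>M\<^esub> s)))"

definition zero_module :: "('r, 'm) module \<Rightarrow> bool" where
  "zero_module M \<longleftrightarrow> carrier M = {\<zero>\<^bsub>M\<^esub>}"

definition direct_sum :: "'i set \<Rightarrow> ('i \<Rightarrow> ('r, 'm) module) \<Rightarrow> ('r, 'i \<Rightarrow> 'm) module" where
  "direct_sum I M =
     \<lparr>carrier = {x \<in> (\<Pi>\<^sub>E k\<in>I. carrier (M k)). finite {k\<in>I. x k \<noteq> \<zero>\<^bsub>M k\<^esub>}},
      mult = undefined, one = undefined,
      zero = (\<lambda>k\<in>I. \<zero>\<^bsub>M k\<^esub>),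
      add = (\<lambda>x y. \<lambda>k\<in>I. x k \<oplus>\<^bsub>M k\<^esub> y k),
      smult = (\<lambda>r x. \<lambda>k\<in>I. r \<odot>\<^bsub>M k\<^esub> x k)\<rparr>"

definition module_prod :: "('r, 'm) module \<Rightarrow> ('r, 'n) module \<Rightarrow> ('r, 'm \<times> 'n) module" where
  "module_prod M N =
     \<lparr>carrier = carrier M \<times> carrier N,
      mult = undefined, one = undefined,
      zero = (\<zero>\<^bsub>M\<^esub>, \<zero>\<^bsub>N\<^esub>),
      add = (\<lambda>(x, y) (x', y'). (x \<oplus>\<^bsub>M\<^esub> x', y \<oplus>\<^bsub>N\<^esub> y')),
      smult = (\<lambda>r (x, y). (r \<odot>\<^bsub>M\<^esub> x, r \<odot>\<^bsub>N\<^esub> y))\<rparr>"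


section \<open>Categories and functors\<close>

record ('o, 'h) cat =
  Obj :: "'o set"
  Hom :: "'o \<Rightarrow> 'o \<Rightarrow> 'h set"
  Id :: "'o \<Rightarrow> 'h"
  Comp :: "'o \<Rightarrow> 'o \<Rightarrow> 'o \<Rightarrow> 'h \<Rightarrow> 'h \<Rightarrow> 'h"

text \<open>\<open>Comp C X Y Z g f\<close> is the composite of \<open>f : X \<rightarrow> Y\<close> and \<open>g : Y \<rightarrow> Z\<close>.\<close>

definition is_category :: "('o, 'h) cat \<Rightarrow> bool" where
  "is_category C \<longleftrightarrow>
     (\<forall>X\<in>Obj C. Id C X \<in> Hom C X X) \<and>
     (\<forall>X\<in>Obj C. \<forall>Y\<in>Obj C. \<forall>Z\<in>Obj C. \<forall>f\<in>Hom C X Y. \<forall>g\<in>Hom C Y Z.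
        Comp C X Y Z g f \<in> Hom C X Z) \<and>
     (\<forall>X\<in>Obj C. \<forall>Y\<in>Obj C. \<forall>f\<in>Hom C X Y.
        Comp C X X Y f (Id C X) = f \<and> Comp C X Y Y (Id C Y) f = f) \<and>
     (\<forall>W\<in>Obj C. \<forall>X\<in>Obj C. \<forall>Y\<in>Obj C. \<forall>Z\<in>Obj C.
        \<forall>f\<in>Hom C W X. \<forall>g\<in>Hom C X Y. \<forall>h\<in>Hom C Y Z.
        Comp C W X Z (Comp C X Y Z h g) f = Comp C W Y Z h (Comp C W X Y g f))"

record ('o, 'h, 'p, 'k) fctr =
  fobj :: "'o \<Rightarrow> 'p"
  fmor :: "'o \<Rightarrow> 'o \<Rightarrow> 'h \<Rightarrow> 'k"

definition is_functor :: "('o, 'h) cat \<Rightarrow> ('p, 'k) cat \<Rightarrow> ('o, 'h, 'p, 'k) fctr \<Rightarrow> bool" where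
  "is_functor C D F \<longleftrightarrow> is_category C \<and> is_category D \<and>
     (\<forall>X\<in>Obj C. fobj F X \<in> Obj D) \<and>
     (\<forall>X\<in>Obj C. \<forall>Y\<in>Obj C. \<forall>f\<in>Hom C X Y. fmor F X Y f \<in> Hom D (fobj F X) (fobj F Y)) \<and>
     (\<forall>X\<in>Obj C. fmor F X X (Id C X) = Id D (fobj F X)) \<and>
     (\<forall>X\<in>Obj C. \<forall>Y\<in>Obj C. \<forall>Z\<in>Obj C. \<forall>f\<in>Hom C X Y. \<forall>g\<in>Hom C Y Z.
        fmor F X Z (Comp C X Y Z g f) =
        Comp D (fobj F X) (fobj F Y) (fobj F Z) (fmor F Y Z g) (fmor F X Y f))"

definition functor_comp ::
  "('p, 'k, 's, 'l) fctr \<Rightarrow> ('o, 'h, 'p, 'k) fctr \<Rightarrow> ('o, 'h, 's, 'l) fctr" where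
  "functor_comp G F =
     \<lparr>fobj = (\<lambda>X. fobj G (fobj F X)),
      fmor = (\<lambda>X Y f. fmor G (fobj F X) (fobj F Y) (fmor F X Y f))\<rparr>"

definition functor_eq ::
  "('o, 'h) cat \<Rightarrow> ('o, 'h, 'p, 'k) fctr \<Rightarrow> ('o, 'h, 'p, 'k) fctr \<Rightarrow> bool" where
  "functor_eq C F G \<longleftrightarrow>
     (\<forall>X\<in>Obj C. fobj F X = fobj G X) \<and>
     (\<forall>X\<in>Obj C. \<forall>Y\<in>Obj C. \<forall>f\<in>Hom C X Y. fmor F X Y f = fmor G X Y f)"

definition full_subcat :: "('o, 'h) cat \<Rightarrow> ('o \<Rightarrow> bool) \<Rightarrow> ('o, 'h) cat" where
  "full_subcat C P = C\<lparr>Obj := {X \<in> Obj C. P X}\<rparr>"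

text \<open>The category whose morphisms are equivalence classes of the given representatives, and the
  functor induced by an assignment on representatives. In both, the union over all representatives
  is a single class exactly when the construction is well defined; this is part of
  \<open>is_category\<close> and \<open>is_functor\<close>.\<close>

definition quotient_cat ::
  "'o set \<Rightarrow> ('o \<Rightarrow> 'o \<Rightarrow> 'f set) \<Rightarrow> ('o \<Rightarrow> 'o \<Rightarrow> ('f \<times> 'f) set) \<Rightarrow> ('o \<Rightarrow> 'f) \<Rightarrow>
   ('o \<Rightarrow> 'o \<Rightarrow> 'o \<Rightarrow> 'f \<Rightarrow> 'f \<Rightarrow> 'f) \<Rightarrow> ('o, 'f set) cat" where
  "quotient_cat Ob Mor Rel idn cmp =
     \<lparr>Obj = Ob,
      Hom = (\<lambda>X Y. Mor X Y // Rel X Y),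
      Id = (\<lambda>X. Rel X X `` {idn X}),
      Comp = (\<lambda>X Y Z c' c. \<Union>g\<in>c'. \<Union>f\<in>c. Rel X Z `` {cmp X Y Z g f})\<rparr>"

definition induced_functor ::
  "('p \<Rightarrow> 'p \<Rightarrow> ('g \<times> 'g) set) \<Rightarrow> ('o \<Rightarrow> 'p) \<Rightarrow> ('o \<Rightarrow> 'o \<Rightarrow> 'f \<Rightarrow> 'g) \<Rightarrow>
   ('o, 'f set, 'p, 'g set) fctr" where
  "induced_functor Rel F0 F1 =
     \<lparr>fobj = F0,
      fmor = (\<lambda>X Y c. \<Union>f\<in>c. Rel (F0 X) (F0 Y) `` {F1 X Y f})\<rparr>"


section \<open>Complexes of projective modules and the homotopy category\<close>

record ('r, 'm) cpx =
  Cmod :: "int \<Rightarrow> ('r, 'm) module"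
  Cdiff :: "int \<Rightarrow> 'm \<Rightarrow> 'm"

definition proj_complexes :: "('r, 'q) ring_scheme \<Rightarrow> ('r, 'm) cpx set" where
  "proj_complexes R = {C.
     (\<forall>i. projective_module R (Cmod C i)) \<and>
     (\<forall>i. Cdiff C i \<in> rmod_hom R (Cmod C i) (Cmod C (i + 1))) \<and>
     (\<forall>i. \<forall>x\<in>carrier (Cmod C i). Cdiff C (i + 1) (Cdiff C i x) = \<zero>\<^bsub>Cmod C (i + 2)\<^esub>)}"

definition bounded_cpx :: "('r, 'm) cpx \<Rightarrow> bool" where
  "bounded_cpx C \<longleftrightarrow> (\<exists>a b. \<forall>i. i < a \<or> b < i \<longrightarrow> zero_module (Cmod C i))"

definition perfect_complexes :: "('r, 'q) ring_scheme \<Rightarrow> ('r, 'm) cpx set" where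
  "perfect_complexes R =
     {C \<in> proj_complexes R. bounded_cpx C \<and> (\<forall>i. finitely_generated R (Cmod C i))}"

definition chain_maps ::
  "('r, 'q) ring_scheme \<Rightarrow> ('r, 'm) cpx \<Rightarrow> ('r, 'n) cpx \<Rightarrow> (int \<Rightarrow> 'm \<Rightarrow> 'n) set" where
  "chain_maps R C D = {f. \<forall>i. f i \<in> rmod_hom R (Cmod C i) (Cmod D i) \<and>
     (\<forall>x\<in>carrier (Cmod C i). f (i + 1) (Cdiff C i x) = Cdiff D i (f i x))}"

definition homotopic ::
  "('r, 'q) ring_scheme \<Rightarrow> ('r, 'm) cpx \<Rightarrow> ('r, 'n) cpx \<Rightarrow>
   (int \<Rightarrow> 'm \<Rightarrow> 'n) \<Rightarrow> (int \<Rightarrow> 'm \<Rightarrow> 'n) \<Rightarrow> bool" where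
  "homotopic R C D f g \<longleftrightarrow>
     (\<exists>h. (\<forall>i. h i \<in> rmod_hom R (Cmod C i) (Cmod D (i - 1))) \<and>
          (\<forall>i. \<forall>x\<in>carrier (Cmod C i).
             f i x = g i x \<oplus>\<^bsub>Cmod D i\<^esub>
               (Cdiff D (i - 1) (h i x) \<oplus>\<^bsub>Cmod D i\<^esub> h (i + 1) (Cdiff C i x))))"

definition zero_map :: "('r, 'n) cpx \<Rightarrow> int \<Rightarrow> 'm \<Rightarrow> 'n" where
  "zero_map D = (\<lambda>i x. \<zero>\<^bsub>Cmod D i\<^esub>)"

text \<open>In every quotient category below, the equivalence relation only looks at values on carriers, so
  representatives differing outside the carriers define the same morphism.\<close>

definition homotopy_rel ::
  "('r, 'q) ring_scheme \<Rightarrow> ('r, 'm) cpx \<Rightarrow> ('r, 'n) cpx \<Rightarrow>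
   ((int \<Rightarrow> 'm \<Rightarrow> 'n) \<times> (int \<Rightarrow> 'm \<Rightarrow> 'n)) set" where
  "homotopy_rel R C D =
     {(f, g). f \<in> chain_maps R C D \<and> g \<in> chain_maps R C D \<and> homotopic R C D f g}"

definition K_Proj ::
  "('r, 'q) ring_scheme \<Rightarrow> (('r, 'm) cpx, (int \<Rightarrow> 'm \<Rightarrow> 'm) set) cat" where
  "K_Proj R = quotient_cat (proj_complexes R) (chain_maps R) (homotopy_rel R)
     (\<lambda>C i x. x) (\<lambda>C D E g f i x. g i (f i x))"


section \<open>Tilting complexes\<close>

definition cpx_shift :: "int \<Rightarrow> ('r, 'm) cpx \<Rightarrow> ('r, 'm) cpx" where
  "cpx_shift n C =
     \<lparr>Cmod = (\<lambda>i. Cmod C (i + n)),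
      Cdiff = (\<lambda>i x. if even n then Cdiff C (i + n) x
                     else \<ominus>\<^bsub>Cmod C (i + n + 1)\<^esub> Cdiff C (i + n) x)\<rparr>"

definition cpx_cone ::
  "('r, 'm) cpx \<Rightarrow> ('r, 'n) cpx \<Rightarrow> (int \<Rightarrow> 'm \<Rightarrow> 'n) \<Rightarrow> ('r, 'm \<times> 'n) cpx" where
  "cpx_cone X Y f =
     \<lparr>Cmod = (\<lambda>i. module_prod (Cmod X (i + 1)) (Cmod Y i)),
      Cdiff = (\<lambda>i (x, y). (\<ominus>\<^bsub>Cmod X (i + 2)\<^esub> Cdiff X (i + 1) x,
                           f (i + 1) x \<oplus>\<^bsub>Cmod Y (i + 1)\<^esub> Cdiff Y i y))\<rparr>"

definition cpx_prod :: "('r, 'm) cpx \<Rightarrow> ('r, 'n) cpx \<Rightarrow> ('r, 'm \<times> 'n) cpx" where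
  "cpx_prod X Y =
     \<lparr>Cmod = (\<lambda>i. module_prod (Cmod X i) (Cmod Y i)),
      Cdiff = (\<lambda>i (x, y). (Cdiff X i x, Cdiff Y i y))\<rparr>"

definition cpx_copies :: "'i set \<Rightarrow> ('r, 'm) cpx \<Rightarrow> ('r, 'i \<Rightarrow> 'm) cpx" where
  "cpx_copies I C =
     \<lparr>Cmod = (\<lambda>i. direct_sum I (\<lambda>k. Cmod C i)),
      Cdiff = (\<lambda>i x. \<lambda>k\<in>I. Cdiff C i (x k))\<rparr>"

definition homotopy_equivalent ::
  "('r, 'q) ring_scheme \<Rightarrow> ('r, 'm) cpx \<Rightarrow> ('r, 'n) cpx \<Rightarrow> bool" where
  "homotopy_equivalent R C D \<longleftrightarrow> (\<exists>f\<in>chain_maps R C D. \<exists>g\<in>chain_maps R D C.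
     homotopic R C C (\<lambda>i x. g i (f i x)) (\<lambda>i x. x) \<and>
     homotopic R D D (\<lambda>i y. f i (g i y)) (\<lambda>i y. y))"

definition cpx_isomorphic ::
  "('r, 'q) ring_scheme \<Rightarrow> ('r, 'm) cpx \<Rightarrow> ('r, 'n) cpx \<Rightarrow> bool" where
  "cpx_isomorphic R C D \<longleftrightarrow> (\<exists>f\<in>chain_maps R C D. \<exists>g\<in>chain_maps R D C.
     (\<forall>i. \<forall>x\<in>carrier (Cmod C i). g i (f i x) = x) \<and>
     (\<forall>i. \<forall>y\<in>carrier (Cmod D i). f i (g i y) = y))"

text \<open>Generation takes place in the bounded homotopy category of finitely generated projective
  modules with elements of type \<open>nat \<Rightarrow> 'r\<close>. Every such module over \<open>R\<close> has an isomorphic copy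
  there, namely a submodule of some finite power of \<open>R\<close>, so up to equivalence this is the whole
  category.\<close>

definition in_add ::
  "('r, 'q) ring_scheme \<Rightarrow> ('r, 'm) cpx \<Rightarrow> ('r, nat \<Rightarrow> 'r) cpx \<Rightarrow> bool" where
  "in_add R T C \<longleftrightarrow> C \<in> perfect_complexes R \<and>
     (\<exists>(C' :: ('r, nat \<Rightarrow> 'r) cpx) (n :: nat). C' \<in> perfect_complexes R \<and>
        homotopy_equivalent R (cpx_prod C C') (cpx_copies {..<n} T))"

inductive generated ::
  "('r, 'q) ring_scheme \<Rightarrow> ('r, 'm) cpx \<Rightarrow> ('r, nat \<Rightarrow> 'r) cpx \<Rightarrow> bool"
  for R and T where
  gen_add: "in_add R T C \<Longrightarrow> generated R T C"
| gen_iso: "\<lbrakk>generated R T C; D \<in> perfect_complexes R; homotopy_equivalent R C D\<rbrakk>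
    \<Longrightarrow> generated R T D"
| gen_shift: "generated R T C \<Longrightarrow> generated R T (cpx_shift n C)"
| gen_cone: "\<lbrakk>generated R T C; generated R T D; f \<in> chain_maps R C D; E \<in> perfect_complexes R;
     homotopy_equivalent R (cpx_cone C D f) E\<rbrakk> \<Longrightarrow> generated R T E"

definition tilting_complex :: "('r, 'q) ring_scheme \<Rightarrow> ('r, 'm) cpx \<Rightarrow> bool" where
  "tilting_complex R T \<longleftrightarrow> T \<in> perfect_complexes R \<and>
     (\<forall>n. n \<noteq> 0 \<longrightarrow> (\<forall>f\<in>chain_maps R T (cpx_shift n T).
        homotopic R T (cpx_shift n T) f (zero_map (cpx_shift n T)))) \<and>
     (\<forall>C\<in>perfect_complexes R. generated R T C)"


section \<open>Complexes over \<open>Sum-T\<close>\<close>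

text \<open>Index sets \<open>I :: 'x set\<close> suffice for a complex with elements of type \<open>'x\<close>: if \<open>T\<close> is nonzero
  in some degree then a direct sum of \<open>I\<close> copies of \<open>T\<close> contains \<open>I\<close> as a set, and otherwise all
  such direct sums are zero.\<close>

definition Sum_T :: "('r, 'q) ring_scheme \<Rightarrow> ('r, 'm) cpx \<Rightarrow> ('r, 'x) cpx set" where
  "Sum_T R T = {C \<in> proj_complexes R. \<exists>I :: 'x set. cpx_isomorphic R (cpx_copies I T) C}"

record ('r, 'x) sumT_cpx =
  Smod :: "int \<Rightarrow> int \<Rightarrow> ('r, 'x) module"
  S0 :: "int \<Rightarrow> int \<Rightarrow> 'x \<Rightarrow> 'x"
  S1 :: "int \<Rightarrow> int \<Rightarrow> 'x \<Rightarrow> 'x"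

definition col :: "('r, 'x) sumT_cpx \<Rightarrow> int \<Rightarrow> ('r, 'x) cpx" where
  "col X j = \<lparr>Cmod = (\<lambda>i. Smod X i j), Cdiff = (\<lambda>i. S0 X i j)\<rparr>"

definition SumT_complexes ::
  "('r, 'q) ring_scheme \<Rightarrow> ('r, 'm) cpx \<Rightarrow> ('r, 'x) sumT_cpx set" where
  "SumT_complexes R T = {X. \<forall>j.
     col X j \<in> Sum_T R T \<and>
     (\<lambda>i. S1 X i j) \<in> chain_maps R (col X j) (col X (j + 1)) \<and>
     homotopic R (col X j) (col X (j + 2))
       (\<lambda>i x. S1 X i (j + 1) (S1 X i j x)) (zero_map (col X (j + 2)))}"

definition SumT_maps ::
  "('r, 'q) ring_scheme \<Rightarrow> ('r, 'x) sumT_cpx \<Rightarrow> ('r, 'x) sumT_cpx \<Rightarrow>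
   (int \<Rightarrow> int \<Rightarrow> 'x \<Rightarrow> 'x) set" where
  "SumT_maps R X Y = {\<alpha>. \<forall>j.
     (\<lambda>i. \<alpha> i j) \<in> chain_maps R (col X j) (col Y j) \<and>
     homotopic R (col X j) (col Y (j + 1))
       (\<lambda>i x. S1 Y i j (\<alpha> i j x)) (\<lambda>i x. \<alpha> i (j + 1) (S1 X i j x))}"

text \<open>Two representing families are identified when they differ by \<open>\<delta>\<^sub>1 h + h \<delta>\<^sub>1\<close> in \<open>Sum-T\<close>,
  i.e. up to chain homotopy with respect to \<open>\<delta>\<^sub>0\<close> in each column.\<close>

definition SumT_rel ::
  "('r, 'q) ring_scheme \<Rightarrow> ('r, 'x) sumT_cpx \<Rightarrow> ('r, 'x) sumT_cpx \<Rightarrow>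
   ((int \<Rightarrow> int \<Rightarrow> 'x \<Rightarrow> 'x) \<times> (int \<Rightarrow> int \<Rightarrow> 'x \<Rightarrow> 'x)) set" where
  "SumT_rel R X Y = {(\<alpha>, \<beta>). \<alpha> \<in> SumT_maps R X Y \<and> \<beta> \<in> SumT_maps R X Y \<and>
     (\<exists>h. (\<forall>j. (\<lambda>i. h i j) \<in> chain_maps R (col X j) (col Y (j - 1))) \<and>
          (\<forall>j. homotopic R (col X j) (col Y j) (\<lambda>i. \<alpha> i j)
             (\<lambda>i x. \<beta> i j x \<oplus>\<^bsub>Smod Y i j\<^esub>
                (S1 Y i (j - 1) (h i j x) \<oplus>\<^bsub>Smod Y i j\<^esub> h i (j + 1) (S1 X i j x)))))}"

definition K_SumT ::
  "('r, 'q) ring_scheme \<Rightarrow> ('r, 'm) cpx \<Rightarrow>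
   (('r, 'x) sumT_cpx, (int \<Rightarrow> int \<Rightarrow> 'x \<Rightarrow> 'x) set) cat" where
  "K_SumT R T = quotient_cat (SumT_complexes R T) (SumT_maps R) (SumT_rel R)
     (\<lambda>X i j x. x) (\<lambda>X Y Z \<beta> \<alpha> i j x. \<beta> i j (\<alpha> i j x))"


section \<open>Complexes over \<open>\<int>\<^sub>+ Proj\<close>\<close>

text \<open>The same record carries the objects of \<open>C(\<int>\<^sub>+ Proj)\<close>, where \<open>Bdiff X n i j\<close> has bidegree
  \<open>(1, n)\<close>, and those of Rickard's category \<open>G\<close>, where it has bidegree \<open>(1 - n, n)\<close>.\<close>

record ('r, 'x) bigraded =
  Bmod :: "int \<Rightarrow> int \<Rightarrow> ('r, 'x) module"
  Bdiff :: "nat \<Rightarrow> int \<Rightarrow> int \<Rightarrow> 'x \<Rightarrow> 'x"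

type_synonym ('x, 'y) gmap = "nat \<Rightarrow> int \<Rightarrow> int \<Rightarrow> 'x \<Rightarrow> 'y"

definition Z_complexes :: "('r, 'q) ring_scheme \<Rightarrow> ('r, 'x) bigraded set" where
  "Z_complexes R = {X.
     (\<forall>i j. projective_module R (Bmod X i j)) \<and>
     (\<forall>n i j. Bdiff X n i j \<in> rmod_hom R (Bmod X i j) (Bmod X (i + 1) (j + int n))) \<and>
     (\<forall>n i j. \<forall>x\<in>carrier (Bmod X i j).
        (\<Oplus>\<^bsub>Bmod X (i + 2) (j + int n)\<^esub>q\<in>{..n}.
           Bdiff X (n - q) (i + 1) (j + int q) (Bdiff X q i j x))
        = \<zero>\<^bsub>Bmod X (i + 2) (j + int n)\<^esub>)}"

definition Z_maps ::
  "('r, 'q) ring_scheme \<Rightarrow> ('r, 'x) bigraded \<Rightarrow> ('r, 'y) bigraded \<Rightarrow> ('x, 'y) gmap set" where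
  "Z_maps R X Y = {f.
     (\<forall>n i j. f n i j \<in> rmod_hom R (Bmod X i j) (Bmod Y i (j + int n))) \<and>
     (\<forall>n i j. \<forall>x\<in>carrier (Bmod X i j).
        (\<Oplus>\<^bsub>Bmod Y (i + 1) (j + int n)\<^esub>q\<in>{..n}.
           f (n - q) (i + 1) (j + int q) (Bdiff X q i j x))
        = (\<Oplus>\<^bsub>Bmod Y (i + 1) (j + int n)\<^esub>q\<in>{..n}.
           Bdiff Y (n - q) i (j + int q) (f q i j x)))}"

definition Z_comp :: "('r, 'z) bigraded \<Rightarrow> ('y, 'z) gmap \<Rightarrow> ('x, 'y) gmap \<Rightarrow> ('x, 'z) gmap" where
  "Z_comp Z g f = (\<lambda>n i j x.
     \<Oplus>\<^bsub>Bmod Z i (j + int n)\<^esub>k\<in>{..n}. g (n - k) i (j + int k) (f k i j x))"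

definition Z_id :: "('r, 'x) bigraded \<Rightarrow> ('x, 'x) gmap" where
  "Z_id X = (\<lambda>n i j x. if n = 0 then x else \<zero>\<^bsub>Bmod X i (j + int n)\<^esub>)"

definition Z_eq :: "('r, 'x) bigraded \<Rightarrow> ('x, 'y) gmap \<Rightarrow> ('x, 'y) gmap \<Rightarrow> bool" where
  "Z_eq X f g \<longleftrightarrow> (\<forall>n i j. \<forall>x\<in>carrier (Bmod X i j). f n i j x = g n i j x)"

definition Z_iso ::
  "('r, 'q) ring_scheme \<Rightarrow> ('r, 'x) bigraded \<Rightarrow> ('r, 'y) bigraded \<Rightarrow> ('x, 'y) gmap \<Rightarrow> bool" where
  "Z_iso R X Y f \<longleftrightarrow> f \<in> Z_maps R X Y \<and>
     (\<exists>g\<in>Z_maps R Y X. Z_eq X (Z_comp X g f) (Z_id X) \<and> Z_eq Y (Z_comp Y f g) (Z_id Y))"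

definition Z_twist :: "('r, 'x) bigraded \<Rightarrow> ('r, 'x) bigraded" where
  "Z_twist X = \<lparr>Bmod = (\<lambda>i j. Bmod X i (j + 1)), Bdiff = (\<lambda>n i j. Bdiff X n i (j + 1))\<rparr>"

definition Z_eta :: "('r, 'x) bigraded \<Rightarrow> ('x, 'x) gmap" where
  "Z_eta X = (\<lambda>n i j x. if n = 1 then x else \<zero>\<^bsub>Bmod X i (j + int n)\<^esub>)"

definition Z_shift :: "('r, 'x) bigraded \<Rightarrow> ('r, 'x) bigraded" where
  "Z_shift X =
     \<lparr>Bmod = (\<lambda>i j. Bmod X (i + 1) j),
      Bdiff = (\<lambda>n i j x. \<ominus>\<^bsub>Bmod X (i + 2) (j + int n)\<^esub> Bdiff X n (i + 1) j x)\<rparr>"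

definition Z_cone ::
  "('r, 'x) bigraded \<Rightarrow> ('r, 'y) bigraded \<Rightarrow> ('x, 'y) gmap \<Rightarrow> ('r, 'x \<times> 'y) bigraded" where
  "Z_cone X Y f =
     \<lparr>Bmod = (\<lambda>i j. module_prod (Bmod X (i + 1) j) (Bmod Y i j)),
      Bdiff = (\<lambda>n i j (x, y).
        (\<ominus>\<^bsub>Bmod X (i + 2) (j + int n)\<^esub> Bdiff X n (i + 1) j x,
         f n (i + 1) j x \<oplus>\<^bsub>Bmod Y (i + 1) (j + int n)\<^esub> Bdiff Y n i j y))\<rparr>"

definition cone_in ::
  "('r, 'x) bigraded \<Rightarrow> ('r, 'y) bigraded \<Rightarrow> ('y, 'x \<times> 'y) gmap" where
  "cone_in X Y = (\<lambda>n i j y.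
     (\<zero>\<^bsub>Bmod X (i + 1) (j + int n)\<^esub>, if n = 0 then y else \<zero>\<^bsub>Bmod Y i (j + int n)\<^esub>))"

definition cone_out :: "('r, 'x) bigraded \<Rightarrow> ('x \<times> 'y, 'x) gmap" where
  "cone_out X = (\<lambda>n i j (x, y). if n = 0 then x else \<zero>\<^bsub>Bmod X (i + 1) (j + int n)\<^esub>)"

text \<open>\<open>a : A \<rightarrow> B\<close> and \<open>b : B \<rightarrow> C\<close> form a conflation of \<open>\<E>\<^sub>\<eta>\<close>. As \<open>Y\<close> and \<open>X[1]\<close> are isomorphic to
  \<open>A\<close> and \<open>C\<close>, their element types may be taken to be those of \<open>A\<close> and \<open>C\<close>.\<close>

definition conflation ::
  "('r, 'q) ring_scheme \<Rightarrow> ('r, 'a) bigraded \<Rightarrow> ('r, 'b) bigraded \<Rightarrow> ('r, 'c) bigraded \<Rightarrow>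
   ('a, 'b) gmap \<Rightarrow> ('b, 'c) gmap \<Rightarrow> bool" where
  "conflation R A B C a b \<longleftrightarrow>
     A \<in> Z_complexes R \<and> B \<in> Z_complexes R \<and> C \<in> Z_complexes R \<and>
     a \<in> Z_maps R A B \<and> b \<in> Z_maps R B C \<and>
     (\<exists>(X :: ('r, 'c) bigraded) (Y :: ('r, 'a) bigraded) f g \<alpha> \<beta> \<gamma>.
        X \<in> Z_complexes R \<and> Y \<in> Z_complexes R \<and> f \<in> Z_maps R X Y \<and>
        g \<in> Z_maps R X (Z_twist Y) \<and> Z_eq X f (Z_comp Y (Z_eta Y) g) \<and>
        Z_iso R Y A \<alpha> \<and> Z_iso R (Z_cone X Y f) B \<beta> \<and> Z_iso R (Z_shift X) C \<gamma> \<and>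
        Z_eq Y (Z_comp B a \<alpha>) (Z_comp B \<beta> (cone_in X Y)) \<and>
        Z_eq (Z_cone X Y f) (Z_comp C b \<beta>) (Z_comp C \<gamma> (cone_out X)))"

text \<open>Injectivity with respect to \<open>\<E>\<^sub>\<eta>\<close>. Conflations of the displayed types suffice as tests: they
  include the one starting with \<open>I \<rightarrow> Con(\<eta>\<^sub>I)\<close>, which splits, and \<open>Con(\<eta>\<^sub>I)\<close> is injective with
  respect to all conflations.\<close>

definition eta_injective :: "('r, 'q) ring_scheme \<Rightarrow> ('r, 'y) bigraded \<Rightarrow> bool" where
  "eta_injective R I \<longleftrightarrow> I \<in> Z_complexes R \<and>
     (\<forall>(A :: ('r, 'y) bigraded) (B :: ('r, 'y \<times> 'y) bigraded) (C :: ('r, 'y) bigraded) a b.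
        conflation R A B C a b \<longrightarrow>
        (\<forall>u\<in>Z_maps R A I. \<exists>v\<in>Z_maps R B I. Z_eq A (Z_comp I v a) u))"

text \<open>A morphism \<open>X \<rightarrow> Y\<close> factoring through some injective object factors through \<open>Con(\<eta>\<^sub>X)\<close>, whose
  elements are pairs; hence injectives with elements of type \<open>'x \<times> 'x\<close> suffice.\<close>

definition eta_stable_rel ::
  "('r, 'q) ring_scheme \<Rightarrow> ('r, 'x) bigraded \<Rightarrow> ('r, 'x) bigraded \<Rightarrow>
   (('x, 'x) gmap \<times> ('x, 'x) gmap) set" where
  "eta_stable_rel R X Y = {(f, g). f \<in> Z_maps R X Y \<and> g \<in> Z_maps R X Y \<and>
     (\<exists>(I :: ('r, 'x \<times> 'x) bigraded) u v.
        eta_injective R I \<and> u \<in> Z_maps R X I \<and> v \<in> Z_maps R I Y \<and>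
        Z_eq X f (\<lambda>n i j x. g n i j x \<oplus>\<^bsub>Bmod Y i (j + int n)\<^esub> Z_comp Y v u n i j x))}"

definition K_eta ::
  "('r, 'q) ring_scheme \<Rightarrow> (('r, 'x) bigraded, ('x, 'x) gmap set) cat" where
  "K_eta R = quotient_cat (Z_complexes R) (Z_maps R) (eta_stable_rel R)
     Z_id (\<lambda>X Y Z. Z_comp Z)"


section \<open>Rickard's category \<open>G\<close> and the isomorphism \<open>\<Psi>\<close>\<close>

definition G_objects :: "('r, 'q) ring_scheme \<Rightarrow> ('r, 'x) bigraded set" where
  "G_objects R = {X.
     (\<forall>p q. projective_module R (Bmod X p q)) \<and>
     (\<forall>n p q. Bdiff X n p q \<in> rmod_hom R (Bmod X p q) (Bmod X (p + 1 - int n) (q + int n))) \<and>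
     (\<forall>n p q. \<forall>x\<in>carrier (Bmod X p q).
        (\<Oplus>\<^bsub>Bmod X (p + 2 - int n) (q + int n)\<^esub>k\<in>{..n}.
           Bdiff X (n - k) (p + 1 - int k) (q + int k) (Bdiff X k p q x))
        = \<zero>\<^bsub>Bmod X (p + 2 - int n) (q + int n)\<^esub>)}"

definition G_maps ::
  "('r, 'q) ring_scheme \<Rightarrow> ('r, 'x) bigraded \<Rightarrow> ('r, 'x) bigraded \<Rightarrow> ('x, 'x) gmap set" where
  "G_maps R X Y = {\<alpha>.
     (\<forall>n p q. \<alpha> n p q \<in> rmod_hom R (Bmod X p q) (Bmod Y (p - int n) (q + int n))) \<and>
     (\<forall>n p q. \<forall>x\<in>carrier (Bmod X p q).
        (\<Oplus>\<^bsub>Bmod Y (p + 1 - int n) (q + int n)\<^esub>k\<in>{..n}.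
           \<alpha> (n - k) (p + 1 - int k) (q + int k) (Bdiff X k p q x))
        = (\<Oplus>\<^bsub>Bmod Y (p + 1 - int n) (q + int n)\<^esub>k\<in>{..n}.
           Bdiff Y (n - k) (p - int k) (q + int k) (\<alpha> k p q x)))}"

definition Psi_obj :: "('r, 'x) bigraded \<Rightarrow> ('r, 'x) bigraded" where
  "Psi_obj X = \<lparr>Bmod = (\<lambda>i j. Bmod X (i - j) j), Bdiff = (\<lambda>n i j. Bdiff X n (i - j) j)\<rparr>"

definition Psi_map :: "('x, 'x) gmap \<Rightarrow> ('x, 'x) gmap" where
  "Psi_map \<alpha> = (\<lambda>n i j. \<alpha> n (i - j) j)"

text \<open>A choice of the operation \<open>X \<mapsto> X\<^sup>*\<^sup>*\<close> (\<open>LO\<close>) and of \<open>\<alpha> \<mapsto> {\<alpha>\<^sub>n}\<close> (\<open>LM\<close>).\<close>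

definition Rickard_choice ::
  "('r, 'q) ring_scheme \<Rightarrow> ('r, 'm) cpx \<Rightarrow>
   (('r, 'x) sumT_cpx \<Rightarrow> ('r, 'x) bigraded) \<Rightarrow>
   (('r, 'x) sumT_cpx \<Rightarrow> ('r, 'x) sumT_cpx \<Rightarrow> (int \<Rightarrow> int \<Rightarrow> 'x \<Rightarrow> 'x) \<Rightarrow> ('x, 'x) gmap) \<Rightarrow> bool"
where
  "Rickard_choice R T LO LM \<longleftrightarrow>
     (\<forall>X\<in>SumT_complexes R T.
        LO X \<in> G_objects R \<and> Bmod (LO X) = Smod X \<and>
        (\<forall>i j. \<forall>x\<in>carrier (Smod X i j).
           Bdiff (LO X) 0 i j x = S0 X i j x \<and>
           Bdiff (LO X) 1 i j x =
             (if even (i + j) then S1 X i j x else \<ominus>\<^bsub>Smod X i (j + 1)\<^esub> S1 X i j x))) \<and>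
     (\<forall>X\<in>SumT_complexes R T. \<forall>Y\<in>SumT_complexes R T. \<forall>\<alpha>\<in>SumT_maps R X Y.
        LM X Y \<alpha> \<in> G_maps R (LO X) (LO Y) \<and>
        (\<forall>i j. \<forall>x\<in>carrier (Smod X i j). LM X Y \<alpha> 0 i j x = \<alpha> i j x))"


section \<open>The functors\<close>

text \<open>The sum \<open>\<Sum>\<^sub>n a\<^sub>n\<close> of homogeneous maps \<open>a\<^sub>n\<close> of degree \<open>n\<close> (with components \<open>M q \<rightarrow> N (q + n)\<close>) on a
  direct sum over the integers. In each coordinate it is a finite sum, because arguments have finite
  support.\<close>

definition homogeneous_sum ::
  "(int \<Rightarrow> ('r, 'x) module) \<Rightarrow> (int \<Rightarrow> ('r, 'y) module) \<Rightarrow> (nat \<Rightarrow> int \<Rightarrow> 'x \<Rightarrow> 'y) \<Rightarrow>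
   (int \<Rightarrow> 'x) \<Rightarrow> (int \<Rightarrow> 'y)" where
  "homogeneous_sum M N a = (\<lambda>x\<in>carrier (direct_sum UNIV M). \<lambda>k.
     \<Oplus>\<^bsub>N k\<^esub>n\<in>{n. x (k - int n) \<noteq> \<zero>\<^bsub>M (k - int n)\<^esub>}. a n (k - int n) (x (k - int n)))"

text \<open>The total complex; the summands \<open>X\<^sup>p\<^sup>q\<close> with \<open>p + q = m\<close> are indexed by \<open>q\<close>.\<close>

definition Tot_obj :: "('r, 'x) bigraded \<Rightarrow> ('r, int \<Rightarrow> 'x) cpx" where
  "Tot_obj X =
     \<lparr>Cmod = (\<lambda>m. direct_sum UNIV (\<lambda>q. Bmod X (m - q) q)),
      Cdiff = (\<lambda>m. homogeneous_sum (\<lambda>q. Bmod X (m - q) q) (\<lambda>q. Bmod X (m + 1 - q) q)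
                     (\<lambda>n q. Bdiff X n (m - q) q))\<rparr>"

definition Tot_map ::
  "('r, 'x) bigraded \<Rightarrow> ('r, 'x) bigraded \<Rightarrow> ('x, 'x) gmap \<Rightarrow> int \<Rightarrow> (int \<Rightarrow> 'x) \<Rightarrow> (int \<Rightarrow> 'x)"
where
  "Tot_map X Y \<alpha> = (\<lambda>m. homogeneous_sum (\<lambda>q. Bmod X (m - q) q) (\<lambda>q. Bmod Y (m - q) q)
     (\<lambda>n q. \<alpha> n (m - q) q))"

definition Phi_functor where
  "Phi_functor R LO LM = induced_functor (homotopy_rel R)
     (\<lambda>X. Tot_obj (LO X)) (\<lambda>X Y \<alpha>. Tot_map (LO X) (LO Y) (LM X Y \<alpha>))"

definition Theta_functor where
  "Theta_functor R LO LM = induced_functor (eta_stable_rel R)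
     (\<lambda>X. Psi_obj (LO X)) (\<lambda>X Y \<alpha>. Psi_map (LM X Y \<alpha>))"

text \<open>The map of direct sums given by the lower triangular matrix with component \<open>f n j\<close> from the
  summand \<open>j\<close> to the summand \<open>j + n\<close>.\<close>

definition triangular_map ::
  "(int \<Rightarrow> ('r, 'x) module) \<Rightarrow> (int \<Rightarrow> ('r, 'y) module) \<Rightarrow> (nat \<Rightarrow> int \<Rightarrow> 'x \<Rightarrow> 'y) \<Rightarrow>
   (int \<Rightarrow> 'x) \<Rightarrow> (int \<Rightarrow> 'y)" where
  "triangular_map M N f = (\<lambda>x\<in>carrier (direct_sum UNIV M). \<lambda>k.
     \<Oplus>\<^bsub>N k\<^esub>j\<in>{j. x j \<noteq> \<zero>\<^bsub>M j\<^esub>}. if j \<le> k then f (nat (k - j)) j (x j) else \<zero>\<^bsub>N k\<^esub>)"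

definition Xi_obj :: "('r, 'x) bigraded \<Rightarrow> ('r, int \<Rightarrow> 'x) cpx" where
  "Xi_obj X =
     \<lparr>Cmod = (\<lambda>i. direct_sum UNIV (Bmod X i)),
      Cdiff = (\<lambda>i. triangular_map (Bmod X i) (Bmod X (i + 1)) (\<lambda>n j. Bdiff X n i j))\<rparr>"

definition Xi_map ::
  "('r, 'x) bigraded \<Rightarrow> ('r, 'x) bigraded \<Rightarrow> ('x, 'x) gmap \<Rightarrow> int \<Rightarrow> (int \<Rightarrow> 'x) \<Rightarrow> (int \<Rightarrow> 'x)"
where
  "Xi_map X Y f = (\<lambda>i. triangular_map (Bmod X i) (Bmod Y i) (\<lambda>n j. f n i j))"

definition Xi_functor where
  "Xi_functor R = induced_functor (homotopy_rel R) Xi_obj Xi_map"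

text \<open>A column of a lower triangular matrix may have infinitely many nonzero entries, and then it does
  not map into the direct sum (take \<open>X\<close> with \<open>X\<^sup>0 = \<Lambda>\<close> only, \<open>Y\<^sup>n = \<Lambda>\<close> for all \<open>n \<ge> 0\<close>, and all
  \<open>f\<^sub>n\<^sup>0\<close> the identity). So the functor \<open>\<Xi>\<close> is considered on the full subcategory of complexes each
  of whose terms has only finitely many nonzero components, where this cannot happen.\<close>

definition locally_finite :: "('r, 'x) bigraded \<Rightarrow> bool" where
  "locally_finite X \<longleftrightarrow> (\<forall>i. finite {j. \<not> zero_module (Bmod X i j)})"

definition K_eta_fin ::
  "('r, 'q) ring_scheme \<Rightarrow> (('r, 'x) bigraded, ('x, 'x) gmap set) cat" where
  "K_eta_fin R = full_subcat (K_eta R) locally_finite"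

end

theory Submission
  imports Defs
begin

text \<open>
  The bidegrees \<open>(p, q)\<close> of \<open>X\<^sup>*\<^sup>*\<close> and \<open>(i, j)\<close> of \<open>\<Psi>(X\<^sup>*\<^sup>*)\<close> are related by
  \<open>i = p + q\<close>, \<open>j = q\<close>. Hence the term of total degree \<open>m\<close> of \<open>X\<^sup>*\<^sup>*\<close> is the direct sum of the objects
  \<open>\<Psi>(X\<^sup>*\<^sup>*)\<^sup>m\<^sup>j\<close>, and a sum \<open>\<Sum>\<^sub>n a\<^sub>n\<close> of homogeneous maps, where \<open>a\<^sub>n\<close> raises \<open>q\<close> by \<open>n\<close>, is exactly the lower
  triangular matrix that \<open>\<Xi>\<close> forms (\<open>Tot_obj_eq_Xi_Psi\<close>, \<open>Tot_map_eq_Xi_Psi\<close>). So \<open>\<Phi>\<close> and \<open>\<Xi> \<circ> \<Theta>\<close> agree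
  already on representatives, and the substance lies in \<open>\<Theta>\<close> and \<open>\<Xi>\<close> being well defined: once they
  are functors, \<open>\<Phi>\<close> is one because it equals their composite.

  A lower triangular matrix may have infinitely many nonzero entries in a column,
  so it does not act on direct sums, but it does act on families \<open>(x\<^sub>j)\<close> that vanish for all sufficiently
  small \<open>j\<close>, here called Laurent families. In this way a complex over \<open>\<int>\<^sub>+ Proj\<close> becomes an ordinary
  complex \<open>hat_cpx X\<close>, filtered by the lowest nonzero degree; morphisms become the chain maps that
  preserve the filtration, and the convolution formulas become composition
  (\<open>Z_complexI\<close>, \<open>Z_mapI\<close>, \<open>hat_map_comp\<close>). The transformation \<open>\<eta>\<close> becomes an index shift that raises the
  filtration by one and is invertible as a map of families.

  Two morphisms agree in \<open>K\<^sub>\<eta>\<close> if and only if they differ by \<open>d s + s d\<close> for some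
  \<open>s\<close> that lowers the filtration by at most one (\<open>eta_stable_rel_iff\<close>). Indeed \<open>Con(\<eta>\<^sub>X)\<close> has a contraction of
  this kind, namely the inverse of \<open>\<eta>\<close>; it passes to injective objects \<open>I\<close>, as they are retracts of \<open>Con(\<eta>\<^sub>I)\<close>; and
  conversely an object with such a contraction is injective, because a map \<open>f = \<eta> g\<close> raises the filtration
  by one, which makes up for the contraction lowering it. On complexes whose terms have finitely many
  nonzero components the Laurent families are the direct sum, so such an \<open>s\<close> is an ordinary homotopy
  and \<open>\<Xi>\<close> is well defined.

  That \<open>\<Theta>\<close> is a functor follows from one uniqueness statement, \<open>Psi_maps_homotopic\<close>: if the
  components of index \<open>0\<close> of two maps \<open>\<Psi>(X\<^sup>*\<^sup>*) \<rightarrow> \<Psi>(Y\<^sup>*\<^sup>*)\<close> represent homotopic morphisms of \<open>C(Sum-T)\<close>, then the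
  two maps agree in \<open>K\<^sub>\<eta>\<close>. The first two components of the required \<open>s\<close> come from the given homotopy
  and from the chain homotopies in the columns. After that, the leading part of the remaining
  defect is a chain map from a column of \<open>X\<close> to a column of \<open>Y\<close> shifted by some \<open>-N \<noteq> 0\<close>. It is
  null-homotopic, because \<open>Hom(T, T[m]) = 0\<close> for \<open>m \<noteq> 0\<close> extends from \<open>T\<close> to direct sums of copies of
  \<open>T\<close>, as \<open>T\<close> is bounded and finitely generated in each degree (\<open>null_in_degree_Sum_T\<close>). Correcting \<open>s\<close>
  by such a null-homotopy raises the filtration level of the defect by one, each component of \<open>s\<close>
  changes only finitely often, and in the limit the defect vanishes.
\<close>

section \<open>Modules and their homomorphisms\<close>

lemma right_module_ring: "right_module R M \<Longrightarrow> ring R"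
  by (simp add: right_module_def)

lemma right_module_group: "right_module R M \<Longrightarrow> abelian_group M"
  by (simp add: right_module_def)

lemmas group_simps =
  abelian_monoid.zero_closed[OF abelian_group.axioms(1)]
  abelian_monoid.a_closed[OF abelian_group.axioms(1)]
  abelian_group.a_inv_closed
  abelian_monoid.l_zero[OF abelian_group.axioms(1)]
  abelian_monoid.r_zero[OF abelian_group.axioms(1)]
  abelian_group.minus_minus
  abelian_group.minus_add

lemmas group_ac =
  abelian_monoid.a_assoc[OF abelian_group.axioms(1)]
  abelian_monoid.a_comm[OF abelian_group.axioms(1)]
  abelian_monoid.a_lcomm[OF abelian_group.axioms(1)]

context abelian_group
begin

lemma neg_zero: "\<ominus> \<zero> = \<zero>"
  using minus_equality[of \<zero> \<zero>] by simp

lemma add_neg_cancel: "\<lbrakk>x \<in> carrier G; y \<in> carrier G\<rbrakk> \<Longrightarrow> x \<oplus> (y \<oplus> \<ominus> x) = y"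
  by (metis a_inv_closed a_comm a_closed r_neg2 a_assoc)

lemma add_neg_cancel': "\<lbrakk>x \<in> carrier G; y \<in> carrier G\<rbrakk> \<Longrightarrow> \<ominus> x \<oplus> (y \<oplus> x) = y"
  by (metis a_inv_closed a_comm a_closed r_neg1 a_assoc)

lemma eq_iff_diff_zero:
  "\<lbrakk>x \<in> carrier G; y \<in> carrier G\<rbrakk> \<Longrightarrow> x = y \<longleftrightarrow> x \<oplus> \<ominus> y = \<zero>"
  by (metis a_inv_closed minus_equality minus_minus r_neg)

lemma finsum_superset:
  assumes "finite B" "A \<subseteq> B" "\<And>k. k \<in> B - A \<Longrightarrow> f k = \<zero>" "f \<in> B \<rightarrow> carrier G"
  shows "finsum G f A = finsum G f B"
  using assms by (intro add.finprod_mono_neutral_cong_left) auto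

end

lemmas group_cancel = abelian_group.l_neg abelian_group.r_neg abelian_group.r_neg1
  abelian_group.r_neg2 abelian_group.neg_zero abelian_group.add_neg_cancel
  abelian_group.add_neg_cancel'

lemma smult_zero_right:
  assumes "right_module R M" "r \<in> carrier R"
  shows "r \<odot>\<^bsub>M\<^esub> \<zero>\<^bsub>M\<^esub> = \<zero>\<^bsub>M\<^esub>"
proof -
  interpret right_module R M by fact
  have "r \<odot>\<^bsub>M\<^esub> (\<zero>\<^bsub>M\<^esub> \<oplus>\<^bsub>M\<^esub> \<zero>\<^bsub>M\<^esub>) = r \<odot>\<^bsub>M\<^esub> \<zero>\<^bsub>M\<^esub> \<oplus>\<^bsub>M\<^esub> r \<odot>\<^bsub>M\<^esub> \<zero>\<^bsub>M\<^esub>"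
    using assms by (intro smult_add) auto
  then show ?thesis using smult_closed[OF assms(2)] by auto
qed

lemma smult_minus_right:
  assumes "right_module R M" "r \<in> carrier R" "x \<in> carrier M"
  shows "r \<odot>\<^bsub>M\<^esub> (\<ominus>\<^bsub>M\<^esub> x) = \<ominus>\<^bsub>M\<^esub> (r \<odot>\<^bsub>M\<^esub> x)"
proof -
  interpret right_module R M by fact
  have "r \<odot>\<^bsub>M\<^esub> (\<ominus>\<^bsub>M\<^esub> x) \<oplus>\<^bsub>M\<^esub> r \<odot>\<^bsub>M\<^esub> x = r \<odot>\<^bsub>M\<^esub> (\<ominus>\<^bsub>M\<^esub> x \<oplus>\<^bsub>M\<^esub> x)"
    using assms by (simp add: smult_add)
  also have "\<dots> = \<zero>\<^bsub>M\<^esub>" using assms by (simp add: M.l_neg smult_zero_right)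
  finally show ?thesis using assms by (intro M.minus_equality[symmetric]) (auto intro: smult_closed)
qed

lemma hom_closed: "f \<in> rmod_hom R M N \<Longrightarrow> x \<in> carrier M \<Longrightarrow> f x \<in> carrier N"
  by (auto simp: rmod_hom_def)

lemma hom_add:
  "f \<in> rmod_hom R M N \<Longrightarrow> x \<in> carrier M \<Longrightarrow> y \<in> carrier M \<Longrightarrow> f (x \<oplus>\<^bsub>M\<^esub> y) = f x \<oplus>\<^bsub>N\<^esub> f y"
  by (auto simp: rmod_hom_def)

lemma hom_smult:
  "f \<in> rmod_hom R M N \<Longrightarrow> r \<in> carrier R \<Longrightarrow> x \<in> carrier M \<Longrightarrow> f (r \<odot>\<^bsub>M\<^esub> x) = r \<odot>\<^bsub>N\<^esub> f x"
  by (auto simp: rmod_hom_def)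

lemma homI:
  assumes "\<And>x. x \<in> carrier M \<Longrightarrow> f x \<in> carrier N"
    and "\<And>x y. x \<in> carrier M \<Longrightarrow> y \<in> carrier M \<Longrightarrow> f (x \<oplus>\<^bsub>M\<^esub> y) = f x \<oplus>\<^bsub>N\<^esub> f y"
    and "\<And>r x. r \<in> carrier R \<Longrightarrow> x \<in> carrier M \<Longrightarrow> f (r \<odot>\<^bsub>M\<^esub> x) = r \<odot>\<^bsub>N\<^esub> f x"
  shows "f \<in> rmod_hom R M N"
  using assms by (auto simp: rmod_hom_def)

lemma hom_zero:
  assumes "f \<in> rmod_hom R M N" "abelian_group M" "abelian_group N"
  shows "f \<zero>\<^bsub>M\<^esub> = \<zero>\<^bsub>N\<^esub>"
proof -
  interpret M: abelian_group M by fact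
  interpret N: abelian_group N by fact
  have "f (\<zero>\<^bsub>M\<^esub> \<oplus>\<^bsub>M\<^esub> \<zero>\<^bsub>M\<^esub>) = f \<zero>\<^bsub>M\<^esub> \<oplus>\<^bsub>N\<^esub> f \<zero>\<^bsub>M\<^esub>"
    by (intro hom_add[OF assms(1)]) auto
  then show ?thesis using hom_closed[OF assms(1), of "\<zero>\<^bsub>M\<^esub>"] by auto
qed

lemma hom_minus:
  assumes "f \<in> rmod_hom R M N" "abelian_group M" "abelian_group N" "x \<in> carrier M"
  shows "f (\<ominus>\<^bsub>M\<^esub> x) = \<ominus>\<^bsub>N\<^esub> f x"
proof -
  interpret M: abelian_group M by fact
  interpret N: abelian_group N by fact
  have "f (\<ominus>\<^bsub>M\<^esub> x) \<oplus>\<^bsub>N\<^esub> f x = f (\<ominus>\<^bsub>M\<^esub> x \<oplus>\<^bsub>M\<^esub> x)"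
    using assms by (simp add: hom_add[OF assms(1)])
  also have "\<dots> = \<zero>\<^bsub>N\<^esub>" using assms by (simp add: M.l_neg hom_zero[OF assms(1-3)])
  finally show ?thesis
    using assms by (intro N.minus_equality[symmetric]) (auto intro: hom_closed[OF assms(1)])
qed

lemma hom_finsum:
  assumes f: "f \<in> rmod_hom R M N" and "abelian_group M" "abelian_group N" "g \<in> A \<rightarrow> carrier M"
  shows "f (finsum M g A) = finsum N (\<lambda>a. f (g a)) A"
proof -
  interpret M: abelian_group M by fact
  interpret N: abelian_group N by fact
  show ?thesis using assms(4)
  proof (induction A rule: infinite_finite_induct)
    case (insert a A)
    then have "finsum M g A \<in> carrier M" "g a \<in> carrier M" by (auto intro: M.finsum_closed)
    then show ?case using insert
      by (subst M.finsum_insert N.finsum_insert; auto simp: hom_add[OF f] hom_closed[OF f] Pi_iff)+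
  qed (use assms hom_zero[OF f] in auto)
qed

lemma hom_comp:
  "f \<in> rmod_hom R L M \<Longrightarrow> g \<in> rmod_hom R M N \<Longrightarrow> (\<lambda>x. g (f x)) \<in> rmod_hom R L N"
  by (auto simp: rmod_hom_def Pi_iff)

lemma hom_id: "(\<lambda>x. x) \<in> rmod_hom R M M"
  by (auto simp: rmod_hom_def)

lemma hom_const_zero: "right_module R N \<Longrightarrow> (\<lambda>x. \<zero>\<^bsub>N\<^esub>) \<in> rmod_hom R M N"
  by (rule homI) (auto simp: group_simps right_module_group smult_zero_right)

lemma hom_cong:
  assumes "f \<in> rmod_hom R M N" "right_module R M" "\<And>x. x \<in> carrier M \<Longrightarrow> g x = f x"
  shows "g \<in> rmod_hom R M N"
  by (rule homI)
    (simp_all add: assms(3) hom_closed[OF assms(1)] hom_add[OF assms(1)] hom_smult[OF assms(1)]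
      group_simps(2)[OF right_module_group[OF assms(2)]] right_module.smult_closed[OF assms(2)])

lemma hom_plus:
  assumes f: "f \<in> rmod_hom R M N" and g: "g \<in> rmod_hom R M N" and "right_module R N"
  shows "(\<lambda>x. f x \<oplus>\<^bsub>N\<^esub> g x) \<in> rmod_hom R M N"
proof -
  interpret right_module R N by fact
  show ?thesis
    by (rule homI) (simp_all add: hom_closed[OF f] hom_closed[OF g] hom_add[OF f] hom_add[OF g]
      hom_smult[OF f] hom_smult[OF g] smult_add a_ac)
qed

lemma hom_uminus:
  assumes f: "f \<in> rmod_hom R M N" and "right_module R N"
  shows "(\<lambda>x. \<ominus>\<^bsub>N\<^esub> f x) \<in> rmod_hom R M N"
proof -
  interpret right_module R N by fact
  show ?thesis
    by (rule homI) (simp_all add: hom_closed[OF f] hom_add[OF f]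
      hom_smult[OF f] smult_minus_right[OF assms(2)] M.minus_add)
qed

lemma hom_finsum_maps:
  assumes "right_module R N" and M: "right_module R M"
    and "\<And>k. k \<in> A \<Longrightarrow> f k \<in> rmod_hom R M N"
  shows "(\<lambda>x. finsum N (\<lambda>k. f k x) A) \<in> rmod_hom R M N"
proof -
  interpret N: right_module R N by fact
  show ?thesis using assms(3)
  proof (induction A rule: infinite_finite_induct)
    case (insert a A)
    have "a \<in> insert a A" by simp
    with insert have *: "(\<lambda>x. f a x \<oplus>\<^bsub>N\<^esub> finsum N (\<lambda>k. f k x) A) \<in> rmod_hom R M N"
      by (intro hom_plus assms(1)) auto
    have "finsum N (\<lambda>k. f k x) (insert a A) = f a x \<oplus>\<^bsub>N\<^esub> finsum N (\<lambda>k. f k x) A"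
      if "x \<in> carrier M" for x
      using insert that by (intro N.finsum_insert) (auto intro: hom_closed)
    with * show ?case by (rule hom_cong[OF _ M])
  qed (simp_all add: hom_const_zero assms)
qed

lemma right_module_prod:
  assumes "right_module R M" "right_module R N"
  shows "right_module R (module_prod M N)"
proof -
  interpret M: right_module R M by fact
  interpret N: right_module R N by fact
  have "abelian_group (module_prod M N)"
  proof (rule abelian_groupI)
    fix z assume "z \<in> carrier (module_prod M N)"
    then show "\<exists>w\<in>carrier (module_prod M N). w \<oplus>\<^bsub>module_prod M N\<^esub> z = \<zero>\<^bsub>module_prod M N\<^esub>"
      by (intro bexI[of _ "(\<ominus>\<^bsub>M\<^esub> fst z, \<ominus>\<^bsub>N\<^esub> snd z)"])
        (auto simp: module_prod_def M.l_neg N.l_neg)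
  qed (auto simp: module_prod_def M.a_ac N.a_ac)
  then show ?thesis
    by (intro right_module.intro right_module_axioms.intro M.R.ring_axioms)
      (auto simp: module_prod_def M.smult_closed N.smult_closed M.smult_add N.smult_add
        M.smult_add_ring N.smult_add_ring M.smult_mult N.smult_mult M.smult_one N.smult_one)
qed

lemma module_prod_simps:
  "carrier (module_prod M N) = carrier M \<times> carrier N"
  "\<zero>\<^bsub>module_prod M N\<^esub> = (\<zero>\<^bsub>M\<^esub>, \<zero>\<^bsub>N\<^esub>)"
  "(x, y) \<oplus>\<^bsub>module_prod M N\<^esub> (x', y') = (x \<oplus>\<^bsub>M\<^esub> x', y \<oplus>\<^bsub>N\<^esub> y')"
  "r \<odot>\<^bsub>module_prod M N\<^esub> (x, y) = (r \<odot>\<^bsub>M\<^esub> x, r \<odot>\<^bsub>N\<^esub> y)"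
  by (simp_all add: module_prod_def)

section \<open>Modules of families\<close>

text \<open>Direct sums and modules of Laurent families carry the same coordinatewise operations and differ only in
  the carrier, which is therefore a parameter.\<close>

definition family_module ::
  "'i set \<Rightarrow> ('i \<Rightarrow> ('r, 'm) module) \<Rightarrow> ('i \<Rightarrow> 'm) set \<Rightarrow> ('r, 'i \<Rightarrow> 'm) module" where
  "family_module I M S =
     \<lparr>carrier = S, mult = undefined, one = undefined,
      zero = (\<lambda>k\<in>I. \<zero>\<^bsub>M k\<^esub>),
      add = (\<lambda>x y. \<lambda>k\<in>I. x k \<oplus>\<^bsub>M k\<^esub> y k),
      smult = (\<lambda>r x. \<lambda>k\<in>I. r \<odot>\<^bsub>M k\<^esub> x k)\<rparr>"

lemma family_module_simps:
  "carrier (family_module I M S) = S"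
  "\<zero>\<^bsub>family_module I M S\<^esub> = (\<lambda>k\<in>I. \<zero>\<^bsub>M k\<^esub>)"
  "x \<oplus>\<^bsub>family_module I M S\<^esub> y = (\<lambda>k\<in>I. x k \<oplus>\<^bsub>M k\<^esub> y k)"
  "r \<odot>\<^bsub>family_module I M S\<^esub> x = (\<lambda>k\<in>I. r \<odot>\<^bsub>M k\<^esub> x k)"
  by (simp_all add: family_module_def)

lemma direct_sum_family:
  "direct_sum I M = family_module I M
     {x \<in> (\<Pi>\<^sub>E k\<in>I. carrier (M k)). finite {k\<in>I. x k \<noteq> \<zero>\<^bsub>M k\<^esub>}}"
  by (simp add: direct_sum_def family_module_def)

lemma right_module_family:
  assumes "ring R" and M: "\<And>k. k \<in> I \<Longrightarrow> right_module R (M k)"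
    and S: "S \<subseteq> (\<Pi>\<^sub>E k\<in>I. carrier (M k))"
    and cl: "(\<lambda>k\<in>I. \<zero>\<^bsub>M k\<^esub>) \<in> S"
      "\<And>x y. x \<in> S \<Longrightarrow> y \<in> S \<Longrightarrow> (\<lambda>k\<in>I. x k \<oplus>\<^bsub>M k\<^esub> y k) \<in> S"
      "\<And>x. x \<in> S \<Longrightarrow> (\<lambda>k\<in>I. \<ominus>\<^bsub>M k\<^esub> x k) \<in> S"
      "\<And>r x. r \<in> carrier R \<Longrightarrow> x \<in> S \<Longrightarrow> (\<lambda>k\<in>I. r \<odot>\<^bsub>M k\<^esub> x k) \<in> S"
  shows "right_module R (family_module I M S)"
    and "\<And>x. x \<in> S \<Longrightarrow> \<ominus>\<^bsub>family_module I M S\<^esub> x = (\<lambda>k\<in>I. \<ominus>\<^bsub>M k\<^esub> x k)"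
proof -
  have M': "abelian_group (M k)" if "k \<in> I" for k
    using M[OF that] by (rule right_module_group)
  have S': "x k \<in> carrier (M k)" if "x \<in> S" "k \<in> I" for x k using S that by auto
  have S'': "x k = undefined" if "x \<in> S" "k \<notin> I" for x k using S that by (auto simp: PiE_iff extensional_def)
  let ?F = "family_module I M S"
  have ag: "abelian_group ?F"
  proof (rule abelian_groupI)
    fix x y assume x: "x \<in> carrier ?F" and y: "y \<in> carrier ?F"
    note [simp] = S'[OF x[unfolded family_module_simps]] S'[OF y[unfolded family_module_simps]]
    show "x \<oplus>\<^bsub>?F\<^esub> y \<in> carrier ?F" using x y by (simp add: family_module_simps cl)
    show "x \<oplus>\<^bsub>?F\<^esub> y = y \<oplus>\<^bsub>?F\<^esub> x"
      by (auto simp: family_module_simps fun_eq_iff abelian_groupE(4)[OF M'])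
    fix z assume z: "z \<in> carrier ?F"
    note [simp] = S'[OF z[unfolded family_module_simps]]
    show "x \<oplus>\<^bsub>?F\<^esub> y \<oplus>\<^bsub>?F\<^esub> z = x \<oplus>\<^bsub>?F\<^esub> (y \<oplus>\<^bsub>?F\<^esub> z)"
      by (auto simp: family_module_simps fun_eq_iff abelian_groupE(3)[OF M'])
  next
    fix z assume "z \<in> carrier ?F"
    then have z: "z \<in> S" by (simp add: family_module_simps)
    note [simp] = S'[OF z] S''[OF z]
    show "\<zero>\<^bsub>?F\<^esub> \<oplus>\<^bsub>?F\<^esub> z = z"
      by (auto simp: family_module_simps fun_eq_iff M' group_simps)
    show "\<exists>w\<in>carrier ?F. w \<oplus>\<^bsub>?F\<^esub> z = \<zero>\<^bsub>?F\<^esub>"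
      using z by (intro bexI[of _ "\<lambda>k\<in>I. \<ominus>\<^bsub>M k\<^esub> z k"])
        (auto simp: family_module_simps cl M' abelian_group.l_neg fun_eq_iff)
  qed (simp_all add: family_module_simps cl)
  show rm: "right_module R ?F"
  proof (intro right_module.intro right_module_axioms.intro assms(1) ag)
    fix r s x assume r: "r \<in> carrier R" "s \<in> carrier R" and "x \<in> carrier ?F"
    then have x: "x \<in> S" by (simp add: family_module_simps)
    note [simp] = S'[OF x]
    show "(r \<oplus>\<^bsub>R\<^esub> s) \<odot>\<^bsub>?F\<^esub> x = r \<odot>\<^bsub>?F\<^esub> x \<oplus>\<^bsub>?F\<^esub> s \<odot>\<^bsub>?F\<^esub> x"
      using r by (auto simp: family_module_simps fun_eq_iff right_module.smult_add_ring[OF M])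
    show "(r \<otimes>\<^bsub>R\<^esub> s) \<odot>\<^bsub>?F\<^esub> x = s \<odot>\<^bsub>?F\<^esub> (r \<odot>\<^bsub>?F\<^esub> x)"
      using r by (auto simp: family_module_simps fun_eq_iff right_module.smult_mult[OF M])
  next
    fix r x y assume r: "r \<in> carrier R" and "x \<in> carrier ?F" "y \<in> carrier ?F"
    then have x: "x \<in> S" and y: "y \<in> S" by (auto simp: family_module_simps)
    note [simp] = S'[OF x] S'[OF y]
    show "r \<odot>\<^bsub>?F\<^esub> (x \<oplus>\<^bsub>?F\<^esub> y) = r \<odot>\<^bsub>?F\<^esub> x \<oplus>\<^bsub>?F\<^esub> r \<odot>\<^bsub>?F\<^esub> y"
      using r by (auto simp: family_module_simps fun_eq_iff right_module.smult_add[OF M])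
  next
    fix x assume "x \<in> carrier ?F"
    then have x: "x \<in> S" by (auto simp: family_module_simps)
    note [simp] = S'[OF x] S''[OF x]
    show "\<one>\<^bsub>R\<^esub> \<odot>\<^bsub>?F\<^esub> x = x"
      by (auto simp: family_module_simps fun_eq_iff right_module.smult_one[OF M])
  qed (simp add: family_module_simps cl)
  show "\<ominus>\<^bsub>?F\<^esub> x = (\<lambda>k\<in>I. \<ominus>\<^bsub>M k\<^esub> x k)" if x: "x \<in> S" for x
  proof -
    note [simp] = S'[OF x]
    show ?thesis using x
      by (intro abelian_group.minus_equality[OF ag])
        (auto simp: family_module_simps cl fun_eq_iff M' group_simps group_cancel)
  qed
qed

lemma direct_sum_simps:
  "x \<in> carrier (direct_sum I M) \<longleftrightarrow>
    x \<in> (\<Pi>\<^sub>E k\<in>I. carrier (M k)) \<and> finite {k\<in>I. x k \<noteq> \<zero>\<^bsub>M k\<^esub>}"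
  "\<zero>\<^bsub>direct_sum I M\<^esub> = (\<lambda>k\<in>I. \<zero>\<^bsub>M k\<^esub>)"
  "x \<oplus>\<^bsub>direct_sum I M\<^esub> y = (\<lambda>k\<in>I. x k \<oplus>\<^bsub>M k\<^esub> y k)"
  "r \<odot>\<^bsub>direct_sum I M\<^esub> x = (\<lambda>k\<in>I. r \<odot>\<^bsub>M k\<^esub> x k)"
  by (simp_all add: direct_sum_def)

lemma right_module_direct_sum:
  assumes R: "ring R" and M: "\<And>k. k \<in> I \<Longrightarrow> right_module R (M k)"
  shows "right_module R (direct_sum I M)"
proof -
  have M': "abelian_group (M k)" if "k \<in> I" for k
    using M[OF that] by (rule right_module_group)
  let ?S = "{x \<in> (\<Pi>\<^sub>E k\<in>I. carrier (M k)). finite {k\<in>I. x k \<noteq> \<zero>\<^bsub>M k\<^esub>}}"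
  show ?thesis unfolding direct_sum_family
  proof (rule right_module_family(1)[OF R M])
    fix x y
    assume x: "x \<in> ?S"
      and y: "y \<in> ?S"
    have [simp]: "x k \<in> carrier (M k)" "y k \<in> carrier (M k)" if "k \<in> I" for k
      using x y that by auto
    have "{k\<in>I. x k \<oplus>\<^bsub>M k\<^esub> y k \<noteq> \<zero>\<^bsub>M k\<^esub>} \<subseteq> {k\<in>I. x k \<noteq> \<zero>\<^bsub>M k\<^esub>} \<union> {k\<in>I. y k \<noteq> \<zero>\<^bsub>M k\<^esub>}"
      using M' by (auto simp: group_simps)
    then show "(\<lambda>k\<in>I. x k \<oplus>\<^bsub>M k\<^esub> y k) \<in> ?S"
      using x y M' by (auto simp: group_simps cong: conj_cong intro: finite_subset)
    have "{k\<in>I. \<ominus>\<^bsub>M k\<^esub> x k \<noteq> \<zero>\<^bsub>M k\<^esub>} \<subseteq> {k\<in>I. x k \<noteq> \<zero>\<^bsub>M k\<^esub>}"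
      using M' by (auto simp: group_cancel)
    then show "(\<lambda>k\<in>I. \<ominus>\<^bsub>M k\<^esub> x k) \<in> ?S"
      using x M' by (auto simp: group_simps cong: conj_cong intro: finite_subset)
  next
    fix r x assume r: "r \<in> carrier R"
      and x: "x \<in> ?S"
    have [simp]: "x k \<in> carrier (M k)" if "k \<in> I" for k
      using x that by auto
    have "{k\<in>I. r \<odot>\<^bsub>M k\<^esub> x k \<noteq> \<zero>\<^bsub>M k\<^esub>} \<subseteq> {k\<in>I. x k \<noteq> \<zero>\<^bsub>M k\<^esub>}"
      using smult_zero_right[OF M r] by auto
    then show "(\<lambda>k\<in>I. r \<odot>\<^bsub>M k\<^esub> x k) \<in> ?S"
      using x M r by (auto simp: right_module.smult_closed[OF M] cong: conj_cong intro: finite_subset)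
  qed (use M' in \<open>auto simp: group_simps cong: conj_cong\<close>)
qed

definition single :: "'i set \<Rightarrow> ('i \<Rightarrow> ('r, 'm) module) \<Rightarrow> 'i \<Rightarrow> 'm \<Rightarrow> 'i \<Rightarrow> 'm" where
  "single I M k x = (\<lambda>l\<in>I. if l = k then x else \<zero>\<^bsub>M l\<^esub>)"

lemma single_hom_direct_sum:
  assumes "\<And>k. k \<in> I \<Longrightarrow> right_module R (M k)" "k \<in> I"
  shows "single I M k \<in> rmod_hom R (M k) (direct_sum I M)"
proof -
  have M': "abelian_group (M k)" if "k \<in> I" for k
    using assms(1)[OF that] by (rule right_module_group)
  have "{l\<in>I. single I M k x l \<noteq> \<zero>\<^bsub>M l\<^esub>} \<subseteq> {k}" for x
    by (auto simp: single_def)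
  then have "finite {l\<in>I. single I M k x l \<noteq> \<zero>\<^bsub>M l\<^esub>}" for x
    by (rule finite_subset) auto
  then show ?thesis using M' assms
    by (intro homI) (auto simp: direct_sum_simps group_simps fun_eq_iff,
      auto simp: single_def group_simps smult_zero_right[OF assms(1)])
qed

lemma direct_sum_hom_eqI:
  assumes f: "f \<in> rmod_hom R (direct_sum I M) N" and g: "g \<in> rmod_hom R (direct_sum I M) N"
    and M: "\<And>k. k \<in> I \<Longrightarrow> right_module R (M k)" and R: "ring R" and N: "right_module R N"
    and eq: "\<And>k x. k \<in> I \<Longrightarrow> x \<in> carrier (M k) \<Longrightarrow> f (single I M k x) = g (single I M k x)"
    and x: "x \<in> carrier (direct_sum I M)"
  shows "f x = g x"
proof -
  have M': "abelian_group (M k)" if "k \<in> I" for k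
    using M[OF that] by (rule right_module_group)
  have D: "abelian_group (direct_sum I M)"
    by (rule right_module_group[OF right_module_direct_sum[OF R M]])
  have N': "abelian_group N" using N by (rule right_module_group)
  have "f x = g x" if "finite A" "x \<in> carrier (direct_sum I M)" "\<And>k. k \<in> I - A \<Longrightarrow> x k = \<zero>\<^bsub>M k\<^esub>" for A x
    using that
  proof (induction A arbitrary: x rule: finite_induct)
    case empty
    then have "x = \<zero>\<^bsub>direct_sum I M\<^esub>"
      by (auto simp: direct_sum_simps fun_eq_iff PiE_iff extensional_def)
    then show ?case by (simp add: hom_zero[OF f D N'] hom_zero[OF g D N'])
  next
    case (insert k A)
    show ?case
    proof (cases "k \<in> I")
      case False
      then have "\<And>l. l \<in> I - A \<Longrightarrow> x l = \<zero>\<^bsub>M l\<^esub>" using insert.prems(2) by auto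
      then show ?thesis using insert.IH[OF insert.prems(1)] by blast
    next
      case True
      define y where "y = (\<lambda>l\<in>I. if l = k then \<zero>\<^bsub>M l\<^esub> else x l)"
      have "{l\<in>I. y l \<noteq> \<zero>\<^bsub>M l\<^esub>} \<subseteq> {l\<in>I. x l \<noteq> \<zero>\<^bsub>M l\<^esub>}" by (auto simp: y_def)
      then have y: "y \<in> carrier (direct_sum I M)"
        using insert.prems(1) M'
        by (auto simp: direct_sum_simps intro: finite_subset) (auto simp: y_def group_simps)
      have xk: "x k \<in> carrier (M k)" using insert.prems(1) True by (auto simp: direct_sum_simps)
      have s: "single I M k (x k) \<in> carrier (direct_sum I M)"
        using hom_closed[OF single_hom_direct_sum[OF M True]] xk by auto
      have "x = single I M k (x k) \<oplus>\<^bsub>direct_sum I M\<^esub> y"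
        using insert.prems(1) M'
        by (auto simp: direct_sum_simps single_def y_def fun_eq_iff PiE_iff extensional_def group_simps)
      moreover have "f y = g y"
        using insert.prems by (intro insert.IH y) (auto simp: y_def)
      ultimately show ?thesis
        using hom_add[OF f s y] hom_add[OF g s y] eq[OF True xk] by simp
    qed
  qed
  moreover have "finite {k\<in>I. x k \<noteq> \<zero>\<^bsub>M k\<^esub>}" using x by (simp add: direct_sum_simps)
  ultimately show ?thesis using x by blast
qed

definition sum_map ::
  "'i set \<Rightarrow> ('i \<Rightarrow> ('r, 'm) module) \<Rightarrow> ('r, 'n) module \<Rightarrow> ('i \<Rightarrow> 'm \<Rightarrow> 'n) \<Rightarrow> ('i \<Rightarrow> 'm) \<Rightarrow> 'n" where
  "sum_map I M N g x = (\<Oplus>\<^bsub>N\<^esub>k\<in>{k\<in>I. x k \<noteq> \<zero>\<^bsub>M k\<^esub>}. g k (x k))"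

lemma sum_map_hom:
  assumes M: "\<And>k. k \<in> I \<Longrightarrow> right_module R (M k)" and N: "right_module R N"
    and g: "\<And>k. k \<in> I \<Longrightarrow> g k \<in> rmod_hom R (M k) N"
  shows "sum_map I M N g \<in> rmod_hom R (direct_sum I M) N"
    and "\<And>k x. k \<in> I \<Longrightarrow> x \<in> carrier (M k) \<Longrightarrow> sum_map I M N g (single I M k x) = g k x"
proof -
  interpret N: right_module R N by fact
  have M': "abelian_group (M k)" if "k \<in> I" for k
    using M[OF that] by (rule right_module_group)
  have g0: "g k \<zero>\<^bsub>M k\<^esub> = \<zero>\<^bsub>N\<^esub>" if "k \<in> I" for k
    using hom_zero[OF g[OF that] M'[OF that] N.abelian_group_axioms] .
  have gc: "g k x \<in> carrier N" if "k \<in> I" "x \<in> carrier (M k)" for k x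
    using hom_closed[OF g] that .
  have sup: "sum_map I M N g x = (\<Oplus>\<^bsub>N\<^esub>k\<in>A. g k (x k))"
    if "finite A" "A \<subseteq> I" "{k\<in>I. x k \<noteq> \<zero>\<^bsub>M k\<^esub>} \<subseteq> A" "\<And>k. k \<in> I \<Longrightarrow> x k \<in> carrier (M k)" for x A
    unfolding sum_map_def using that by (intro N.finsum_superset) (auto simp: g0 gc)
  show "sum_map I M N g (single I M k x) = g k x" if k: "k \<in> I" and x: "x \<in> carrier (M k)" for k x
    using k x by (subst sup[of "{k}"]) (auto simp: single_def M' group_simps gc)
  show "sum_map I M N g \<in> rmod_hom R (direct_sum I M) N"
  proof (rule homI)
    fix x assume x: "x \<in> carrier (direct_sum I M)"
    have xk: "x k \<in> carrier (M k)" if "k \<in> I" for k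
      using x that by (auto simp: direct_sum_simps)
    show "sum_map I M N g x \<in> carrier N"
      unfolding sum_map_def by (intro N.finsum_closed) (auto simp: gc xk)
    fix r assume r: "r \<in> carrier R"
    have "(\<lambda>y. r \<odot>\<^bsub>N\<^esub> y) (\<Oplus>\<^bsub>N\<^esub>k\<in>{k\<in>I. x k \<noteq> \<zero>\<^bsub>M k\<^esub>}. g k (x k)) =
       (\<Oplus>\<^bsub>N\<^esub>k\<in>{k\<in>I. x k \<noteq> \<zero>\<^bsub>M k\<^esub>}. r \<odot>\<^bsub>N\<^esub> g k (x k))"
      if "\<And>k. k \<in> {k\<in>I. x k \<noteq> \<zero>\<^bsub>M k\<^esub>} \<Longrightarrow> g k (x k) \<in> carrier N"
    proof -
      have "finite {k\<in>I. x k \<noteq> \<zero>\<^bsub>M k\<^esub>}" using x by (simp add: direct_sum_simps)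
      then show ?thesis using that
        by (induction rule: finite_induct)
          (auto simp: smult_zero_right[OF N r] N.smult_closed r N.smult_add Pi_iff)
    qed
    also have "\<dots> = (\<Oplus>\<^bsub>N\<^esub>k\<in>{k\<in>I. x k \<noteq> \<zero>\<^bsub>M k\<^esub>}. g k ((r \<odot>\<^bsub>direct_sum I M\<^esub> x) k))"
      using x r by (intro N.finsum_cong')
        (auto simp: direct_sum_simps hom_smult[OF g] gc N.smult_closed xk right_module.smult_closed[OF M])
    also have "\<dots> = sum_map I M N g (r \<odot>\<^bsub>direct_sum I M\<^esub> x)"
      using x r by (intro sup[symmetric])
        (auto simp: direct_sum_simps smult_zero_right[OF M] right_module.smult_closed[OF M] xk)
    finally show "sum_map I M N g (r \<odot>\<^bsub>direct_sum I M\<^esub> x) = r \<odot>\<^bsub>N\<^esub> sum_map I M N g x"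
      using x by (auto simp: sum_map_def direct_sum_simps gc xk)
  next
    fix x y assume x: "x \<in> carrier (direct_sum I M)" and y: "y \<in> carrier (direct_sum I M)"
    (* A common finite index set on which all three sums can be taken. *)
    define A where "A = {k\<in>I. x k \<noteq> \<zero>\<^bsub>M k\<^esub>} \<union> {k\<in>I. y k \<noteq> \<zero>\<^bsub>M k\<^esub>}"
    have A: "finite A" "A \<subseteq> I" using x y by (auto simp: A_def direct_sum_simps)
    have xk: "x k \<in> carrier (M k)" "y k \<in> carrier (M k)" if "k \<in> I" for k
      using x y that by (auto simp: direct_sum_simps)
    have "sum_map I M N g (x \<oplus>\<^bsub>direct_sum I M\<^esub> y) = (\<Oplus>\<^bsub>N\<^esub>k\<in>A. g k ((x \<oplus>\<^bsub>direct_sum I M\<^esub> y) k))"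
      using A xk M' by (intro sup) (auto simp: direct_sum_simps group_simps A_def)
    also have "\<dots> = (\<Oplus>\<^bsub>N\<^esub>k\<in>A. g k (x k) \<oplus>\<^bsub>N\<^esub> g k (y k))"
      using A xk by (intro N.finsum_cong') (auto simp: direct_sum_simps hom_add[OF g] gc subset_iff)
    also have "\<dots> = (\<Oplus>\<^bsub>N\<^esub>k\<in>A. g k (x k)) \<oplus>\<^bsub>N\<^esub> (\<Oplus>\<^bsub>N\<^esub>k\<in>A. g k (y k))"
      using A xk by (intro N.finsum_addf) (auto simp: gc subset_iff)
    also have "(\<Oplus>\<^bsub>N\<^esub>k\<in>A. g k (x k)) = sum_map I M N g x"
      using A xk by (intro sup[symmetric]) (auto simp: A_def)
    also have "(\<Oplus>\<^bsub>N\<^esub>k\<in>A. g k (y k)) = sum_map I M N g y"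
      using A xk by (intro sup[symmetric]) (auto simp: A_def)
    finally show "sum_map I M N g (x \<oplus>\<^bsub>direct_sum I M\<^esub> y) =
      sum_map I M N g x \<oplus>\<^bsub>N\<^esub> sum_map I M N g y" .
  qed
qed

section \<open>Projective modules\<close>

text \<open>The ring as a right module over itself; by the convention for right modules, \<open>r \<odot> x\<close> is the product \<open>x r\<close>.\<close>

definition regular_module :: "('r, 'q) ring_scheme \<Rightarrow> ('r, 'r) module" where
  "regular_module R = \<lparr>carrier = carrier R, mult = undefined, one = undefined,
     zero = \<zero>\<^bsub>R\<^esub>, add = (\<oplus>\<^bsub>R\<^esub>), smult = (\<lambda>r x. x \<otimes>\<^bsub>R\<^esub> r)\<rparr>"

lemma right_module_regular:
  assumes "ring R"
  shows "right_module R (regular_module R)"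
proof -
  interpret R: ring R by fact
  have "abelian_group (regular_module R)"
  proof (rule abelian_groupI)
    fix x assume "x \<in> carrier (regular_module R)"
    then show "\<exists>y\<in>carrier (regular_module R). y \<oplus>\<^bsub>regular_module R\<^esub> x = \<zero>\<^bsub>regular_module R\<^esub>"
      by (intro bexI[of _ "\<ominus>\<^bsub>R\<^esub> x"]) (auto simp: regular_module_def R.l_neg)
  qed (auto simp: regular_module_def R.a_ac)
  then show ?thesis
    by (intro right_module.intro right_module_axioms.intro assms)
      (auto simp: regular_module_def R.l_distr R.r_distr R.m_assoc)
qed

lemma projective_right_module: "projective_module R P \<Longrightarrow> right_module R P"
  by (simp add: projective_module_def)

lemma smult_hom_regular:
  assumes "right_module R M" "x \<in> carrier M"
  shows "(\<lambda>r. r \<odot>\<^bsub>M\<^esub> x) \<in> rmod_hom R (regular_module R) M"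
  using assms
  by (intro homI) (auto simp: regular_module_def right_module.smult_closed
      right_module.smult_add_ring right_module.smult_mult)

text \<open>Projectivity is defined by lifting along epimorphisms between modules of particular element types. Lifting the
  identity along the free module on the set \<open>carrier P\<close> gives a section \<open>s\<close> of its canonical map, and for
  an arbitrary epimorphism \<open>g\<close> one lifts the images of the free generators and composes with \<open>s\<close>.\<close>

lemma projective_lift:
  fixes P :: "('r, 'm) module"
  assumes P: "projective_module R P" and M: "right_module R M" and N: "right_module R N"
    and g: "g \<in> rmod_hom R M N" and surj: "carrier N \<subseteq> g ` carrier M" and f: "f \<in> rmod_hom R P N"
  shows "\<exists>h\<in>rmod_hom R P M. \<forall>x\<in>carrier P. g (h x) = f x"
proof -
  define I where "I = carrier P"
  define A where "A = regular_module R"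
  define F where "F = direct_sum I (\<lambda>_. A)"
  have P': "right_module R P" using P by (rule projective_right_module)
  have R: "ring R" using P' by (rule right_module_ring)
  have A: "right_module R A" unfolding A_def by (rule right_module_regular[OF R])
  have F: "right_module R F" unfolding F_def by (intro right_module_direct_sum R A)
  have one: "\<one>\<^bsub>R\<^esub> \<in> carrier A" using R by (simp add: A_def regular_module_def ring.ring_simprules)
  define \<pi> where "\<pi> = sum_map I (\<lambda>_. A) P (\<lambda>x r. r \<odot>\<^bsub>P\<^esub> x)"
  have \<pi>: "\<pi> \<in> rmod_hom R F P"
    unfolding \<pi>_def F_def by (rule sum_map_hom[OF A P']) (auto simp: A_def I_def smult_hom_regular P')
  have \<pi>1: "\<pi> (single I (\<lambda>_. A) x r) = r \<odot>\<^bsub>P\<^esub> x" if "x \<in> I" "r \<in> carrier A" for x r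
    unfolding \<pi>_def using that
    by (intro sum_map_hom(2)[OF A P']) (auto simp: A_def I_def smult_hom_regular P')
  have sc: "single I (\<lambda>_. A) x r \<in> carrier F" if "x \<in> I" "r \<in> carrier A" for x r
    using hom_closed[OF single_hom_direct_sum[where M = "\<lambda>_. A", OF A], of x I r] that by (simp add: F_def)
  have "\<pi> ` carrier F = carrier P"
  proof
    show "\<pi> ` carrier F \<subseteq> carrier P" using hom_closed[OF \<pi>] by auto
    show "carrier P \<subseteq> \<pi> ` carrier F"
    proof
      fix x assume "x \<in> carrier P"
      then show "x \<in> \<pi> ` carrier F" using \<pi>1[OF _ one, of x] sc[OF _ one, of x] P'
        by (intro image_eqI[of _ _ "single I (\<lambda>_. A) x \<one>\<^bsub>R\<^esub>"])
          (auto simp: I_def right_module.smult_one)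
    qed
  qed
  from P[unfolded projective_module_def, THEN conjunct2, rule_format, OF F P' \<pi> this hom_id]
  obtain s where s: "s \<in> rmod_hom R P F" and \<pi>s: "\<And>x. x \<in> carrier P \<Longrightarrow> \<pi> (s x) = x"
    by auto
  have "\<forall>x\<in>I. \<exists>m\<in>carrier M. g m = f x"
    using surj hom_closed[OF f] by (force simp: I_def)
  then obtain m where m: "\<And>x. x \<in> I \<Longrightarrow> m x \<in> carrier M \<and> g (m x) = f x" by metis
  define k where "k = sum_map I (\<lambda>_. A) M (\<lambda>x r. r \<odot>\<^bsub>M\<^esub> m x)"
  have k: "k \<in> rmod_hom R F M"
    unfolding k_def F_def by (rule sum_map_hom[OF A M]) (auto simp: A_def m smult_hom_regular M)
  have k1: "k (single I (\<lambda>_. A) x r) = r \<odot>\<^bsub>M\<^esub> m x" if "x \<in> I" "r \<in> carrier A" for x r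
    unfolding k_def using that
    by (intro sum_map_hom(2)[OF A M]) (auto simp: A_def m smult_hom_regular M)
  have gk: "g (k x) = f (\<pi> x)" if "x \<in> carrier F" for x
  proof (rule direct_sum_hom_eqI[where f = "\<lambda>x. g (k x)" and g = "\<lambda>x. f (\<pi> x)" and I = I and M = "\<lambda>_. A"])
    show "(\<lambda>x. g (k x)) \<in> rmod_hom R (direct_sum I (\<lambda>_. A)) N"
      using hom_comp[OF k g] by (simp add: F_def)
    show "(\<lambda>x. f (\<pi> x)) \<in> rmod_hom R (direct_sum I (\<lambda>_. A)) N"
      using hom_comp[OF \<pi> f] by (simp add: F_def)
    fix x r assume *: "x \<in> I" "r \<in> carrier A"
    then have "r \<in> carrier R" by (simp add: A_def regular_module_def)
    with * show "g (k (single I (\<lambda>_. A) x r)) = f (\<pi> (single I (\<lambda>_. A) x r))"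
      using m[of x] by (simp add: k1 \<pi>1 hom_smult[OF g] hom_smult[OF f, folded I_def])
  qed (use that A R N in \<open>auto simp: F_def\<close>)
  show ?thesis
    by (rule bexI[OF _ hom_comp[OF s k]]) (simp add: gk hom_closed[OF s] \<pi>s)
qed

lemma projective_direct_sum:
  assumes R: "ring R" and P: "\<And>k. k \<in> I \<Longrightarrow> projective_module R (P k)"
  shows "projective_module R (direct_sum I P)"
  unfolding projective_module_def
proof (intro conjI allI impI)
  have P': "\<And>k. k \<in> I \<Longrightarrow> right_module R (P k)" using P by (rule projective_right_module)
  show D: "right_module R (direct_sum I P)" by (intro right_module_direct_sum R P')
  fix M :: "('a, ('c \<Rightarrow> 'd) \<Rightarrow> 'a) module" and N :: "('a, 'c \<Rightarrow> 'd) module" and g f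
  assume M: "right_module R M" and N: "right_module R N" and g: "g \<in> rmod_hom R M N"
    and surj: "g ` carrier M = carrier N" and f: "f \<in> rmod_hom R (direct_sum I P) N"
  have "\<exists>h\<in>rmod_hom R (P k) M. \<forall>x\<in>carrier (P k). g (h x) = f (single I P k x)" if k: "k \<in> I" for k
    using surj by (intro projective_lift[OF P[OF k] M N g _ hom_comp[OF single_hom_direct_sum[OF P' k] f]]) auto
  then have "\<forall>k. \<exists>h. k \<in> I \<longrightarrow> h \<in> rmod_hom R (P k) M \<and> (\<forall>x\<in>carrier (P k). g (h x) = f (single I P k x))"
    by blast
  from choice[OF this] obtain h where h: "\<And>k. k \<in> I \<Longrightarrow> h k \<in> rmod_hom R (P k) M"
    and gh: "\<And>k x. k \<in> I \<Longrightarrow> x \<in> carrier (P k) \<Longrightarrow> g (h k x) = f (single I P k x)" by blast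
  have H: "sum_map I P M h \<in> rmod_hom R (direct_sum I P) M" by (rule sum_map_hom[OF P' M h])
  show "\<exists>h\<in>rmod_hom R (direct_sum I P) M. \<forall>x\<in>carrier (direct_sum I P). g (h x) = f x"
  proof (intro bexI[OF _ H] ballI)
    fix x assume "x \<in> carrier (direct_sum I P)"
    then show "g (sum_map I P M h x) = f x"
      by (rule direct_sum_hom_eqI[OF hom_comp[OF H g] f P' R N, rotated -1])
        (auto simp: sum_map_hom(2)[OF P' M h] gh)
  qed
qed

lemma projective_prod:
  assumes P: "projective_module R P" and Q: "projective_module R Q"
  shows "projective_module R (module_prod P Q)"
  unfolding projective_module_def
proof (intro conjI allI impI)
  have P': "right_module R P" and Q': "right_module R Q"
    using P Q by (auto intro: projective_right_module)
  show D: "right_module R (module_prod P Q)" by (intro right_module_prod P' Q')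
  fix M :: "('a, ('c \<times> 'd) \<Rightarrow> 'a) module" and N :: "('a, 'c \<times> 'd) module" and g f
  assume M: "right_module R M" and N: "right_module R N" and g: "g \<in> rmod_hom R M N"
    and surj: "g ` carrier M = carrier N" and f: "f \<in> rmod_hom R (module_prod P Q) N"
  have i1: "(\<lambda>x. (x, \<zero>\<^bsub>Q\<^esub>)) \<in> rmod_hom R P (module_prod P Q)"
    and i2: "(\<lambda>y. (\<zero>\<^bsub>P\<^esub>, y)) \<in> rmod_hom R Q (module_prod P Q)"
    and p1: "fst \<in> rmod_hom R (module_prod P Q) P"
    and p2: "snd \<in> rmod_hom R (module_prod P Q) Q"
    using P' Q'
    by (auto intro!: homI simp: module_prod_simps group_simps right_module_group smult_zero_right)
  obtain h1 where h1: "h1 \<in> rmod_hom R P M" and gh1: "\<And>x. x \<in> carrier P \<Longrightarrow> g (h1 x) = f (x, \<zero>\<^bsub>Q\<^esub>)"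
    using projective_lift[OF P M N g _ hom_comp[OF i1 f]] surj by blast
  obtain h2 where h2: "h2 \<in> rmod_hom R Q M" and gh2: "\<And>y. y \<in> carrier Q \<Longrightarrow> g (h2 y) = f (\<zero>\<^bsub>P\<^esub>, y)"
    using projective_lift[OF Q M N g _ hom_comp[OF i2 f]] surj by blast
  have H: "(\<lambda>z. h1 (fst z) \<oplus>\<^bsub>M\<^esub> h2 (snd z)) \<in> rmod_hom R (module_prod P Q) M"
    by (intro hom_plus hom_comp[OF p1 h1] hom_comp[OF p2 h2] M)
  show "\<exists>h\<in>rmod_hom R (module_prod P Q) M. \<forall>z\<in>carrier (module_prod P Q). g (h z) = f z"
  proof (intro bexI[OF _ H] ballI)
    fix z assume "z \<in> carrier (module_prod P Q)"
    then obtain x y where z: "z = (x, y)" "x \<in> carrier P" "y \<in> carrier Q"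
      by (auto simp: module_prod_simps)
    have "f (x, \<zero>\<^bsub>Q\<^esub>) \<oplus>\<^bsub>N\<^esub> f (\<zero>\<^bsub>P\<^esub>, y) = f (x, y)"
      using z P' Q' by (subst hom_add[OF f, symmetric])
        (auto simp: module_prod_simps group_simps right_module_group)
    then show "g (h1 (fst z) \<oplus>\<^bsub>M\<^esub> h2 (snd z)) = f z"
      using z by (simp add: hom_add[OF g] hom_closed[OF h1] hom_closed[OF h2] gh1 gh2)
  qed
qed

section \<open>Quotient categories and induced functors\<close>

lemma UN_eq_const: "\<lbrakk>a \<in> A; \<And>x. x \<in> A \<Longrightarrow> f x = c\<rbrakk> \<Longrightarrow> (\<Union>x\<in>A. f x) = c"
  by blast

text \<open>Conditions on representatives under which \<open>quotient_cat\<close> is a category. The category laws hold up to the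
  relation, so that representatives may differ outside the carriers.\<close>

locale quotient_category =
  fixes Ob :: "'o set" and Mor :: "'o \<Rightarrow> 'o \<Rightarrow> 'f set" and Rel :: "'o \<Rightarrow> 'o \<Rightarrow> ('f \<times> 'f) set"
    and idn :: "'o \<Rightarrow> 'f" and cmp :: "'o \<Rightarrow> 'o \<Rightarrow> 'o \<Rightarrow> 'f \<Rightarrow> 'f \<Rightarrow> 'f"
  assumes Rel_equiv: "\<lbrakk>X \<in> Ob; Y \<in> Ob\<rbrakk> \<Longrightarrow> equiv (Mor X Y) (Rel X Y)"
    and idn_Mor: "X \<in> Ob \<Longrightarrow> idn X \<in> Mor X X"
    and cmp_Mor: "\<lbrakk>X \<in> Ob; Y \<in> Ob; Z \<in> Ob; f \<in> Mor X Y; g \<in> Mor Y Z\<rbrakk> \<Longrightarrow> cmp X Y Z g f \<in> Mor X Z"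
    and cmp_cong_left: "\<lbrakk>X \<in> Ob; Y \<in> Ob; Z \<in> Ob; f \<in> Mor X Y; (g, g') \<in> Rel Y Z\<rbrakk>
      \<Longrightarrow> (cmp X Y Z g f, cmp X Y Z g' f) \<in> Rel X Z"
    and cmp_cong_right: "\<lbrakk>X \<in> Ob; Y \<in> Ob; Z \<in> Ob; (f, f') \<in> Rel X Y; g \<in> Mor Y Z\<rbrakk>
      \<Longrightarrow> (cmp X Y Z g f, cmp X Y Z g f') \<in> Rel X Z"
    and cmp_idn_right: "\<lbrakk>X \<in> Ob; Y \<in> Ob; f \<in> Mor X Y\<rbrakk> \<Longrightarrow> (cmp X X Y f (idn X), f) \<in> Rel X Y"
    and cmp_idn_left: "\<lbrakk>X \<in> Ob; Y \<in> Ob; f \<in> Mor X Y\<rbrakk> \<Longrightarrow> (cmp X Y Y (idn Y) f, f) \<in> Rel X Y"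
    and cmp_assoc: "\<lbrakk>W \<in> Ob; X \<in> Ob; Y \<in> Ob; Z \<in> Ob; f \<in> Mor W X; g \<in> Mor X Y; h \<in> Mor Y Z\<rbrakk>
      \<Longrightarrow> (cmp W X Z (cmp X Y Z h g) f, cmp W Y Z h (cmp W X Y g f)) \<in> Rel W Z"
begin

abbreviation "Q \<equiv> quotient_cat Ob Mor Rel idn cmp"

lemma class_eq: "\<lbrakk>X \<in> Ob; Y \<in> Ob; (f, g) \<in> Rel X Y\<rbrakk> \<Longrightarrow> Rel X Y `` {f} = Rel X Y `` {g}"
  by (rule equiv_class_eq[OF Rel_equiv])

lemma class_cases:
  assumes "c \<in> Hom Q X Y"
  obtains f where "f \<in> Mor X Y" "c = Rel X Y `` {f}"
  using assms by (auto simp: quotient_cat_def elim: quotientE)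

lemma class_Hom: "f \<in> Mor X Y \<Longrightarrow> Rel X Y `` {f} \<in> Hom Q X Y"
  by (simp add: quotient_cat_def quotientI)

lemma in_class_Mor: "\<lbrakk>X \<in> Ob; Y \<in> Ob; g \<in> Rel X Y `` {f}\<rbrakk> \<Longrightarrow> g \<in> Mor X Y"
  using Rel_equiv[of X Y] by (auto simp: equiv_def)

lemma Comp_class:
  assumes "X \<in> Ob" "Y \<in> Ob" "Z \<in> Ob" "f \<in> Mor X Y" "g \<in> Mor Y Z"
  shows "Comp Q X Y Z (Rel Y Z `` {g}) (Rel X Y `` {f}) = Rel X Z `` {cmp X Y Z g f}"
proof -
  have eq: "Rel X Z `` {cmp X Y Z g' f'} = Rel X Z `` {cmp X Y Z g f}"
    if "(g, g') \<in> Rel Y Z" "(f, f') \<in> Rel X Y" for f' g'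
  proof -
    have "f' \<in> Mor X Y" using in_class_Mor that assms by blast
    then have "Rel X Z `` {cmp X Y Z g f'} = Rel X Z `` {cmp X Y Z g' f'}"
      using assms that by (intro class_eq cmp_cong_left)
    moreover have "Rel X Z `` {cmp X Y Z g f} = Rel X Z `` {cmp X Y Z g f'}"
      using assms that by (intro class_eq cmp_cong_right)
    ultimately show ?thesis by simp
  qed
  have "g \<in> Rel Y Z `` {g}" "f \<in> Rel X Y `` {f}"
    using assms by (metis equiv_class_self[OF Rel_equiv])+
  then show ?thesis unfolding quotient_cat_def cat.simps
    by (intro UN_eq_const[where A = "Rel Y Z `` {g}" and a = g] UN_eq_const[where A = "Rel X Y `` {f}" and a = f])
      (auto intro!: eq)
qed

lemma is_category_quotient: "is_category Q"
proof -
  have Obj: "Obj Q = Ob" and Id: "Id Q X = Rel X X `` {idn X}" for X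
    by (simp_all add: quotient_cat_def)
  show ?thesis unfolding is_category_def Obj Id
  proof (intro conjI ballI)
    fix X Y Z f g assume Ob: "X \<in> Ob" "Y \<in> Ob" "Z \<in> Ob" and "f \<in> Hom Q X Y" "g \<in> Hom Q Y Z"
    then show "Comp Q X Y Z g f \<in> Hom Q X Z"
      using Ob class_cases[of f X Y] class_cases[of g Y Z] by (metis Comp_class class_Hom cmp_Mor)
  next
    fix X Y c assume Ob: "X \<in> Ob" "Y \<in> Ob" and c: "c \<in> Hom Q X Y"
    from c obtain f where f: "f \<in> Mor X Y" "c = Rel X Y `` {f}" by (rule class_cases)
    show "Comp Q X X Y c (Rel X X `` {idn X}) = c" "Comp Q X Y Y (Rel Y Y `` {idn Y}) c = c"
      using Ob f(1) unfolding f(2) by (simp_all add: Comp_class idn_Mor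
        class_eq[OF _ _ cmp_idn_right] class_eq[OF _ _ cmp_idn_left])
  next
    fix W X Y Z a b c assume Ob: "W \<in> Ob" "X \<in> Ob" "Y \<in> Ob" "Z \<in> Ob"
      and "a \<in> Hom Q W X" "b \<in> Hom Q X Y" "c \<in> Hom Q Y Z"
    then obtain f g h where f: "f \<in> Mor W X" "g \<in> Mor X Y" "h \<in> Mor Y Z"
      and eq: "a = Rel W X `` {f}" "b = Rel X Y `` {g}" "c = Rel Y Z `` {h}"
      by (meson class_cases)
    show "Comp Q W X Z (Comp Q X Y Z c b) a = Comp Q W Y Z c (Comp Q W X Y b a)"
      using Ob f unfolding eq by (simp add: Comp_class cmp_Mor class_eq[OF _ _ cmp_assoc])
  qed (auto intro: class_Hom idn_Mor)
qed

end

lemma quotient_category_full_subcat: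
  "full_subcat (quotient_cat Ob Mor Rel idn cmp) P = quotient_cat {X \<in> Ob. P X} Mor Rel idn cmp"
  by (simp add: full_subcat_def quotient_cat_def)

lemma (in quotient_category) restrict_objects:
  "quotient_category {X \<in> Ob. P X} Mor Rel idn cmp"
proof qed (auto intro: Rel_equiv idn_Mor cmp_Mor cmp_cong_left cmp_cong_right cmp_idn_right
    cmp_idn_left cmp_assoc)

locale quotient_functor =
  A: quotient_category Ob Mor Rel idn cmp + B: quotient_category Ob' Mor' Rel' idn' cmp'
  for Ob :: "'o set" and Mor :: "'o \<Rightarrow> 'o \<Rightarrow> 'f set" and Rel idn cmp
    and Ob' :: "'p set" and Mor' :: "'p \<Rightarrow> 'p \<Rightarrow> 'g set" and Rel' idn' cmp' +
  fixes F0 :: "'o \<Rightarrow> 'p" and F1 :: "'o \<Rightarrow> 'o \<Rightarrow> 'f \<Rightarrow> 'g"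
  assumes F0: "X \<in> Ob \<Longrightarrow> F0 X \<in> Ob'"
    and F1: "\<lbrakk>X \<in> Ob; Y \<in> Ob; f \<in> Mor X Y\<rbrakk> \<Longrightarrow> F1 X Y f \<in> Mor' (F0 X) (F0 Y)"
    and F1_cong: "\<lbrakk>X \<in> Ob; Y \<in> Ob; (f, g) \<in> Rel X Y\<rbrakk> \<Longrightarrow> (F1 X Y f, F1 X Y g) \<in> Rel' (F0 X) (F0 Y)"
    and F1_idn: "X \<in> Ob \<Longrightarrow> (F1 X X (idn X), idn' (F0 X)) \<in> Rel' (F0 X) (F0 X)"
    and F1_cmp: "\<lbrakk>X \<in> Ob; Y \<in> Ob; Z \<in> Ob; f \<in> Mor X Y; g \<in> Mor Y Z\<rbrakk> \<Longrightarrow>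
      (F1 X Z (cmp X Y Z g f), cmp' (F0 X) (F0 Y) (F0 Z) (F1 Y Z g) (F1 X Y f)) \<in> Rel' (F0 X) (F0 Z)"
begin

abbreviation "F \<equiv> induced_functor Rel' F0 F1"

lemma fmor_class:
  assumes "X \<in> Ob" "Y \<in> Ob" "f \<in> Mor X Y"
  shows "fmor F X Y (Rel X Y `` {f}) = Rel' (F0 X) (F0 Y) `` {F1 X Y f}"
proof -
  have eq: "Rel' (F0 X) (F0 Y) `` {F1 X Y g} = Rel' (F0 X) (F0 Y) `` {F1 X Y f}" if "(f, g) \<in> Rel X Y" for g
    using B.class_eq[OF F0 F0 F1_cong] assms that by simp
  have "f \<in> Rel X Y `` {f}" using assms by (intro equiv_class_self[OF A.Rel_equiv])
  then show ?thesis unfolding induced_functor_def fctr.simps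
    by (intro UN_eq_const[of f]) (auto intro!: eq)
qed

lemma is_functor_induced: "is_functor A.Q B.Q F"
proof -
  have simps: "Obj A.Q = Ob" "Obj B.Q = Ob'" "fobj F = F0"
    "Id A.Q X = Rel X X `` {idn X}" "Id B.Q X' = Rel' X' X' `` {idn' X'}" for X X'
    by (simp_all add: quotient_cat_def induced_functor_def)
  show ?thesis unfolding is_functor_def simps
  proof (intro conjI ballI A.is_category_quotient B.is_category_quotient F0)
    fix X Y f assume Ob: "X \<in> Ob" "Y \<in> Ob" and "f \<in> Hom A.Q X Y"
    then show "fmor F X Y f \<in> Hom B.Q (F0 X) (F0 Y)"
      using Ob A.class_cases[of f X Y] by (metis fmor_class B.class_Hom F1)
  next
    fix X assume "X \<in> Ob"
    then show "fmor F X X (Rel X X `` {idn X}) = Rel' (F0 X) (F0 X) `` {idn' (F0 X)}"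
      by (simp add: fmor_class A.idn_Mor B.class_eq[OF F0 F0 F1_idn])
  next
    fix X Y Z a b assume Ob: "X \<in> Ob" "Y \<in> Ob" "Z \<in> Ob" and "a \<in> Hom A.Q X Y" "b \<in> Hom A.Q Y Z"
    then obtain f g where f: "f \<in> Mor X Y" "g \<in> Mor Y Z"
      and eq: "a = Rel X Y `` {f}" "b = Rel Y Z `` {g}"
      by (meson A.class_cases)
    show "fmor F X Z (Comp A.Q X Y Z b a) =
        Comp B.Q (F0 X) (F0 Y) (F0 Z) (fmor F Y Z b) (fmor F X Y a)"
      using Ob f unfolding eq
      by (simp add: A.Comp_class B.Comp_class F0 F1 fmor_class A.cmp_Mor B.class_eq[OF _ _ F1_cmp])
  qed
qed

end

context quotient_functor
begin

lemma restrict_codomain: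
  assumes "\<And>X. X \<in> Ob \<Longrightarrow> P (F0 X)"
  shows "quotient_functor Ob Mor Rel idn cmp {Y \<in> Ob'. P Y} Mor' Rel' idn' cmp' F0 F1"
  by (intro quotient_functor.intro A.quotient_category_axioms B.restrict_objects quotient_functor_axioms.intro)
    (use assms F0 F1 F1_cong F1_idn F1_cmp in auto)

text \<open>A composite of induced functors is induced by the composite assignment. The assignment \<open>H0\<close>, \<open>H1\<close> need
  only agree with it on objects and morphisms, which is how two different formulas are compared.\<close>

lemma functor_comp_induced:
  assumes G: "quotient_functor Ob' Mor' Rel' idn' cmp' Ob'' Mor'' Rel'' idn'' cmp'' G0 G1"
    and H0: "\<And>X. X \<in> Ob \<Longrightarrow> H0 X = G0 (F0 X)"
    and H1: "\<And>X Y f. \<lbrakk>X \<in> Ob; Y \<in> Ob; f \<in> Mor X Y\<rbrakk> \<Longrightarrow> H1 X Y f = G1 (F0 X) (F0 Y) (F1 X Y f)"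
  shows "functor_eq A.Q (induced_functor Rel'' H0 H1) (functor_comp (induced_functor Rel'' G0 G1) F)"
proof -
  interpret G: quotient_functor Ob' Mor' Rel' idn' cmp' Ob'' Mor'' Rel'' idn'' cmp'' G0 G1 by (rule G)
  have Obj: "Obj A.Q = Ob" by (simp add: quotient_cat_def)
  show ?thesis
    unfolding functor_eq_def Obj
  proof (intro conjI ballI)
    fix X assume "X \<in> Ob"
    then show "fobj (induced_functor Rel'' H0 H1) X = fobj (functor_comp G.F F) X"
      by (simp add: induced_functor_def functor_comp_def H0)
  next
    fix X Y c assume X: "X \<in> Ob" and Y: "Y \<in> Ob" and "c \<in> Hom A.Q X Y"
    then obtain f where f: "f \<in> Mor X Y" and c: "c = Rel X Y `` {f}" by (auto elim: A.class_cases)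
    let ?G = "\<lambda>g. Rel'' (G0 (F0 X)) (G0 (F0 Y)) `` {G1 (F0 X) (F0 Y) (F1 X Y g)}"
    have "fmor (induced_functor Rel'' H0 H1) X Y c = ?G f"
      unfolding induced_functor_def fctr.simps
    proof (rule UN_eq_const)
      show "f \<in> c" unfolding c by (rule equiv_class_self[OF A.Rel_equiv[OF X Y] f])
      fix g assume "g \<in> c"
      then have fg: "(f, g) \<in> Rel X Y" and g: "g \<in> Mor X Y" using A.in_class_Mor[OF X Y] by (auto simp: c)
      have "?G g = ?G f"
        using G.B.class_eq[OF G.F0[OF F0[OF X]] G.F0[OF F0[OF Y]] G.F1_cong[OF F0[OF X] F0[OF Y] F1_cong[OF X Y fg]]] by simp
      then show "Rel'' (H0 X) (H0 Y) `` {H1 X Y g} = ?G f" by (simp add: H0 X Y H1 g)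
    qed
    also have "\<dots> = fmor (functor_comp G.F F) X Y c"
      by (simp add: functor_comp_def c fmor_class[OF X Y f] G.fmor_class[OF F0[OF X] F0[OF Y] F1[OF X Y f]])
        (simp add: induced_functor_def G.fmor_class[OF F0[OF X] F0[OF Y] F1[OF X Y f], unfolded induced_functor_def, simplified])
    finally show "fmor (induced_functor Rel'' H0 H1) X Y c = fmor (functor_comp G.F F) X Y c" .
  qed
qed

end

lemma is_functor_comp:
  assumes F: "is_functor C D F" and G: "is_functor D E G"
  shows "is_functor C E (functor_comp G F)"
  using assms unfolding is_functor_def functor_comp_def by simp

lemma is_functor_cong:
  assumes G: "is_functor C D G" and eq: "functor_eq C F G"
  shows "is_functor C D F"
proof -
  have o: "\<And>X. X \<in> Obj C \<Longrightarrow> fobj F X = fobj G X"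
    and m: "\<And>X Y f. X \<in> Obj C \<Longrightarrow> Y \<in> Obj C \<Longrightarrow> f \<in> Hom C X Y \<Longrightarrow> fmor F X Y f = fmor G X Y f"
    using eq by (auto simp: functor_eq_def)
  have "is_category C" using G by (simp add: is_functor_def)
  then have "\<And>X. X \<in> Obj C \<Longrightarrow> Id C X \<in> Hom C X X"
    "\<And>X Y Z f g. X \<in> Obj C \<Longrightarrow> Y \<in> Obj C \<Longrightarrow> Z \<in> Obj C \<Longrightarrow> f \<in> Hom C X Y \<Longrightarrow> g \<in> Hom C Y Z
      \<Longrightarrow> Comp C X Y Z g f \<in> Hom C X Z"
    by (simp_all add: is_category_def)
  then show ?thesis using G unfolding is_functor_def by (simp add: o m)
qed

section \<open>Chain homotopies\<close>

text \<open>Complexes of arbitrary right modules, because modules of Laurent families over projective modules need not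
  be projective.\<close>

definition module_complexes :: "('r, 'q) ring_scheme \<Rightarrow> ('r, 'm) cpx set" where
  "module_complexes R = {C.
     (\<forall>i. right_module R (Cmod C i)) \<and>
     (\<forall>i. Cdiff C i \<in> rmod_hom R (Cmod C i) (Cmod C (i + 1))) \<and>
     (\<forall>i. \<forall>x\<in>carrier (Cmod C i). Cdiff C (i + 1) (Cdiff C i x) = \<zero>\<^bsub>Cmod C (i + 2)\<^esub>)}"

lemma proj_module_complex: "C \<in> proj_complexes R \<Longrightarrow> C \<in> module_complexes R"
  by (auto simp: proj_complexes_def module_complexes_def projective_right_module)

lemma module_complexD:
  assumes "C \<in> module_complexes R"
  shows "right_module R (Cmod C i)" "abelian_group (Cmod C i)"
    "Cdiff C i \<in> rmod_hom R (Cmod C i) (Cmod C (i + 1))"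
    "Cdiff C (i - 1) \<in> rmod_hom R (Cmod C (i - 1)) (Cmod C i)"
    "x \<in> carrier (Cmod C i) \<Longrightarrow> Cdiff C (i + 1) (Cdiff C i x) = \<zero>\<^bsub>Cmod C (i + 2)\<^esub>"
proof -
  show "right_module R (Cmod C i)" "Cdiff C i \<in> rmod_hom R (Cmod C i) (Cmod C (i + 1))"
    "x \<in> carrier (Cmod C i) \<Longrightarrow> Cdiff C (i + 1) (Cdiff C i x) = \<zero>\<^bsub>Cmod C (i + 2)\<^esub>" for i x
    using assms by (auto simp: module_complexes_def)
  then show "abelian_group (Cmod C i)" "Cdiff C (i - 1) \<in> rmod_hom R (Cmod C (i - 1)) (Cmod C i)"
    by (metis right_module_group) (metis diff_add_cancel \<open>\<And>i. Cdiff C i \<in> _ i\<close>)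
qed

lemma chain_mapD:
  assumes "f \<in> chain_maps R C D"
  shows "f i \<in> rmod_hom R (Cmod C i) (Cmod D i)"
    "x \<in> carrier (Cmod C i) \<Longrightarrow> f (i + 1) (Cdiff C i x) = Cdiff D i (f i x)"
    "x \<in> carrier (Cmod C (i - 1)) \<Longrightarrow> f i (Cdiff C (i - 1) x) = Cdiff D (i - 1) (f (i - 1) x)"
  using assms by (auto simp: chain_maps_def) (metis diff_add_cancel)

definition homotopy_between ::
  "('r, 'm) cpx \<Rightarrow> ('r, 'n) cpx \<Rightarrow> (int \<Rightarrow> 'm \<Rightarrow> 'n) \<Rightarrow> (int \<Rightarrow> 'm \<Rightarrow> 'n) \<Rightarrow> (int \<Rightarrow> 'm \<Rightarrow> 'n) \<Rightarrow> bool" where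
  "homotopy_between C D h f g \<longleftrightarrow> (\<forall>i. \<forall>x\<in>carrier (Cmod C i).
     f i x = g i x \<oplus>\<^bsub>Cmod D i\<^esub> (Cdiff D (i - 1) (h i x) \<oplus>\<^bsub>Cmod D i\<^esub> h (i + 1) (Cdiff C i x)))"

definition degree_maps ::
  "('r, 'q) ring_scheme \<Rightarrow> ('r, 'm) cpx \<Rightarrow> ('r, 'n) cpx \<Rightarrow> (int \<Rightarrow> 'm \<Rightarrow> 'n) set" where
  "degree_maps R C D = {h. \<forall>i. h i \<in> rmod_hom R (Cmod C i) (Cmod D (i - 1))}"

lemma homotopic_iff:
  "homotopic R C D f g \<longleftrightarrow> (\<exists>h\<in>degree_maps R C D. homotopy_between C D h f g)"
  by (auto simp: homotopic_def homotopy_between_def degree_maps_def)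

lemma degree_mapsD:
  assumes "h \<in> degree_maps R C D"
  shows "h i \<in> rmod_hom R (Cmod C i) (Cmod D (i - 1))" "h (i + 1) \<in> rmod_hom R (Cmod C (i + 1)) (Cmod D i)"
proof -
  show *: "h i \<in> rmod_hom R (Cmod C i) (Cmod D (i - 1))" for i
    using assms by (simp add: degree_maps_def)
  show "h (i + 1) \<in> rmod_hom R (Cmod C (i + 1)) (Cmod D i)" using *[of "i + 1"] by simp
qed

definition plus_maps :: "('r, 'n) cpx \<Rightarrow> (int \<Rightarrow> 'm \<Rightarrow> 'n) \<Rightarrow> (int \<Rightarrow> 'm \<Rightarrow> 'n) \<Rightarrow> int \<Rightarrow> 'm \<Rightarrow> 'n" where
  "plus_maps D f g = (\<lambda>i x. f i x \<oplus>\<^bsub>Cmod D i\<^esub> g i x)"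

definition plus_homotopy :: "('r, 'n) cpx \<Rightarrow> (int \<Rightarrow> 'm \<Rightarrow> 'n) \<Rightarrow> (int \<Rightarrow> 'm \<Rightarrow> 'n) \<Rightarrow> int \<Rightarrow> 'm \<Rightarrow> 'n" where
  "plus_homotopy D h k = (\<lambda>i x. h i x \<oplus>\<^bsub>Cmod D (i - 1)\<^esub> k i x)"

definition minus_homotopy :: "('r, 'n) cpx \<Rightarrow> (int \<Rightarrow> 'm \<Rightarrow> 'n) \<Rightarrow> int \<Rightarrow> 'm \<Rightarrow> 'n" where
  "minus_homotopy D h = (\<lambda>i x. \<ominus>\<^bsub>Cmod D (i - 1)\<^esub> h i x)"

definition zero_homotopy :: "('r, 'n) cpx \<Rightarrow> int \<Rightarrow> 'm \<Rightarrow> 'n" where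
  "zero_homotopy D = (\<lambda>i x. \<zero>\<^bsub>Cmod D (i - 1)\<^esub>)"

context abelian_group
begin

lemma homotopy_group_sym:
  "\<lbrakk>g \<in> carrier G; a \<in> carrier G; b \<in> carrier G\<rbrakk> \<Longrightarrow> g = (g \<oplus> (a \<oplus> b)) \<oplus> (\<ominus> a \<oplus> \<ominus> b)"
  by (simp add: a_assoc add_neg_cancel' r_neg1 r_neg2 r_neg l_neg a_lcomm[of b])

end

lemma chain_map_id: "(\<lambda>i x. x) \<in> chain_maps R C C"
  by (simp add: chain_maps_def hom_id)

lemma chain_map_comp:
  assumes "f \<in> chain_maps R B C" "g \<in> chain_maps R C D"
  shows "(\<lambda>i x. g i (f i x)) \<in> chain_maps R B D"
  using chain_mapD(1)[OF assms(1)] chain_mapD(1)[OF assms(2)]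
    chain_mapD(2)[OF assms(1)] chain_mapD(2)[OF assms(2)] hom_comp hom_closed
  unfolding chain_maps_def by (fastforce intro: hom_comp)

context
  fixes R :: "('r, 'q) ring_scheme" and C :: "('r, 'm) cpx" and D :: "('r, 'n) cpx"
  assumes C: "C \<in> module_complexes R" and D: "D \<in> module_complexes R"
begin

lemma chain_map_plus:
  assumes f: "f \<in> chain_maps R C D" and g: "g \<in> chain_maps R C D"
  shows "plus_maps D f g \<in> chain_maps R C D"
proof -
  have "plus_maps D f g i \<in> rmod_hom R (Cmod C i) (Cmod D i)" for i
    unfolding plus_maps_def
    by (intro hom_plus chain_mapD(1)[OF f] chain_mapD(1)[OF g] module_complexD(1)[OF D])
  moreover have "plus_maps D f g (i + 1) (Cdiff C i x) = Cdiff D i (plus_maps D f g i x)"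
    if x: "x \<in> carrier (Cmod C i)" for i x
    using x hom_closed[OF chain_mapD(1)[OF f] x] hom_closed[OF chain_mapD(1)[OF g] x]
    by (simp add: plus_maps_def chain_mapD(2)[OF f] chain_mapD(2)[OF g] hom_add[OF module_complexD(3)[OF D]])
  ultimately show ?thesis by (simp add: chain_maps_def)
qed

lemma chain_map_minus:
  assumes f: "f \<in> chain_maps R C D"
  shows "(\<lambda>i x. \<ominus>\<^bsub>Cmod D i\<^esub> f i x) \<in> chain_maps R C D"
  using hom_uminus[OF chain_mapD(1)[OF f] module_complexD(1)[OF D]] chain_mapD(2)[OF f]
    hom_minus[OF module_complexD(3)[OF D] module_complexD(2)[OF D] module_complexD(2)[OF D]
      hom_closed[OF chain_mapD(1)[OF f]]]
  by (auto simp: chain_maps_def)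

lemma chain_map_zero: "zero_map D \<in> chain_maps R C D"
  unfolding chain_maps_def zero_map_def
  by (auto intro: hom_const_zero module_complexD(1)[OF D]
    simp: hom_zero[OF module_complexD(3)[OF D] module_complexD(2)[OF D] module_complexD(2)[OF D]])

lemma degree_map_plus:
  "h \<in> degree_maps R C D \<Longrightarrow> k \<in> degree_maps R C D \<Longrightarrow> plus_homotopy D h k \<in> degree_maps R C D"
  unfolding degree_maps_def plus_homotopy_def by (auto intro: hom_plus module_complexD(1)[OF D])

lemma degree_map_minus:
  "h \<in> degree_maps R C D \<Longrightarrow> minus_homotopy D h \<in> degree_maps R C D"
  unfolding degree_maps_def minus_homotopy_def by (auto intro: hom_uminus module_complexD(1)[OF D])

lemma degree_map_zero: "zero_homotopy D \<in> degree_maps R C D"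
  unfolding degree_maps_def zero_homotopy_def by (auto intro: hom_const_zero module_complexD(1)[OF D])

lemmas C_simps = hom_closed[OF module_complexD(3)[OF C]]
lemmas D_simps = hom_closed[OF module_complexD(4)[OF D]] hom_closed[OF module_complexD(3)[OF D]]
  hom_zero[OF module_complexD(4)[OF D] module_complexD(2)[OF D] module_complexD(2)[OF D]]
  hom_add[OF module_complexD(4)[OF D]]
  hom_minus[OF module_complexD(4)[OF D] module_complexD(2)[OF D] module_complexD(2)[OF D]]
  group_simps[OF module_complexD(2)[OF D]]

lemma homotopy_between_zero:
  assumes "\<And>i x. x \<in> carrier (Cmod C i) \<Longrightarrow> f i x = g i x"
    and "\<And>i x. x \<in> carrier (Cmod C i) \<Longrightarrow> g i x \<in> carrier (Cmod D i)"
  shows "homotopy_between C D (zero_homotopy D) f g"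
  unfolding homotopy_between_def zero_homotopy_def by (simp add: D_simps assms)

lemma homotopy_between_minus:
  assumes h: "h \<in> degree_maps R C D" and fg: "homotopy_between C D h f g"
    and g: "\<And>i x. x \<in> carrier (Cmod C i) \<Longrightarrow> g i x \<in> carrier (Cmod D i)"
  shows "homotopy_between C D (minus_homotopy D h) g f"
  unfolding homotopy_between_def
proof (intro allI ballI)
  fix i x assume x: "x \<in> carrier (Cmod C i)"
  note cl = hom_closed[OF degree_mapsD(1)[OF h]] hom_closed[OF degree_mapsD(2)[OF h]]
  show "g i x = f i x \<oplus>\<^bsub>Cmod D i\<^esub> (Cdiff D (i - 1) (minus_homotopy D h i x)
      \<oplus>\<^bsub>Cmod D i\<^esub> minus_homotopy D h (i + 1) (Cdiff C i x))"
    using fg x abelian_group.homotopy_group_sym[OF module_complexD(2)[OF D], of "g i x" i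
        "Cdiff D (i - 1) (h i x)" "h (i + 1) (Cdiff C i x)"]
    unfolding homotopy_between_def by (simp add: minus_homotopy_def D_simps C_simps cl g)
qed

lemma homotopy_between_plus:
  assumes h: "h \<in> degree_maps R C D" and k: "k \<in> degree_maps R C D"
    and fg: "homotopy_between C D h f g" and fg': "homotopy_between C D k f' g'"
    and g: "\<And>i x. x \<in> carrier (Cmod C i) \<Longrightarrow> g i x \<in> carrier (Cmod D i)"
    and g': "\<And>i x. x \<in> carrier (Cmod C i) \<Longrightarrow> g' i x \<in> carrier (Cmod D i)"
  shows "homotopy_between C D (plus_homotopy D h k) (plus_maps D f f') (plus_maps D g g')"
  unfolding homotopy_between_def
proof (intro allI ballI)
  fix i x assume x: "x \<in> carrier (Cmod C i)"
  note cl = hom_closed[OF degree_mapsD(1)[OF h]] hom_closed[OF degree_mapsD(2)[OF h]]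
    hom_closed[OF degree_mapsD(1)[OF k]] hom_closed[OF degree_mapsD(2)[OF k]]
  show "plus_maps D f f' i x = plus_maps D g g' i x \<oplus>\<^bsub>Cmod D i\<^esub>
      (Cdiff D (i - 1) (plus_homotopy D h k i x)
      \<oplus>\<^bsub>Cmod D i\<^esub> plus_homotopy D h k (i + 1) (Cdiff C i x))"
    using fg fg' x unfolding homotopy_between_def
    by (simp add: plus_homotopy_def plus_maps_def D_simps C_simps cl g g' group_ac[OF module_complexD(2)[OF D]])
qed

lemma homotopy_between_trans:
  assumes h: "h \<in> degree_maps R C D" and k: "k \<in> degree_maps R C D"
    and fg: "homotopy_between C D h f g" and gl: "homotopy_between C D k g l"
    and l: "\<And>i x. x \<in> carrier (Cmod C i) \<Longrightarrow> l i x \<in> carrier (Cmod D i)"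
  shows "homotopy_between C D (plus_homotopy D h k) f l"
  unfolding homotopy_between_def
proof (intro allI ballI)
  fix i x assume x: "x \<in> carrier (Cmod C i)"
  note cl = hom_closed[OF degree_mapsD(1)[OF h]] hom_closed[OF degree_mapsD(2)[OF h]]
    hom_closed[OF degree_mapsD(1)[OF k]] hom_closed[OF degree_mapsD(2)[OF k]]
  show "f i x = l i x \<oplus>\<^bsub>Cmod D i\<^esub>
      (Cdiff D (i - 1) (plus_homotopy D h k i x)
      \<oplus>\<^bsub>Cmod D i\<^esub> plus_homotopy D h k (i + 1) (Cdiff C i x))"
    using fg gl x unfolding homotopy_between_def
    by (simp add: plus_homotopy_def D_simps C_simps cl l group_ac[OF module_complexD(2)[OF D]])
qed

end

lemma homotopy_between_comp_left:
  assumes C: "C \<in> module_complexes R" and D: "D \<in> module_complexes R" and E: "E \<in> module_complexes R"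
    and h: "h \<in> degree_maps R C D" and fg: "homotopy_between C D h f f'"
    and f': "\<And>i x. x \<in> carrier (Cmod C i) \<Longrightarrow> f' i x \<in> carrier (Cmod D i)"
    and g: "g \<in> chain_maps R D E"
  shows "homotopy_between C E (\<lambda>i x. g (i - 1) (h i x)) (\<lambda>i x. g i (f i x)) (\<lambda>i x. g i (f' i x))"
    and "(\<lambda>i x. g (i - 1) (h i x)) \<in> degree_maps R C E"
proof -
  show "(\<lambda>i x. g (i - 1) (h i x)) \<in> degree_maps R C E"
    using degree_mapsD(1)[OF h] chain_mapD(1)[OF g] by (auto simp: degree_maps_def intro: hom_comp)
  show "homotopy_between C E (\<lambda>i x. g (i - 1) (h i x)) (\<lambda>i x. g i (f i x)) (\<lambda>i x. g i (f' i x))"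
    unfolding homotopy_between_def
  proof (intro allI ballI)
    fix i x assume x: "x \<in> carrier (Cmod C i)"
    note cl = hom_closed[OF degree_mapsD(1)[OF h]] hom_closed[OF degree_mapsD(2)[OF h]]
    show "g i (f i x) = g i (f' i x) \<oplus>\<^bsub>Cmod E i\<^esub>
      (Cdiff E (i - 1) (g (i - 1) (h i x)) \<oplus>\<^bsub>Cmod E i\<^esub> g (i + 1 - 1) (h (i + 1) (Cdiff C i x)))"
      using fg x unfolding homotopy_between_def
      by (simp add: hom_add[OF chain_mapD(1)[OF g]] f' D_simps[OF C D] C_simps[OF C D] cl
        chain_mapD(3)[OF g])
  qed
qed

lemma homotopy_between_comp_right:
  assumes B: "B \<in> module_complexes R" and h: "h \<in> degree_maps R C D" and fg: "homotopy_between C D h f f'"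
    and g: "g \<in> chain_maps R B C"
  shows "homotopy_between B D (\<lambda>i x. h i (g i x)) (\<lambda>i x. f i (g i x)) (\<lambda>i x. f' i (g i x))"
    and "(\<lambda>i x. h i (g i x)) \<in> degree_maps R B D"
proof -
  show "(\<lambda>i x. h i (g i x)) \<in> degree_maps R B D"
    using degree_mapsD(1)[OF h] chain_mapD(1)[OF g] by (auto simp: degree_maps_def intro: hom_comp)
  show "homotopy_between B D (\<lambda>i x. h i (g i x)) (\<lambda>i x. f i (g i x)) (\<lambda>i x. f' i (g i x))"
    unfolding homotopy_between_def
    using fg by (auto simp: homotopy_between_def chain_mapD(2)[OF g] hom_closed[OF chain_mapD(1)[OF g]])
qed

lemma homotopy_relD:
  "(f, g) \<in> homotopy_rel R C D \<Longrightarrow> f \<in> chain_maps R C D"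
  "(f, g) \<in> homotopy_rel R C D \<Longrightarrow> g \<in> chain_maps R C D"
  "(f, g) \<in> homotopy_rel R C D \<Longrightarrow> \<exists>h\<in>degree_maps R C D. homotopy_between C D h f g"
  by (auto simp: homotopy_rel_def homotopic_iff)

lemma homotopy_relI:
  "\<lbrakk>f \<in> chain_maps R C D; g \<in> chain_maps R C D; h \<in> degree_maps R C D; homotopy_between C D h f g\<rbrakk>
    \<Longrightarrow> (f, g) \<in> homotopy_rel R C D"
  by (auto simp: homotopy_rel_def homotopic_iff)

lemma homotopy_rel_eqI:
  assumes "C \<in> module_complexes R" "D \<in> module_complexes R" "f \<in> chain_maps R C D" "g \<in> chain_maps R C D"
    and "\<And>i x. x \<in> carrier (Cmod C i) \<Longrightarrow> f i x = g i x"
  shows "(f, g) \<in> homotopy_rel R C D"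
  by (rule homotopy_relI[OF assms(3,4) degree_map_zero[OF assms(1,2)] homotopy_between_zero[OF assms(1,2)]])
    (auto intro: assms(5) hom_closed[OF chain_mapD(1)[OF assms(4)]])

lemma homotopy_rel_sym:
  assumes C: "C \<in> module_complexes R" and D: "D \<in> module_complexes R" and fg: "(f, g) \<in> homotopy_rel R C D"
  shows "(g, f) \<in> homotopy_rel R C D"
proof -
  obtain h where h: "h \<in> degree_maps R C D" "homotopy_between C D h f g"
    using homotopy_relD(3)[OF fg] by blast
  show ?thesis
    by (rule homotopy_relI[OF homotopy_relD(2,1)[OF fg] degree_map_minus[OF C D h(1)]
        homotopy_between_minus[OF C D h]]) (rule hom_closed[OF chain_mapD(1)[OF homotopy_relD(2)[OF fg]]])
qed

lemma homotopy_rel_trans: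
  assumes C: "C \<in> module_complexes R" and D: "D \<in> module_complexes R"
    and fg: "(f, g) \<in> homotopy_rel R C D" and gl: "(g, l) \<in> homotopy_rel R C D"
  shows "(f, l) \<in> homotopy_rel R C D"
proof -
  obtain h where h: "h \<in> degree_maps R C D" "homotopy_between C D h f g"
    using homotopy_relD(3)[OF fg] by blast
  obtain k where k: "k \<in> degree_maps R C D" "homotopy_between C D k g l"
    using homotopy_relD(3)[OF gl] by blast
  show ?thesis
    by (rule homotopy_relI[OF homotopy_relD(1)[OF fg] homotopy_relD(2)[OF gl]
        degree_map_plus[OF C D h(1) k(1)] homotopy_between_trans[OF C D h(1) k(1) h(2) k(2)]])
      (rule hom_closed[OF chain_mapD(1)[OF homotopy_relD(2)[OF gl]]])
qed

lemma homotopy_rel_equiv: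
  assumes C: "C \<in> module_complexes R" and D: "D \<in> module_complexes R"
  shows "equiv (chain_maps R C D) (homotopy_rel R C D)"
proof (rule equivI)
  show "homotopy_rel R C D \<subseteq> chain_maps R C D \<times> chain_maps R C D"
    by (auto dest: homotopy_relD)
  show "refl_on (chain_maps R C D) (homotopy_rel R C D)"
    by (rule refl_onI) (auto intro: homotopy_rel_eqI[OF C D])
  show "sym (homotopy_rel R C D)" by (rule symI) (rule homotopy_rel_sym[OF C D])
  show "trans (homotopy_rel R C D)" by (rule transI) (rule homotopy_rel_trans[OF C D])
qed

lemma homotopy_rel_plus:
  assumes C: "C \<in> module_complexes R" and D: "D \<in> module_complexes R"
    and fg: "(f, g) \<in> homotopy_rel R C D" and fg': "(f', g') \<in> homotopy_rel R C D"
  shows "(plus_maps D f f', plus_maps D g g') \<in> homotopy_rel R C D"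
proof -
  obtain h where h: "h \<in> degree_maps R C D" "homotopy_between C D h f g"
    using homotopy_relD(3)[OF fg] by blast
  obtain k where k: "k \<in> degree_maps R C D" "homotopy_between C D k f' g'"
    using homotopy_relD(3)[OF fg'] by blast
  show ?thesis
    by (rule homotopy_relI[OF chain_map_plus[OF C D] chain_map_plus[OF C D]
        degree_map_plus[OF C D h(1) k(1)] homotopy_between_plus[OF C D h(1) k(1) h(2) k(2)]])
      (auto intro: homotopy_relD(1,2)[OF fg] homotopy_relD(1,2)[OF fg']
        hom_closed[OF chain_mapD(1)[OF homotopy_relD(2)[OF fg]]]
        hom_closed[OF chain_mapD(1)[OF homotopy_relD(2)[OF fg']]])
qed

lemma homotopy_rel_comp_left:
  assumes C: "C \<in> module_complexes R" and D: "D \<in> module_complexes R" and E: "E \<in> module_complexes R"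
    and ff': "(f, f') \<in> homotopy_rel R C D" and g: "g \<in> chain_maps R D E"
  shows "(\<lambda>i x. g i (f i x), \<lambda>i x. g i (f' i x)) \<in> homotopy_rel R C E"
proof -
  obtain h where h: "h \<in> degree_maps R C D" "homotopy_between C D h f f'"
    using homotopy_relD(3)[OF ff'] by blast
  note cl = hom_closed[OF chain_mapD(1)[OF homotopy_relD(2)[OF ff']]]
  show ?thesis
    by (rule homotopy_relI[OF chain_map_comp[OF homotopy_relD(1)[OF ff'] g]
        chain_map_comp[OF homotopy_relD(2)[OF ff'] g]
        homotopy_between_comp_left(2,1)[OF C D E h cl g]])
qed

lemma homotopy_rel_comp_right:
  assumes B: "B \<in> module_complexes R" and ff': "(f, f') \<in> homotopy_rel R C D" and g: "g \<in> chain_maps R B C"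
  shows "(\<lambda>i x. f i (g i x), \<lambda>i x. f' i (g i x)) \<in> homotopy_rel R B D"
proof -
  obtain h where h: "h \<in> degree_maps R C D" "homotopy_between C D h f f'"
    using homotopy_relD(3)[OF ff'] by blast
  show ?thesis
    by (rule homotopy_relI[OF chain_map_comp[OF g homotopy_relD(1)[OF ff']]
        chain_map_comp[OF g homotopy_relD(2)[OF ff']]
        homotopy_between_comp_right(2,1)[OF B h g]])
qed

lemma quotient_category_K_Proj:
  "quotient_category (proj_complexes R) (chain_maps R) (homotopy_rel R)
     (\<lambda>C i x. x) (\<lambda>C D E g f i x. g i (f i x))"
proof (rule quotient_category.intro, goal_cases)
  case (4 X Y Z f g g')
  show ?case by (rule homotopy_rel_comp_right[OF proj_module_complex[OF 4(1)] 4(5,4)])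
next
  case (5 X Y Z f f' g)
  show ?case by (rule homotopy_rel_comp_left[OF 5(1-3)[THEN proj_module_complex] 5(4,5)])
qed (auto intro: homotopy_rel_equiv proj_module_complex chain_map_id chain_map_comp
    intro!: homotopy_rel_eqI)

section \<open>The homotopy category of complexes over \<open>Sum-T\<close>\<close>

lemma col_simps [simp]: "Cmod (col X j) i = Smod X i j" "Cdiff (col X j) i = S0 X i j"
  by (simp_all add: col_def)

lemma SumT_complexD:
  assumes "X \<in> SumT_complexes R T"
  shows "col X j \<in> Sum_T R T" "col X j \<in> module_complexes R"
    "(\<lambda>i. S1 X i j) \<in> chain_maps R (col X j) (col X (j + 1))"
    "(\<lambda>i. S1 X i (j - 1)) \<in> chain_maps R (col X (j - 1)) (col X j)"
proof -
  show *: "col X j \<in> Sum_T R T" "(\<lambda>i. S1 X i j) \<in> chain_maps R (col X j) (col X (j + 1))" for j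
    using assms by (auto simp: SumT_complexes_def)
  then show "col X j \<in> module_complexes R" by (auto simp: Sum_T_def intro: proj_module_complex)
  show "(\<lambda>i. S1 X i (j - 1)) \<in> chain_maps R (col X (j - 1)) (col X j)" using *(2)[of "j - 1"] by simp
qed

lemma SumT_mapD:
  assumes "\<alpha> \<in> SumT_maps R X Y" "X \<in> SumT_complexes R T" "Y \<in> SumT_complexes R T"
  shows "(\<lambda>i. \<alpha> i j) \<in> chain_maps R (col X j) (col Y j)"
    "(\<lambda>i x. S1 Y i j (\<alpha> i j x), \<lambda>i x. \<alpha> i (j + 1) (S1 X i j x)) \<in> homotopy_rel R (col X j) (col Y (j + 1))"
proof -
  show *: "(\<lambda>i. \<alpha> i j) \<in> chain_maps R (col X j) (col Y j)" for j
    using assms by (auto simp: SumT_maps_def)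
  show "(\<lambda>i x. S1 Y i j (\<alpha> i j x), \<lambda>i x. \<alpha> i (j + 1) (S1 X i j x)) \<in> homotopy_rel R (col X j) (col Y (j + 1))"
    using assms(1) chain_map_comp[OF * SumT_complexD(3)[OF assms(3)]]
      chain_map_comp[OF SumT_complexD(3)[OF assms(2)] *]
    by (auto simp: homotopy_rel_def SumT_maps_def)
qed

lemma SumT_mapI:
  assumes "\<And>j. (\<lambda>i. \<alpha> i j) \<in> chain_maps R (col X j) (col Y j)"
    "\<And>j. (\<lambda>i x. S1 Y i j (\<alpha> i j x), \<lambda>i x. \<alpha> i (j + 1) (S1 X i j x)) \<in> homotopy_rel R (col X j) (col Y (j + 1))"
  shows "\<alpha> \<in> SumT_maps R X Y"
  using assms by (auto simp: SumT_maps_def homotopy_rel_def)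

definition SumT_homotopies ::
  "('r, 'q) ring_scheme \<Rightarrow> ('r, 'x) sumT_cpx \<Rightarrow> ('r, 'x) sumT_cpx \<Rightarrow> (int \<Rightarrow> int \<Rightarrow> 'x \<Rightarrow> 'x) set" where
  "SumT_homotopies R X Y = {h. \<forall>j. (\<lambda>i. h i j) \<in> chain_maps R (col X j) (col Y (j - 1))}"

definition SumT_boundary ::
  "('r, 'x) sumT_cpx \<Rightarrow> ('r, 'x) sumT_cpx \<Rightarrow> (int \<Rightarrow> int \<Rightarrow> 'x \<Rightarrow> 'x) \<Rightarrow> int \<Rightarrow> int \<Rightarrow> 'x \<Rightarrow> 'x" where
  "SumT_boundary X Y h j = plus_maps (col Y j)
     (\<lambda>i x. S1 Y i (j - 1) (h i j x)) (\<lambda>i x. h i (j + 1) (S1 X i j x))"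

context
  fixes R :: "('r, 'q) ring_scheme" and T :: "('r, 'm) cpx" and X Y :: "('r, 'x) sumT_cpx"
  assumes X: "X \<in> SumT_complexes R T" and Y: "Y \<in> SumT_complexes R T"
begin

lemma SumT_homotopyD:
  assumes "h \<in> SumT_homotopies R X Y"
  shows "(\<lambda>i. h i j) \<in> chain_maps R (col X j) (col Y (j - 1))"
    "(\<lambda>i. h i (j + 1)) \<in> chain_maps R (col X (j + 1)) (col Y j)"
proof -
  show *: "(\<lambda>i. h i j) \<in> chain_maps R (col X j) (col Y (j - 1))" for j
    using assms by (auto simp: SumT_homotopies_def)
  show "(\<lambda>i. h i (j + 1)) \<in> chain_maps R (col X (j + 1)) (col Y j)" using *[of "j + 1"] by simp
qed

lemma SumT_boundary_chain_map:
  assumes h: "h \<in> SumT_homotopies R X Y"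
  shows "SumT_boundary X Y h j \<in> chain_maps R (col X j) (col Y j)"
  unfolding SumT_boundary_def
  by (intro chain_map_plus[OF SumT_complexD(2)[OF X] SumT_complexD(2)[OF Y]]
      chain_map_comp[OF SumT_homotopyD(1)[OF h] SumT_complexD(4)[OF Y]]
      chain_map_comp[OF SumT_complexD(3)[OF X] SumT_homotopyD(2)[OF h]])

lemma SumT_rel_iff:
  "(\<alpha>, \<beta>) \<in> SumT_rel R X Y \<longleftrightarrow> \<alpha> \<in> SumT_maps R X Y \<and> \<beta> \<in> SumT_maps R X Y \<and>
    (\<exists>h\<in>SumT_homotopies R X Y. \<forall>j. (\<lambda>i. \<alpha> i j, plus_maps (col Y j) (\<lambda>i. \<beta> i j) (SumT_boundary X Y h j))
       \<in> homotopy_rel R (col X j) (col Y j))" (is "?L \<longleftrightarrow> ?R")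
proof -
  have "(\<lambda>i. \<alpha> i j, plus_maps (col Y j) (\<lambda>i. \<beta> i j) (SumT_boundary X Y h j)) \<in> homotopy_rel R (col X j) (col Y j) \<longleftrightarrow>
     homotopic R (col X j) (col Y j) (\<lambda>i. \<alpha> i j)
             (\<lambda>i x. \<beta> i j x \<oplus>\<^bsub>Smod Y i j\<^esub>
                (S1 Y i (j - 1) (h i j x) \<oplus>\<^bsub>Smod Y i j\<^esub> h i (j + 1) (S1 X i j x)))"
    if "\<alpha> \<in> SumT_maps R X Y" "\<beta> \<in> SumT_maps R X Y" "h \<in> SumT_homotopies R X Y" for h j
    using SumT_mapD(1)[OF that(1) X Y, of j] chain_map_plus[OF SumT_complexD(2)[OF X] SumT_complexD(2)[OF Y]
      SumT_mapD(1)[OF that(2) X Y, of j] SumT_boundary_chain_map[OF that(3)]]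
    by (simp add: homotopy_rel_def plus_maps_def SumT_boundary_def)
  then show ?thesis unfolding SumT_rel_def SumT_homotopies_def by blast
qed

lemma SumT_relI:
  assumes "\<alpha> \<in> SumT_maps R X Y" "\<beta> \<in> SumT_maps R X Y" "h \<in> SumT_homotopies R X Y"
    and "\<And>j. (\<lambda>i. \<alpha> i j, plus_maps (col Y j) (\<lambda>i. \<beta> i j) (SumT_boundary X Y h j))
       \<in> homotopy_rel R (col X j) (col Y j)"
  shows "(\<alpha>, \<beta>) \<in> SumT_rel R X Y"
  using assms by (auto simp: SumT_rel_iff)

lemma SumT_relE:
  assumes "(\<alpha>, \<beta>) \<in> SumT_rel R X Y"
  obtains h where "\<alpha> \<in> SumT_maps R X Y" "\<beta> \<in> SumT_maps R X Y" "h \<in> SumT_homotopies R X Y"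
    "\<And>j. (\<lambda>i. \<alpha> i j, plus_maps (col Y j) (\<lambda>i. \<beta> i j) (SumT_boundary X Y h j))
       \<in> homotopy_rel R (col X j) (col Y j)"
  using assms by (auto simp: SumT_rel_iff)

lemmas Ycol = SumT_complexD(2)[OF Y]
lemmas Xcol = SumT_complexD(2)[OF X]
lemmas Ygroup = module_complexD(2)[OF Ycol, simplified]

lemma SumT_rel_refl:
  assumes \<alpha>: "\<alpha> \<in> SumT_maps R X Y"
  shows "(\<alpha>, \<alpha>) \<in> SumT_rel R X Y"
proof (rule SumT_relI[OF \<alpha> \<alpha>])
  let ?h = "\<lambda>i j x. \<zero>\<^bsub>Smod Y i (j - 1)\<^esub>"
  show h: "?h \<in> SumT_homotopies R X Y"
    using chain_map_zero[OF Xcol Ycol] by (auto simp: SumT_homotopies_def zero_map_def)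
  fix j
  have S1: "S1 Y i (j - 1) \<zero>\<^bsub>Smod Y i (j - 1)\<^esub> = \<zero>\<^bsub>Smod Y i j\<^esub>" for i
    using hom_zero[OF chain_mapD(1)[OF SumT_complexD(4)[OF Y]]] Ygroup by simp
  show "(\<lambda>i. \<alpha> i j, plus_maps (col Y j) (\<lambda>i. \<alpha> i j) (SumT_boundary X Y ?h j))
       \<in> homotopy_rel R (col X j) (col Y j)"
    using hom_closed[OF chain_mapD(1)[OF SumT_mapD(1)[OF \<alpha> X Y]]]
    by (intro homotopy_rel_eqI Xcol Ycol SumT_mapD(1)[OF \<alpha> X Y]
        chain_map_plus SumT_boundary_chain_map h)
      (simp add: plus_maps_def SumT_boundary_def S1 group_simps[OF Ygroup])
qed

lemma SumT_rel_sym: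
  assumes "(\<alpha>, \<beta>) \<in> SumT_rel R X Y"
  shows "(\<beta>, \<alpha>) \<in> SumT_rel R X Y"
  using assms
proof (rule SumT_relE)
  fix h assume \<alpha>: "\<alpha> \<in> SumT_maps R X Y" and \<beta>: "\<beta> \<in> SumT_maps R X Y" and h: "h \<in> SumT_homotopies R X Y"
    and \<alpha>\<beta>: "\<And>j. (\<lambda>i. \<alpha> i j, plus_maps (col Y j) (\<lambda>i. \<beta> i j) (SumT_boundary X Y h j))
       \<in> homotopy_rel R (col X j) (col Y j)"
  let ?h = "\<lambda>i j x. \<ominus>\<^bsub>Smod Y i (j - 1)\<^esub> h i j x"
  have h': "?h \<in> SumT_homotopies R X Y"
    using chain_map_minus[OF Xcol Ycol SumT_homotopyD(1)[OF h]] by (simp add: SumT_homotopies_def)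
  have eq: "\<beta> i j x = plus_maps (col Y j) (plus_maps (col Y j) (\<lambda>i. \<beta> i j) (SumT_boundary X Y h j)) (SumT_boundary X Y ?h j) i x"
    if x: "x \<in> carrier (Cmod (col X j) i)" for i j x
  proof -
    have x': "S1 X i j x \<in> carrier (Smod X i (j + 1))"
      using hom_closed[OF chain_mapD(1)[OF SumT_complexD(3)[OF X]]] x by simp
    have cl: "\<beta> i j x \<in> carrier (Smod Y i j)" "h i j x \<in> carrier (Smod Y i (j - 1))"
      "h i (j + 1) (S1 X i j x) \<in> carrier (Smod Y i j)"
      using hom_closed[OF chain_mapD(1)[OF SumT_homotopyD(1)[OF h]]] x x'
        hom_closed[OF chain_mapD(1)[OF SumT_homotopyD(2)[OF h]]]
        hom_closed[OF chain_mapD(1)[OF SumT_mapD(1)[OF \<beta> X Y]]] by auto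
    have cl': "S1 Y i (j - 1) (h i j x) \<in> carrier (Smod Y i j)"
      "S1 Y i (j - 1) (\<ominus>\<^bsub>Smod Y i (j - 1)\<^esub> h i j x) = \<ominus>\<^bsub>Smod Y i j\<^esub> S1 Y i (j - 1) (h i j x)"
      using hom_closed[OF chain_mapD(1)[OF SumT_complexD(4)[OF Y]]]
        hom_minus[OF chain_mapD(1)[OF SumT_complexD(4)[OF Y]]] cl Ygroup by auto
    show ?thesis
      unfolding plus_maps_def SumT_boundary_def
      using abelian_group.homotopy_group_sym[OF Ygroup cl(1) cl'(1) cl(3)] by (simp add: cl')
  qed
  show ?thesis
  proof (rule SumT_relI[OF \<beta> \<alpha> h'])
    fix j
    have "(\<lambda>i. \<beta> i j, plus_maps (col Y j) (plus_maps (col Y j) (\<lambda>i. \<beta> i j) (SumT_boundary X Y h j))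
       (SumT_boundary X Y ?h j)) \<in> homotopy_rel R (col X j) (col Y j)"
      by (intro homotopy_rel_eqI Xcol Ycol SumT_mapD(1)[OF \<beta> X Y]
        chain_map_plus SumT_boundary_chain_map h h' eq)
    moreover have "(plus_maps (col Y j) (plus_maps (col Y j) (\<lambda>i. \<beta> i j) (SumT_boundary X Y h j))
       (SumT_boundary X Y ?h j), plus_maps (col Y j) (\<lambda>i. \<alpha> i j) (SumT_boundary X Y ?h j))
       \<in> homotopy_rel R (col X j) (col Y j)"
      by (intro homotopy_rel_plus homotopy_rel_sym[OF _ _ \<alpha>\<beta>] Xcol Ycol
          homotopy_rel_eqI[where f = "SumT_boundary X Y ?h j"] SumT_boundary_chain_map h' refl)
    ultimately show "(\<lambda>i. \<beta> i j, plus_maps (col Y j) (\<lambda>i. \<alpha> i j) (SumT_boundary X Y ?h j))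
       \<in> homotopy_rel R (col X j) (col Y j)"
      by (rule homotopy_rel_trans[OF Xcol Ycol])
  qed
qed

lemma SumT_rel_trans:
  assumes "(\<alpha>, \<beta>) \<in> SumT_rel R X Y" "(\<beta>, \<gamma>) \<in> SumT_rel R X Y"
  shows "(\<alpha>, \<gamma>) \<in> SumT_rel R X Y"
proof -
  obtain h where \<alpha>: "\<alpha> \<in> SumT_maps R X Y" and h: "h \<in> SumT_homotopies R X Y"
    and \<alpha>\<beta>: "\<And>j. (\<lambda>i. \<alpha> i j, plus_maps (col Y j) (\<lambda>i. \<beta> i j) (SumT_boundary X Y h j))
       \<in> homotopy_rel R (col X j) (col Y j)"
    using assms(1) unfolding SumT_rel_iff by blast
  obtain k where \<gamma>: "\<gamma> \<in> SumT_maps R X Y" and k: "k \<in> SumT_homotopies R X Y"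
    and \<beta>\<gamma>: "\<And>j. (\<lambda>i. \<beta> i j, plus_maps (col Y j) (\<lambda>i. \<gamma> i j) (SumT_boundary X Y k j))
       \<in> homotopy_rel R (col X j) (col Y j)"
    using assms(2) unfolding SumT_rel_iff by blast
  let ?h = "\<lambda>i j x. h i j x \<oplus>\<^bsub>Smod Y i (j - 1)\<^esub> k i j x"
  have h': "?h \<in> SumT_homotopies R X Y"
    using chain_map_plus[OF Xcol Ycol SumT_homotopyD(1)[OF h] SumT_homotopyD(1)[OF k]]
    by (simp add: SumT_homotopies_def plus_maps_def)
  have eq: "plus_maps (col Y j) (plus_maps (col Y j) (\<lambda>i. \<gamma> i j) (SumT_boundary X Y k j)) (SumT_boundary X Y h j) i x
      = plus_maps (col Y j) (\<lambda>i. \<gamma> i j) (SumT_boundary X Y ?h j) i x"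
    if x: "x \<in> carrier (Cmod (col X j) i)" for i j x
  proof -
    have x': "S1 X i j x \<in> carrier (Smod X i (j + 1))"
      using hom_closed[OF chain_mapD(1)[OF SumT_complexD(3)[OF X]]] x by simp
    have cl: "\<gamma> i j x \<in> carrier (Smod Y i j)" "h i j x \<in> carrier (Smod Y i (j - 1))"
      "h i (j + 1) (S1 X i j x) \<in> carrier (Smod Y i j)" "k i j x \<in> carrier (Smod Y i (j - 1))"
      "k i (j + 1) (S1 X i j x) \<in> carrier (Smod Y i j)"
      using hom_closed[OF chain_mapD(1)[OF SumT_homotopyD(1)[OF h]]] x x'
        hom_closed[OF chain_mapD(1)[OF SumT_homotopyD(2)[OF h]]]
        hom_closed[OF chain_mapD(1)[OF SumT_homotopyD(1)[OF k]]]
        hom_closed[OF chain_mapD(1)[OF SumT_homotopyD(2)[OF k]]]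
        hom_closed[OF chain_mapD(1)[OF SumT_mapD(1)[OF \<gamma> X Y]]] by auto
    have cl': "S1 Y i (j - 1) (h i j x) \<in> carrier (Smod Y i j)" "S1 Y i (j - 1) (k i j x) \<in> carrier (Smod Y i j)"
      "S1 Y i (j - 1) (h i j x \<oplus>\<^bsub>Smod Y i (j - 1)\<^esub> k i j x) =
       S1 Y i (j - 1) (h i j x) \<oplus>\<^bsub>Smod Y i j\<^esub> S1 Y i (j - 1) (k i j x)"
      using hom_closed[OF chain_mapD(1)[OF SumT_complexD(4)[OF Y]]]
        hom_add[OF chain_mapD(1)[OF SumT_complexD(4)[OF Y]]] cl by auto
    show ?thesis
      unfolding plus_maps_def SumT_boundary_def
      by (simp add: cl cl' group_ac[OF Ygroup] group_simps[OF Ygroup])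
  qed
  show ?thesis
  proof (rule SumT_relI[OF \<alpha> \<gamma> h'])
    fix j
    have 1: "(plus_maps (col Y j) (\<lambda>i. \<beta> i j) (SumT_boundary X Y h j),
       plus_maps (col Y j) (plus_maps (col Y j) (\<lambda>i. \<gamma> i j) (SumT_boundary X Y k j)) (SumT_boundary X Y h j))
       \<in> homotopy_rel R (col X j) (col Y j)"
      by (intro homotopy_rel_plus \<beta>\<gamma> Xcol Ycol
          homotopy_rel_eqI[where f = "SumT_boundary X Y h j"] SumT_boundary_chain_map h refl)
    have 2: "(plus_maps (col Y j) (plus_maps (col Y j) (\<lambda>i. \<gamma> i j) (SumT_boundary X Y k j)) (SumT_boundary X Y h j),
       plus_maps (col Y j) (\<lambda>i. \<gamma> i j) (SumT_boundary X Y ?h j)) \<in> homotopy_rel R (col X j) (col Y j)"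
      by (intro homotopy_rel_eqI Xcol Ycol SumT_mapD(1)[OF \<gamma> X Y]
        chain_map_plus SumT_boundary_chain_map h h' k eq)
    show "(\<lambda>i. \<alpha> i j, plus_maps (col Y j) (\<lambda>i. \<gamma> i j) (SumT_boundary X Y ?h j))
       \<in> homotopy_rel R (col X j) (col Y j)"
      by (intro homotopy_rel_trans[OF Xcol Ycol \<alpha>\<beta> homotopy_rel_trans[OF Xcol Ycol 1 2]])
  qed
qed

lemma SumT_rel_equiv: "equiv (SumT_maps R X Y) (SumT_rel R X Y)"
proof (rule equivI)
  show "SumT_rel R X Y \<subseteq> SumT_maps R X Y \<times> SumT_maps R X Y" by (auto simp: SumT_rel_def)
  show "refl_on (SumT_maps R X Y) (SumT_rel R X Y)" by (rule refl_onI) (rule SumT_rel_refl)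
  show "sym (SumT_rel R X Y)" by (rule symI) (rule SumT_rel_sym)
  show "trans (SumT_rel R X Y)" by (rule transI) (rule SumT_rel_trans)
qed

end

lemma SumT_map_id:
  assumes X: "X \<in> SumT_complexes R T"
  shows "(\<lambda>i j x. x) \<in> SumT_maps R X X"
proof (rule SumT_mapI)
  fix j
  show "(\<lambda>i x. x) \<in> chain_maps R (col X j) (col X j)" by (rule chain_map_id)
  show "(\<lambda>i. S1 X i j, \<lambda>i. S1 X i j) \<in> homotopy_rel R (col X j) (col X (j + 1))"
    by (intro homotopy_rel_eqI SumT_complexD[OF X] refl)
qed

lemma SumT_map_comp:
  assumes X: "X \<in> SumT_complexes R T" and Y: "Y \<in> SumT_complexes R T" and Z: "Z \<in> SumT_complexes R T"
    and \<alpha>: "\<alpha> \<in> SumT_maps R X Y" and \<beta>: "\<beta> \<in> SumT_maps R Y Z"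
  shows "(\<lambda>i j x. \<beta> i j (\<alpha> i j x)) \<in> SumT_maps R X Z"
proof (rule SumT_mapI)
  note Xc = SumT_complexD(2)[OF X] and Yc = SumT_complexD(2)[OF Y] and Zc = SumT_complexD(2)[OF Z]
  fix j
  show "(\<lambda>i x. \<beta> i j (\<alpha> i j x)) \<in> chain_maps R (col X j) (col Z j)"
    by (rule chain_map_comp[OF SumT_mapD(1)[OF \<alpha> X Y] SumT_mapD(1)[OF \<beta> Y Z]])
  show "(\<lambda>i x. S1 Z i j (\<beta> i j (\<alpha> i j x)), \<lambda>i x. \<beta> i (j + 1) (\<alpha> i (j + 1) (S1 X i j x)))
    \<in> homotopy_rel R (col X j) (col Z (j + 1))"
    by (rule homotopy_rel_trans[OF Xc Zc
      homotopy_rel_comp_right[OF Xc SumT_mapD(2)[OF \<beta> Y Z] SumT_mapD(1)[OF \<alpha> X Y]]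
      homotopy_rel_comp_left[OF Xc Yc Zc SumT_mapD(2)[OF \<alpha> X Y] SumT_mapD(1)[OF \<beta> Y Z]]])
qed

text \<open>As \<open>\<beta>\<close> commutes with \<open>\<delta>\<^sub>1\<close> only up to homotopy in each column, the composite of \<open>\<beta>\<close> with a homotopy
  \<open>h\<close> satisfies the required equation only up to the column homotopy between \<open>\<beta> \<delta>\<^sub>1 h\<close> and \<open>\<delta>\<^sub>1 \<beta> h\<close>, which is
  added.\<close>

lemma SumT_rel_comp_left:
  assumes X: "X \<in> SumT_complexes R T" and Y: "Y \<in> SumT_complexes R T" and Z: "Z \<in> SumT_complexes R T"
    and \<alpha>\<alpha>': "(\<alpha>, \<alpha>') \<in> SumT_rel R X Y" and \<beta>: "\<beta> \<in> SumT_maps R Y Z"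
  shows "(\<lambda>i j x. \<beta> i j (\<alpha> i j x), \<lambda>i j x. \<beta> i j (\<alpha>' i j x)) \<in> SumT_rel R X Z"
proof -
  note Xc = SumT_complexD(2)[OF X] and Yc = SumT_complexD(2)[OF Y] and Zc = SumT_complexD(2)[OF Z]
  note \<beta>c = SumT_mapD(1)[OF \<beta> Y Z]
  obtain h where \<alpha>: "\<alpha> \<in> SumT_maps R X Y" and \<alpha>': "\<alpha>' \<in> SumT_maps R X Y" and h: "h \<in> SumT_homotopies R X Y"
    and eq: "\<And>j. (\<lambda>i. \<alpha> i j, plus_maps (col Y j) (\<lambda>i. \<alpha>' i j) (SumT_boundary X Y h j))
       \<in> homotopy_rel R (col X j) (col Y j)"
    using \<alpha>\<alpha>' unfolding SumT_rel_iff[OF X Y] by blast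
  note \<alpha>'c = SumT_mapD(1)[OF \<alpha>' X Y]
  let ?h = "\<lambda>i j x. \<beta> i (j - 1) (h i j x)"
  have h': "?h \<in> SumT_homotopies R X Z"
    using chain_map_comp[OF SumT_homotopyD(1)[OF X Y h] \<beta>c] by (simp add: SumT_homotopies_def)
  show ?thesis
  proof (rule SumT_relI[OF X Z SumT_map_comp[OF X Y Z \<alpha> \<beta>] SumT_map_comp[OF X Y Z \<alpha>' \<beta>] h'])
    fix j
    let ?u = "\<lambda>i x. \<beta> i j (S1 Y i (j - 1) (h i j x))"
    let ?u' = "\<lambda>i x. S1 Z i (j - 1) (\<beta> i (j - 1) (h i j x))"
    let ?v = "\<lambda>i x. \<beta> i j (h i (j + 1) (S1 X i j x))"
    have hS: "(\<lambda>i x. h i (j + 1) (S1 X i j x)) \<in> chain_maps R (col X j) (col Y j)"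
      by (rule chain_map_comp[OF SumT_complexD(3)[OF X] SumT_homotopyD(2)[OF X Y h]])
    have Sh: "(\<lambda>i x. S1 Y i (j - 1) (h i j x)) \<in> chain_maps R (col X j) (col Y j)"
      by (rule chain_map_comp[OF SumT_homotopyD(1)[OF X Y h] SumT_complexD(4)[OF Y]])
    have v: "?v \<in> chain_maps R (col X j) (col Z j)" and u: "?u \<in> chain_maps R (col X j) (col Z j)"
      and a: "(\<lambda>i x. \<beta> i j (\<alpha>' i j x)) \<in> chain_maps R (col X j) (col Z j)"
      by (rule chain_map_comp[OF hS \<beta>c] chain_map_comp[OF Sh \<beta>c] chain_map_comp[OF \<alpha>'c \<beta>c])+
    have 1: "(\<lambda>i x. \<beta> i j (\<alpha> i j x), \<lambda>i x. \<beta> i j (plus_maps (col Y j) (\<lambda>i. \<alpha>' i j) (SumT_boundary X Y h j) i x))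
      \<in> homotopy_rel R (col X j) (col Z j)"
      by (rule homotopy_rel_comp_left[OF Xc Yc Zc eq \<beta>c])
    have 2: "(\<lambda>i x. \<beta> i j (plus_maps (col Y j) (\<lambda>i. \<alpha>' i j) (SumT_boundary X Y h j) i x),
        plus_maps (col Z j) (\<lambda>i x. \<beta> i j (\<alpha>' i j x)) (plus_maps (col Z j) ?u ?v)) \<in> homotopy_rel R (col X j) (col Z j)"
    proof (rule homotopy_rel_eqI[OF Xc Zc])
      show "(\<lambda>i x. \<beta> i j (plus_maps (col Y j) (\<lambda>i. \<alpha>' i j) (SumT_boundary X Y h j) i x))
          \<in> chain_maps R (col X j) (col Z j)"
        by (intro chain_map_comp[OF chain_map_plus[OF Xc Yc] \<beta>c] \<alpha>'c SumT_boundary_chain_map[OF X Y h])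
      show "plus_maps (col Z j) (\<lambda>i x. \<beta> i j (\<alpha>' i j x)) (plus_maps (col Z j) ?u ?v) \<in> chain_maps R (col X j) (col Z j)"
        by (intro chain_map_plus[OF Xc Zc] a u v)
      fix i x assume x: "x \<in> carrier (Cmod (col X j) i)"
      show "\<beta> i j (plus_maps (col Y j) (\<lambda>i. \<alpha>' i j) (SumT_boundary X Y h j) i x) =
          plus_maps (col Z j) (\<lambda>i x. \<beta> i j (\<alpha>' i j x)) (plus_maps (col Z j) ?u ?v) i x"
        using hom_closed[OF chain_mapD(1)[OF hS] x] hom_closed[OF chain_mapD(1)[OF Sh] x]
          hom_closed[OF chain_mapD(1)[OF \<alpha>'c] x] module_complexD(2)[OF Yc, of j i]
        by (simp add: plus_maps_def SumT_boundary_def hom_add[OF chain_mapD(1)[OF \<beta>c], simplified] group_simps)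
    qed
    have 3: "(plus_maps (col Z j) (\<lambda>i x. \<beta> i j (\<alpha>' i j x)) (plus_maps (col Z j) ?u ?v),
        plus_maps (col Z j) (\<lambda>i x. \<beta> i j (\<alpha>' i j x)) (plus_maps (col Z j) ?u' ?v)) \<in> homotopy_rel R (col X j) (col Z j)"
    proof -
      have "(\<lambda>i x. \<beta> i j (S1 Y i (j - 1) x), \<lambda>i x. S1 Z i (j - 1) (\<beta> i (j - 1) x))
          \<in> homotopy_rel R (col Y (j - 1)) (col Z j)"
        using homotopy_rel_sym[OF Yc Zc SumT_mapD(2)[OF \<beta> Y Z, of "j - 1"]] by simp
      from homotopy_rel_comp_right[OF Xc this SumT_homotopyD(1)[OF X Y h]]
      have "(?u, ?u') \<in> homotopy_rel R (col X j) (col Z j)" .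
      then show ?thesis
        by (intro homotopy_rel_plus[OF Xc Zc] homotopy_rel_eqI[OF Xc Zc v v]
            homotopy_rel_eqI[OF Xc Zc a a] refl)
    qed
    show "(\<lambda>i x. \<beta> i j (\<alpha> i j x), plus_maps (col Z j) (\<lambda>i x. \<beta> i j (\<alpha>' i j x)) (SumT_boundary X Z ?h j))
       \<in> homotopy_rel R (col X j) (col Z j)"
      using homotopy_rel_trans[OF Xc Zc 1 homotopy_rel_trans[OF Xc Zc 2 3]]
      by (simp add: SumT_boundary_def)
  qed
qed

lemma SumT_rel_comp_right:
  assumes X: "X \<in> SumT_complexes R T" and Y: "Y \<in> SumT_complexes R T" and Z: "Z \<in> SumT_complexes R T"
    and \<alpha>: "\<alpha> \<in> SumT_maps R X Y" and \<beta>\<beta>': "(\<beta>, \<beta>') \<in> SumT_rel R Y Z"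
  shows "(\<lambda>i j x. \<beta> i j (\<alpha> i j x), \<lambda>i j x. \<beta>' i j (\<alpha> i j x)) \<in> SumT_rel R X Z"
proof -
  note Xc = SumT_complexD(2)[OF X] and Yc = SumT_complexD(2)[OF Y] and Zc = SumT_complexD(2)[OF Z]
  note \<alpha>c = SumT_mapD(1)[OF \<alpha> X Y]
  obtain k where \<beta>: "\<beta> \<in> SumT_maps R Y Z" and \<beta>': "\<beta>' \<in> SumT_maps R Y Z" and k: "k \<in> SumT_homotopies R Y Z"
    and eq: "\<And>j. (\<lambda>i. \<beta> i j, plus_maps (col Z j) (\<lambda>i. \<beta>' i j) (SumT_boundary Y Z k j))
       \<in> homotopy_rel R (col Y j) (col Z j)"
    using \<beta>\<beta>' unfolding SumT_rel_iff[OF Y Z] by blast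
  let ?k = "\<lambda>i j x. k i j (\<alpha> i j x)"
  have k': "?k \<in> SumT_homotopies R X Z"
    using chain_map_comp[OF \<alpha>c SumT_homotopyD(1)[OF Y Z k]] by (simp add: SumT_homotopies_def)
  show ?thesis
  proof (rule SumT_relI[OF X Z SumT_map_comp[OF X Y Z \<alpha> \<beta>] SumT_map_comp[OF X Y Z \<alpha> \<beta>'] k'])
    fix j
    let ?u = "\<lambda>i x. S1 Z i (j - 1) (k i j (\<alpha> i j x))"
    let ?v = "\<lambda>i x. k i (j + 1) (S1 Y i j (\<alpha> i j x))"
    let ?v' = "\<lambda>i x. k i (j + 1) (\<alpha> i (j + 1) (S1 X i j x))"
    let ?a = "\<lambda>i x. \<beta>' i j (\<alpha> i j x)"
    have u: "?u \<in> chain_maps R (col X j) (col Z j)" and a: "?a \<in> chain_maps R (col X j) (col Z j)"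
      by (rule chain_map_comp[OF \<alpha>c chain_map_comp[OF SumT_homotopyD(1)[OF Y Z k] SumT_complexD(4)[OF Z]]]
          chain_map_comp[OF \<alpha>c SumT_mapD(1)[OF \<beta>' Y Z]])+
    have v: "(?v, ?v') \<in> homotopy_rel R (col X j) (col Z j)"
      by (rule homotopy_rel_comp_left[OF Xc Yc Zc SumT_mapD(2)[OF \<alpha> X Y] SumT_homotopyD(2)[OF Y Z k]])
    have 1: "(\<lambda>i x. \<beta> i j (\<alpha> i j x), plus_maps (col Z j) ?a (plus_maps (col Z j) ?u ?v))
      \<in> homotopy_rel R (col X j) (col Z j)"
      using homotopy_rel_comp_right[OF Xc eq \<alpha>c] by (simp add: plus_maps_def SumT_boundary_def)
    have 2: "(plus_maps (col Z j) ?a (plus_maps (col Z j) ?u ?v),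
        plus_maps (col Z j) ?a (plus_maps (col Z j) ?u ?v')) \<in> homotopy_rel R (col X j) (col Z j)"
      by (intro homotopy_rel_plus[OF Xc Zc] homotopy_rel_eqI[OF Xc Zc u u]
            homotopy_rel_eqI[OF Xc Zc a a] refl v)
    show "(\<lambda>i x. \<beta> i j (\<alpha> i j x), plus_maps (col Z j) ?a (SumT_boundary X Z ?k j))
       \<in> homotopy_rel R (col X j) (col Z j)"
      using homotopy_rel_trans[OF Xc Zc 1 2] by (simp add: SumT_boundary_def)
  qed
qed

lemma quotient_category_K_SumT:
  "quotient_category (SumT_complexes R T) (SumT_maps R) (SumT_rel R)
     (\<lambda>X i j x. x) (\<lambda>X Y Z \<beta> \<alpha> i j x. \<beta> i j (\<alpha> i j x))"
proof (rule quotient_category.intro, goal_cases)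
  case (4 X Y Z f g g')
  show ?case by (rule SumT_rel_comp_right[OF 4])
next
  case (5 X Y Z f f' g)
  show ?case by (rule SumT_rel_comp_left[OF 5])
next
  case (8 W X Y Z f g h)
  show ?case
    by (rule SumT_rel_refl[OF 8(1,4) SumT_map_comp[OF 8(1,2,4,5) SumT_map_comp[OF 8(2-4,6,7)]]])
qed (auto intro: SumT_rel_equiv SumT_map_id SumT_map_comp SumT_rel_refl)

section \<open>Laurent families and filtered maps\<close>

text \<open>Families vanishing in all sufficiently small degrees. On these a lower triangular matrix acts even if its
  columns have infinitely many nonzero entries, because each row meets only finitely many entries of such a
  family.\<close>

definition laurent :: "(int \<Rightarrow> ('r, 'x) module) \<Rightarrow> ('r, int \<Rightarrow> 'x) module" where
  "laurent M = family_module UNIV M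
     {x. (\<forall>j. x j \<in> carrier (M j)) \<and> (\<exists>b. \<forall>j<b. x j = \<zero>\<^bsub>M j\<^esub>)}"

abbreviation "single\<^sub>Z \<equiv> single (UNIV :: int set)"

definition module_family :: "('r, 'q) ring_scheme \<Rightarrow> ('i \<Rightarrow> ('r, 'x) module) \<Rightarrow> bool" where
  "module_family R M \<longleftrightarrow> (\<forall>j. right_module R (M j))"

lemma module_familyD: "module_family R M \<Longrightarrow> right_module R (M j)"
  by (simp add: module_family_def)

text \<open>The matrices whose entries go from degree \<open>j\<close> to degrees at least \<open>j + L\<close>, indexed by the excess \<open>n\<close> over
  \<open>j + L\<close>. Morphisms over \<open>\<int>\<^sub>+ Proj\<close> are the case \<open>L = 0\<close>, homotopies the case \<open>L = -1\<close>.\<close>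

definition filtered_families ::
  "('r, 'q) ring_scheme \<Rightarrow> int \<Rightarrow> (int \<Rightarrow> ('r, 'x) module) \<Rightarrow> (int \<Rightarrow> ('r, 'y) module) \<Rightarrow>
   (nat \<Rightarrow> int \<Rightarrow> 'x \<Rightarrow> 'y) set" where
  "filtered_families R L M N = {f. \<forall>n j. f n j \<in> rmod_hom R (M j) (N (j + L + int n))}"

lemma filtered_familyD: "f \<in> filtered_families R L M N \<Longrightarrow> f n j \<in> rmod_hom R (M j) (N (j + L + int n))"
  by (simp add: filtered_families_def)

lemma laurent_simps:
  "x \<in> carrier (laurent M) \<longleftrightarrow> (\<forall>j. x j \<in> carrier (M j)) \<and> (\<exists>b. \<forall>j<b. x j = \<zero>\<^bsub>M j\<^esub>)"
  "\<zero>\<^bsub>laurent M\<^esub> = (\<lambda>j. \<zero>\<^bsub>M j\<^esub>)"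
  "x \<oplus>\<^bsub>laurent M\<^esub> y = (\<lambda>j. x j \<oplus>\<^bsub>M j\<^esub> y j)"
  "r \<odot>\<^bsub>laurent M\<^esub> x = (\<lambda>j. r \<odot>\<^bsub>M j\<^esub> x j)"
  by (simp_all add: laurent_def family_module_simps restrict_def)

lemma laurent_closed: "x \<in> carrier (laurent M) \<Longrightarrow> x j \<in> carrier (M j)"
  by (simp add: laurent_simps)

lemma laurent_module:
  assumes R: "ring R" and M: "module_family R M"
  shows "right_module R (laurent M)"
    and "\<And>x. x \<in> carrier (laurent M) \<Longrightarrow> \<ominus>\<^bsub>laurent M\<^esub> x = (\<lambda>j. \<ominus>\<^bsub>M j\<^esub> x j)"
proof -
  note M' = right_module_group[OF module_familyD[OF M]]
  let ?S = "{x. (\<forall>j. x j \<in> carrier (M j)) \<and> (\<exists>b. \<forall>j<b. x j = \<zero>\<^bsub>M j\<^esub>)}"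
  have S: "?S \<subseteq> (\<Pi>\<^sub>E j\<in>UNIV. carrier (M j))" by auto
  have 1: "(\<lambda>j\<in>UNIV. \<zero>\<^bsub>M j\<^esub>) \<in> ?S" by (simp add: group_simps M')
  have 2: "(\<lambda>j\<in>UNIV. x j \<oplus>\<^bsub>M j\<^esub> y j) \<in> ?S" if "x \<in> ?S" "y \<in> ?S" for x y
  proof -
    from that obtain b c where "\<forall>j<b. x j = \<zero>\<^bsub>M j\<^esub>" "\<forall>j<c. y j = \<zero>\<^bsub>M j\<^esub>" by auto
    then have "\<forall>j<min b c. x j \<oplus>\<^bsub>M j\<^esub> y j = \<zero>\<^bsub>M j\<^esub>" by (simp add: group_simps M')
    then have "\<exists>b. \<forall>j<b. x j \<oplus>\<^bsub>M j\<^esub> y j = \<zero>\<^bsub>M j\<^esub>" by blast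
    with that show ?thesis by (simp add: group_simps M')
  qed
  have 3: "(\<lambda>j\<in>UNIV. \<ominus>\<^bsub>M j\<^esub> x j) \<in> ?S" if "x \<in> ?S" for x
  proof -
    from that obtain b where "\<forall>j<b. x j = \<zero>\<^bsub>M j\<^esub>" by auto
    then have "\<forall>j<b. \<ominus>\<^bsub>M j\<^esub> x j = \<zero>\<^bsub>M j\<^esub>" by (simp add: group_cancel M')
    then have "\<exists>b. \<forall>j<b. \<ominus>\<^bsub>M j\<^esub> x j = \<zero>\<^bsub>M j\<^esub>" by blast
    with that show ?thesis by (simp add: group_simps M')
  qed
  have 4: "(\<lambda>j\<in>UNIV. r \<odot>\<^bsub>M j\<^esub> x j) \<in> ?S" if r: "r \<in> carrier R" and x: "x \<in> ?S" for r x
  proof -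
    from x obtain b where "\<forall>j<b. x j = \<zero>\<^bsub>M j\<^esub>" by auto
    then have "\<forall>j<b. r \<odot>\<^bsub>M j\<^esub> x j = \<zero>\<^bsub>M j\<^esub>" by (simp add: smult_zero_right[OF module_familyD[OF M] r])
    then have "\<exists>b. \<forall>j<b. r \<odot>\<^bsub>M j\<^esub> x j = \<zero>\<^bsub>M j\<^esub>" by blast
    with x r show ?thesis by (simp add: right_module.smult_closed[OF module_familyD[OF M]])
  qed
  show "right_module R (laurent M)"
    unfolding laurent_def by (rule right_module_family(1)[OF R module_familyD[OF M] S 1 2 3 4])
  show "\<ominus>\<^bsub>laurent M\<^esub> x = (\<lambda>j. \<ominus>\<^bsub>M j\<^esub> x j)" if "x \<in> carrier (laurent M)" for x
    using right_module_family(2)[OF R module_familyD[OF M] S 1 2 3 4, of x] that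
    by (simp add: laurent_def family_module_simps restrict_def)
qed

lemma single_laurent:
  assumes M: "module_family R M"
  shows "single\<^sub>Z M j \<in> rmod_hom R (M j) (laurent M)"
proof (rule homI)
  note M' = right_module_group[OF module_familyD[OF M]]
  have "\<forall>l<j. single\<^sub>Z M j x l = \<zero>\<^bsub>M l\<^esub>" for x by (simp add: single_def)
  then show "single\<^sub>Z M j x \<in> carrier (laurent M)" if "x \<in> carrier (M j)" for x
    using that by (auto simp: laurent_simps) (auto simp: single_def group_simps M')
  show "single\<^sub>Z M j (x \<oplus>\<^bsub>M j\<^esub> y) = single\<^sub>Z M j x \<oplus>\<^bsub>laurent M\<^esub> single\<^sub>Z M j y" for x y
    by (auto simp: single_def laurent_simps group_simps M')
  show "single\<^sub>Z M j (r \<odot>\<^bsub>M j\<^esub> x) = r \<odot>\<^bsub>laurent M\<^esub> single\<^sub>Z M j x" if "r \<in> carrier R" for r x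
    using that by (auto simp: single_def laurent_simps smult_zero_right[OF module_familyD[OF M]])
qed

lemma coordinate_laurent: "(\<lambda>x. x j) \<in> rmod_hom R (laurent M) (M j)"
  by (rule homI) (auto simp: laurent_simps)

definition starts_at :: "(int \<Rightarrow> ('r, 'x) module) \<Rightarrow> int \<Rightarrow> (int \<Rightarrow> 'x) \<Rightarrow> bool" where
  "starts_at M b x \<longleftrightarrow> (\<forall>j<b. x j = \<zero>\<^bsub>M j\<^esub>)"

definition filtered_maps ::
  "('r, 'q) ring_scheme \<Rightarrow> int \<Rightarrow> (int \<Rightarrow> ('r, 'x) module) \<Rightarrow> (int \<Rightarrow> ('r, 'y) module) \<Rightarrow>
   ((int \<Rightarrow> 'x) \<Rightarrow> (int \<Rightarrow> 'y)) set" where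
  "filtered_maps R L M N = {F \<in> rmod_hom R (laurent M) (laurent N).
     \<forall>b. \<forall>x\<in>carrier (laurent M). starts_at M b x \<longrightarrow> starts_at N (b + L) (F x)}"

lemma filtered_mapD:
  assumes "F \<in> filtered_maps R L M N"
  shows "F \<in> rmod_hom R (laurent M) (laurent N)"
    "\<lbrakk>x \<in> carrier (laurent M); starts_at M b x\<rbrakk> \<Longrightarrow> starts_at N (b + L) (F x)"
  using assms by (auto simp: filtered_maps_def)

lemma filtered_map_weaken: "F \<in> filtered_maps R L M N \<Longrightarrow> L' \<le> L \<Longrightarrow> F \<in> filtered_maps R L' M N"
  unfolding filtered_maps_def starts_at_def by (auto; smt (verit))

lemma filtered_map_id: "(\<lambda>x. x) \<in> filtered_maps R 0 M M"
  by (simp add: filtered_maps_def hom_id)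

lemma filtered_map_comp:
  assumes "F \<in> filtered_maps R L M N" "G \<in> filtered_maps R L' N P"
  shows "(\<lambda>x. G (F x)) \<in> filtered_maps R (L + L') M P"
proof -
  have "starts_at P (b + (L + L')) (G (F x))" if "x \<in> carrier (laurent M)" "starts_at M b x" for b x
    using filtered_mapD(2)[OF assms(2) hom_closed[OF filtered_mapD(1)[OF assms(1)] that(1)]
        filtered_mapD(2)[OF assms(1) that]] by (simp add: add.assoc)
  then show ?thesis
    using hom_comp[OF filtered_mapD(1)[OF assms(1)] filtered_mapD(1)[OF assms(2)]]
    by (simp add: filtered_maps_def)
qed

lemma filtered_map_cong:
  assumes "F \<in> filtered_maps R L M N" "right_module R (laurent M)"
    and "\<And>x. x \<in> carrier (laurent M) \<Longrightarrow> G x = F x"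
  shows "G \<in> filtered_maps R L M N"
  using assms hom_cong[OF filtered_mapD(1)[OF assms(1)] assms(2,3)]
  by (simp add: filtered_maps_def)

definition apply_family ::
  "(int \<Rightarrow> ('r, 'x) module) \<Rightarrow> (int \<Rightarrow> ('r, 'y) module) \<Rightarrow> int \<Rightarrow> (nat \<Rightarrow> int \<Rightarrow> 'x \<Rightarrow> 'y) \<Rightarrow>
   (int \<Rightarrow> 'x) \<Rightarrow> int \<Rightarrow> 'y" where
  "apply_family M N L f x = (\<lambda>k.
     \<Oplus>\<^bsub>N k\<^esub>j\<in>{j. x j \<noteq> \<zero>\<^bsub>M j\<^esub> \<and> j + L \<le> k}. f (nat (k - j - L)) j (x j))"

context
  fixes R :: "('r, 'q) ring_scheme" and M :: "int \<Rightarrow> ('r, 'x) module" and N :: "int \<Rightarrow> ('r, 'y) module"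
  assumes R: "ring R" and M: "module_family R M" and N: "module_family R N"
begin

lemmas N_group = right_module_group[OF module_familyD[OF N]]
lemmas M_group = right_module_group[OF module_familyD[OF M]]
lemmas laurent_N = laurent_module(1)[OF R N]
lemmas laurent_M = laurent_module(1)[OF R M]

lemma filtered_map_zero: "(\<lambda>x. \<zero>\<^bsub>laurent N\<^esub>) \<in> filtered_maps R L M N"
  using hom_const_zero[OF laurent_N] by (simp add: filtered_maps_def starts_at_def laurent_simps)

lemma filtered_map_plus:
  assumes "F \<in> filtered_maps R L M N" "G \<in> filtered_maps R L M N"
  shows "(\<lambda>x. F x \<oplus>\<^bsub>laurent N\<^esub> G x) \<in> filtered_maps R L M N"
  using hom_plus[OF filtered_mapD(1)[OF assms(1)] filtered_mapD(1)[OF assms(2)] laurent_N] assms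
  by (simp add: filtered_maps_def starts_at_def laurent_simps(3) group_simps N_group)

lemma filtered_map_minus:
  assumes "F \<in> filtered_maps R L M N"
  shows "(\<lambda>x. \<ominus>\<^bsub>laurent N\<^esub> F x) \<in> filtered_maps R L M N"
proof -
  have "starts_at N (b + L) (\<ominus>\<^bsub>laurent N\<^esub> F x)" if "x \<in> carrier (laurent M)" "starts_at M b x" for b x
    using filtered_mapD(2)[OF assms that] laurent_module(2)[OF R N hom_closed[OF filtered_mapD(1)[OF assms] that(1)]]
    by (simp add: starts_at_def group_cancel N_group)
  then show ?thesis
    using hom_uminus[OF filtered_mapD(1)[OF assms] laurent_N] by (simp add: filtered_maps_def)
qed

lemma laurent_minus:
  assumes "x \<in> carrier (laurent N)"
  shows "\<ominus>\<^bsub>laurent N\<^esub> x = (\<lambda>j. \<ominus>\<^bsub>N j\<^esub> x j)"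
  using laurent_module(2)[OF R N assms] .

text \<open>The continuity of filtered maps: the value of \<open>F x\<close> in degree \<open>k\<close> depends only on the entries of \<open>x\<close> in degrees
  at most \<open>k - L\<close>, and only finitely many of these are nonzero. The induction splits them off one by one from the
  bottom.\<close>

lemma filtered_map_coordinate_zero:
  assumes F: "F \<in> filtered_maps R L M N" and x: "x \<in> carrier (laurent M)"
    and zero: "\<And>j. F (single\<^sub>Z M j (x j)) k = \<zero>\<^bsub>N k\<^esub>"
  shows "F x k = \<zero>\<^bsub>N k\<^esub>"
proof -
  have "F y k = \<zero>\<^bsub>N k\<^esub>"
    if "y \<in> carrier (laurent M)" "\<And>j. y j = x j \<or> y j = \<zero>\<^bsub>M j\<^esub>" "starts_at M (k - L + 1 - int n) y" for n y
    using that
  proof (induction n arbitrary: y)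
    case 0
    then show ?case using filtered_mapD(2)[OF F 0(1,3)] by (simp add: starts_at_def)
  next
    case (Suc n)
    define l where "l = k - L - int n"
    define z where "z = y(l := \<zero>\<^bsub>M l\<^esub>)"
    have yl: "y l \<in> carrier (M l)" using Suc.prems(1) by (simp add: laurent_simps)
    have s: "single\<^sub>Z M l (y l) \<in> carrier (laurent M)"
      by (rule hom_closed[OF single_laurent[OF M] yl])
    obtain b where "\<forall>j<b. y j = \<zero>\<^bsub>M j\<^esub>" using Suc.prems(1) by (auto simp: laurent_simps)
    then have "\<forall>j<b. z j = \<zero>\<^bsub>M j\<^esub>" by (simp add: z_def)
    then have z: "z \<in> carrier (laurent M)"
      using Suc.prems(1) by (auto simp: laurent_simps) (auto simp: z_def group_simps M_group)
    have "y = single\<^sub>Z M l (y l) \<oplus>\<^bsub>laurent M\<^esub> z"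
      using Suc.prems(1) by (auto simp: laurent_simps single_def z_def group_simps M_group)
    then have "F y = F (single\<^sub>Z M l (y l)) \<oplus>\<^bsub>laurent N\<^esub> F z"
      using hom_add[OF filtered_mapD(1)[OF F] s z] by simp
    moreover have "F z k = \<zero>\<^bsub>N k\<^esub>"
    proof (rule Suc.IH[OF z])
      show "z j = x j \<or> z j = \<zero>\<^bsub>M j\<^esub>" for j using Suc.prems(2)[of j] by (auto simp: z_def)
      have "z j = \<zero>\<^bsub>M j\<^esub>" if "j < k - L + 1 - int n" for j
        using Suc.prems(3) that by (cases "j = l") (auto simp: z_def l_def starts_at_def)
      then show "starts_at M (k - L + 1 - int n) z" by (simp add: starts_at_def)
    qed
    moreover have "F (single\<^sub>Z M l (y l)) k = \<zero>\<^bsub>N k\<^esub>"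
    proof (cases "y l = x l")
      case False
      then have "single\<^sub>Z M l (y l) = \<zero>\<^bsub>laurent M\<^esub>"
        using Suc.prems(2)[of l] by (auto simp: single_def laurent_simps)
      then show ?thesis
        using hom_zero[OF filtered_mapD(1)[OF F] right_module_group[OF laurent_M] right_module_group[OF laurent_N]]
        by (simp add: laurent_simps)
    qed (use zero in simp)
    ultimately show ?case by (simp add: laurent_simps(3) group_simps N_group)
  qed
  moreover obtain b where "\<forall>j<b. x j = \<zero>\<^bsub>M j\<^esub>" using x by (auto simp: laurent_simps)
  then have "starts_at M (k - L + 1 - int (nat (k - L + 1 - b))) x" by (auto simp: starts_at_def)
  ultimately show ?thesis using x by blast
qed

lemma filtered_map_eqI:
  assumes F: "F \<in> filtered_maps R L M N" and G: "G \<in> filtered_maps R L M N"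
    and eq: "\<And>j x n. x \<in> carrier (M j) \<Longrightarrow> F (single\<^sub>Z M j x) (j + L + int n) = G (single\<^sub>Z M j x) (j + L + int n)"
    and x: "x \<in> carrier (laurent M)"
  shows "F x = G x"
proof
  fix k
  have cl: "F y k \<in> carrier (N k)" "G y k \<in> carrier (N k)" "G y \<in> carrier (laurent N)" if "y \<in> carrier (laurent M)" for y
    using hom_closed[OF filtered_mapD(1)[OF F] that] hom_closed[OF filtered_mapD(1)[OF G] that]
    by (auto intro: laurent_closed)
  let ?D = "\<lambda>x. F x \<oplus>\<^bsub>laurent N\<^esub> \<ominus>\<^bsub>laurent N\<^esub> G x"
  have D: "?D y k = F y k \<oplus>\<^bsub>N k\<^esub> \<ominus>\<^bsub>N k\<^esub> G y k" if "y \<in> carrier (laurent M)" for y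
    by (simp add: laurent_minus[OF cl(3)[OF that]] laurent_simps(3))
  have "?D x k = \<zero>\<^bsub>N k\<^esub>"
  proof (rule filtered_map_coordinate_zero[OF filtered_map_plus[OF F filtered_map_minus[OF G]] x])
    fix j
    have xj: "x j \<in> carrier (M j)" using x by (rule laurent_closed)
    then have s: "single\<^sub>Z M j (x j) \<in> carrier (laurent M)"
      by (rule hom_closed[OF single_laurent[OF M]])
    have "F (single\<^sub>Z M j (x j)) k = G (single\<^sub>Z M j (x j)) k"
    proof (cases "j + L \<le> k")
      case True
      then show ?thesis using eq[OF xj, of "nat (k - j - L)"] by simp
    next
      case False
      have "starts_at M j (single\<^sub>Z M j (x j))" by (simp add: starts_at_def single_def)
      from filtered_mapD(2)[OF F s this] filtered_mapD(2)[OF G s this] show ?thesis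
        using False by (simp add: starts_at_def)
    qed
    then show "?D (single\<^sub>Z M j (x j)) k = \<zero>\<^bsub>N k\<^esub>"
      using cl[OF s] by (simp add: D[OF s] group_cancel N_group)
  qed
  then show "F x k = G x k" using D[OF x] cl[OF x] abelian_group.eq_iff_diff_zero[OF N_group] by simp
qed

text \<open>The level of a filtered map can be read off from its matrix; this is how a defect is shown to move up in
  the filtration.\<close>

lemma filtered_map_raise:
  assumes F: "F \<in> filtered_maps R L M N"
    and zero: "\<And>j x n. \<lbrakk>x \<in> carrier (M j); int n < d\<rbrakk> \<Longrightarrow> F (single\<^sub>Z M j x) (j + L + int n) = \<zero>\<^bsub>N (j + L + int n)\<^esub>"
  shows "F \<in> filtered_maps R (L + d) M N"
proof -
  have "F x k = \<zero>\<^bsub>N k\<^esub>" if x: "x \<in> carrier (laurent M)" and b: "starts_at M b x" and k: "k < b + (L + d)" for x b k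
  proof (rule filtered_map_coordinate_zero[OF F x])
    fix j
    have xj: "x j \<in> carrier (M j)" using x by (rule laurent_closed)
    then have s: "single\<^sub>Z M j (x j) \<in> carrier (laurent M)"
      by (rule hom_closed[OF single_laurent[OF M]])
    show "F (single\<^sub>Z M j (x j)) k = \<zero>\<^bsub>N k\<^esub>"
    proof (cases "j + L \<le> k")
      case True
      show ?thesis
      proof (cases "j < b")
        case True
        then have "single\<^sub>Z M j (x j) = \<zero>\<^bsub>laurent M\<^esub>"
          using b by (auto simp: single_def laurent_simps starts_at_def)
        then show ?thesis
          using hom_zero[OF filtered_mapD(1)[OF F] right_module_group[OF laurent_M] right_module_group[OF laurent_N]]
          by (simp add: laurent_simps)
      next
        case False
        with True k zero[OF xj, of "nat (k - j - L)"] show ?thesis by simp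
      qed
    next
      case False
      have "starts_at M j (single\<^sub>Z M j (x j))" by (simp add: starts_at_def single_def)
      from filtered_mapD(2)[OF F s this] show ?thesis
        using False by (simp add: starts_at_def)
    qed
  qed
  then show ?thesis using F by (auto simp: filtered_maps_def starts_at_def)
qed

context
  fixes L :: int and f :: "nat \<Rightarrow> int \<Rightarrow> 'x \<Rightarrow> 'y"
  assumes f: "f \<in> filtered_families R L M N"
begin

lemma family_component: "j + L \<le> k \<Longrightarrow> f (nat (k - j - L)) j \<in> rmod_hom R (M j) (N k)"
  using filtered_familyD[OF f, of "nat (k - j - L)" j] by simp

lemma apply_family_superset:
  assumes "x \<in> carrier (laurent M)" "finite A" "\<And>j. j \<in> A \<Longrightarrow> j + L \<le> k"
    "\<And>j. x j \<noteq> \<zero>\<^bsub>M j\<^esub> \<Longrightarrow> j + L \<le> k \<Longrightarrow> j \<in> A"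
  shows "apply_family M N L f x k = (\<Oplus>\<^bsub>N k\<^esub>j\<in>A. f (nat (k - j - L)) j (x j))"
  unfolding apply_family_def using assms
  by (intro abelian_group.finsum_superset[OF N_group])
    (auto simp: hom_zero[OF family_component M_group N_group] intro: hom_closed[OF family_component] laurent_closed)

lemma apply_family_single:
  assumes "x \<in> carrier (M j)"
  shows "apply_family M N L f (single\<^sub>Z M j x) (j + L + int n) = f n j x"
proof -
  interpret N: abelian_group "N (j + L + int n)" by (rule N_group)
  have "apply_family M N L f (single\<^sub>Z M j x) (j + L + int n) =
      (\<Oplus>\<^bsub>N (j + L + int n)\<^esub>l\<in>{j}. f (nat (j + L + int n - l - L)) l (single\<^sub>Z M j x l))"
    by (intro apply_family_superset hom_closed[OF single_laurent[OF M] assms])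
      (auto simp: single_def split: if_splits)
  also have "\<dots> = f n j x"
    using assms hom_closed[OF filtered_familyD[OF f] assms] by (simp add: single_def)
  finally show ?thesis .
qed

lemma apply_family_filtered: "apply_family M N L f \<in> filtered_maps R L M N"
proof -
  have formula: "apply_family M N L f x k = (\<Oplus>\<^bsub>N k\<^esub>j\<in>{b..k - L}. f (nat (k - j - L)) j (x j))"
    if "x \<in> carrier (laurent M)" "starts_at M b x" for x b k
    using that by (intro apply_family_superset) (auto simp: starts_at_def not_le[symmetric])
  have hom: "f (nat (k - j - L)) j \<in> rmod_hom R (M j) (N k)" if "j \<in> {b..k - L}" for b j k
    using that by (intro family_component) auto
  have start: "starts_at N (b + L) (apply_family M N L f x)" if "x \<in> carrier (laurent M)" "starts_at M b x" for x b
    using that N_group by (auto simp: starts_at_def[of N] formula[OF that] abelian_monoid.finsum_empty[OF abelian_group.axioms(1)])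
  have sumhom: "(\<lambda>x. \<Oplus>\<^bsub>N k\<^esub>j\<in>{b..k - L}. f (nat (k - j - L)) j (x j)) \<in> rmod_hom R (laurent M) (N k)" for b k
    by (intro hom_finsum_maps module_familyD[OF N] laurent_M hom_comp[OF coordinate_laurent hom])
  have "apply_family M N L f \<in> rmod_hom R (laurent M) (laurent N)"
  proof (rule homI)
    fix x assume x: "x \<in> carrier (laurent M)"
    then obtain b where b: "starts_at M b x" by (auto simp: laurent_simps starts_at_def)
    have "apply_family M N L f x k \<in> carrier (N k)" for k
      using hom_closed[OF sumhom x] formula[OF x b] by simp
    with start[OF x b] show "apply_family M N L f x \<in> carrier (laurent N)"
      by (auto simp: laurent_simps starts_at_def)
    fix r assume r: "r \<in> carrier R"
    have b': "starts_at M b (r \<odot>\<^bsub>laurent M\<^esub> x)"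
      using b by (auto simp: starts_at_def laurent_simps smult_zero_right[OF module_familyD[OF M] r])
    show "apply_family M N L f (r \<odot>\<^bsub>laurent M\<^esub> x) = r \<odot>\<^bsub>laurent N\<^esub> apply_family M N L f x"
      by (simp add: fun_eq_iff laurent_simps(4)[where M = N] formula[OF x b] hom_smult[OF sumhom r x]
          formula[OF right_module.smult_closed[OF laurent_M r x] b'])
  next
    fix x y assume x: "x \<in> carrier (laurent M)" and y: "y \<in> carrier (laurent M)"
    obtain b where b: "starts_at M b x" using x by (auto simp: laurent_simps starts_at_def)
    obtain c where c: "starts_at M c y" using y by (auto simp: laurent_simps starts_at_def)
    let ?b = "min b c"
    have b': "starts_at M ?b x" "starts_at M ?b y" using b c by (auto simp: starts_at_def)
    then have bc: "starts_at M ?b (x \<oplus>\<^bsub>laurent M\<^esub> y)"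
      by (auto simp: starts_at_def laurent_simps group_simps M_group)
    have xy: "x \<oplus>\<^bsub>laurent M\<^esub> y \<in> carrier (laurent M)"
      using x y group_simps(2)[OF right_module_group[OF laurent_M]] by simp
    show "apply_family M N L f (x \<oplus>\<^bsub>laurent M\<^esub> y) = apply_family M N L f x \<oplus>\<^bsub>laurent N\<^esub> apply_family M N L f y"
      by (simp add: fun_eq_iff laurent_simps(3)[where M = N] formula[OF x b'(1)] formula[OF y b'(2)] formula[OF xy bc]
          hom_add[OF sumhom x y])
  qed
  then show ?thesis using start by (simp add: filtered_maps_def)
qed

lemma apply_family_eqI:
  assumes "F \<in> filtered_maps R L M N" "x \<in> carrier (laurent M)"
    and "\<And>n j y. y \<in> carrier (M j) \<Longrightarrow> F (single\<^sub>Z M j y) (j + L + int n) = f n j y"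
  shows "apply_family M N L f x = F x"
  using assms by (intro filtered_map_eqI[OF apply_family_filtered]) (auto simp: apply_family_single)

end

lemma family_of_filtered:
  assumes F: "F \<in> filtered_maps R L M N"
  shows "(\<lambda>x. F (single\<^sub>Z M j x) (j + L + int n)) \<in> rmod_hom R (M j) (N (j + L + int n))"
  by (rule hom_comp[OF single_laurent[OF M] hom_comp[OF filtered_mapD(1)[OF F] coordinate_laurent]])

end

text \<open>Composition in \<open>\<int>\<^sub>+ Proj\<close> is matrix multiplication, so it becomes composition of maps of Laurent families.\<close>

lemma apply_family_convolution:
  assumes R: "ring R" and M: "module_family R M" and N: "module_family R N"
    and P: "module_family R P"
    and f: "f \<in> filtered_families R 0 M N" and g: "g \<in> filtered_families R 0 N P"
    and x: "x \<in> carrier (M j)"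
  shows "apply_family N P 0 g (apply_family M N 0 f (single\<^sub>Z M j x)) (j + int n) =
    (\<Oplus>\<^bsub>P (j + int n)\<^esub>q\<in>{..n}. g (n - q) (j + int q) (f q j x))"
proof -
  interpret P: abelian_group "P (j + int n)" by (rule right_module_group[OF module_familyD[OF P]])
  let ?s = "single\<^sub>Z M j x" let ?y = "apply_family M N 0 f ?s"
  have F: "apply_family M N 0 f \<in> filtered_maps R 0 M N"
    by (rule apply_family_filtered[OF R M N f])
  have s: "?s \<in> carrier (laurent M)" by (rule hom_closed[OF single_laurent[OF M] x])
  have y: "?y \<in> carrier (laurent N)" by (rule hom_closed[OF filtered_mapD(1)[OF F] s])
  have "starts_at M j ?s" by (simp add: starts_at_def single_def)
  from filtered_mapD(2)[OF F s this] have y0: "?y k = \<zero>\<^bsub>N k\<^esub>" if "k < j" for k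
    using that by (simp add: starts_at_def)
  have yk: "?y (j + int q) = f q j x" for q
    using apply_family_single[OF R M N f x, of q] by simp
  have "apply_family N P 0 g ?y (j + int n) =
      (\<Oplus>\<^bsub>P (j + int n)\<^esub>k\<in>(\<lambda>q. j + int q) ` {..n}. g (nat (j + int n - k - 0)) k (?y k))"
  proof (rule apply_family_superset[OF R N P g y])
    fix k assume "?y k \<noteq> \<zero>\<^bsub>N k\<^esub>" "k + 0 \<le> j + int n"
    then have "j \<le> k" "k \<le> j + int n" using y0 by (force simp: not_less[symmetric])+
    then show "k \<in> (\<lambda>q. j + int q) ` {..n}" by (intro image_eqI[of _ _ "nat (k - j)"]) auto
  qed auto
  also have "\<dots> = (\<Oplus>\<^bsub>P (j + int n)\<^esub>q\<in>{..n}. g (nat (j + int n - (j + int q) - 0)) (j + int q) (?y (j + int q)))"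
  proof (rule P.finsum_reindex)
    show "(\<lambda>k. g (nat (j + int n - k - 0)) k (?y k)) \<in> (\<lambda>q. j + int q) ` {..n} \<rightarrow> carrier (P (j + int n))"
    proof
      fix k assume "k \<in> (\<lambda>q. j + int q) ` {..n}"
      then have "g (nat (j + int n - k - 0)) k \<in> rmod_hom R (N k) (P (j + int n))"
        by (intro family_component[OF R N P g]) auto
      then show "g (nat (j + int n - k - 0)) k (?y k) \<in> carrier (P (j + int n))"
        by (rule hom_closed) (rule laurent_closed[OF y])
    qed
    show "inj_on (\<lambda>q. j + int q) {..n}" by (auto simp: inj_on_def)
  qed
  also have "\<dots> = (\<Oplus>\<^bsub>P (j + int n)\<^esub>q\<in>{..n}. g (n - q) (j + int q) (f q j x))"
  proof (rule P.finsum_cong'[OF refl])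
    show "(\<lambda>q. g (n - q) (j + int q) (f q j x)) \<in> {..n} \<rightarrow> carrier (P (j + int n))"
    proof
      fix q assume "q \<in> {..n}"
      then have "g (n - q) (j + int q) \<in> rmod_hom R (N (j + int q)) (P (j + int n))"
        using filtered_familyD[OF g, of "n - q" "j + int q"] by simp
      then show "g (n - q) (j + int q) (f q j x) \<in> carrier (P (j + int n))"
        by (rule hom_closed) (use hom_closed[OF filtered_familyD[OF f] x, of q] in simp)
    qed
    fix q assume "q \<in> {..n}"
    then have "nat (j + int n - (j + int q) - 0) = n - q" by auto
    then show "g (nat (j + int n - (j + int q) - 0)) (j + int q) (?y (j + int q)) = g (n - q) (j + int q) (f q j x)"
      by (simp only: yk)
  qed
  finally show ?thesis .
qed

section \<open>Complexes over \<open>\<int>\<^sub>+ Proj\<close> as complexes of Laurent families\<close>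

text \<open>The passage to Laurent families turns the convolution identities in the definitions of complexes, morphisms and
  composites over \<open>\<int>\<^sub>+ Proj\<close> into the usual \<open>d d = 0\<close>, \<open>f d = d f\<close> and composition.\<close>

definition hat_cpx :: "('r, 'x) bigraded \<Rightarrow> ('r, int \<Rightarrow> 'x) cpx" where
  "hat_cpx X =
     \<lparr>Cmod = (\<lambda>i. laurent (Bmod X i)),
      Cdiff = (\<lambda>i. apply_family (Bmod X i) (Bmod X (i + 1)) 0 (\<lambda>n j. Bdiff X n i j))\<rparr>"

definition hat_map ::
  "('r, 'x) bigraded \<Rightarrow> ('r, 'y) bigraded \<Rightarrow> ('x, 'y) gmap \<Rightarrow> int \<Rightarrow> (int \<Rightarrow> 'x) \<Rightarrow> (int \<Rightarrow> 'y)" where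
  "hat_map X Y f = (\<lambda>i. apply_family (Bmod X i) (Bmod Y i) 0 (\<lambda>n j. f n i j))"

lemma Cmod_hat [simp]: "Cmod (hat_cpx X) i = laurent (Bmod X i)"
  by (simp add: hat_cpx_def)

context
  fixes R :: "('r, 'q) ring_scheme"
  assumes R: "ring R"
begin

lemma Z_complexD:
  assumes X: "X \<in> Z_complexes R"
  shows "projective_module R (Bmod X i j)" "module_family R (Bmod X i)"
    "Cdiff (hat_cpx X) i \<in> filtered_maps R 0 (Bmod X i) (Bmod X (i + 1))"
    "x \<in> carrier (Bmod X i j) \<Longrightarrow> Cdiff (hat_cpx X) i (single\<^sub>Z (Bmod X i) j x) (j + int n) = Bdiff X n i j x"
    "hat_cpx X \<in> module_complexes R"
proof -
  show P: "projective_module R (Bmod X i j)" for i j using X by (simp add: Z_complexes_def)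
  then show M: "module_family R (Bmod X i)" for i
    by (simp add: module_family_def projective_right_module)
  have f: "(\<lambda>n j. Bdiff X n i j) \<in> filtered_families R 0 (Bmod X i) (Bmod X (i + 1))" for i
    using X by (simp add: Z_complexes_def filtered_families_def)
  show d: "Cdiff (hat_cpx X) i \<in> filtered_maps R 0 (Bmod X i) (Bmod X (i + 1))" for i
    unfolding hat_cpx_def cpx.simps by (rule apply_family_filtered[OF R M M f])
  show "Cdiff (hat_cpx X) i (single\<^sub>Z (Bmod X i) j x) (j + int n) = Bdiff X n i j x"
    if "x \<in> carrier (Bmod X i j)"
    using apply_family_single[OF R M M f that, of n] by (simp add: hat_cpx_def)
  have dd: "Cdiff (hat_cpx X) (i + 1) (Cdiff (hat_cpx X) i x) = \<zero>\<^bsub>laurent (Bmod X (i + 2))\<^esub>"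
    if x: "x \<in> carrier (laurent (Bmod X i))" for i x
  proof (rule filtered_map_eqI[OF R M M _ filtered_map_zero[OF R M M] _ x])
    show "(\<lambda>x. Cdiff (hat_cpx X) (i + 1) (Cdiff (hat_cpx X) i x)) \<in> filtered_maps R 0 (Bmod X i) (Bmod X (i + 2))"
      using filtered_map_comp[OF d[of i] d[of "i + 1"]] by (simp add: add.assoc)
    fix j x n assume x: "x \<in> carrier (Bmod X i j)"
    have "Cdiff (hat_cpx X) (i + 1) (Cdiff (hat_cpx X) i (single\<^sub>Z (Bmod X i) j x)) (j + int n)
        = (\<Oplus>\<^bsub>Bmod X (i + 2) (j + int n)\<^esub>q\<in>{..n}. Bdiff X (n - q) (i + 1) (j + int q) (Bdiff X q i j x))"
      using apply_family_convolution[OF R M M M f f[of "i + 1"] x, of n] by (simp add: hat_cpx_def add.assoc)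
    also have "\<dots> = \<zero>\<^bsub>Bmod X (i + 2) (j + int n)\<^esub>" using X x by (simp add: Z_complexes_def)
    finally show "Cdiff (hat_cpx X) (i + 1) (Cdiff (hat_cpx X) i (single\<^sub>Z (Bmod X i) j x)) (j + 0 + int n)
      = \<zero>\<^bsub>laurent (Bmod X (i + 2))\<^esub> (j + 0 + int n)" by (simp add: laurent_simps)
  qed
  show "hat_cpx X \<in> module_complexes R"
    unfolding module_complexes_def using laurent_module(1)[OF R M] filtered_mapD(1)[OF d] dd by simp
qed

text \<open>Objects over \<open>\<int>\<^sub>+ Proj\<close> can be described by their differential on Laurent families, from which the components
  are recovered as matrix entries. All constructions below are made on that side.\<close>

lemma Z_complexI:
  assumes P: "\<And>i j. projective_module R (Bmod X i j)"
    and D: "\<And>i. D i \<in> filtered_maps R 0 (Bmod X i) (Bmod X (i + 1))"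
    and DD: "\<And>i x. x \<in> carrier (laurent (Bmod X i)) \<Longrightarrow> D (i + 1) (D i x) = \<zero>\<^bsub>laurent (Bmod X (i + 2))\<^esub>"
    and Bdiff: "\<And>n i j x. x \<in> carrier (Bmod X i j) \<Longrightarrow> Bdiff X n i j x = D i (single\<^sub>Z (Bmod X i) j x) (j + int n)"
  shows "X \<in> Z_complexes R"
    and "x \<in> carrier (laurent (Bmod X i)) \<Longrightarrow> Cdiff (hat_cpx X) i x = D i x"
proof -
  have M: "module_family R (Bmod X i)" for i
    using P by (simp add: module_family_def projective_right_module)
  have "Bdiff X n i j \<in> rmod_hom R (Bmod X i j) (Bmod X (i + 1) (j + int n))" for n i j
    using hom_cong[OF family_of_filtered[OF R M M D] module_familyD[OF M], where g = "Bdiff X n i j"] Bdiff by simp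
  then have f: "(\<lambda>n j. Bdiff X n i j) \<in> filtered_families R 0 (Bmod X i) (Bmod X (i + 1))" for i
    by (simp add: filtered_families_def)
  show eq: "Cdiff (hat_cpx X) i x = D i x" if "x \<in> carrier (laurent (Bmod X i))" for i x
    unfolding hat_cpx_def cpx.simps
    by (rule apply_family_eqI[OF R M M f D that]) (simp add: Bdiff)
  have "(\<Oplus>\<^bsub>Bmod X (i + 2) (j + int n)\<^esub>q\<in>{..n}. Bdiff X (n - q) (i + 1) (j + int q) (Bdiff X q i j x))
      = \<zero>\<^bsub>Bmod X (i + 2) (j + int n)\<^esub>" if x: "x \<in> carrier (Bmod X i j)" for n i j x
  proof -
    have s: "single\<^sub>Z (Bmod X i) j x \<in> carrier (laurent (Bmod X i))"
      by (rule hom_closed[OF single_laurent[OF M] x])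
    have "(\<Oplus>\<^bsub>Bmod X (i + 2) (j + int n)\<^esub>q\<in>{..n}. Bdiff X (n - q) (i + 1) (j + int q) (Bdiff X q i j x))
      = Cdiff (hat_cpx X) (i + 1) (Cdiff (hat_cpx X) i (single\<^sub>Z (Bmod X i) j x)) (j + int n)"
      using apply_family_convolution[OF R M M M f f[of "i + 1"] x, of n] by (simp add: hat_cpx_def add.assoc)
    also have "\<dots> = D (i + 1) (D i (single\<^sub>Z (Bmod X i) j x)) (j + int n)"
      by (simp add: eq s hom_closed[OF filtered_mapD(1)[OF D] s])
    finally show ?thesis by (simp add: DD[OF s] laurent_simps)
  qed
  then show "X \<in> Z_complexes R"
    using P f by (simp add: Z_complexes_def filtered_families_def)
qed

lemma Z_map_family:
  "f \<in> Z_maps R X Y \<Longrightarrow> (\<lambda>n j. f n i j) \<in> filtered_families R 0 (Bmod X i) (Bmod Y i)"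
  by (simp add: Z_maps_def filtered_families_def)

lemma Z_maps_iff:
  assumes X: "X \<in> Z_complexes R" and Y: "Y \<in> Z_complexes R"
  shows "f \<in> Z_maps R X Y \<longleftrightarrow> (\<forall>i. (\<lambda>n j. f n i j) \<in> filtered_families R 0 (Bmod X i) (Bmod Y i)) \<and>
    hat_map X Y f \<in> chain_maps R (hat_cpx X) (hat_cpx Y)"
proof (cases "\<forall>i. (\<lambda>n j. f n i j) \<in> filtered_families R 0 (Bmod X i) (Bmod Y i)")
  case False
  then show ?thesis using Z_map_family by blast
next
  case True
  note M = Z_complexD(2)[OF X] and N = Z_complexD(2)[OF Y]
  have f: "(\<lambda>n j. f n i j) \<in> filtered_families R 0 (Bmod X i) (Bmod Y i)" for i using True by blast
  have dX: "(\<lambda>n j. Bdiff X n i j) \<in> filtered_families R 0 (Bmod X i) (Bmod X (i + 1))" for i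
    using X by (simp add: Z_complexes_def filtered_families_def)
  have dY: "(\<lambda>n j. Bdiff Y n i j) \<in> filtered_families R 0 (Bmod Y i) (Bmod Y (i + 1))" for i
    using Y by (simp add: Z_complexes_def filtered_families_def)
  have F: "hat_map X Y f i \<in> filtered_maps R 0 (Bmod X i) (Bmod Y i)" for i
    unfolding hat_map_def by (rule apply_family_filtered[OF R M N f])
  have fd: "hat_map X Y f (i + 1) (Cdiff (hat_cpx X) i (single\<^sub>Z (Bmod X i) j x)) (j + int n) =
      (\<Oplus>\<^bsub>Bmod Y (i + 1) (j + int n)\<^esub>q\<in>{..n}. f (n - q) (i + 1) (j + int q) (Bdiff X q i j x))"
    if "x \<in> carrier (Bmod X i j)" for i j x n
    using apply_family_convolution[OF R M M N dX f that] by (simp add: hat_map_def hat_cpx_def)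
  have df: "Cdiff (hat_cpx Y) i (hat_map X Y f i (single\<^sub>Z (Bmod X i) j x)) (j + int n) =
      (\<Oplus>\<^bsub>Bmod Y (i + 1) (j + int n)\<^esub>q\<in>{..n}. Bdiff Y (n - q) i (j + int q) (f q i j x))"
    if "x \<in> carrier (Bmod X i j)" for i j x n
    using apply_family_convolution[OF R M N N f dY that] by (simp add: hat_map_def hat_cpx_def)
  have "(\<forall>i. \<forall>x\<in>carrier (laurent (Bmod X i)).
      hat_map X Y f (i + 1) (Cdiff (hat_cpx X) i x) = Cdiff (hat_cpx Y) i (hat_map X Y f i x)) \<longleftrightarrow>
    (\<forall>n i j. \<forall>x\<in>carrier (Bmod X i j).
        (\<Oplus>\<^bsub>Bmod Y (i + 1) (j + int n)\<^esub>q\<in>{..n}. f (n - q) (i + 1) (j + int q) (Bdiff X q i j x))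
        = (\<Oplus>\<^bsub>Bmod Y (i + 1) (j + int n)\<^esub>q\<in>{..n}. Bdiff Y (n - q) i (j + int q) (f q i j x)))"
    (is "?L \<longleftrightarrow> ?R")
  proof
    assume ?L
    then have "hat_map X Y f (i + 1) (Cdiff (hat_cpx X) i (single\<^sub>Z (Bmod X i) j x)) (j + int n) =
      Cdiff (hat_cpx Y) i (hat_map X Y f i (single\<^sub>Z (Bmod X i) j x)) (j + int n)"
      if "x \<in> carrier (Bmod X i j)" for i j x n
      using hom_closed[OF single_laurent[OF M] that] by simp
    then show ?R by (simp add: fd df)
  next
    assume r: ?R
    show ?L
    proof (intro allI ballI)
      fix i x assume x: "x \<in> carrier (laurent (Bmod X i))"
      have 1: "(\<lambda>x. hat_map X Y f (i + 1) (Cdiff (hat_cpx X) i x)) \<in> filtered_maps R 0 (Bmod X i) (Bmod Y (i + 1))"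
        using filtered_map_comp[OF Z_complexD(3)[OF X] F] by simp
      have 2: "(\<lambda>x. Cdiff (hat_cpx Y) i (hat_map X Y f i x)) \<in> filtered_maps R 0 (Bmod X i) (Bmod Y (i + 1))"
        using filtered_map_comp[OF F Z_complexD(3)[OF Y]] by simp
      show "hat_map X Y f (i + 1) (Cdiff (hat_cpx X) i x) = Cdiff (hat_cpx Y) i (hat_map X Y f i x)"
        by (rule filtered_map_eqI[OF R M N 1 2 _ x]) (simp add: fd df r)
    qed
  qed
  then show ?thesis using f filtered_mapD(1)[OF F]
    by (simp add: Z_maps_def chain_maps_def filtered_families_def)
qed

lemma Z_mapD:
  assumes X: "X \<in> Z_complexes R" and Y: "Y \<in> Z_complexes R" and f: "f \<in> Z_maps R X Y"
  shows "hat_map X Y f i \<in> filtered_maps R 0 (Bmod X i) (Bmod Y i)"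
    "x \<in> carrier (Bmod X i j) \<Longrightarrow> hat_map X Y f i (single\<^sub>Z (Bmod X i) j x) (j + int n) = f n i j x"
    "hat_map X Y f \<in> chain_maps R (hat_cpx X) (hat_cpx Y)"
proof -
  note M = Z_complexD(2)[OF X] and N = Z_complexD(2)[OF Y]
  show "hat_map X Y f i \<in> filtered_maps R 0 (Bmod X i) (Bmod Y i)"
    unfolding hat_map_def by (rule apply_family_filtered[OF R M N Z_map_family[OF f]])
  show "hat_map X Y f i (single\<^sub>Z (Bmod X i) j x) (j + int n) = f n i j x"
    if "x \<in> carrier (Bmod X i j)"
    using apply_family_single[OF R M N Z_map_family[OF f] that, of n] by (simp add: hat_map_def)
  show "hat_map X Y f \<in> chain_maps R (hat_cpx X) (hat_cpx Y)"
    using f Z_maps_iff[OF X Y] by blast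
qed

lemma Z_mapI:
  assumes X: "X \<in> Z_complexes R" and Y: "Y \<in> Z_complexes R"
    and F: "\<And>i. F i \<in> filtered_maps R 0 (Bmod X i) (Bmod Y i)"
    and chain: "\<And>i x. x \<in> carrier (laurent (Bmod X i)) \<Longrightarrow> F (i + 1) (Cdiff (hat_cpx X) i x) = Cdiff (hat_cpx Y) i (F i x)"
    and f: "\<And>n i j x. x \<in> carrier (Bmod X i j) \<Longrightarrow> f n i j x = F i (single\<^sub>Z (Bmod X i) j x) (j + int n)"
  shows "f \<in> Z_maps R X Y"
    and "x \<in> carrier (laurent (Bmod X i)) \<Longrightarrow> hat_map X Y f i x = F i x"
proof -
  note M = Z_complexD(2)[OF X] and N = Z_complexD(2)[OF Y]
  have "f n i j \<in> rmod_hom R (Bmod X i j) (Bmod Y i (j + int n))" for n i j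
    using hom_cong[OF family_of_filtered[OF R M N F] module_familyD[OF M], where g = "f n i j"] f by simp
  then have f': "(\<lambda>n j. f n i j) \<in> filtered_families R 0 (Bmod X i) (Bmod Y i)" for i
    by (simp add: filtered_families_def)
  show eq: "hat_map X Y f i x = F i x" if "x \<in> carrier (laurent (Bmod X i))" for i x
    unfolding hat_map_def by (rule apply_family_eqI[OF R M N f' F that]) (simp add: f)
  show "f \<in> Z_maps R X Y"
    unfolding Z_maps_iff[OF X Y]
    using f' hom_closed[OF filtered_mapD(1)[OF Z_complexD(3)[OF X]]]
      hom_cong[OF filtered_mapD(1)[OF F] laurent_module(1)[OF R M]] eq
    by (simp add: chain_maps_def chain)
qed

lemma hat_map_comp:
  assumes X: "X \<in> Z_complexes R" and Y: "Y \<in> Z_complexes R" and Z: "Z \<in> Z_complexes R"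
    and f: "f \<in> Z_maps R X Y" and g: "g \<in> Z_maps R Y Z"
  shows "Z_comp Z g f \<in> Z_maps R X Z"
    and "x \<in> carrier (laurent (Bmod X i)) \<Longrightarrow>
      hat_map X Z (Z_comp Z g f) i x = hat_map Y Z g i (hat_map X Y f i x)"
proof -
  let ?F = "\<lambda>i x. hat_map Y Z g i (hat_map X Y f i x)"
  have F: "?F i \<in> filtered_maps R 0 (Bmod X i) (Bmod Z i)" for i
    using filtered_map_comp[OF Z_mapD(1)[OF X Y f] Z_mapD(1)[OF Y Z g]] by simp
  have chain: "?F (i + 1) (Cdiff (hat_cpx X) i x) = Cdiff (hat_cpx Z) i (?F i x)"
    if "x \<in> carrier (laurent (Bmod X i))" for i x
    using chain_mapD(2)[OF chain_map_comp[OF Z_mapD(3)[OF X Y f] Z_mapD(3)[OF Y Z g]]] that by simp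
  have comp: "Z_comp Z g f n i j x = ?F i (single\<^sub>Z (Bmod X i) j x) (j + int n)"
    if "x \<in> carrier (Bmod X i j)" for n i j x
    using apply_family_convolution[OF R Z_complexD(2)[OF X] Z_complexD(2)[OF Y] Z_complexD(2)[OF Z]
        Z_map_family[OF f] Z_map_family[OF g] that] by (simp add: Z_comp_def hat_map_def)
  show "Z_comp Z g f \<in> Z_maps R X Z" by (rule Z_mapI(1)[OF X Z F chain comp])
  show "hat_map X Z (Z_comp Z g f) i x = ?F i x" if "x \<in> carrier (laurent (Bmod X i))"
    by (rule Z_mapI(2)[OF X Z F chain comp that])
qed

lemma hat_map_id:
  assumes X: "X \<in> Z_complexes R"
  shows "Z_id X \<in> Z_maps R X X" and "x \<in> carrier (laurent (Bmod X i)) \<Longrightarrow> hat_map X X (Z_id X) i x = x"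
proof -
  have id: "Z_id X n i j x = single\<^sub>Z (Bmod X i) j x (j + int n)" for n i j x
    by (simp add: Z_id_def single_def)
  show "Z_id X \<in> Z_maps R X X"
    by (rule Z_mapI(1)[OF X X filtered_map_id _ id]) simp
  show "hat_map X X (Z_id X) i x = x" if "x \<in> carrier (laurent (Bmod X i))"
    by (rule Z_mapI(2)[OF X X filtered_map_id _ id that]) simp
qed

lemma Z_eq_iff:
  assumes X: "X \<in> Z_complexes R" and Y: "Y \<in> Z_complexes R"
    and f: "f \<in> Z_maps R X Y" and g: "g \<in> Z_maps R X Y"
  shows "Z_eq X f g \<longleftrightarrow> (\<forall>i. \<forall>x\<in>carrier (laurent (Bmod X i)). hat_map X Y f i x = hat_map X Y g i x)"
proof
  assume "Z_eq X f g"
  then have "hat_map X Y f i x = hat_map X Y g i x" if "x \<in> carrier (laurent (Bmod X i))" for i x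
    by (intro filtered_map_eqI[OF R Z_complexD(2)[OF X] Z_complexD(2)[OF Y] Z_mapD(1)[OF X Y f] Z_mapD(1)[OF X Y g] _ that])
      (simp add: Z_mapD(2)[OF X Y f] Z_mapD(2)[OF X Y g] Z_eq_def)
  then show "\<forall>i. \<forall>x\<in>carrier (laurent (Bmod X i)). hat_map X Y f i x = hat_map X Y g i x" by blast
next
  assume eq: "\<forall>i. \<forall>x\<in>carrier (laurent (Bmod X i)). hat_map X Y f i x = hat_map X Y g i x"
  have "f n i j x = g n i j x" if x: "x \<in> carrier (Bmod X i j)" for n i j x
    using Z_mapD(2)[OF X Y f x, of n] Z_mapD(2)[OF X Y g x, of n] eq
      hom_closed[OF single_laurent[OF Z_complexD(2)[OF X]] x] by metis
  then show "Z_eq X f g" by (simp add: Z_eq_def)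
qed

end

section \<open>Products and shifts of Laurent families\<close>

lemma module_family_prod:
  "module_family R M \<Longrightarrow> module_family R N \<Longrightarrow> module_family R (\<lambda>j. module_prod (M j) (N j))"
  by (simp add: module_family_def right_module_prod)

definition zip_families :: "(int \<Rightarrow> 'x) \<Rightarrow> (int \<Rightarrow> 'y) \<Rightarrow> int \<Rightarrow> 'x \<times> 'y" where
  "zip_families a b = (\<lambda>j. (a j, b j))"

lemma zip_families_simps [simp]:
  "fst \<circ> zip_families a b = a" "snd \<circ> zip_families a b = b" "zip_families (fst \<circ> z) (snd \<circ> z) = z"
  "fst (zip_families a b j) = a j" "snd (zip_families a b j) = b j"
  "zip_families a b = zip_families a' b' \<longleftrightarrow> a = a' \<and> b = b'"
  by (auto simp: zip_families_def fun_eq_iff)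

lemma laurent_prod_iff:
  "z \<in> carrier (laurent (\<lambda>j. module_prod (M j) (N j))) \<longleftrightarrow>
    fst \<circ> z \<in> carrier (laurent M) \<and> snd \<circ> z \<in> carrier (laurent N)"
proof -
  have "\<exists>b. \<forall>j<b. z j = (\<zero>\<^bsub>M j\<^esub>, \<zero>\<^bsub>N j\<^esub>)"
    if "\<forall>j<b. fst (z j) = \<zero>\<^bsub>M j\<^esub>" "\<forall>j<c. snd (z j) = \<zero>\<^bsub>N j\<^esub>" for b c
    using that by (intro exI[of _ "min b c"]) (auto simp: prod_eq_iff)
  then show ?thesis
    by (auto simp: laurent_simps module_prod_simps mem_Times_iff prod_eq_iff)
qed

lemma laurent_prod_simps:
  "zip_families a b \<oplus>\<^bsub>laurent (\<lambda>j. module_prod (M j) (N j))\<^esub> zip_families a' b'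
    = zip_families (a \<oplus>\<^bsub>laurent M\<^esub> a') (b \<oplus>\<^bsub>laurent N\<^esub> b')"
  "r \<odot>\<^bsub>laurent (\<lambda>j. module_prod (M j) (N j))\<^esub> zip_families a b
    = zip_families (r \<odot>\<^bsub>laurent M\<^esub> a) (r \<odot>\<^bsub>laurent N\<^esub> b)"
  "\<zero>\<^bsub>laurent (\<lambda>j. module_prod (M j) (N j))\<^esub> = zip_families \<zero>\<^bsub>laurent M\<^esub> \<zero>\<^bsub>laurent N\<^esub>"
  by (auto simp: laurent_simps zip_families_def module_prod_simps)

lemma laurent_prod_projections:
  "fst \<circ> (z \<oplus>\<^bsub>laurent (\<lambda>j. module_prod (M j) (N j))\<^esub> w) = (fst \<circ> z) \<oplus>\<^bsub>laurent M\<^esub> (fst \<circ> w)"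
  "snd \<circ> (z \<oplus>\<^bsub>laurent (\<lambda>j. module_prod (M j) (N j))\<^esub> w) = (snd \<circ> z) \<oplus>\<^bsub>laurent N\<^esub> (snd \<circ> w)"
  "fst \<circ> (r \<odot>\<^bsub>laurent (\<lambda>j. module_prod (M j) (N j))\<^esub> z) = r \<odot>\<^bsub>laurent M\<^esub> (fst \<circ> z)"
  "snd \<circ> (r \<odot>\<^bsub>laurent (\<lambda>j. module_prod (M j) (N j))\<^esub> z) = r \<odot>\<^bsub>laurent N\<^esub> (snd \<circ> z)"
  by (auto simp: laurent_simps module_prod_def fun_eq_iff split: prod.splits)

lemma filtered_fst: "(\<lambda>z. fst \<circ> z) \<in> filtered_maps R 0 (\<lambda>j. module_prod (M j) (N j)) M"
  and filtered_snd: "(\<lambda>z. snd \<circ> z) \<in> filtered_maps R 0 (\<lambda>j. module_prod (M j) (N j)) N"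
  by (auto simp: filtered_maps_def starts_at_def module_prod_simps laurent_prod_iff
      laurent_prod_projections intro!: homI)

lemma filtered_zip:
  assumes F: "F \<in> filtered_maps R L P M" and G: "G \<in> filtered_maps R L P N"
  shows "(\<lambda>x. zip_families (F x) (G x)) \<in> filtered_maps R L P (\<lambda>j. module_prod (M j) (N j))"
proof -
  have "(\<lambda>x. zip_families (F x) (G x)) \<in> rmod_hom R (laurent P) (laurent (\<lambda>j. module_prod (M j) (N j)))"
    by (rule homI) (simp_all add: laurent_prod_iff laurent_prod_simps
      hom_closed[OF filtered_mapD(1)[OF F]] hom_closed[OF filtered_mapD(1)[OF G]]
      hom_add[OF filtered_mapD(1)[OF F]] hom_add[OF filtered_mapD(1)[OF G]]
      hom_smult[OF filtered_mapD(1)[OF F]] hom_smult[OF filtered_mapD(1)[OF G]])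
  then show ?thesis
    using filtered_mapD(2)[OF F] filtered_mapD(2)[OF G]
    by (simp add: filtered_maps_def starts_at_def module_prod_simps zip_families_def)
qed

lemma single_prod:
  "fst \<circ> single\<^sub>Z (\<lambda>j. module_prod (M j) (N j)) j (x, y) = single\<^sub>Z M j x"
  "snd \<circ> single\<^sub>Z (\<lambda>j. module_prod (M j) (N j)) j (x, y) = single\<^sub>Z N j y"
  by (auto simp: single_def module_prod_simps fun_eq_iff)

definition shift_family :: "(int \<Rightarrow> 'x) \<Rightarrow> int \<Rightarrow> 'x" where
  "shift_family x = (\<lambda>j. x (j + 1))"

definition unshift_family :: "(int \<Rightarrow> 'x) \<Rightarrow> int \<Rightarrow> 'x" where
  "unshift_family x = (\<lambda>j. x (j - 1))"

lemma shift_unshift [simp]: "shift_family (unshift_family x) = x" "unshift_family (shift_family x) = x"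
  by (simp_all add: shift_family_def unshift_family_def)

lemma shift_laurent_iff:
  "shift_family x \<in> carrier (laurent (\<lambda>j. M (j + 1))) \<longleftrightarrow> x \<in> carrier (laurent M)"
proof -
  have all: "(\<forall>j. P (j + 1)) \<longleftrightarrow> (\<forall>j. P j)" for P :: "int \<Rightarrow> bool"
    by (metis diff_add_cancel)
  have "(\<exists>b. \<forall>j<b. x (j + 1) = \<zero>\<^bsub>M (j + 1)\<^esub>) \<longleftrightarrow> (\<exists>b. \<forall>j<b. x j = \<zero>\<^bsub>M j\<^esub>)"
  proof
    assume "\<exists>b. \<forall>j<b. x (j + 1) = \<zero>\<^bsub>M (j + 1)\<^esub>"
    then obtain b where b: "\<forall>j<b. x (j + 1) = \<zero>\<^bsub>M (j + 1)\<^esub>" by blast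
    have "\<forall>j<b + 1. x j = \<zero>\<^bsub>M j\<^esub>"
    proof (intro allI impI)
      fix j assume "j < b + 1"
      then show "x j = \<zero>\<^bsub>M j\<^esub>" using b[rule_format, of "j - 1"] by simp
    qed
    then show "\<exists>b. \<forall>j<b. x j = \<zero>\<^bsub>M j\<^esub>" by blast
  next
    assume "\<exists>b. \<forall>j<b. x j = \<zero>\<^bsub>M j\<^esub>"
    then obtain b where "\<forall>j<b. x j = \<zero>\<^bsub>M j\<^esub>" by blast
    then show "\<exists>b. \<forall>j<b. x (j + 1) = \<zero>\<^bsub>M (j + 1)\<^esub>" by (intro exI[of _ "b - 1"]) simp
  qed
  then show ?thesis
    unfolding laurent_simps shift_family_def using all[of "\<lambda>j. x j \<in> carrier (M j)"] by simp
qed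

lemma unshift_laurent_iff:
  "unshift_family x \<in> carrier (laurent M) \<longleftrightarrow> x \<in> carrier (laurent (\<lambda>j. M (j + 1)))"
  using shift_laurent_iff[of "unshift_family x" M] by simp

lemma filtered_shift: "shift_family \<in> filtered_maps R (- 1) M (\<lambda>j. M (j + 1))"
proof -
  have "shift_family \<in> rmod_hom R (laurent M) (laurent (\<lambda>j. M (j + 1)))"
    by (rule homI) (simp_all only: shift_laurent_iff, simp_all add: laurent_simps shift_family_def)
  then show ?thesis by (simp add: filtered_maps_def starts_at_def shift_family_def)
qed

lemma filtered_unshift: "unshift_family \<in> filtered_maps R 1 (\<lambda>j. M (j + 1)) M"
proof -
  have "unshift_family \<in> rmod_hom R (laurent (\<lambda>j. M (j + 1))) (laurent M)"
    by (rule homI) (simp_all only: unshift_laurent_iff, simp_all add: laurent_simps unshift_family_def)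
  moreover have "starts_at M (b + 1) (unshift_family x)" if "starts_at (\<lambda>j. M (j + 1)) b x" for b x
    using that by (auto simp: starts_at_def unshift_family_def dest: spec[of _ "_ - 1"])
  ultimately show ?thesis by (simp add: filtered_maps_def)
qed

lemma unshift_single: "unshift_family (single\<^sub>Z (\<lambda>j. M (j + 1)) j x) = single\<^sub>Z M (j + 1) x"
  by (auto simp: unshift_family_def single_def fun_eq_iff)

section \<open>Twists, shifts and cones\<close>

lemma Bmod_twist [simp]: "Bmod (Z_twist X) i = (\<lambda>j. Bmod X i (j + 1))"
  by (simp add: Z_twist_def)

lemma Bmod_cone [simp]: "Bmod (Z_cone X Y f) i = (\<lambda>j. module_prod (Bmod X (i + 1) j) (Bmod Y i j))"
  by (simp add: Z_cone_def)

lemma Bmod_shift [simp]: "Bmod (Z_shift X) i = Bmod X (i + 1)"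
  by (simp add: Z_shift_def fun_eq_iff)

text \<open>The usual differential of a mapping cone, on Laurent families.\<close>

definition cone_diff ::
  "('r, 'x) bigraded \<Rightarrow> ('r, 'y) bigraded \<Rightarrow> ('x, 'y) gmap \<Rightarrow> int \<Rightarrow> (int \<Rightarrow> 'x \<times> 'y) \<Rightarrow> int \<Rightarrow> 'x \<times> 'y" where
  "cone_diff X Y f i z = zip_families
     (\<ominus>\<^bsub>laurent (Bmod X (i + 2))\<^esub> Cdiff (hat_cpx X) (i + 1) (fst \<circ> z))
     (hat_map X Y f (i + 1) (fst \<circ> z) \<oplus>\<^bsub>laurent (Bmod Y (i + 1))\<^esub> Cdiff (hat_cpx Y) i (snd \<circ> z))"

context
  fixes R :: "('r, 'q) ring_scheme"
  assumes R: "ring R"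
begin

lemma hat_group: "X \<in> Z_complexes R \<Longrightarrow> abelian_group (laurent (Bmod X i))"
  using module_complexD(2)[OF Z_complexD(5)[OF R]] by simp

lemma hat_diff_closed:
  assumes "X \<in> Z_complexes R"
  shows "x \<in> carrier (laurent (Bmod X i)) \<Longrightarrow> Cdiff (hat_cpx X) i x \<in> carrier (laurent (Bmod X (i + 1)))"
    and "x \<in> carrier (laurent (Bmod X (i + 1))) \<Longrightarrow> Cdiff (hat_cpx X) (i + 1) x \<in> carrier (laurent (Bmod X (i + 2)))"
proof -
  show *: "x \<in> carrier (laurent (Bmod X i)) \<Longrightarrow> Cdiff (hat_cpx X) i x \<in> carrier (laurent (Bmod X (i + 1)))" for i x
    by (rule hom_closed[OF filtered_mapD(1)[OF Z_complexD(3)[OF R assms]]])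
  show "x \<in> carrier (laurent (Bmod X (i + 1))) \<Longrightarrow> Cdiff (hat_cpx X) (i + 1) x \<in> carrier (laurent (Bmod X (i + 2)))"
    using *[of x "i + 1"] by (simp add: add.assoc)
qed

lemma hat_diff_hom:
  assumes "X \<in> Z_complexes R"
  shows "Cdiff (hat_cpx X) i \<in> rmod_hom R (laurent (Bmod X i)) (laurent (Bmod X (i + 1)))"
    "Cdiff (hat_cpx X) (i + 1) \<in> rmod_hom R (laurent (Bmod X (i + 1))) (laurent (Bmod X (i + 2)))"
    "Cdiff (hat_cpx X) (i - 1) \<in> rmod_hom R (laurent (Bmod X (i - 1))) (laurent (Bmod X i))"
proof -
  show *: "Cdiff (hat_cpx X) i \<in> rmod_hom R (laurent (Bmod X i)) (laurent (Bmod X (i + 1)))" for i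
    by (rule filtered_mapD(1)[OF Z_complexD(3)[OF R assms]])
  show "Cdiff (hat_cpx X) (i + 1) \<in> rmod_hom R (laurent (Bmod X (i + 1))) (laurent (Bmod X (i + 2)))"
    using *[of "i + 1"] by (simp add: add.assoc)
  show "Cdiff (hat_cpx X) (i - 1) \<in> rmod_hom R (laurent (Bmod X (i - 1))) (laurent (Bmod X i))"
    using *[of "i - 1"] by simp
qed

lemma hat_diff_diff:
  assumes "X \<in> Z_complexes R" "x \<in> carrier (laurent (Bmod X i))"
  shows "Cdiff (hat_cpx X) (i + 1) (Cdiff (hat_cpx X) i x) = \<zero>\<^bsub>laurent (Bmod X (i + 2))\<^esub>"
  using module_complexD(5)[OF Z_complexD(5)[OF R assms(1)]] assms(2) by simp

lemma Z_twist_complex: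
  assumes X: "X \<in> Z_complexes R"
  shows "Z_twist X \<in> Z_complexes R"
    and "x \<in> carrier (laurent (\<lambda>j. Bmod X i (j + 1))) \<Longrightarrow>
      Cdiff (hat_cpx (Z_twist X)) i x = shift_family (Cdiff (hat_cpx X) i (unshift_family x))"
proof -
  let ?D = "\<lambda>i x. shift_family (Cdiff (hat_cpx X) i (unshift_family x))"
  have P: "projective_module R (Bmod (Z_twist X) i j)" for i j
    using Z_complexD(1)[OF R X] by simp
  have D: "?D i \<in> filtered_maps R 0 (Bmod (Z_twist X) i) (Bmod (Z_twist X) (i + 1))" for i
    using filtered_map_comp[OF filtered_map_comp[OF filtered_unshift Z_complexD(3)[OF R X]] filtered_shift] by simp
  have DD: "?D (i + 1) (?D i x) = \<zero>\<^bsub>laurent (Bmod (Z_twist X) (i + 2))\<^esub>"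
    if "x \<in> carrier (laurent (Bmod (Z_twist X) i))" for i x
    using that by (simp add: hat_diff_diff[OF X] unshift_laurent_iff)
      (simp add: shift_family_def laurent_simps)
  have B: "Bdiff (Z_twist X) n i j x = ?D i (single\<^sub>Z (Bmod (Z_twist X) i) j x) (j + int n)"
    if "x \<in> carrier (Bmod (Z_twist X) i j)" for n i j x
  proof -
    have x: "x \<in> carrier (Bmod X i (j + 1))" using that by simp
    have "?D i (single\<^sub>Z (Bmod (Z_twist X) i) j x) (j + int n) =
        Cdiff (hat_cpx X) i (single\<^sub>Z (Bmod X i) (j + 1) x) (j + 1 + int n)"
      by (simp add: unshift_single) (simp add: shift_family_def add_ac)
    then show ?thesis using Z_complexD(4)[OF R X x] by (simp add: Z_twist_def)
  qed
  show "Z_twist X \<in> Z_complexes R" by (rule Z_complexI(1)[OF R P D DD B])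
  show "Cdiff (hat_cpx (Z_twist X)) i x = ?D i x" if "x \<in> carrier (laurent (\<lambda>j. Bmod X i (j + 1)))"
    using Z_complexI(2)[OF R P D DD B, of x i] that by simp
qed

lemma Z_shift_complex:
  assumes X: "X \<in> Z_complexes R"
  shows "Z_shift X \<in> Z_complexes R"
    and "x \<in> carrier (laurent (Bmod X (i + 1))) \<Longrightarrow>
      Cdiff (hat_cpx (Z_shift X)) i x = \<ominus>\<^bsub>laurent (Bmod X (i + 2))\<^esub> Cdiff (hat_cpx X) (i + 1) x"
proof -
  let ?D = "\<lambda>i x. \<ominus>\<^bsub>laurent (Bmod X (i + 2))\<^esub> Cdiff (hat_cpx X) (i + 1) x"
  have S: "Bmod (Z_shift X) i = Bmod X (i + 1)" for i by (simp add: Z_shift_def fun_eq_iff)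
  have d: "Cdiff (hat_cpx X) (i + 1) \<in> filtered_maps R 0 (Bmod X (i + 1)) (Bmod X (i + 2))" for i
    using Z_complexD(3)[OF R X, of "i + 1"] by (simp add: add.assoc)
  have P: "projective_module R (Bmod (Z_shift X) i j)" for i j
    using Z_complexD(1)[OF R X] by (simp add: S)
  have D: "?D i \<in> filtered_maps R 0 (Bmod (Z_shift X) i) (Bmod (Z_shift X) (i + 1))" for i
    using filtered_map_minus[OF R Z_complexD(2)[OF R X] Z_complexD(2)[OF R X] d, of i] by (simp add: S add.assoc)
  have DD: "?D (i + 1) (?D i x) = \<zero>\<^bsub>laurent (Bmod (Z_shift X) (i + 2))\<^esub>"
    if "x \<in> carrier (laurent (Bmod (Z_shift X) i))" for i x
  proof -
    have x: "x \<in> carrier (laurent (Bmod X (i + 1)))" using that by (simp add: S)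
    have dx: "Cdiff (hat_cpx X) (i + 1) x \<in> carrier (laurent (Bmod X (i + 2)))"
      by (rule hat_diff_closed(2)[OF X x])
    have "Cdiff (hat_cpx X) (i + 2) (\<ominus>\<^bsub>laurent (Bmod X (i + 2))\<^esub> Cdiff (hat_cpx X) (i + 1) x)
        = \<ominus>\<^bsub>laurent (Bmod X (i + 2 + 1))\<^esub> Cdiff (hat_cpx X) (i + 2) (Cdiff (hat_cpx X) (i + 1) x)"
      by (rule hom_minus[OF hat_diff_hom(1)[OF X] hat_group[OF X] hat_group[OF X] dx])
    also have "Cdiff (hat_cpx X) (i + 2) (Cdiff (hat_cpx X) (i + 1) x) = \<zero>\<^bsub>laurent (Bmod X (i + 3))\<^esub>"
      using hat_diff_diff[OF X x] by (simp add: add.assoc)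
    finally show ?thesis
      by (simp add: S add.assoc abelian_group.neg_zero[OF hat_group[OF X]])
  qed
  have B: "Bdiff (Z_shift X) n i j x = ?D i (single\<^sub>Z (Bmod (Z_shift X) i) j x) (j + int n)"
    if "x \<in> carrier (Bmod (Z_shift X) i j)" for n i j x
  proof -
    have x: "x \<in> carrier (Bmod X (i + 1) j)" using that by (simp add: S)
    have s: "single\<^sub>Z (Bmod X (i + 1)) j x \<in> carrier (laurent (Bmod X (i + 1)))"
      by (rule hom_closed[OF single_laurent[OF Z_complexD(2)[OF R X]] x])
    show ?thesis
      using Z_complexD(4)[OF R X x, of n] laurent_module(2)[OF R Z_complexD(2)[OF R X] hat_diff_closed(2)[OF X s]]
      by (simp add: S) (simp add: Z_shift_def)
  qed
  show "Z_shift X \<in> Z_complexes R" by (rule Z_complexI(1)[OF R P D DD B])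
  show "Cdiff (hat_cpx (Z_shift X)) i x = ?D i x" if "x \<in> carrier (laurent (Bmod X (i + 1)))"
    using Z_complexI(2)[OF R P D DD B, of x i] that by (simp add: S)
qed

context
  fixes X :: "('r, 'x) bigraded" and Y :: "('r, 'y) bigraded" and f :: "('x, 'y) gmap"
  assumes X: "X \<in> Z_complexes R" and Y: "Y \<in> Z_complexes R" and f: "f \<in> Z_maps R X Y"
begin

lemma cone_base_closed: "x \<in> carrier (laurent (Bmod X i)) \<Longrightarrow> hat_map X Y f i x \<in> carrier (laurent (Bmod Y i))"
  by (rule hom_closed[OF filtered_mapD(1)[OF Z_mapD(1)[OF R X Y f]]])

lemma Z_cone_complex:
  shows "Z_cone X Y f \<in> Z_complexes R"
    and "z \<in> carrier (laurent (Bmod (Z_cone X Y f) i)) \<Longrightarrow> Cdiff (hat_cpx (Z_cone X Y f)) i z = cone_diff X Y f i z"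
proof -
  let ?C = "Z_cone X Y f"
  have d: "Cdiff (hat_cpx X) (i + 1) \<in> filtered_maps R 0 (Bmod X (i + 1)) (Bmod X (i + 2))" for i
    using Z_complexD(3)[OF R X, of "i + 1"] by (simp add: add.assoc)
  have P: "projective_module R (Bmod ?C i j)" for i j
    by (simp add: projective_prod Z_complexD(1)[OF R X] Z_complexD(1)[OF R Y])
  have M: "module_family R (Bmod ?C i)" for i
    by (simp add: module_family_prod Z_complexD(2)[OF R X] Z_complexD(2)[OF R Y])
  have D: "cone_diff X Y f i \<in> filtered_maps R 0 (Bmod ?C i) (Bmod ?C (i + 1))" for i
  proof -
    have p1: "(\<lambda>z. fst \<circ> z) \<in> filtered_maps R 0 (Bmod ?C i) (Bmod X (i + 1))"
      and p2: "(\<lambda>z. snd \<circ> z) \<in> filtered_maps R 0 (Bmod ?C i) (Bmod Y i)"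
      by (simp_all add: filtered_fst filtered_snd)
    have 1: "(\<lambda>z. \<ominus>\<^bsub>laurent (Bmod X (i + 2))\<^esub> Cdiff (hat_cpx X) (i + 1) (fst \<circ> z))
        \<in> filtered_maps R 0 (Bmod ?C i) (Bmod X (i + 2))"
      using filtered_map_minus[OF R M Z_complexD(2)[OF R X] filtered_map_comp[OF p1 d[of i]]] by simp
    have 2: "(\<lambda>z. hat_map X Y f (i + 1) (fst \<circ> z) \<oplus>\<^bsub>laurent (Bmod Y (i + 1))\<^esub> Cdiff (hat_cpx Y) i (snd \<circ> z))
        \<in> filtered_maps R 0 (Bmod ?C i) (Bmod Y (i + 1))"
      using filtered_map_plus[OF R M Z_complexD(2)[OF R Y]
        filtered_map_comp[OF p1 Z_mapD(1)[OF R X Y f]] filtered_map_comp[OF p2 Z_complexD(3)[OF R Y]]] by simp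
    show ?thesis using filtered_zip[OF 1 2] by (simp add: cone_diff_def[abs_def] add.assoc)
  qed
  have DD: "cone_diff X Y f (i + 1) (cone_diff X Y f i z) = \<zero>\<^bsub>laurent (Bmod ?C (i + 2))\<^esub>"
    if "z \<in> carrier (laurent (Bmod ?C i))" for i z
  proof -
    define a b where "a = fst \<circ> z" and "b = snd \<circ> z"
    have a: "a \<in> carrier (laurent (Bmod X (i + 1)))" and b: "b \<in> carrier (laurent (Bmod Y i))"
      using that by (simp_all add: a_def b_def laurent_prod_iff)
    have da: "Cdiff (hat_cpx X) (i + 1) a \<in> carrier (laurent (Bmod X (i + 2)))"
      by (rule hat_diff_closed(2)[OF X a])
    have "Cdiff (hat_cpx X) (i + 2) (\<ominus>\<^bsub>laurent (Bmod X (i + 2))\<^esub> Cdiff (hat_cpx X) (i + 1) a)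
        = \<ominus>\<^bsub>laurent (Bmod X (i + 2 + 1))\<^esub> Cdiff (hat_cpx X) (i + 2) (Cdiff (hat_cpx X) (i + 1) a)"
      by (rule hom_minus[OF hat_diff_hom(1)[OF X] hat_group[OF X] hat_group[OF X] da])
    also have "Cdiff (hat_cpx X) (i + 2) (Cdiff (hat_cpx X) (i + 1) a) = \<zero>\<^bsub>laurent (Bmod X (i + 3))\<^esub>"
      using hat_diff_diff[OF X a] by (simp add: add.assoc)
    finally have 1: "Cdiff (hat_cpx X) (i + 2) (\<ominus>\<^bsub>laurent (Bmod X (i + 2))\<^esub> Cdiff (hat_cpx X) (i + 1) a)
        = \<zero>\<^bsub>laurent (Bmod X (i + 3))\<^esub>"
      by (simp add: add.assoc abelian_group.neg_zero[OF hat_group[OF X]])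
    have fa: "hat_map X Y f (i + 1) a \<in> carrier (laurent (Bmod Y (i + 1)))" by (rule cone_base_closed[OF a])
    have "hat_map X Y f (i + 2) (Cdiff (hat_cpx X) (i + 1) a) = Cdiff (hat_cpx Y) (i + 1) (hat_map X Y f (i + 1) a)"
      using chain_mapD(2)[OF Z_mapD(3)[OF R X Y f], of a "i + 1"] a by (simp add: add.assoc)
    then have 2: "hat_map X Y f (i + 2) (\<ominus>\<^bsub>laurent (Bmod X (i + 2))\<^esub> Cdiff (hat_cpx X) (i + 1) a) =
        \<ominus>\<^bsub>laurent (Bmod Y (i + 2))\<^esub> Cdiff (hat_cpx Y) (i + 1) (hat_map X Y f (i + 1) a)"
      by (simp add: hom_minus[OF filtered_mapD(1)[OF Z_mapD(1)[OF R X Y f]] hat_group[OF X] hat_group[OF Y] da])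
    have 3: "Cdiff (hat_cpx Y) (i + 1) (hat_map X Y f (i + 1) a \<oplus>\<^bsub>laurent (Bmod Y (i + 1))\<^esub> Cdiff (hat_cpx Y) i b)
      = Cdiff (hat_cpx Y) (i + 1) (hat_map X Y f (i + 1) a) \<oplus>\<^bsub>laurent (Bmod Y (i + 2))\<^esub> \<zero>\<^bsub>laurent (Bmod Y (i + 2))\<^esub>"
      by (simp add: hom_add[OF hat_diff_hom(2)[OF Y] fa hat_diff_closed(1)[OF Y b]] hat_diff_diff[OF Y b])
    have dfa: "Cdiff (hat_cpx Y) (i + 1) (hat_map X Y f (i + 1) a) \<in> carrier (laurent (Bmod Y (i + 2)))"
      by (rule hat_diff_closed(2)[OF Y fa])
    show ?thesis
      unfolding cone_diff_def a_def[symmetric] b_def[symmetric]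
      using dfa by (simp add: add.assoc 1 2 3 laurent_prod_simps abelian_group.neg_zero[OF hat_group[OF X]]
          group_simps[OF hat_group[OF Y]] abelian_group.l_neg[OF hat_group[OF Y]])
  qed
  have B: "Bdiff ?C n i j z = cone_diff X Y f i (single\<^sub>Z (Bmod ?C i) j z) (j + int n)"
    if "z \<in> carrier (Bmod ?C i j)" for n i j z
  proof -
    obtain x y where z: "z = (x, y)" and x: "x \<in> carrier (Bmod X (i + 1) j)" and y: "y \<in> carrier (Bmod Y i j)"
      using \<open>z \<in> _\<close> by (auto simp: module_prod_simps)
    have s: "single\<^sub>Z (Bmod X (i + 1)) j x \<in> carrier (laurent (Bmod X (i + 1)))"
      by (rule hom_closed[OF single_laurent[OF Z_complexD(2)[OF R X]] x])
    show ?thesis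
      using Z_complexD(4)[OF R X x, of n] Z_complexD(4)[OF R Y y, of n] Z_mapD(2)[OF R X Y f x, of n]
        laurent_module(2)[OF R Z_complexD(2)[OF R X] hat_diff_closed(2)[OF X s]]
      by (simp add: z cone_diff_def single_prod laurent_simps(3) zip_families_def) (simp add: Z_cone_def)
  qed
  show "?C \<in> Z_complexes R" by (rule Z_complexI(1)[OF R P D DD B])
  show "Cdiff (hat_cpx ?C) i z = cone_diff X Y f i z" if "z \<in> carrier (laurent (Bmod ?C i))"
    by (rule Z_complexI(2)[OF R P D DD B that])
qed

lemma Z_cone_in:
  shows "cone_in X Y \<in> Z_maps R Y (Z_cone X Y f)"
    and "y \<in> carrier (laurent (Bmod Y i)) \<Longrightarrow>
      hat_map Y (Z_cone X Y f) (cone_in X Y) i y = zip_families \<zero>\<^bsub>laurent (Bmod X (i + 1))\<^esub> y"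
proof -
  let ?C = "Z_cone X Y f" let ?F = "\<lambda>i y. zip_families \<zero>\<^bsub>laurent (Bmod X (i + 1))\<^esub> y"
  have F: "?F i \<in> filtered_maps R 0 (Bmod Y i) (Bmod ?C i)" for i
    using filtered_zip[OF filtered_map_zero[OF R Z_complexD(2)[OF R Y] Z_complexD(2)[OF R X]] filtered_map_id]
    by simp
  have zero: "hat_map X Y f (i + 1) \<zero>\<^bsub>laurent (Bmod X (i + 1))\<^esub> = \<zero>\<^bsub>laurent (Bmod Y (i + 1))\<^esub>"
    "Cdiff (hat_cpx X) (i + 1) \<zero>\<^bsub>laurent (Bmod X (i + 1))\<^esub> = \<zero>\<^bsub>laurent (Bmod X (i + 2))\<^esub>" for i
    using hom_zero[OF filtered_mapD(1)[OF Z_mapD(1)[OF R X Y f]] hat_group[OF X] hat_group[OF Y]]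
      hom_zero[OF hat_diff_hom(2)[OF X] hat_group[OF X] hat_group[OF X]] by simp_all
  have chain: "?F (i + 1) (Cdiff (hat_cpx Y) i y) = Cdiff (hat_cpx ?C) i (?F i y)"
    if "y \<in> carrier (laurent (Bmod Y i))" for i y
    using that hat_diff_closed(1)[OF Y that]
    by (subst Z_cone_complex(2)) (simp_all add: laurent_prod_iff cone_diff_def zero add.assoc
      group_simps[OF hat_group[OF X]] group_simps[OF hat_group[OF Y]] abelian_group.neg_zero[OF hat_group[OF X]])
  have c: "cone_in X Y n i j y = ?F i (single\<^sub>Z (Bmod Y i) j y) (j + int n)" for n i j y
    by (simp add: cone_in_def zip_families_def laurent_simps single_def)
  show "cone_in X Y \<in> Z_maps R Y ?C" by (rule Z_mapI(1)[OF R Y Z_cone_complex(1) F chain c])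
  show "hat_map Y ?C (cone_in X Y) i y = ?F i y" if "y \<in> carrier (laurent (Bmod Y i))"
    by (rule Z_mapI(2)[OF R Y Z_cone_complex(1) F chain c that])
qed

lemma Z_cone_out:
  shows "cone_out X \<in> Z_maps R (Z_cone X Y f) (Z_shift X)"
    and "z \<in> carrier (laurent (Bmod (Z_cone X Y f) i)) \<Longrightarrow>
      hat_map (Z_cone X Y f) (Z_shift X) (cone_out X) i z = fst \<circ> z"
proof -
  let ?C = "Z_cone X Y f" let ?F = "\<lambda>i z. fst \<circ> z"
  have F: "?F i \<in> filtered_maps R 0 (Bmod ?C i) (Bmod (Z_shift X) i)" for i
    using filtered_fst by simp
  have chain: "?F (i + 1) (Cdiff (hat_cpx ?C) i z) = Cdiff (hat_cpx (Z_shift X)) i (?F i z)"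
    if "z \<in> carrier (laurent (Bmod ?C i))" for i z
    using that Z_cone_complex(2)[OF that] Z_shift_complex(2)[OF X]
    by (simp add: laurent_prod_iff cone_diff_def)
  have c: "cone_out X n i j z = ?F i (single\<^sub>Z (Bmod ?C i) j z) (j + int n)" for n i j z
    by (cases z) (simp add: cone_out_def single_def module_prod_simps)
  show "cone_out X \<in> Z_maps R ?C (Z_shift X)"
    by (rule Z_mapI(1)[OF R Z_cone_complex(1) Z_shift_complex(1)[OF X] F chain c])
  show "hat_map ?C (Z_shift X) (cone_out X) i z = ?F i z" if "z \<in> carrier (laurent (Bmod ?C i))"
    by (rule Z_mapI(2)[OF R Z_cone_complex(1) Z_shift_complex(1)[OF X] F chain c that])
qed

text \<open>The universal property of the cone: a map \<open>w\<close> on \<open>Y\<close> together with a null-homotopy \<open>S\<close> of \<open>w f\<close> is a map on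
  \<open>Con(f)\<close>. For the result to be a morphism over \<open>\<int>\<^sub>+ Proj\<close>, the null-homotopy \<open>S\<close> has to preserve the filtration.\<close>

lemma Z_cone_extend:
  fixes W :: "('r, 'z) bigraded"
  assumes W: "W \<in> Z_complexes R" and w: "w \<in> chain_maps R (hat_cpx Y) (hat_cpx W)"
    and wf: "\<And>i. w i \<in> filtered_maps R 0 (Bmod Y i) (Bmod W i)"
    and S: "\<And>i. S i \<in> filtered_maps R 0 (Bmod X i) (Bmod W (i - 1))"
    and null: "\<And>i a. a \<in> carrier (laurent (Bmod X i)) \<Longrightarrow>
      w i (hat_map X Y f i a) = Cdiff (hat_cpx W) (i - 1) (S i a) \<oplus>\<^bsub>laurent (Bmod W i)\<^esub> S (i + 1) (Cdiff (hat_cpx X) i a)"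
  shows "\<exists>v\<in>Z_maps R (Z_cone X Y f) W. \<forall>i. \<forall>z\<in>carrier (laurent (Bmod (Z_cone X Y f) i)).
     hat_map (Z_cone X Y f) W v i z = S (i + 1) (fst \<circ> z) \<oplus>\<^bsub>laurent (Bmod W i)\<^esub> w i (snd \<circ> z)"
proof -
  let ?C = "Z_cone X Y f"
  let ?F = "\<lambda>i z. S (i + 1) (fst \<circ> z) \<oplus>\<^bsub>laurent (Bmod W i)\<^esub> w i (snd \<circ> z)"
  define v where "v = (\<lambda>n i j z. ?F i (single\<^sub>Z (Bmod ?C i) j z) (j + int n))"
  have S': "S (i + 1) \<in> filtered_maps R 0 (Bmod X (i + 1)) (Bmod W i)" for i using S[of "i + 1"] by simp
  have S'': "S (i + 2) \<in> filtered_maps R 0 (Bmod X (i + 2)) (Bmod W (i + 1))" for i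
    using S'[of "i + 1"] by (simp add: add.assoc)
  have M: "module_family R (Bmod ?C i)" for i by (rule Z_complexD(2)[OF R Z_cone_complex(1)])
  have F: "?F i \<in> filtered_maps R 0 (Bmod ?C i) (Bmod W i)" for i
  proof -
    have p1: "(\<lambda>z. fst \<circ> z) \<in> filtered_maps R 0 (Bmod ?C i) (Bmod X (i + 1))"
      and p2: "(\<lambda>z. snd \<circ> z) \<in> filtered_maps R 0 (Bmod ?C i) (Bmod Y i)"
      by (simp_all add: filtered_fst filtered_snd)
    show ?thesis
      using filtered_map_plus[OF R M Z_complexD(2)[OF R W] filtered_map_comp[OF p1 S'[of i]]
          filtered_map_comp[OF p2 wf]] by simp
  qed
  have chain: "?F (i + 1) (Cdiff (hat_cpx ?C) i z) = Cdiff (hat_cpx W) i (?F i z)"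
    if z: "z \<in> carrier (laurent (Bmod ?C i))" for i z
  proof -
    define a b where "a = fst \<circ> z" and "b = snd \<circ> z"
    have a: "a \<in> carrier (laurent (Bmod X (i + 1)))" and b: "b \<in> carrier (laurent (Bmod Y i))"
      using z by (simp_all add: a_def b_def laurent_prod_iff)
    have da: "Cdiff (hat_cpx X) (i + 1) a \<in> carrier (laurent (Bmod X (i + 2)))"
      by (rule hat_diff_closed(2)[OF X a])
    have db: "Cdiff (hat_cpx Y) i b \<in> carrier (laurent (Bmod Y (i + 1)))"
      by (rule hat_diff_closed(1)[OF Y b])
    have fa: "hat_map X Y f (i + 1) a \<in> carrier (laurent (Bmod Y (i + 1)))" by (rule cone_base_closed[OF a])
    have Sa: "S (i + 1) a \<in> carrier (laurent (Bmod W i))" by (rule hom_closed[OF filtered_mapD(1)[OF S'] a])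
    have Sda: "S (i + 2) (Cdiff (hat_cpx X) (i + 1) a) \<in> carrier (laurent (Bmod W (i + 1)))"
      by (rule hom_closed[OF filtered_mapD(1)[OF S''] da])
    have wb: "w i b \<in> carrier (laurent (Bmod W i))" by (rule hom_closed[OF filtered_mapD(1)[OF wf] b])
    have dSa: "Cdiff (hat_cpx W) i (S (i + 1) a) \<in> carrier (laurent (Bmod W (i + 1)))"
      by (rule hat_diff_closed(1)[OF W Sa])
    have dwb: "Cdiff (hat_cpx W) i (w i b) \<in> carrier (laurent (Bmod W (i + 1)))"
      by (rule hat_diff_closed(1)[OF W wb])
    have 1: "S (i + 2) (\<ominus>\<^bsub>laurent (Bmod X (i + 2))\<^esub> Cdiff (hat_cpx X) (i + 1) a)
        = \<ominus>\<^bsub>laurent (Bmod W (i + 1))\<^esub> S (i + 2) (Cdiff (hat_cpx X) (i + 1) a)"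
      by (rule hom_minus[OF filtered_mapD(1)[OF S''] hat_group[OF X] hat_group[OF W] da])
    have 2: "w (i + 1) (hat_map X Y f (i + 1) a \<oplus>\<^bsub>laurent (Bmod Y (i + 1))\<^esub> Cdiff (hat_cpx Y) i b) =
        (Cdiff (hat_cpx W) i (S (i + 1) a) \<oplus>\<^bsub>laurent (Bmod W (i + 1))\<^esub> S (i + 2) (Cdiff (hat_cpx X) (i + 1) a))
          \<oplus>\<^bsub>laurent (Bmod W (i + 1))\<^esub> Cdiff (hat_cpx W) i (w i b)"
      using null[OF a] chain_mapD(2)[OF w, of b i] b
      by (simp add: hom_add[OF filtered_mapD(1)[OF wf] fa db] add.assoc)
    have 3: "Cdiff (hat_cpx W) i (S (i + 1) a \<oplus>\<^bsub>laurent (Bmod W i)\<^esub> w i b) =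
        Cdiff (hat_cpx W) i (S (i + 1) a) \<oplus>\<^bsub>laurent (Bmod W (i + 1))\<^esub> Cdiff (hat_cpx W) i (w i b)"
      by (rule hom_add[OF hat_diff_hom(1)[OF W] Sa wb])
    interpret W: abelian_group "laurent (Bmod W (i + 1))" by (rule hat_group[OF W])
    show ?thesis
      unfolding Z_cone_complex(2)[OF z] cone_diff_def a_def[symmetric] b_def[symmetric]
      using Sda dSa dwb by (simp add: add.assoc 1 2 3 W.a_ac W.r_neg W.r_neg1 W.add_neg_cancel)
  qed
  have v: "v \<in> Z_maps R ?C W"
    by (rule Z_mapI(1)[OF R Z_cone_complex(1) W F chain]) (simp_all add: v_def comp_def)
  moreover have "hat_map ?C W v i z = ?F i z" if "z \<in> carrier (laurent (Bmod ?C i))" for i z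
    by (rule Z_mapI(2)[OF R Z_cone_complex(1) W F chain _ that]) (simp_all add: v_def comp_def)
  ultimately show ?thesis by blast
qed

end

lemma Z_eta_map:
  assumes X: "X \<in> Z_complexes R"
  shows "Z_eta X \<in> Z_maps R (Z_twist X) X"
    and "x \<in> carrier (laurent (\<lambda>j. Bmod X i (j + 1))) \<Longrightarrow> hat_map (Z_twist X) X (Z_eta X) i x = unshift_family x"
proof -
  have F: "unshift_family \<in> filtered_maps R 0 (Bmod (Z_twist X) i) (Bmod X i)" for i
    by (simp, rule filtered_map_weaken[OF filtered_unshift]) simp
  have chain: "unshift_family (Cdiff (hat_cpx (Z_twist X)) i x) = Cdiff (hat_cpx X) i (unshift_family x)"
    if "x \<in> carrier (laurent (Bmod (Z_twist X) i))" for i x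
    using that by (simp add: Z_twist_complex(2)[OF X])
  have e: "Z_eta X n i j x = unshift_family (single\<^sub>Z (Bmod (Z_twist X) i) j x) (j + int n)" for n i j x
    by (simp add: unshift_single) (simp add: Z_eta_def single_def)
  show "Z_eta X \<in> Z_maps R (Z_twist X) X"
    by (rule Z_mapI(1)[OF R Z_twist_complex(1)[OF X] X F chain e])
  show "hat_map (Z_twist X) X (Z_eta X) i x = unshift_family x" if "x \<in> carrier (laurent (\<lambda>j. Bmod X i (j + 1)))"
    using Z_mapI(2)[OF R Z_twist_complex(1)[OF X] X F chain e, of x i] that by simp
qed

end

section \<open>The stable category and homotopies through \<open>\<eta>\<close>\<close>

text \<open>Homotopies may lower the filtration by one. They are the maps that preserve the filtration after
  composition with \<open>\<eta>\<close>, which raises it by one.\<close>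

definition Z_homotopies ::
  "('r, 'q) ring_scheme \<Rightarrow> ('r, 'x) bigraded \<Rightarrow> ('r, 'y) bigraded \<Rightarrow>
   (int \<Rightarrow> (int \<Rightarrow> 'x) \<Rightarrow> (int \<Rightarrow> 'y)) set" where
  "Z_homotopies R X Y = {s. \<forall>i. s i \<in> filtered_maps R (- 1) (Bmod X i) (Bmod Y (i - 1))}"

definition eta_contraction ::
  "('r, 'q) ring_scheme \<Rightarrow> ('r, 'x) bigraded \<Rightarrow> (int \<Rightarrow> (int \<Rightarrow> 'x) \<Rightarrow> (int \<Rightarrow> 'x)) \<Rightarrow> bool" where
  "eta_contraction R I \<sigma> \<longleftrightarrow> \<sigma> \<in> Z_homotopies R I I \<and>
     homotopy_between (hat_cpx I) (hat_cpx I) \<sigma> (\<lambda>i x. x) (zero_map (hat_cpx I))"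

definition eta_homotopy_rel ::
  "('r, 'q) ring_scheme \<Rightarrow> ('r, 'x) bigraded \<Rightarrow> ('r, 'y) bigraded \<Rightarrow>
   (('x, 'y) gmap \<times> ('x, 'y) gmap) set" where
  "eta_homotopy_rel R X Y = {(f, g). f \<in> Z_maps R X Y \<and> g \<in> Z_maps R X Y \<and>
     (\<exists>s\<in>Z_homotopies R X Y. homotopy_between (hat_cpx X) (hat_cpx Y) s (hat_map X Y f) (hat_map X Y g))}"

lemma Z_homotopyD:
  assumes "s \<in> Z_homotopies R X Y"
  shows "s i \<in> filtered_maps R (- 1) (Bmod X i) (Bmod Y (i - 1))"
    "s (i + 1) \<in> filtered_maps R (- 1) (Bmod X (i + 1)) (Bmod Y i)"
    "s \<in> degree_maps R (hat_cpx X) (hat_cpx Y)"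
proof -
  show *: "s i \<in> filtered_maps R (- 1) (Bmod X i) (Bmod Y (i - 1))" for i
    using assms by (simp add: Z_homotopies_def)
  show "s (i + 1) \<in> filtered_maps R (- 1) (Bmod X (i + 1)) (Bmod Y i)" using *[of "i + 1"] by simp
  show "s \<in> degree_maps R (hat_cpx X) (hat_cpx Y)"
    using filtered_mapD(1)[OF *] by (simp add: degree_maps_def)
qed

abbreviation eta_cone :: "('r, 'x) bigraded \<Rightarrow> ('r, 'x \<times> 'x) bigraded" where
  "eta_cone X \<equiv> Z_cone (Z_twist X) X (Z_eta X)"

context
  fixes R :: "('r, 'q) ring_scheme"
  assumes R: "ring R"
begin

lemma eta_contractionD:
  assumes I: "I \<in> Z_complexes R" and \<sigma>: "eta_contraction R I \<sigma>" and x: "x \<in> carrier (laurent (Bmod I i))"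
  shows "Cdiff (hat_cpx I) (i - 1) (\<sigma> i x) \<oplus>\<^bsub>laurent (Bmod I i)\<^esub> \<sigma> (i + 1) (Cdiff (hat_cpx I) i x) = x"
proof -
  have s: "\<sigma> \<in> Z_homotopies R I I" using \<sigma> by (simp add: eta_contraction_def)
  have "Cdiff (hat_cpx I) (i - 1) (\<sigma> i x) \<oplus>\<^bsub>laurent (Bmod I i)\<^esub> \<sigma> (i + 1) (Cdiff (hat_cpx I) i x)
      \<in> carrier (laurent (Bmod I i))"
    using hom_closed[OF hat_diff_hom(3)[OF R I] hom_closed[OF filtered_mapD(1)[OF Z_homotopyD(1)[OF s]] x]]
      hom_closed[OF filtered_mapD(1)[OF Z_homotopyD(2)[OF s]] hat_diff_closed(1)[OF R I x]]
    by (simp add: group_simps[OF hat_group[OF R I]])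
  moreover have "x = zero_map (hat_cpx I) i x \<oplus>\<^bsub>Cmod (hat_cpx I) i\<^esub>
      (Cdiff (hat_cpx I) (i - 1) (\<sigma> i x) \<oplus>\<^bsub>Cmod (hat_cpx I) i\<^esub> \<sigma> (i + 1) (Cdiff (hat_cpx I) i x))"
    using \<sigma> x unfolding eta_contraction_def homotopy_between_def Cmod_hat by blast
  ultimately show ?thesis
    unfolding zero_map_def Cmod_hat using abelian_monoid.l_zero[OF abelian_group.axioms(1)[OF hat_group[OF R I]]]
    by metis
qed

lemma eta_cone_complex: "X \<in> Z_complexes R \<Longrightarrow> eta_cone X \<in> Z_complexes R"
  by (intro Z_cone_complex(1)[OF R] Z_twist_complex(1)[OF R] Z_eta_map(1)[OF R])

text \<open>In \<open>Con(\<eta>\<^sub>X)\<close> the contraction sends \<open>(a, b)\<close> to \<open>(\<eta>\<^sup>-\<^sup>1 b, 0)\<close>; the inverse of the index shift \<open>\<eta>\<close> lowers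
  the filtration by one.\<close>

lemma eta_cone_contraction:
  fixes X :: "('r, 'x) bigraded"
  assumes X: "X \<in> Z_complexes R"
  shows "\<exists>\<sigma>. eta_contraction R (eta_cone X) \<sigma>"
proof -
  let ?C = "eta_cone X"
  define \<sigma> where "\<sigma> i z = zip_families (shift_family (snd \<circ> z)) \<zero>\<^bsub>laurent (Bmod X (i - 1))\<^esub>" for i and z :: "int \<Rightarrow> 'x \<times> 'x"
  note tw = Z_twist_complex(1)[OF R X] and eta = Z_eta_map(1)[OF R X]
  have C: "?C \<in> Z_complexes R" by (rule eta_cone_complex[OF X])
  have "\<sigma> i \<in> filtered_maps R (- 1) (Bmod ?C i) (Bmod ?C (i - 1))" for i
  proof -
    have p2: "(\<lambda>z. snd \<circ> z) \<in> filtered_maps R 0 (Bmod ?C i) (Bmod X i)" by (simp add: filtered_snd)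
    have 1: "(\<lambda>z. shift_family (snd \<circ> z)) \<in> filtered_maps R (- 1) (Bmod ?C i) (\<lambda>j. Bmod X i (j + 1))"
      using filtered_map_comp[OF p2 filtered_shift] by simp
    have 2: "(\<lambda>z. \<zero>\<^bsub>laurent (Bmod X (i - 1))\<^esub>) \<in> filtered_maps R (- 1) (Bmod ?C i) (Bmod X (i - 1))"
      by (rule filtered_map_zero[OF R Z_complexD(2)[OF R C] Z_complexD(2)[OF R X]])
    show ?thesis using filtered_zip[OF 1 2] by (simp add: \<sigma>_def[abs_def])
  qed
  moreover have "homotopy_between (hat_cpx ?C) (hat_cpx ?C) \<sigma> (\<lambda>i x. x) (zero_map (hat_cpx ?C))"
    unfolding homotopy_between_def
  proof (intro allI ballI)
    fix i z assume "z \<in> carrier (Cmod (hat_cpx ?C) i)"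
    then have z: "z \<in> carrier (laurent (Bmod ?C i))" by simp
    define a b where "a = fst \<circ> z" and "b = snd \<circ> z"
    have a: "a \<in> carrier (laurent (\<lambda>j. Bmod X (i + 1) (j + 1)))" and b: "b \<in> carrier (laurent (Bmod X i))"
      using z by (simp_all add: a_def b_def laurent_prod_iff)
    have sb: "shift_family b \<in> carrier (laurent (\<lambda>j. Bmod X i (j + 1)))" using b by (simp add: shift_laurent_iff)
    have db: "shift_family (Cdiff (hat_cpx X) i b) \<in> carrier (laurent (\<lambda>j. Bmod X (i + 1) (j + 1)))"
      using hat_diff_closed(1)[OF R X b] by (simp only: shift_laurent_iff)
    interpret T: abelian_group "laurent (\<lambda>j. Bmod X (i + 1) (j + 1))"
      using hat_group[OF R tw, of "i + 1"] by simp
    interpret X: abelian_group "laurent (Bmod X i)" by (rule hat_group[OF R X])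
    have \<sigma>z: "\<sigma> i z = zip_families (shift_family b) \<zero>\<^bsub>laurent (Bmod X (i - 1))\<^esub>"
      by (simp add: \<sigma>_def b_def)
    have "\<sigma> i z \<in> carrier (laurent (Bmod ?C (i - 1)))"
      using sb group_simps(1)[OF hat_group[OF R X]] by (simp add: \<sigma>z laurent_prod_iff)
    then have "Cdiff (hat_cpx ?C) (i - 1) (\<sigma> i z) = cone_diff (Z_twist X) X (Z_eta X) (i - 1) (\<sigma> i z)"
      by (rule Z_cone_complex(2)[OF R tw X eta])
    also have "\<dots> = zip_families (\<ominus>\<^bsub>laurent (\<lambda>j. Bmod X (i + 1) (j + 1))\<^esub> shift_family (Cdiff (hat_cpx X) i b)) b"
      using sb b hom_zero[OF hat_diff_hom(3)[OF R X] hat_group[OF R X] hat_group[OF R X]]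
      by (simp add: cone_diff_def \<sigma>z Z_twist_complex(2)[OF R X] Z_eta_map(2)[OF R X] add.commute[of 1 i])
    finally have 1: "Cdiff (hat_cpx ?C) (i - 1) (\<sigma> i z) =
      zip_families (\<ominus>\<^bsub>laurent (\<lambda>j. Bmod X (i + 1) (j + 1))\<^esub> shift_family (Cdiff (hat_cpx X) i b)) b" .
    have "snd \<circ> Cdiff (hat_cpx ?C) i z = unshift_family a \<oplus>\<^bsub>laurent (Bmod X (i + 1))\<^esub> Cdiff (hat_cpx X) i b"
      using Z_cone_complex(2)[OF R tw X eta z] a
      by (simp add: cone_diff_def a_def[symmetric] b_def[symmetric] Z_eta_map(2)[OF R X])
    then have 2: "\<sigma> (i + 1) (Cdiff (hat_cpx ?C) i z) =
        zip_families (a \<oplus>\<^bsub>laurent (\<lambda>j. Bmod X (i + 1) (j + 1))\<^esub> shift_family (Cdiff (hat_cpx X) i b)) \<zero>\<^bsub>laurent (Bmod X i)\<^esub>"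
      by (simp add: \<sigma>_def) (simp add: laurent_simps shift_family_def unshift_family_def)
    have zab: "z = zip_families a b" by (simp add: a_def b_def)
    show "z = zero_map (hat_cpx ?C) i z \<oplus>\<^bsub>Cmod (hat_cpx ?C) i\<^esub>
        (Cdiff (hat_cpx ?C) (i - 1) (\<sigma> i z) \<oplus>\<^bsub>Cmod (hat_cpx ?C) i\<^esub> \<sigma> (i + 1) (Cdiff (hat_cpx ?C) i z))"
      unfolding 1 2 zero_map_def Cmod_hat Bmod_cone Bmod_twist laurent_prod_simps
      using a b db by (simp add: zab T.add_neg_cancel')
  qed
  ultimately show ?thesis unfolding eta_contraction_def Z_homotopies_def by blast
qed

lemma Z_iso_id: "X \<in> Z_complexes R \<Longrightarrow> Z_iso R X X (Z_id X)"
  unfolding Z_iso_def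
  by (auto intro!: bexI[of _ "Z_id X"] simp: Z_eq_iff[OF R] hat_map_id[OF R] hat_map_comp[OF R])

lemma hat_map_closed:
  assumes "X \<in> Z_complexes R" "Y \<in> Z_complexes R" "f \<in> Z_maps R X Y" "x \<in> carrier (laurent (Bmod X i))"
  shows "hat_map X Y f i x \<in> carrier (laurent (Bmod Y i))"
  by (rule hom_closed[OF filtered_mapD(1)[OF Z_mapD(1)[OF R assms(1-3)]] assms(4)])

lemma eta_cone_conflation:
  assumes X: "X \<in> Z_complexes R"
  shows "conflation R X (eta_cone X) (Z_shift (Z_twist X)) (cone_in (Z_twist X) X) (cone_out (Z_twist X))"
proof -
  note tw = Z_twist_complex(1)[OF R X] and eta = Z_eta_map(1)[OF R X]
  note C = eta_cone_complex[OF X] and sh = Z_shift_complex(1)[OF R tw]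
  note inn = Z_cone_in(1)[OF R tw X eta] and out = Z_cone_out(1)[OF R tw X eta]
  have 1: "Z_eq (Z_twist X) (Z_eta X) (Z_comp X (Z_eta X) (Z_id (Z_twist X)))"
    by (simp add: Z_eq_iff[OF R tw X eta hat_map_comp(1)[OF R tw tw X hat_map_id(1)[OF R tw] eta]]
        hat_map_comp(2)[OF R tw tw X hat_map_id(1)[OF R tw] eta, simplified]
        hat_map_id(2)[OF R tw, simplified])
  have 2: "Z_eq X (Z_comp (eta_cone X) (cone_in (Z_twist X) X) (Z_id X))
      (Z_comp (eta_cone X) (Z_id (eta_cone X)) (cone_in (Z_twist X) X))"
    unfolding Z_eq_iff[OF R X C hat_map_comp(1)[OF R X X C hat_map_id(1)[OF R X] inn]
        hat_map_comp(1)[OF R X C C inn hat_map_id(1)[OF R C]]]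
    using hat_map_comp(2)[OF R X X C hat_map_id(1)[OF R X] inn]
        hat_map_comp(2)[OF R X C C inn hat_map_id(1)[OF R C]]
        hat_map_id(2)[OF R X] hat_map_id(2)[OF R C] hat_map_closed[OF X C inn] by metis
  have 3: "Z_eq (eta_cone X) (Z_comp (Z_shift (Z_twist X)) (cone_out (Z_twist X)) (Z_id (eta_cone X)))
      (Z_comp (Z_shift (Z_twist X)) (Z_id (Z_shift (Z_twist X))) (cone_out (Z_twist X)))"
    unfolding Z_eq_iff[OF R C sh hat_map_comp(1)[OF R C C sh hat_map_id(1)[OF R C] out]
        hat_map_comp(1)[OF R C sh sh out hat_map_id(1)[OF R sh]]]
    using hat_map_comp(2)[OF R C C sh hat_map_id(1)[OF R C] out]
        hat_map_comp(2)[OF R C sh sh out hat_map_id(1)[OF R sh]]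
        hat_map_id(2)[OF R C] hat_map_id(2)[OF R sh] hat_map_closed[OF C sh out] by metis
  show ?thesis
    unfolding conflation_def
    using X C sh inn out tw eta 1 2 3 hat_map_id(1)[OF R tw] Z_iso_id[OF X] Z_iso_id[OF C] Z_iso_id[OF sh]
    by blast
qed

text \<open>An injective \<open>I\<close> is a retract of \<open>Con(\<eta>\<^sub>I)\<close>, since \<open>I \<rightarrow> Con(\<eta>\<^sub>I)\<close> starts a conflation; compressing the contraction
  of \<open>Con(\<eta>\<^sub>I)\<close> to \<open>I\<close> gives the required one.\<close>

lemma eta_injective_contraction:
  assumes inj: "eta_injective R I"
  shows "\<exists>\<sigma>. eta_contraction R I \<sigma>"
proof -
  have I: "I \<in> Z_complexes R" using inj by (simp add: eta_injective_def)
  note tw = Z_twist_complex(1)[OF R I] and eta = Z_eta_map(1)[OF R I]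
  note C = eta_cone_complex[OF I] and inn = Z_cone_in(1)[OF R tw I eta]
  let ?C = "eta_cone I"
  obtain v where v: "v \<in> Z_maps R ?C I" and vin: "Z_eq I (Z_comp I v (cone_in (Z_twist I) I)) (Z_id I)"
    using inj eta_cone_conflation[OF I] hat_map_id(1)[OF R I] unfolding eta_injective_def by blast
  have vin': "hat_map ?C I v i (zip_families \<zero>\<^bsub>laurent (\<lambda>j. Bmod I (i + 1) (j + 1))\<^esub> x) = x"
    if x: "x \<in> carrier (laurent (Bmod I i))" for i x
  proof -
    have "hat_map ?C I v i (hat_map I ?C (cone_in (Z_twist I) I) i x) = x"
      using vin x hat_map_comp(2)[OF R I C I inn v x] hat_map_id(2)[OF R I x]
      unfolding Z_eq_iff[OF R I I hat_map_comp(1)[OF R I C I inn v] hat_map_id(1)[OF R I]] by metis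
    then show ?thesis using Z_cone_in(2)[OF R tw I eta x] by simp
  qed
  define \<sigma> where "\<sigma> i x = hat_map ?C I v (i - 1) (zip_families (shift_family x) \<zero>\<^bsub>laurent (Bmod I (i - 1))\<^esub>)" for i x
  have \<sigma>: "\<sigma> i \<in> filtered_maps R (- 1) (Bmod I i) (Bmod I (i - 1))" for i
  proof -
    have 2: "(\<lambda>z. \<zero>\<^bsub>laurent (Bmod I (i - 1))\<^esub>) \<in> filtered_maps R (- 1) (Bmod I i) (Bmod I (i - 1))"
      by (rule filtered_map_zero[OF R Z_complexD(2)[OF R I] Z_complexD(2)[OF R I]])
    have "(\<lambda>x. zip_families (shift_family x) \<zero>\<^bsub>laurent (Bmod I (i - 1))\<^esub>)
      \<in> filtered_maps R (- 1) (Bmod I i) (Bmod ?C (i - 1))"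
      using filtered_zip[OF filtered_shift[of R "Bmod I i"] 2] by simp
    from filtered_map_comp[OF this Z_mapD(1)[OF R C I v]] show ?thesis by (simp add: \<sigma>_def[abs_def])
  qed
  have "homotopy_between (hat_cpx I) (hat_cpx I) \<sigma> (\<lambda>i x. x) (zero_map (hat_cpx I))"
    unfolding homotopy_between_def
  proof (intro allI ballI)
    fix i x assume "x \<in> carrier (Cmod (hat_cpx I) i)"
    then have x: "x \<in> carrier (laurent (Bmod I i))" by simp
    let ?z = "zip_families (shift_family x) \<zero>\<^bsub>laurent (Bmod I (i - 1))\<^esub>"
    let ?T = "laurent (\<lambda>j. Bmod I (i + 1) (j + 1))" and ?dx = "shift_family (Cdiff (hat_cpx I) i x)"
    interpret T: abelian_group ?T using hat_group[OF R tw, of "i + 1"] by simp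
    interpret I: abelian_group "laurent (Bmod I i)" by (rule hat_group[OF R I])
    have sx: "shift_family x \<in> carrier (laurent (\<lambda>j. Bmod I i (j + 1)))" using x by (simp add: shift_laurent_iff)
    have dx: "?dx \<in> carrier ?T"
      using hat_diff_closed(1)[OF R I x] by (simp only: shift_laurent_iff)
    have z: "?z \<in> carrier (laurent (Bmod ?C (i - 1)))"
      using sx group_simps(1)[OF hat_group[OF R I]] by (simp add: laurent_prod_iff)
    have "Cdiff (hat_cpx ?C) (i - 1) ?z = cone_diff (Z_twist I) I (Z_eta I) (i - 1) ?z"
      by (rule Z_cone_complex(2)[OF R tw I eta z])
    also have "\<dots> = zip_families (\<ominus>\<^bsub>?T\<^esub> ?dx) x"
      using sx x hom_zero[OF hat_diff_hom(3)[OF R I] hat_group[OF R I] hat_group[OF R I]]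
      by (simp add: cone_diff_def Z_twist_complex(2)[OF R I] Z_eta_map(2)[OF R I] add.commute[of 1 i])
    finally have dz: "Cdiff (hat_cpx ?C) (i - 1) ?z = zip_families (\<ominus>\<^bsub>?T\<^esub> ?dx) x" .
    have z1: "zip_families \<zero>\<^bsub>?T\<^esub> x \<in> carrier (laurent (Bmod ?C i))"
      and z2: "zip_families (\<ominus>\<^bsub>?T\<^esub> ?dx) x \<in> carrier (laurent (Bmod ?C i))"
      and z3: "zip_families ?dx \<zero>\<^bsub>laurent (Bmod I i)\<^esub> \<in> carrier (laurent (Bmod ?C i))"
      using x dx by (simp_all add: laurent_prod_iff)
    have "Cdiff (hat_cpx I) (i - 1) (\<sigma> i x) = hat_map ?C I v i (zip_families (\<ominus>\<^bsub>?T\<^esub> ?dx) x)"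
      using chain_mapD(3)[OF Z_mapD(3)[OF R C I v], of ?z i] z dz by (simp add: \<sigma>_def)
    moreover have "\<sigma> (i + 1) (Cdiff (hat_cpx I) i x) = hat_map ?C I v i (zip_families ?dx \<zero>\<^bsub>laurent (Bmod I i)\<^esub>)"
      by (simp add: \<sigma>_def)
    moreover have "hat_map ?C I v i (zip_families (\<ominus>\<^bsub>?T\<^esub> ?dx) x) \<oplus>\<^bsub>laurent (Bmod I i)\<^esub>
        hat_map ?C I v i (zip_families ?dx \<zero>\<^bsub>laurent (Bmod I i)\<^esub>) = hat_map ?C I v i (zip_families \<zero>\<^bsub>?T\<^esub> x)"
      using hom_add[OF filtered_mapD(1)[OF Z_mapD(1)[OF R C I v]] z2 z3] dx x
      by (simp add: laurent_prod_simps T.l_neg)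
    ultimately show "x = zero_map (hat_cpx I) i x \<oplus>\<^bsub>Cmod (hat_cpx I) i\<^esub>
        (Cdiff (hat_cpx I) (i - 1) (\<sigma> i x) \<oplus>\<^bsub>Cmod (hat_cpx I) i\<^esub> \<sigma> (i + 1) (Cdiff (hat_cpx I) i x))"
      using x by (simp add: vin' zero_map_def)
  qed
  then show ?thesis using \<sigma> by (auto simp: eta_contraction_def Z_homotopies_def)
qed

text \<open>Up to isomorphism the map \<open>A \<rightarrow> B\<close> of a conflation is \<open>Y \<rightarrow> Con(f)\<close> with \<open>f = \<eta> g\<close>, so extending \<open>w : Y \<rightarrow> I\<close> to
  \<open>Con(f)\<close> means finding a null-homotopy of \<open>w f\<close> that preserves the filtration. The contraction \<open>\<sigma>\<close> of \<open>I\<close> provides \<open>\<sigma> w f\<close>, where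
  the loss of one level in \<open>\<sigma>\<close> is made up for by \<open>f\<close>.\<close>

lemma eta_contraction_injective:
  fixes I :: "('r, 'y) bigraded"
  assumes I: "I \<in> Z_complexes R" and \<sigma>: "eta_contraction R I \<sigma>"
  shows "eta_injective R I"
  unfolding eta_injective_def
proof (intro conjI allI impI ballI I)
  fix A :: "('r, 'y) bigraded" and B :: "('r, 'y \<times> 'y) bigraded" and C :: "('r, 'y) bigraded" and a b u
  assume conf: "conflation R A B C a b" and u: "u \<in> Z_maps R A I"
  have A: "A \<in> Z_complexes R" and B: "B \<in> Z_complexes R" and a: "a \<in> Z_maps R A B"
    using conf by (simp_all add: conflation_def)
  obtain X Y :: "('r, 'y) bigraded" and f g \<alpha> \<beta> where X: "X \<in> Z_complexes R" and Y: "Y \<in> Z_complexes R"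
    and f: "f \<in> Z_maps R X Y" and g: "g \<in> Z_maps R X (Z_twist Y)"
    and fg: "Z_eq X f (Z_comp Y (Z_eta Y) g)"
    and iso\<alpha>: "Z_iso R Y A \<alpha>" and iso\<beta>: "Z_iso R (Z_cone X Y f) B \<beta>"
    and comm: "Z_eq Y (Z_comp B a \<alpha>) (Z_comp B \<beta> (cone_in X Y))"
    using conf unfolding conflation_def by blast
  let ?K = "Z_cone X Y f"
  note twY = Z_twist_complex(1)[OF R Y] and etaY = Z_eta_map(1)[OF R Y]
  note K = Z_cone_complex(1)[OF R X Y f] and inn = Z_cone_in(1)[OF R X Y f]
  obtain \<alpha>' where \<alpha>: "\<alpha> \<in> Z_maps R Y A" and \<alpha>': "\<alpha>' \<in> Z_maps R A Y" and \<alpha>\<alpha>': "Z_eq A (Z_comp A \<alpha> \<alpha>') (Z_id A)"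
    using iso\<alpha> by (auto simp: Z_iso_def)
  obtain \<beta>' where \<beta>: "\<beta> \<in> Z_maps R ?K B" and \<beta>': "\<beta>' \<in> Z_maps R B ?K" and \<beta>'\<beta>: "Z_eq ?K (Z_comp ?K \<beta>' \<beta>) (Z_id ?K)"
    using iso\<beta> by (auto simp: Z_iso_def)
  have s: "\<sigma> \<in> Z_homotopies R I I" using \<sigma> by (simp add: eta_contraction_def)
  have f1: "hat_map X Y f i \<in> filtered_maps R 1 (Bmod X i) (Bmod Y i)" for i
  proof (rule filtered_map_cong)
    show "(\<lambda>x. unshift_family (hat_map X (Z_twist Y) g i x)) \<in> filtered_maps R 1 (Bmod X i) (Bmod Y i)"
      using filtered_map_comp[OF Z_mapD(1)[OF R X twY g, of i, unfolded Bmod_twist] filtered_unshift[where M = "Bmod Y i"]]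
      by simp
    show "right_module R (laurent (Bmod X i))" by (rule laurent_module(1)[OF R Z_complexD(2)[OF R X]])
    fix x assume x: "x \<in> carrier (laurent (Bmod X i))"
    then have "hat_map X Y f i x = hat_map X Y (Z_comp Y (Z_eta Y) g) i x"
      using fg Z_eq_iff[OF R X Y f hat_map_comp(1)[OF R X twY Y g etaY]] by blast
    also have "\<dots> = unshift_family (hat_map X (Z_twist Y) g i x)"
      using hat_map_closed[OF X twY g x] by (simp add: hat_map_comp(2)[OF R X twY Y g etaY x] Z_eta_map(2)[OF R Y])
    finally show "hat_map X Y f i x = unshift_family (hat_map X (Z_twist Y) g i x)" .
  qed
  define w where "w = hat_map Y I (Z_comp I u \<alpha>)"
  have u\<alpha>: "Z_comp I u \<alpha> \<in> Z_maps R Y I" by (rule hat_map_comp(1)[OF R Y A I \<alpha> u])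
  have wc: "w \<in> chain_maps R (hat_cpx Y) (hat_cpx I)" unfolding w_def by (rule Z_mapD(3)[OF R Y I u\<alpha>])
  have wf: "w i \<in> filtered_maps R 0 (Bmod Y i) (Bmod I i)" for i unfolding w_def by (rule Z_mapD(1)[OF R Y I u\<alpha>])
  define S where "S i x = \<sigma> i (w i (hat_map X Y f i x))" for i x
  have S: "S i \<in> filtered_maps R 0 (Bmod X i) (Bmod I (i - 1))" for i
    using filtered_map_comp[OF filtered_map_comp[OF f1 wf] Z_homotopyD(1)[OF s]] by (simp add: S_def[abs_def])
  have null: "w i (hat_map X Y f i x) =
      Cdiff (hat_cpx I) (i - 1) (S i x) \<oplus>\<^bsub>laurent (Bmod I i)\<^esub> S (i + 1) (Cdiff (hat_cpx X) i x)"
    if x: "x \<in> carrier (laurent (Bmod X i))" for i x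
  proof -
    have "w i (hat_map X Y f i x) \<in> carrier (laurent (Bmod I i))"
      by (rule hom_closed[OF filtered_mapD(1)[OF wf] hat_map_closed[OF X Y f x]])
    from eta_contractionD[OF I \<sigma> this] show ?thesis
      using chain_mapD(2)[OF chain_map_comp[OF Z_mapD(3)[OF R X Y f] wc], of x i] x by (simp add: S_def)
  qed
  obtain v' where v': "v' \<in> Z_maps R ?K I" and v'_eq: "\<And>i z. z \<in> carrier (laurent (Bmod ?K i)) \<Longrightarrow>
     hat_map ?K I v' i z = S (i + 1) (fst \<circ> z) \<oplus>\<^bsub>laurent (Bmod I i)\<^esub> w i (snd \<circ> z)"
    using Z_cone_extend[OF R X Y f I wc wf S null] by blast
  have v: "Z_comp I v' \<beta>' \<in> Z_maps R B I" by (rule hat_map_comp(1)[OF R B K I \<beta>' v'])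
  have "Z_eq A (Z_comp I (Z_comp I v' \<beta>') a) u"
    unfolding Z_eq_iff[OF R A I hat_map_comp(1)[OF R A B I a v] u]
  proof (intro allI ballI)
    fix i x assume x: "x \<in> carrier (laurent (Bmod A i))"
    define y where "y = hat_map A Y \<alpha>' i x"
    have y: "y \<in> carrier (laurent (Bmod Y i))" unfolding y_def by (rule hat_map_closed[OF A Y \<alpha>' x])
    have xy: "hat_map Y A \<alpha> i y = x"
      using \<alpha>\<alpha>' x unfolding Z_eq_iff[OF R A A hat_map_comp(1)[OF R A Y A \<alpha>' \<alpha>] hat_map_id(1)[OF R A]]
      by (simp add: hat_map_comp(2)[OF R A Y A \<alpha>' \<alpha>] hat_map_id(2)[OF R A] y_def)
    define k where "k = hat_map Y ?K (cone_in X Y) i y"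
    have k: "k \<in> carrier (laurent (Bmod ?K i))" unfolding k_def by (rule hat_map_closed[OF Y K inn y])
    have k_eq: "k = zip_families \<zero>\<^bsub>laurent (Bmod X (i + 1))\<^esub> y"
      unfolding k_def by (rule Z_cone_in(2)[OF R X Y f y])
    have ax: "hat_map A B a i x = hat_map ?K B \<beta> i k"
      using comm y hat_map_comp(2)[OF R Y A B \<alpha> a y] hat_map_comp(2)[OF R Y K B inn \<beta> y]
      unfolding Z_eq_iff[OF R Y B hat_map_comp(1)[OF R Y A B \<alpha> a] hat_map_comp(1)[OF R Y K B inn \<beta>]] xy k_def
      by metis
    have \<beta>k: "hat_map B ?K \<beta>' i (hat_map ?K B \<beta> i k) = k"
      using \<beta>'\<beta> k unfolding Z_eq_iff[OF R K K hat_map_comp(1)[OF R K B K \<beta> \<beta>'] hat_map_id(1)[OF R K]]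
      using hat_map_comp(2)[OF R K B K \<beta> \<beta>' k] hat_map_id(2)[OF R K k] by metis
    have "hat_map A I (Z_comp I (Z_comp I v' \<beta>') a) i x = hat_map B I (Z_comp I v' \<beta>') i (hat_map A B a i x)"
      by (rule hat_map_comp(2)[OF R A B I a v x])
    also have "\<dots> = hat_map ?K I v' i k"
      using hat_map_comp(2)[OF R B K I \<beta>' v' hat_map_closed[OF A B a x]] by (simp only: ax \<beta>k)
    also have "\<dots> = S (i + 1) \<zero>\<^bsub>laurent (Bmod X (i + 1))\<^esub> \<oplus>\<^bsub>laurent (Bmod I i)\<^esub> w i y"
      by (simp only: v'_eq[OF k]) (simp add: k_eq)
    also have "S (i + 1) \<zero>\<^bsub>laurent (Bmod X (i + 1))\<^esub> = \<zero>\<^bsub>laurent (Bmod I i)\<^esub>"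
      using hom_zero[OF filtered_mapD(1)[OF S] hat_group[OF R X] hat_group[OF R I], of "i + 1"] by simp
    also have "\<dots> \<oplus>\<^bsub>laurent (Bmod I i)\<^esub> w i y = hat_map A I u i x"
      using hom_closed[OF filtered_mapD(1)[OF wf] y]
      by (simp add: group_simps[OF hat_group[OF R I]]) (simp add: w_def hat_map_comp(2)[OF R Y A I \<alpha> u y] xy)
    finally show "hat_map A I (Z_comp I (Z_comp I v' \<beta>') a) i x = hat_map A I u i x" .
  qed
  with v show "\<exists>v\<in>Z_maps R B I. Z_eq A (Z_comp I v a) u" by blast
qed

lemma Z_map_plus:
  assumes X: "X \<in> Z_complexes R" and Y: "Y \<in> Z_complexes R"
    and f: "f \<in> Z_maps R X Y" and g: "g \<in> Z_maps R X Y"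
  shows "(\<lambda>n i j x. f n i j x \<oplus>\<^bsub>Bmod Y i (j + int n)\<^esub> g n i j x) \<in> Z_maps R X Y" (is "?h \<in> _")
    and "x \<in> carrier (laurent (Bmod X i)) \<Longrightarrow>
      hat_map X Y (\<lambda>n i j x. f n i j x \<oplus>\<^bsub>Bmod Y i (j + int n)\<^esub> g n i j x) i x =
        hat_map X Y f i x \<oplus>\<^bsub>laurent (Bmod Y i)\<^esub> hat_map X Y g i x"
proof -
  let ?F = "\<lambda>i x. hat_map X Y f i x \<oplus>\<^bsub>laurent (Bmod Y i)\<^esub> hat_map X Y g i x"
  have F: "?F i \<in> filtered_maps R 0 (Bmod X i) (Bmod Y i)" for i
    by (rule filtered_map_plus[OF R Z_complexD(2)[OF R X] Z_complexD(2)[OF R Y] Z_mapD(1)[OF R X Y f] Z_mapD(1)[OF R X Y g]])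
  have chain: "?F (i + 1) (Cdiff (hat_cpx X) i x) = Cdiff (hat_cpx Y) i (?F i x)"
    if "x \<in> carrier (laurent (Bmod X i))" for i x
    using chain_mapD(2)[OF chain_map_plus[OF Z_complexD(5)[OF R X] Z_complexD(5)[OF R Y]
      Z_mapD(3)[OF R X Y f] Z_mapD(3)[OF R X Y g]], of x i] that by (simp add: plus_maps_def)
  have h: "?h n i j x = ?F i (single\<^sub>Z (Bmod X i) j x) (j + int n)" if "x \<in> carrier (Bmod X i j)" for n i j x
    using Z_mapD(2)[OF R X Y f that] Z_mapD(2)[OF R X Y g that] by (simp add: laurent_simps(3))
  show "?h \<in> Z_maps R X Y" by (rule Z_mapI(1)[OF R X Y F chain h])
  show "hat_map X Y ?h i x = ?F i x" if "x \<in> carrier (laurent (Bmod X i))"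
    by (rule Z_mapI(2)[OF R X Y F chain h that])
qed

text \<open>If \<open>f - g = v u\<close> factors through an injective object with contraction \<open>\<sigma>\<close>, then \<open>v \<sigma> u\<close> is a homotopy. Conversely,
  a homotopy \<open>s\<close> from \<open>f\<close> to \<open>g\<close> gives the null-homotopy \<open>s \<eta>\<close> of \<open>(f - g) \<eta>\<close>, hence an extension of \<open>f - g\<close> along
  \<open>X \<rightarrow> Con(\<eta>\<^sub>X)\<close>.\<close>

lemma eta_stable_rel_iff:
  fixes X Y :: "('r, 'x) bigraded"
  assumes X: "X \<in> Z_complexes R" and Y: "Y \<in> Z_complexes R"
  shows "eta_stable_rel R X Y = eta_homotopy_rel R X Y"
proof (intro subset_antisym subrelI)
  fix f g assume "(f, g) \<in> eta_stable_rel R X Y"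
  then obtain I :: "('r, 'x \<times> 'x) bigraded" and u v where f: "f \<in> Z_maps R X Y" and g: "g \<in> Z_maps R X Y"
    and inj: "eta_injective R I" and u: "u \<in> Z_maps R X I" and v: "v \<in> Z_maps R I Y"
    and eq: "Z_eq X f (\<lambda>n i j x. g n i j x \<oplus>\<^bsub>Bmod Y i (j + int n)\<^esub> Z_comp Y v u n i j x)"
    unfolding eta_stable_rel_def by blast
  have I: "I \<in> Z_complexes R" using inj by (simp add: eta_injective_def)
  obtain \<sigma> where \<sigma>: "eta_contraction R I \<sigma>" using eta_injective_contraction[OF inj] by blast
  have s: "\<sigma> \<in> Z_homotopies R I I" using \<sigma> by (simp add: eta_contraction_def)
  have vu: "Z_comp Y v u \<in> Z_maps R X Y" by (rule hat_map_comp(1)[OF R X I Y u v])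
  define h where "h i x = hat_map I Y v (i - 1) (\<sigma> i (hat_map X I u i x))" for i x
  have h: "h \<in> Z_homotopies R X Y"
    using filtered_map_comp[OF filtered_map_comp[OF Z_mapD(1)[OF R X I u] Z_homotopyD(1)[OF s]] Z_mapD(1)[OF R I Y v]]
    by (simp add: Z_homotopies_def h_def[abs_def])
  have "homotopy_between (hat_cpx X) (hat_cpx Y) h (hat_map X Y f) (hat_map X Y g)"
    unfolding homotopy_between_def Cmod_hat
  proof (intro allI ballI)
    fix i x assume x: "x \<in> carrier (laurent (Bmod X i))"
    define y where "y = hat_map X I u i x"
    have y: "y \<in> carrier (laurent (Bmod I i))" unfolding y_def by (rule hat_map_closed[OF X I u x])
    have \<sigma>y: "\<sigma> i y \<in> carrier (laurent (Bmod I (i - 1)))"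
      by (rule hom_closed[OF filtered_mapD(1)[OF Z_homotopyD(1)[OF s]] y])
    have d\<sigma>y: "Cdiff (hat_cpx I) (i - 1) (\<sigma> i y) \<in> carrier (laurent (Bmod I i))"
      by (rule hom_closed[OF hat_diff_hom(3)[OF R I] \<sigma>y])
    have \<sigma>dy: "\<sigma> (i + 1) (Cdiff (hat_cpx I) i y) \<in> carrier (laurent (Bmod I i))"
      by (rule hom_closed[OF filtered_mapD(1)[OF Z_homotopyD(2)[OF s]] hat_diff_closed(1)[OF R I y]])
    have "hat_map X Y f i x =
        hat_map X Y (\<lambda>n i j x. g n i j x \<oplus>\<^bsub>Bmod Y i (j + int n)\<^esub> Z_comp Y v u n i j x) i x"
      using eq[unfolded Z_eq_iff[OF R X Y f Z_map_plus(1)[OF X Y g vu]]] x by blast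
    also have "\<dots> = hat_map X Y g i x \<oplus>\<^bsub>laurent (Bmod Y i)\<^esub> hat_map I Y v i y"
      by (simp only: Z_map_plus(2)[OF X Y g vu x] hat_map_comp(2)[OF R X I Y u v x] y_def)
    also have "hat_map I Y v i y = hat_map I Y v i (Cdiff (hat_cpx I) (i - 1) (\<sigma> i y) \<oplus>\<^bsub>laurent (Bmod I i)\<^esub>
        \<sigma> (i + 1) (Cdiff (hat_cpx I) i y))"
      by (simp only: eta_contractionD[OF I \<sigma> y])
    also have "\<dots> = Cdiff (hat_cpx Y) (i - 1) (hat_map I Y v (i - 1) (\<sigma> i y)) \<oplus>\<^bsub>laurent (Bmod Y i)\<^esub>
        hat_map I Y v i (\<sigma> (i + 1) (Cdiff (hat_cpx I) i y))"
      using chain_mapD(3)[OF Z_mapD(3)[OF R I Y v], of "\<sigma> i y" i] \<sigma>y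
      by (simp add: hom_add[OF filtered_mapD(1)[OF Z_mapD(1)[OF R I Y v]] d\<sigma>y \<sigma>dy])
    also have "Cdiff (hat_cpx I) i y = hat_map X I u (i + 1) (Cdiff (hat_cpx X) i x)"
      using chain_mapD(2)[OF Z_mapD(3)[OF R X I u], of x i] x by (simp add: y_def)
    finally show "hat_map X Y f i x = hat_map X Y g i x \<oplus>\<^bsub>laurent (Bmod Y i)\<^esub>
       (Cdiff (hat_cpx Y) (i - 1) (h i x) \<oplus>\<^bsub>laurent (Bmod Y i)\<^esub> h (i + 1) (Cdiff (hat_cpx X) i x))"
      by (simp add: h_def y_def)
  qed
  then show "(f, g) \<in> eta_homotopy_rel R X Y" using f g h by (auto simp: eta_homotopy_rel_def)
next
  fix f g assume "(f, g) \<in> eta_homotopy_rel R X Y"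
  then obtain s where f: "f \<in> Z_maps R X Y" and g: "g \<in> Z_maps R X Y" and s: "s \<in> Z_homotopies R X Y"
    and fg: "homotopy_between (hat_cpx X) (hat_cpx Y) s (hat_map X Y f) (hat_map X Y g)"
    by (auto simp: eta_homotopy_rel_def)
  let ?I = "eta_cone X"
  note tw = Z_twist_complex(1)[OF R X] and eta = Z_eta_map(1)[OF R X]
  note I = eta_cone_complex[OF X] and inn = Z_cone_in(1)[OF R tw X eta]
  define w where "w i x = hat_map X Y f i x \<oplus>\<^bsub>laurent (Bmod Y i)\<^esub> \<ominus>\<^bsub>laurent (Bmod Y i)\<^esub> hat_map X Y g i x" for i x
  have wc: "w \<in> chain_maps R (hat_cpx X) (hat_cpx Y)"
    using chain_map_plus[OF Z_complexD(5)[OF R X] Z_complexD(5)[OF R Y] Z_mapD(3)[OF R X Y f]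
        chain_map_minus[OF Z_complexD(5)[OF R X] Z_complexD(5)[OF R Y] Z_mapD(3)[OF R X Y g]]]
    by (simp add: plus_maps_def w_def[abs_def])
  have wf: "w i \<in> filtered_maps R 0 (Bmod X i) (Bmod Y i)" for i
    using filtered_map_plus[OF R Z_complexD(2)[OF R X] Z_complexD(2)[OF R Y] Z_mapD(1)[OF R X Y f]
        filtered_map_minus[OF R Z_complexD(2)[OF R X] Z_complexD(2)[OF R Y] Z_mapD(1)[OF R X Y g]]]
    by (simp add: w_def[abs_def])
  have w_eq: "w i x = Cdiff (hat_cpx Y) (i - 1) (s i x) \<oplus>\<^bsub>laurent (Bmod Y i)\<^esub> s (i + 1) (Cdiff (hat_cpx X) i x)"
    and f_eq: "hat_map X Y f i x = hat_map X Y g i x \<oplus>\<^bsub>laurent (Bmod Y i)\<^esub> w i x"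
    if x: "x \<in> carrier (laurent (Bmod X i))" for i x
  proof -
    interpret Y: abelian_group "laurent (Bmod Y i)" by (rule hat_group[OF R Y])
    have cl: "Cdiff (hat_cpx Y) (i - 1) (s i x) \<in> carrier (laurent (Bmod Y i))"
      "s (i + 1) (Cdiff (hat_cpx X) i x) \<in> carrier (laurent (Bmod Y i))"
      by (rule hom_closed[OF hat_diff_hom(3)[OF R Y] hom_closed[OF filtered_mapD(1)[OF Z_homotopyD(1)[OF s]] x]]
          hom_closed[OF filtered_mapD(1)[OF Z_homotopyD(2)[OF s]] hat_diff_closed(1)[OF R X x]])+
    have "hat_map X Y f i x = hat_map X Y g i x \<oplus>\<^bsub>laurent (Bmod Y i)\<^esub>
        (Cdiff (hat_cpx Y) (i - 1) (s i x) \<oplus>\<^bsub>laurent (Bmod Y i)\<^esub> s (i + 1) (Cdiff (hat_cpx X) i x))"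
      using fg x unfolding homotopy_between_def Cmod_hat by blast
    then show "w i x = Cdiff (hat_cpx Y) (i - 1) (s i x) \<oplus>\<^bsub>laurent (Bmod Y i)\<^esub> s (i + 1) (Cdiff (hat_cpx X) i x)"
      using cl hat_map_closed[OF X Y g x] Y.add_neg_cancel[OF hat_map_closed[OF X Y g x] Y.a_closed[OF cl]]
      by (simp add: w_def Y.a_assoc)
    show "hat_map X Y f i x = hat_map X Y g i x \<oplus>\<^bsub>laurent (Bmod Y i)\<^esub> w i x"
      using hat_map_closed[OF X Y f x] hat_map_closed[OF X Y g x] by (simp add: w_def Y.add_neg_cancel)
  qed
  define S where "S i x = s i (unshift_family x)" for i x
  have S: "S i \<in> filtered_maps R 0 (Bmod (Z_twist X) i) (Bmod Y (i - 1))" for i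
    using filtered_map_comp[OF filtered_unshift[where M = "Bmod X i"] Z_homotopyD(1)[OF s]] by (simp add: S_def[abs_def])
  have null: "w i (hat_map (Z_twist X) X (Z_eta X) i x) =
      Cdiff (hat_cpx Y) (i - 1) (S i x) \<oplus>\<^bsub>laurent (Bmod Y i)\<^esub> S (i + 1) (Cdiff (hat_cpx (Z_twist X)) i x)"
    if "x \<in> carrier (laurent (Bmod (Z_twist X) i))" for i x
    using that w_eq[of "unshift_family x" i]
    by (simp add: S_def Z_eta_map(2)[OF R X] Z_twist_complex(2)[OF R X] unshift_laurent_iff)
  obtain v where v: "v \<in> Z_maps R ?I Y" and v_eq: "\<And>i z. z \<in> carrier (laurent (Bmod ?I i)) \<Longrightarrow>
     hat_map ?I Y v i z = S (i + 1) (fst \<circ> z) \<oplus>\<^bsub>laurent (Bmod Y i)\<^esub> w i (snd \<circ> z)"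
    using Z_cone_extend[OF R tw X eta Y wc wf S null] by blast
  have vin: "Z_comp Y v (cone_in (Z_twist X) X) \<in> Z_maps R X Y" by (rule hat_map_comp(1)[OF R X I Y inn v])
  have "hat_map X Y f i x = hat_map X Y (\<lambda>n i j x. g n i j x \<oplus>\<^bsub>Bmod Y i (j + int n)\<^esub>
      Z_comp Y v (cone_in (Z_twist X) X) n i j x) i x"
    if x: "x \<in> carrier (laurent (Bmod X i))" for i x
  proof -
    have k: "hat_map X ?I (cone_in (Z_twist X) X) i x \<in> carrier (laurent (Bmod ?I i))"
      by (rule hat_map_closed[OF X I inn x])
    have "S (i + 1) \<zero>\<^bsub>laurent (Bmod (Z_twist X) (i + 1))\<^esub> = \<zero>\<^bsub>laurent (Bmod Y i)\<^esub>"
      using hom_zero[OF filtered_mapD(1)[OF S] hat_group[OF R tw] hat_group[OF R Y], of "i + 1"] by simp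
    then have "hat_map X Y (Z_comp Y v (cone_in (Z_twist X) X)) i x = w i x"
      using v_eq[OF k] hom_closed[OF filtered_mapD(1)[OF wf] x]
      unfolding hat_map_comp(2)[OF R X I Y inn v x] Z_cone_in(2)[OF R tw X eta x]
      by (simp add: group_simps[OF hat_group[OF R Y]])
    then show ?thesis using f_eq[OF x] Z_map_plus(2)[OF X Y g vin x] by simp
  qed
  then have "Z_eq X f (\<lambda>n i j x. g n i j x \<oplus>\<^bsub>Bmod Y i (j + int n)\<^esub> Z_comp Y v (cone_in (Z_twist X) X) n i j x)"
    unfolding Z_eq_iff[OF R X Y f Z_map_plus(1)[OF X Y g vin]] by blast
  moreover obtain \<sigma> where "eta_contraction R ?I \<sigma>" using eta_cone_contraction[OF X] by blast
  then have "eta_injective R ?I" by (rule eta_contraction_injective[OF I])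
  ultimately show "(f, g) \<in> eta_stable_rel R X Y"
    unfolding eta_stable_rel_def using f g inn v by blast
qed

lemma eta_homotopy_relI:
  assumes "f \<in> Z_maps R X Y" "g \<in> Z_maps R X Y" "s \<in> Z_homotopies R X Y"
    "homotopy_between (hat_cpx X) (hat_cpx Y) s (hat_map X Y f) (hat_map X Y g)"
  shows "(f, g) \<in> eta_homotopy_rel R X Y"
  using assms by (auto simp: eta_homotopy_rel_def)

lemma eta_homotopy_rel_eqI:
  assumes X: "X \<in> Z_complexes R" and Y: "Y \<in> Z_complexes R"
    and f: "f \<in> Z_maps R X Y" and g: "g \<in> Z_maps R X Y"
    and eq: "\<And>i x. x \<in> carrier (laurent (Bmod X i)) \<Longrightarrow> hat_map X Y f i x = hat_map X Y g i x"
  shows "(f, g) \<in> eta_homotopy_rel R X Y"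
proof (rule eta_homotopy_relI[OF f g])
  show "zero_homotopy (hat_cpx Y) \<in> Z_homotopies R X Y"
    using filtered_map_zero[OF R Z_complexD(2)[OF R X] Z_complexD(2)[OF R Y]]
    by (simp add: Z_homotopies_def zero_homotopy_def)
  show "homotopy_between (hat_cpx X) (hat_cpx Y) (zero_homotopy (hat_cpx Y)) (hat_map X Y f) (hat_map X Y g)"
    by (rule homotopy_between_zero[OF Z_complexD(5)[OF R X] Z_complexD(5)[OF R Y]])
      (simp_all add: eq hat_map_closed[OF X Y g])
qed

lemma eta_homotopy_rel_equiv:
  assumes X: "X \<in> Z_complexes R" and Y: "Y \<in> Z_complexes R"
  shows "equiv (Z_maps R X Y) (eta_homotopy_rel R X Y)"
proof (rule equivI)
  note X' = Z_complexD(5)[OF R X] and Y' = Z_complexD(5)[OF R Y]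
  note M = Z_complexD(2)[OF R X] and N = Z_complexD(2)[OF R Y]
  show "eta_homotopy_rel R X Y \<subseteq> Z_maps R X Y \<times> Z_maps R X Y" by (auto simp: eta_homotopy_rel_def)
  show "refl_on (Z_maps R X Y) (eta_homotopy_rel R X Y)"
    by (rule refl_onI) (auto intro: eta_homotopy_rel_eqI[OF X Y])
  show "sym (eta_homotopy_rel R X Y)"
  proof (rule symI)
    fix f g assume "(f, g) \<in> eta_homotopy_rel R X Y"
    then obtain s where f: "f \<in> Z_maps R X Y" and g: "g \<in> Z_maps R X Y" and s: "s \<in> Z_homotopies R X Y"
      and fg: "homotopy_between (hat_cpx X) (hat_cpx Y) s (hat_map X Y f) (hat_map X Y g)"
      by (auto simp: eta_homotopy_rel_def)
    have "minus_homotopy (hat_cpx Y) s \<in> Z_homotopies R X Y"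
      using filtered_map_minus[OF R M N Z_homotopyD(1)[OF s]] by (simp add: Z_homotopies_def minus_homotopy_def)
    moreover have "homotopy_between (hat_cpx X) (hat_cpx Y) (minus_homotopy (hat_cpx Y) s) (hat_map X Y g) (hat_map X Y f)"
      by (rule homotopy_between_minus[OF X' Y' Z_homotopyD(3)[OF s] fg]) (simp add: hat_map_closed[OF X Y g])
    ultimately show "(g, f) \<in> eta_homotopy_rel R X Y" by (rule eta_homotopy_relI[OF g f])
  qed
  show "trans (eta_homotopy_rel R X Y)"
  proof (rule transI)
    fix f g l assume "(f, g) \<in> eta_homotopy_rel R X Y" "(g, l) \<in> eta_homotopy_rel R X Y"
    then obtain s t where f: "f \<in> Z_maps R X Y" and s: "s \<in> Z_homotopies R X Y"
      and fg: "homotopy_between (hat_cpx X) (hat_cpx Y) s (hat_map X Y f) (hat_map X Y g)"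
      and l: "l \<in> Z_maps R X Y" and t: "t \<in> Z_homotopies R X Y"
      and gl: "homotopy_between (hat_cpx X) (hat_cpx Y) t (hat_map X Y g) (hat_map X Y l)"
      by (auto simp: eta_homotopy_rel_def)
    have "plus_homotopy (hat_cpx Y) s t \<in> Z_homotopies R X Y"
      using filtered_map_plus[OF R M N Z_homotopyD(1)[OF s] Z_homotopyD(1)[OF t]]
      by (simp add: Z_homotopies_def plus_homotopy_def)
    moreover have "homotopy_between (hat_cpx X) (hat_cpx Y) (plus_homotopy (hat_cpx Y) s t) (hat_map X Y f) (hat_map X Y l)"
      by (rule homotopy_between_trans[OF X' Y' Z_homotopyD(3)[OF s] Z_homotopyD(3)[OF t] fg gl])
        (simp add: hat_map_closed[OF X Y l])
    ultimately show "(f, l) \<in> eta_homotopy_rel R X Y" by (rule eta_homotopy_relI[OF f l])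
  qed
qed

lemma homotopy_between_cong:
  assumes "homotopy_between C D h f g" "\<And>i x. x \<in> carrier (Cmod C i) \<Longrightarrow> f' i x = f i x"
    "\<And>i x. x \<in> carrier (Cmod C i) \<Longrightarrow> g' i x = g i x"
  shows "homotopy_between C D h f' g'"
  using assms by (simp add: homotopy_between_def)

lemma eta_homotopy_rel_comp_left:
  assumes X: "X \<in> Z_complexes R" and Y: "Y \<in> Z_complexes R" and Z: "Z \<in> Z_complexes R"
    and ff': "(f, f') \<in> eta_homotopy_rel R X Y" and g: "g \<in> Z_maps R Y Z"
  shows "(Z_comp Z g f, Z_comp Z g f') \<in> eta_homotopy_rel R X Z"
proof -
  obtain s where f: "f \<in> Z_maps R X Y" and f': "f' \<in> Z_maps R X Y" and s: "s \<in> Z_homotopies R X Y"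
    and h: "homotopy_between (hat_cpx X) (hat_cpx Y) s (hat_map X Y f) (hat_map X Y f')"
    using ff' by (auto simp: eta_homotopy_rel_def)
  show ?thesis
  proof (rule eta_homotopy_relI[OF hat_map_comp(1)[OF R X Y Z f g] hat_map_comp(1)[OF R X Y Z f' g]])
    show "(\<lambda>i x. hat_map Y Z g (i - 1) (s i x)) \<in> Z_homotopies R X Z"
      using filtered_map_comp[OF Z_homotopyD(1)[OF s] Z_mapD(1)[OF R Y Z g]] by (simp add: Z_homotopies_def)
    show "homotopy_between (hat_cpx X) (hat_cpx Z) (\<lambda>i x. hat_map Y Z g (i - 1) (s i x))
        (hat_map X Z (Z_comp Z g f)) (hat_map X Z (Z_comp Z g f'))"
      by (rule homotopy_between_cong[OF homotopy_between_comp_left(1)[OF Z_complexD(5)[OF R X] Z_complexD(5)[OF R Y]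
          Z_complexD(5)[OF R Z] Z_homotopyD(3)[OF s] h _ Z_mapD(3)[OF R Y Z g]]])
        (simp_all add: hat_map_closed[OF X Y f'] hat_map_comp(2)[OF R X Y Z f g] hat_map_comp(2)[OF R X Y Z f' g])
  qed
qed

lemma eta_homotopy_rel_comp_right:
  assumes X: "X \<in> Z_complexes R" and Y: "Y \<in> Z_complexes R" and Z: "Z \<in> Z_complexes R"
    and f: "f \<in> Z_maps R X Y" and gg': "(g, g') \<in> eta_homotopy_rel R Y Z"
  shows "(Z_comp Z g f, Z_comp Z g' f) \<in> eta_homotopy_rel R X Z"
proof -
  obtain s where g: "g \<in> Z_maps R Y Z" and g': "g' \<in> Z_maps R Y Z" and s: "s \<in> Z_homotopies R Y Z"
    and h: "homotopy_between (hat_cpx Y) (hat_cpx Z) s (hat_map Y Z g) (hat_map Y Z g')"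
    using gg' by (auto simp: eta_homotopy_rel_def)
  show ?thesis
  proof (rule eta_homotopy_relI[OF hat_map_comp(1)[OF R X Y Z f g] hat_map_comp(1)[OF R X Y Z f g']])
    show "(\<lambda>i x. s i (hat_map X Y f i x)) \<in> Z_homotopies R X Z"
      using filtered_map_comp[OF Z_mapD(1)[OF R X Y f] Z_homotopyD(1)[OF s]] by (simp add: Z_homotopies_def)
    show "homotopy_between (hat_cpx X) (hat_cpx Z) (\<lambda>i x. s i (hat_map X Y f i x))
        (hat_map X Z (Z_comp Z g f)) (hat_map X Z (Z_comp Z g' f))"
      by (rule homotopy_between_cong[OF homotopy_between_comp_right(1)[OF Z_complexD(5)[OF R X]
          Z_homotopyD(3)[OF s] h Z_mapD(3)[OF R X Y f]]])
        (simp_all add: hat_map_comp(2)[OF R X Y Z f g] hat_map_comp(2)[OF R X Y Z f g'])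
  qed
qed

lemma quotient_category_K_eta:
  "quotient_category (Z_complexes R) (Z_maps R) (eta_stable_rel R :: ('r, 'x) bigraded \<Rightarrow> _) Z_id (\<lambda>X Y Z. Z_comp Z)"
proof (rule quotient_category.intro, goal_cases)
  case (1 X Y)
  then show ?case using eta_homotopy_rel_equiv[OF 1] by (simp add: eta_stable_rel_iff[OF 1])
next
  case (2 X)
  then show ?case by (rule hat_map_id(1)[OF R])
next
  case (3 X Y Z f g)
  then show ?case by (rule hat_map_comp(1)[OF R])
next
  case (4 X Y Z f g g')
  then show ?case using eta_homotopy_rel_comp_right[OF 4(1-4)] by (simp add: eta_stable_rel_iff)
next
  case (5 X Y Z f f' g)
  then show ?case using eta_homotopy_rel_comp_left[OF 5(1-3) _ 5(5)] by (simp add: eta_stable_rel_iff)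
next
  case (6 X Y f)
  note id = hat_map_id[OF R 6(1)]
  show ?case unfolding eta_stable_rel_iff[OF 6(1,2)]
    using hat_map_comp[OF R 6(1,1,2) id(1) 6(3)] id(2) by (intro eta_homotopy_rel_eqI 6) simp_all
next
  case (7 X Y f)
  note id = hat_map_id[OF R 7(2)]
  show ?case unfolding eta_stable_rel_iff[OF 7(1,2)]
    using hat_map_comp[OF R 7(1,2,2) 7(3) id(1)] id(2) hat_map_closed[OF 7] by (intro eta_homotopy_rel_eqI 7) simp_all
next
  case (8 W X Y Z f g h)
  note gf = hat_map_comp[OF R 8(1-3) 8(5,6)] and hg = hat_map_comp[OF R 8(2-4) 8(6,7)]
  note l = hat_map_comp[OF R 8(1,2,4) 8(5) hg(1)] and r = hat_map_comp[OF R 8(1,3,4) gf(1) 8(7)]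
  show ?case unfolding eta_stable_rel_iff[OF 8(1,4)]
    by (intro eta_homotopy_rel_eqI 8 l(1) r(1)) (simp add: l(2) r(2) gf(2) hg(2)[OF hat_map_closed[OF 8(1,2,5)]])
qed

end

section \<open>The functor \<open>\<Xi>\<close>\<close>

lemma K_eta_fin_quotient:
  "K_eta_fin R = quotient_cat {X \<in> Z_complexes R. locally_finite X} (Z_maps R) (eta_stable_rel R) Z_id (\<lambda>X Y Z. Z_comp Z)"
  by (simp add: K_eta_fin_def K_eta_def quotient_category_full_subcat)

text \<open>For an object with locally finite terms, \<open>Xi_obj X\<close> and \<open>hat_cpx X\<close> have the same modules, but their
  differentials are different functions outside the carriers.\<close>

definition agree_cpx :: "('r, 'm) cpx \<Rightarrow> ('r, 'm) cpx \<Rightarrow> bool" where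
  "agree_cpx C C' \<longleftrightarrow> (\<forall>i. Cmod C i = Cmod C' i \<and> (\<forall>x\<in>carrier (Cmod C i). Cdiff C i x = Cdiff C' i x))"

lemma homotopy_rel_agree:
  assumes C: "agree_cpx C C'" and D: "agree_cpx D D'"
  shows "chain_maps R C D = chain_maps R C' D'" and "homotopy_rel R C D = homotopy_rel R C' D'"
proof -
  have m: "Cmod C' i = Cmod C i" "Cmod D' i = Cmod D i" for i
    using C D by (simp_all add: agree_cpx_def)
  have d: "x \<in> carrier (Cmod C i) \<Longrightarrow> Cdiff C' i x = Cdiff C i x"
    "y \<in> carrier (Cmod D i) \<Longrightarrow> Cdiff D' i y = Cdiff D i y" for i x y
    using C D by (simp_all add: agree_cpx_def)
  have dh: "Cdiff D' i (f x) = Cdiff D i (f x)"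
    if "f \<in> rmod_hom R (Cmod C i) (Cmod D i)" "x \<in> carrier (Cmod C i)" for f i x
    using hom_closed[OF that] by (rule d(2))
  show *: "chain_maps R C D = chain_maps R C' D'"
    unfolding chain_maps_def m by (intro Collect_cong) (auto simp: d dh)
  have "homotopy_between C D h f g \<longleftrightarrow> homotopy_between C' D' h f g" if "h \<in> degree_maps R C D" for h f g
    unfolding homotopy_between_def m
    by (simp add: d hom_closed[OF degree_mapsD(1)[OF that]])
  moreover have "degree_maps R C D = degree_maps R C' D'" by (simp add: degree_maps_def m)
  ultimately have "homotopic R C D f g \<longleftrightarrow> homotopic R C' D' f g" for f g
    unfolding homotopic_iff by blast
  then show "homotopy_rel R C D = homotopy_rel R C' D'"
    unfolding homotopy_rel_def * by simp
qed

lemma direct_sum_eq_laurent: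
  assumes "finite {j. \<not> zero_module (M j)}"
  shows "direct_sum UNIV M = laurent M"
proof -
  have "finite {k\<in>UNIV. x k \<noteq> \<zero>\<^bsub>M k\<^esub>}" and "\<exists>b. \<forall>j<b. x j = \<zero>\<^bsub>M j\<^esub>"
    if x: "\<And>j. x j \<in> carrier (M j)" for x
  proof -
    have "{k\<in>UNIV. x k \<noteq> \<zero>\<^bsub>M k\<^esub>} \<subseteq> {j. \<not> zero_module (M j)}"
      using x by (auto simp: zero_module_def)
    then show *: "finite {k\<in>UNIV. x k \<noteq> \<zero>\<^bsub>M k\<^esub>}" by (rule finite_subset) (rule assms)
    have "x j = \<zero>\<^bsub>M j\<^esub>" if "j < Min (insert 0 {k\<in>UNIV. x k \<noteq> \<zero>\<^bsub>M k\<^esub>})" for j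
      using that * by auto
    then show "\<exists>b. \<forall>j<b. x j = \<zero>\<^bsub>M j\<^esub>" by blast
  qed
  then have "{x \<in> (\<Pi>\<^sub>E k\<in>UNIV. carrier (M k)). finite {k\<in>UNIV. x k \<noteq> \<zero>\<^bsub>M k\<^esub>}} =
      {x. (\<forall>j. x j \<in> carrier (M j)) \<and> (\<exists>b. \<forall>j<b. x j = \<zero>\<^bsub>M j\<^esub>)}"
    by (intro Collect_cong) (auto simp: PiE_iff)
  then show ?thesis by (simp add: direct_sum_family laurent_def)
qed

lemma triangular_map_eq_apply_family:
  assumes R: "ring R" and M: "module_family R M" and N: "module_family R N"
    and f: "f \<in> filtered_families R 0 M N" and fin: "finite {j. \<not> zero_module (M j)}"
    and x: "x \<in> carrier (laurent M)"
  shows "triangular_map M N f x = apply_family M N 0 f x"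
proof
  fix k
  interpret N: abelian_group "N k" by (rule right_module_group[OF module_familyD[OF N]])
  have xj: "x j \<in> carrier (M j)" for j using x by (rule laurent_closed)
  have fcl: "f (nat (k - j)) j (x j) \<in> carrier (N k)" if "j \<le> k" for j
    using hom_closed[OF family_component[OF R M N f, of j k]] that xj by simp
  have x': "x \<in> carrier (direct_sum UNIV M)" using x by (simp add: direct_sum_eq_laurent[OF fin])
  have fs: "finite {j. x j \<noteq> \<zero>\<^bsub>M j\<^esub>}" using x' by (simp add: direct_sum_simps)
  let ?g = "\<lambda>j. if j \<le> k then f (nat (k - j)) j (x j) else \<zero>\<^bsub>N k\<^esub>"
  have "apply_family M N 0 f x k = (\<Oplus>\<^bsub>N k\<^esub>j\<in>{j. x j \<noteq> \<zero>\<^bsub>M j\<^esub> \<and> j + 0 \<le> k}. ?g j)"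
    unfolding apply_family_def by (intro N.finsum_cong') (auto simp: fcl)
  also have "\<dots> = (\<Oplus>\<^bsub>N k\<^esub>j\<in>{j. x j \<noteq> \<zero>\<^bsub>M j\<^esub>}. ?g j)"
    by (intro N.finsum_superset fs) (auto simp: fcl)
  finally show "triangular_map M N f x k = apply_family M N 0 f x k"
    using x' by (simp add: triangular_map_def)
qed

context
  fixes R :: "('r, 'q) ring_scheme"
  assumes R: "ring R"
begin

lemma Z_diff_family:
  "X \<in> Z_complexes R \<Longrightarrow> (\<lambda>n j. Bdiff X n i j) \<in> filtered_families R 0 (Bmod X i) (Bmod X (i + 1))"
  by (simp add: Z_complexes_def filtered_families_def)

lemma Xi_obj_agree:
  assumes X: "X \<in> Z_complexes R" and fin: "locally_finite X"
  shows "agree_cpx (Xi_obj X) (hat_cpx X)"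
proof -
  have f: "finite {j. \<not> zero_module (Bmod X i j)}" for i using fin by (simp add: locally_finite_def)
  show ?thesis
    unfolding agree_cpx_def
    using triangular_map_eq_apply_family[OF R Z_complexD(2)[OF R X] Z_complexD(2)[OF R X] Z_diff_family[OF X] f]
    by (simp add: Xi_obj_def direct_sum_eq_laurent[OF f]) (simp add: hat_cpx_def)
qed

lemma Xi_map_eq:
  assumes X: "X \<in> Z_complexes R" and fin: "locally_finite X" and Y: "Y \<in> Z_complexes R"
    and f: "f \<in> Z_maps R X Y" and x: "x \<in> carrier (laurent (Bmod X i))"
  shows "Xi_map X Y f i x = hat_map X Y f i x"
  unfolding Xi_map_def hat_map_def
  using fin by (intro triangular_map_eq_apply_family[OF R Z_complexD(2)[OF R X] Z_complexD(2)[OF R Y] Z_map_family[OF R f] _ x])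
    (simp add: locally_finite_def)

lemma Xi_obj_complex:
  assumes X: "X \<in> Z_complexes R" and fin: "locally_finite X"
  shows "Xi_obj X \<in> proj_complexes R"
proof -
  have eq: "laurent (Bmod X i) = Cmod (Xi_obj X) i"
    "x \<in> carrier (laurent (Bmod X i)) \<Longrightarrow> Cdiff (Xi_obj X) i x = Cdiff (hat_cpx X) i x" for i x
    using Xi_obj_agree[OF X fin] by (auto simp: agree_cpx_def)
  have "projective_module R (Cmod (Xi_obj X) i)" for i
    by (simp add: Xi_obj_def projective_direct_sum R Z_complexD(1)[OF R X])
  moreover have "Cdiff (Xi_obj X) i \<in> rmod_hom R (laurent (Bmod X i)) (laurent (Bmod X (i + 1)))" for i
    by (rule hom_cong[OF hat_diff_hom(1)[OF R X] laurent_module(1)[OF R Z_complexD(2)[OF R X]] eq(2)])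
  moreover have "Cdiff (Xi_obj X) (i + 1) (Cdiff (Xi_obj X) i x) = \<zero>\<^bsub>laurent (Bmod X (i + 2))\<^esub>"
    if "x \<in> carrier (laurent (Bmod X i))" for i x
    using that hat_diff_closed(1)[OF R X that] hat_diff_diff[OF R X that] by (simp add: eq(2))
  ultimately show ?thesis unfolding proj_complexes_def eq(1) by blast
qed

lemma Xi_map_chain_map:
  assumes X: "X \<in> Z_complexes R" and finX: "locally_finite X"
    and Y: "Y \<in> Z_complexes R" and finY: "locally_finite Y" and f: "f \<in> Z_maps R X Y"
  shows "Xi_map X Y f \<in> chain_maps R (Xi_obj X) (Xi_obj Y)"
    and "(Xi_map X Y f, hat_map X Y f) \<in> homotopy_rel R (Xi_obj X) (Xi_obj Y)"
proof -
  note hX = Z_complexD(5)[OF R X] and hY = Z_complexD(5)[OF R Y]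
  note eq = Xi_map_eq[OF X finX Y f] and fh = Z_mapD(3)[OF R X Y f]
  have "Xi_map X Y f i \<in> rmod_hom R (laurent (Bmod X i)) (laurent (Bmod Y i))" for i
    by (rule hom_cong[OF filtered_mapD(1)[OF Z_mapD(1)[OF R X Y f]] laurent_module(1)[OF R Z_complexD(2)[OF R X]] eq])
  then have "Xi_map X Y f \<in> chain_maps R (hat_cpx X) (hat_cpx Y)"
    using chain_mapD(2)[OF fh] by (simp add: chain_maps_def eq hat_diff_closed(1)[OF R X])
  moreover from this have "(Xi_map X Y f, hat_map X Y f) \<in> homotopy_rel R (hat_cpx X) (hat_cpx Y)"
    by (rule homotopy_rel_eqI[OF hX hY _ fh]) (simp add: eq)
  ultimately show "Xi_map X Y f \<in> chain_maps R (Xi_obj X) (Xi_obj Y)"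
    "(Xi_map X Y f, hat_map X Y f) \<in> homotopy_rel R (Xi_obj X) (Xi_obj Y)"
    by (simp_all add: homotopy_rel_agree[OF Xi_obj_agree[OF X finX] Xi_obj_agree[OF Y finY]])
qed

lemma Xi_map_cong:
  assumes X: "X \<in> Z_complexes R" and finX: "locally_finite X"
    and Y: "Y \<in> Z_complexes R" and finY: "locally_finite Y" and fg: "(f, g) \<in> eta_stable_rel R X Y"
  shows "(Xi_map X Y f, Xi_map X Y g) \<in> homotopy_rel R (Xi_obj X) (Xi_obj Y)"
proof -
  note X' = proj_module_complex[OF Xi_obj_complex[OF X finX]] and Y' = proj_module_complex[OF Xi_obj_complex[OF Y finY]]
  obtain s where f: "f \<in> Z_maps R X Y" and g: "g \<in> Z_maps R X Y" and s: "s \<in> Z_homotopies R X Y"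
    and h: "homotopy_between (hat_cpx X) (hat_cpx Y) s (hat_map X Y f) (hat_map X Y g)"
    using fg by (auto simp: eta_stable_rel_iff[OF R X Y] eta_homotopy_rel_def)
  have "(hat_map X Y f, hat_map X Y g) \<in> homotopy_rel R (hat_cpx X) (hat_cpx Y)"
    by (rule homotopy_relI[OF Z_mapD(3)[OF R X Y f] Z_mapD(3)[OF R X Y g] Z_homotopyD(3)[OF s] h])
  then have "(hat_map X Y f, hat_map X Y g) \<in> homotopy_rel R (Xi_obj X) (Xi_obj Y)"
    by (simp add: homotopy_rel_agree[OF Xi_obj_agree[OF X finX] Xi_obj_agree[OF Y finY]])
  then show ?thesis
    using Xi_map_chain_map(2)[OF X finX Y finY f] homotopy_rel_sym[OF X' Y' Xi_map_chain_map(2)[OF X finX Y finY g]]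
      homotopy_rel_trans[OF X' Y'] by blast
qed

lemma quotient_functor_Xi:
  "quotient_functor {X \<in> Z_complexes R. locally_finite X} (Z_maps R)
     (eta_stable_rel R :: ('r, 'x) bigraded \<Rightarrow> _) Z_id (\<lambda>X Y Z. Z_comp Z)
     (proj_complexes R) (chain_maps R) (homotopy_rel R) (\<lambda>C i x. x) (\<lambda>C D E g f i x. g i (f i x))
     Xi_obj Xi_map"
proof (intro quotient_functor.intro quotient_functor_axioms.intro quotient_category_K_Proj
    quotient_category.restrict_objects[OF quotient_category_K_eta[OF R]], goal_cases)
  case (1 X)
  then show ?case by (simp add: Xi_obj_complex)
next
  case (2 X Y f)
  then show ?case by (simp add: Xi_map_chain_map)
next
  case (3 X Y f g)
  then show ?case by (simp add: Xi_map_cong)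
next
  case (4 X)
  then have X: "X \<in> Z_complexes R" "locally_finite X" by auto
  have C: "Cmod (Xi_obj X) i = laurent (Bmod X i)" for i
    using Xi_obj_agree[OF X] by (simp add: agree_cpx_def)
  note X' = proj_module_complex[OF Xi_obj_complex[OF X]] and id = hat_map_id[OF R X(1)]
  show ?case
    by (rule homotopy_rel_eqI[OF X' X' Xi_map_chain_map(1)[OF X X id(1)] chain_map_id])
      (simp add: C Xi_map_eq[OF X X(1) id(1)] id(2))
next
  case (5 X Y Z f g)
  then have X: "X \<in> Z_complexes R" "locally_finite X" and Y: "Y \<in> Z_complexes R" "locally_finite Y"
    and Z: "Z \<in> Z_complexes R" "locally_finite Z" and f: "f \<in> Z_maps R X Y" and g: "g \<in> Z_maps R Y Z" by auto
  have C: "Cmod (Xi_obj X) i = laurent (Bmod X i)" for i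
    using Xi_obj_agree[OF X] by (simp add: agree_cpx_def)
  note X' = proj_module_complex[OF Xi_obj_complex[OF X]] and Z' = proj_module_complex[OF Xi_obj_complex[OF Z]]
  note gf = hat_map_comp[OF R X(1) Y(1) Z(1) f g]
  show ?case
    by (rule homotopy_rel_eqI[OF X' Z' Xi_map_chain_map(1)[OF X Z gf(1)]
        chain_map_comp[OF Xi_map_chain_map(1)[OF X Y f] Xi_map_chain_map(1)[OF Y Z g]]])
      (simp add: C Xi_map_eq[OF X Z(1) gf(1)] gf(2) Xi_map_eq[OF X Y(1) f] Xi_map_eq[OF Y Z(1) g] hat_map_closed[OF R X(1) Y(1) f])
qed

lemma is_functor_Xi: "is_functor (K_eta_fin R) (K_Proj R) (Xi_functor R)"
  unfolding K_eta_fin_quotient K_Proj_def Xi_functor_def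
  by (rule quotient_functor.is_functor_induced[OF quotient_functor_Xi])

end

section \<open>Vanishing of shifted morphisms between sums of copies of a tilting complex\<close>

text \<open>The vanishing of \<open>Hom(C, D[m])\<close> in the homotopy category, phrased without the sign \<open>(-1)\<^sup>m\<close> in the differential
  of \<open>D[m]\<close>: the columns of \<open>\<Psi>(X\<^sup>*\<^sup>*)\<close> are shifted by varying amounts, and there no signs occur.\<close>

definition null_in_degree :: "('r, 'q) ring_scheme \<Rightarrow> int \<Rightarrow> ('r, 'm) cpx \<Rightarrow> ('r, 'n) cpx \<Rightarrow> bool" where
  "null_in_degree R m C D \<longleftrightarrow> (\<forall>E. (\<forall>i. E i \<in> rmod_hom R (Cmod C i) (Cmod D (i + m))) \<longrightarrow>
     (\<forall>i. \<forall>x\<in>carrier (Cmod C i). E (i + 1) (Cdiff C i x) = Cdiff D (i + m) (E i x)) \<longrightarrow>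
     (\<exists>k. (\<forall>i. k i \<in> rmod_hom R (Cmod C i) (Cmod D (i + m - 1))) \<and>
       (\<forall>i. \<forall>x\<in>carrier (Cmod C i).
          E i x = Cdiff D (i + m - 1) (k i x) \<oplus>\<^bsub>Cmod D (i + m)\<^esub> k (i + 1) (Cdiff C i x))))"

lemma null_in_degreeI:
  assumes "\<And>E. \<lbrakk>\<And>i. E i \<in> rmod_hom R (Cmod C i) (Cmod D (i + m));
      \<And>i x. x \<in> carrier (Cmod C i) \<Longrightarrow> E (i + 1) (Cdiff C i x) = Cdiff D (i + m) (E i x)\<rbrakk> \<Longrightarrow>
    \<exists>k. (\<forall>i. k i \<in> rmod_hom R (Cmod C i) (Cmod D (i + m - 1))) \<and>
       (\<forall>i. \<forall>x\<in>carrier (Cmod C i).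
          E i x = Cdiff D (i + m - 1) (k i x) \<oplus>\<^bsub>Cmod D (i + m)\<^esub> k (i + 1) (Cdiff C i x))"
  shows "null_in_degree R m C D"
  using assms unfolding null_in_degree_def by blast

lemma null_in_degreeE:
  assumes "null_in_degree R m C D" "\<And>i. E i \<in> rmod_hom R (Cmod C i) (Cmod D (i + m))"
    "\<And>i x. x \<in> carrier (Cmod C i) \<Longrightarrow> E (i + 1) (Cdiff C i x) = Cdiff D (i + m) (E i x)"
  obtains k where "\<And>i. k i \<in> rmod_hom R (Cmod C i) (Cmod D (i + m - 1))"
    "\<And>i x. x \<in> carrier (Cmod C i) \<Longrightarrow>
       E i x = Cdiff D (i + m - 1) (k i x) \<oplus>\<^bsub>Cmod D (i + m)\<^esub> k (i + 1) (Cdiff C i x)"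
  using assms unfolding null_in_degree_def by blast

lemma null_in_degree_tilting:
  assumes T: "tilting_complex R T" and m: "m \<noteq> 0"
  shows "null_in_degree R m T T"
proof (rule null_in_degreeI)
  fix E assume E: "\<And>i. E i \<in> rmod_hom R (Cmod T i) (Cmod T (i + m))"
    and Ed: "\<And>i x. x \<in> carrier (Cmod T i) \<Longrightarrow> E (i + 1) (Cdiff T i x) = Cdiff T (i + m) (E i x)"
  have Tc: "T \<in> module_complexes R"
    using T by (auto simp: tilting_complex_def perfect_complexes_def intro: proj_module_complex)
  note grp = module_complexD(2)[OF Tc] and rm = module_complexD(1)[OF Tc]
  let ?S = "cpx_shift m T"
  (* The sign (-1)^(m i) in degree i absorbs the sign (-1)^m in the differential of T[m]. *)
  define f where "f i x = (if even (m * i) then E i x else \<ominus>\<^bsub>Cmod T (i + m)\<^esub> E i x)" for i x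
  have f: "f i \<in> rmod_hom R (Cmod T i) (Cmod T (i + m))" for i
  proof -
    have "f i = (if even (m * i) then E i else (\<lambda>x. \<ominus>\<^bsub>Cmod T (i + m)\<^esub> E i x))" by (auto simp: f_def)
    then show ?thesis using E[of i] hom_uminus[OF E[of i] rm] by simp
  qed
  have d_minus: "Cdiff T (i + m) (\<ominus>\<^bsub>Cmod T (i + m)\<^esub> y) = \<ominus>\<^bsub>Cmod T (i + m + 1)\<^esub> Cdiff T (i + m) y"
    if "y \<in> carrier (Cmod T (i + m))" for i y
    by (rule hom_minus[OF module_complexD(3)[OF Tc] grp grp that])
  have "f \<in> chain_maps R T ?S"
    unfolding chain_maps_def
  proof (intro CollectI allI conjI ballI)
    fix i show "f i \<in> rmod_hom R (Cmod T i) (Cmod ?S i)" using f by (simp add: cpx_shift_def)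
    fix x assume x: "x \<in> carrier (Cmod T i)"
    have Ex: "E i x \<in> carrier (Cmod T (i + m))" by (rule hom_closed[OF E x])
    have dEx: "Cdiff T (i + m) (E i x) \<in> carrier (Cmod T (i + m + 1))"
      by (rule hom_closed[OF module_complexD(3)[OF Tc] Ex])
    have i1: "i + 1 + m = i + m + 1" by simp
    show "f (i + 1) (Cdiff T i x) = Cdiff ?S i (f i x)"
      using dEx d_minus[OF Ex]
      by (auto simp: f_def cpx_shift_def Ed[OF x] i1 group_simps[OF grp])
  qed
  then have "homotopic R T ?S f (zero_map ?S)"
    using T m by (auto simp: tilting_complex_def)
  then obtain h where h: "\<And>i. h i \<in> rmod_hom R (Cmod T i) (Cmod T (i - 1 + m))"
    and fh: "\<And>i x. x \<in> carrier (Cmod T i) \<Longrightarrow> f i x = \<zero>\<^bsub>Cmod T (i + m)\<^esub> \<oplus>\<^bsub>Cmod T (i + m)\<^esub>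
        (Cdiff ?S (i - 1) (h i x) \<oplus>\<^bsub>Cmod T (i + m)\<^esub> h (i + 1) (Cdiff T i x))"
    unfolding homotopic_def zero_map_def by (auto simp: cpx_shift_def)
  have im: "i - 1 + m = i + m - 1" for i by simp
  (* The sign (-1)^(m (i + 1)), which carries the homotopy for f back to one for E. *)
  define k where "k i x = (if odd m \<and> even i then \<ominus>\<^bsub>Cmod T (i + m - 1)\<^esub> h i x else h i x)" for i x
  have k: "k i \<in> rmod_hom R (Cmod T i) (Cmod T (i + m - 1))" for i
  proof -
    have "k i = (if odd m \<and> even i then (\<lambda>x. \<ominus>\<^bsub>Cmod T (i + m - 1)\<^esub> h i x) else h i)" by (auto simp: k_def)
    then show ?thesis using h[of i] hom_uminus[OF h[of i] rm] by (simp add: im)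
  qed
  have "E i x = Cdiff T (i + m - 1) (k i x) \<oplus>\<^bsub>Cmod T (i + m)\<^esub> k (i + 1) (Cdiff T i x)"
    if x: "x \<in> carrier (Cmod T i)" for i x
  proof -
    interpret G: abelian_group "Cmod T (i + m)" by (rule grp)
    have hx: "h i x \<in> carrier (Cmod T (i + m - 1))" using hom_closed[OF h x] by (simp add: im)
    have d: "Cdiff T (i + m - 1) \<in> rmod_hom R (Cmod T (i + m - 1)) (Cmod T (i + m))"
      using module_complexD(3)[OF Tc, of "i + m - 1"] by simp
    have a: "Cdiff T (i + m - 1) (h i x) \<in> carrier (Cmod T (i + m))" (is "?a \<in> _") by (rule hom_closed[OF d hx])
    have b: "h (i + 1) (Cdiff T i x) \<in> carrier (Cmod T (i + m))" (is "?b \<in> _")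
      using hom_closed[OF h[of "i + 1"] hom_closed[OF module_complexD(3)[OF Tc] x]] by simp
    have am: "Cdiff T (i + m - 1) (\<ominus>\<^bsub>Cmod T (i + m - 1)\<^esub> h i x) = \<ominus>\<^bsub>Cmod T (i + m)\<^esub> ?a"
      by (rule hom_minus[OF d grp grp hx])
    have Ex: "E i x \<in> carrier (Cmod T (i + m))" by (rule hom_closed[OF E x])
    have fx: "f i x = (if even m then ?a \<oplus>\<^bsub>Cmod T (i + m)\<^esub> ?b else \<ominus>\<^bsub>Cmod T (i + m)\<^esub> ?a \<oplus>\<^bsub>Cmod T (i + m)\<^esub> ?b)"
      using fh[OF x] a b by (simp add: cpx_shift_def im)
    show ?thesis
    proof (cases "even m")
      case True
      then show ?thesis using fx by (simp add: f_def k_def)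
    next
      case odd: False
      show ?thesis
      proof (cases "even i")
        case True
        then show ?thesis using fx odd by (simp add: f_def k_def am)
      next
        case False
        then have "\<ominus>\<^bsub>Cmod T (i + m)\<^esub> E i x = \<ominus>\<^bsub>Cmod T (i + m)\<^esub> ?a \<oplus>\<^bsub>Cmod T (i + m)\<^esub> ?b"
          using fx odd by (simp add: f_def)
        then have "E i x = \<ominus>\<^bsub>Cmod T (i + m)\<^esub> (\<ominus>\<^bsub>Cmod T (i + m)\<^esub> ?a \<oplus>\<^bsub>Cmod T (i + m)\<^esub> ?b)"
          using Ex G.minus_minus by metis
        then show ?thesis using odd False a b by (simp add: k_def G.minus_add)
      qed
    qed
  qed
  then show "\<exists>k. (\<forall>i. k i \<in> rmod_hom R (Cmod T i) (Cmod T (i + m - 1))) \<and>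
       (\<forall>i. \<forall>x\<in>carrier (Cmod T i).
          E i x = Cdiff T (i + m - 1) (k i x) \<oplus>\<^bsub>Cmod T (i + m)\<^esub> k (i + 1) (Cdiff T i x))"
    using k by blast
qed

lemma copies_simps [simp]:
  "Cmod (cpx_copies I C) i = direct_sum I (\<lambda>_. Cmod C i)"
  "Cdiff (cpx_copies I C) i = (\<lambda>x. \<lambda>k\<in>I. Cdiff C i (x k))"
  by (simp_all add: cpx_copies_def)

lemma coordinate_direct_sum: "k \<in> I \<Longrightarrow> (\<lambda>x. x k) \<in> rmod_hom R (direct_sum I M) (M k)"
  by (rule homI) (auto simp: direct_sum_simps)

text \<open>Coordinatewise null-homotopies need not map into the direct sum. They do after being replaced by zero in the coordinates
  in which \<open>E\<close> vanishes, because \<open>T\<close> is bounded and finitely generated in each degree, so that only finitely many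
  coordinates of \<open>E\<close> are nonzero.\<close>

lemma null_in_degree_copies_right:
  fixes T :: "('r, 'm) cpx" and J :: "'j set"
  assumes T: "T \<in> perfect_complexes R" and null: "null_in_degree R m T T"
  shows "null_in_degree R m T (cpx_copies J T)"
proof (rule null_in_degreeI)
  let ?D = "cpx_copies J T"
  fix E assume E: "\<And>i. E i \<in> rmod_hom R (Cmod T i) (Cmod ?D (i + m))"
    and Ed: "\<And>i x. x \<in> carrier (Cmod T i) \<Longrightarrow> E (i + 1) (Cdiff T i x) = Cdiff ?D (i + m) (E i x)"
  have Tc: "T \<in> module_complexes R"
    using T by (auto simp: perfect_complexes_def intro: proj_module_complex)
  note grp = module_complexD(2)[OF Tc] and rm = module_complexD(1)[OF Tc]
  have Ep: "(\<lambda>x. E i x p) \<in> rmod_hom R (Cmod T i) (Cmod T (i + m))" if "p \<in> J" for i p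
    by (rule hom_comp[OF E[unfolded copies_simps] coordinate_direct_sum[OF that, where M = "\<lambda>_. Cmod T (i + m)"]])
  have "\<exists>k. (\<forall>i. k i \<in> rmod_hom R (Cmod T i) (Cmod T (i + m - 1))) \<and>
       (\<forall>i. \<forall>x\<in>carrier (Cmod T i).
          E i x p = Cdiff T (i + m - 1) (k i x) \<oplus>\<^bsub>Cmod T (i + m)\<^esub> k (i + 1) (Cdiff T i x))" if p: "p \<in> J" for p
  proof -
    have "E (i + 1) (Cdiff T i x) p = Cdiff T (i + m) (E i x p)" if "x \<in> carrier (Cmod T i)" for i x
      using Ed[OF that] p by simp
    then show ?thesis
      using null_in_degreeE[where E = "\<lambda>i x. E i x p", OF null Ep[OF p]] by metis
  qed
  then have "\<forall>p. \<exists>k. p \<in> J \<longrightarrow> (\<forall>i. k i \<in> rmod_hom R (Cmod T i) (Cmod T (i + m - 1))) \<and>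
       (\<forall>i. \<forall>x\<in>carrier (Cmod T i).
          E i x p = Cdiff T (i + m - 1) (k i x) \<oplus>\<^bsub>Cmod T (i + m)\<^esub> k (i + 1) (Cdiff T i x))" by blast
  from choice[OF this] obtain k where k: "\<And>p i. p \<in> J \<Longrightarrow> k p i \<in> rmod_hom R (Cmod T i) (Cmod T (i + m - 1))"
    and Ek: "\<And>p i x. p \<in> J \<Longrightarrow> x \<in> carrier (Cmod T i) \<Longrightarrow>
          E i x p = Cdiff T (i + m - 1) (k p i x) \<oplus>\<^bsub>Cmod T (i + m)\<^esub> k p (i + 1) (Cdiff T i x)" by blast
  (* A nonzero coordinate of E is detected on one of the finitely many generators of the nonzero terms of T. *)
  define J0 where "J0 = {p\<in>J. \<exists>i. \<exists>x\<in>carrier (Cmod T i). E i x p \<noteq> \<zero>\<^bsub>Cmod T (i + m)\<^esub>}"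
  have "finite J0"
  proof -
    obtain a b where ab: "\<And>i. i < a \<or> b < i \<Longrightarrow> zero_module (Cmod T i)"
      using T by (auto simp: perfect_complexes_def bounded_cpx_def)
    have "\<forall>i. \<exists>S. finite S \<and> S \<subseteq> carrier (Cmod T i) \<and>
       (\<forall>x\<in>carrier (Cmod T i). \<exists>c\<in>S \<rightarrow> carrier R. x = (\<Oplus>\<^bsub>Cmod T i\<^esub>s\<in>S. c s \<odot>\<^bsub>Cmod T i\<^esub> s))"
      using T by (auto simp: perfect_complexes_def finitely_generated_def)
    from choice[OF this] obtain S where S: "\<And>i. finite (S i)" "\<And>i. S i \<subseteq> carrier (Cmod T i)"
      and gen: "\<And>i x. x \<in> carrier (Cmod T i) \<Longrightarrow>
         \<exists>c\<in>S i \<rightarrow> carrier R. x = (\<Oplus>\<^bsub>Cmod T i\<^esub>s\<in>S i. c s \<odot>\<^bsub>Cmod T i\<^esub> s)" by blast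
    have "J0 \<subseteq> (\<Union>i\<in>{a..b}. \<Union>s\<in>S i. {p\<in>J. E i s p \<noteq> \<zero>\<^bsub>Cmod T (i + m)\<^esub>})" (is "_ \<subseteq> ?U")
    proof
      fix p assume "p \<in> J0"
      then obtain i x where p: "p \<in> J" and x: "x \<in> carrier (Cmod T i)" and ne: "E i x p \<noteq> \<zero>\<^bsub>Cmod T (i + m)\<^esub>"
        by (auto simp: J0_def)
      have i: "i \<in> {a..b}"
      proof (rule ccontr)
        assume "i \<notin> {a..b}"
        then have "x = \<zero>\<^bsub>Cmod T i\<^esub>" using ab[of i] x by (auto simp: zero_module_def)
        then show False using ne hom_zero[OF Ep[OF p] grp grp] by simp
      qed
      have "\<exists>s\<in>S i. E i s p \<noteq> \<zero>\<^bsub>Cmod T (i + m)\<^esub>"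
      proof (rule ccontr)
        assume "\<not> ?thesis"
        then have z: "E i s p = \<zero>\<^bsub>Cmod T (i + m)\<^esub>" if "s \<in> S i" for s using that by blast
        obtain c where c: "c \<in> S i \<rightarrow> carrier R" and xc: "x = (\<Oplus>\<^bsub>Cmod T i\<^esub>s\<in>S i. c s \<odot>\<^bsub>Cmod T i\<^esub> s)"
          using gen[OF x] by blast
        interpret G: abelian_group "Cmod T (i + m)" by (rule grp)
        have "E i x p = (\<Oplus>\<^bsub>Cmod T (i + m)\<^esub>s\<in>S i. E i (c s \<odot>\<^bsub>Cmod T i\<^esub> s) p)"
          unfolding xc using c S(2)[of i]
          by (intro hom_finsum[OF Ep[OF p] grp grp]) (auto intro!: right_module.smult_closed[OF rm])
        also have "\<dots> = (\<Oplus>\<^bsub>Cmod T (i + m)\<^esub>s\<in>S i. \<zero>\<^bsub>Cmod T (i + m)\<^esub>)"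
          using c S(2)[of i]
          by (intro G.finsum_cong') (auto simp: hom_smult[OF Ep[OF p]] z Pi_iff subset_iff smult_zero_right[OF rm])
        also have "\<dots> = \<zero>\<^bsub>Cmod T (i + m)\<^esub>" by simp
        finally show False using ne by simp
      qed
      with i p show "p \<in> ?U" by blast
    qed
    moreover have "finite {p\<in>J. E i s p \<noteq> \<zero>\<^bsub>Cmod T (i + m)\<^esub>}" if "s \<in> S i" for i s
    proof -
      have "s \<in> carrier (Cmod T i)" using that S(2) by auto
      from hom_closed[OF E this] show ?thesis by (simp add: direct_sum_simps)
    qed
    then have "finite ?U" using S(1) by auto
    ultimately show ?thesis by (rule finite_subset)
  qed
  define K where "K i x = (\<lambda>p\<in>J. if p \<in> J0 then k p i x else \<zero>\<^bsub>Cmod T (i + m - 1)\<^esub>)" for i x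
  have "K i \<in> rmod_hom R (Cmod T i) (Cmod ?D (i + m - 1))" for i
  proof (rule homI)
    fix x assume x: "x \<in> carrier (Cmod T i)"
    have "{p\<in>J. K i x p \<noteq> \<zero>\<^bsub>Cmod T (i + m - 1)\<^esub>} \<subseteq> J0" by (auto simp: K_def)
    then have "finite {p\<in>J. K i x p \<noteq> \<zero>\<^bsub>Cmod T (i + m - 1)\<^esub>}" using \<open>finite J0\<close> by (rule finite_subset)
    then show "K i x \<in> carrier (Cmod ?D (i + m - 1))"
      by (simp add: direct_sum_simps) (auto simp: K_def hom_closed[OF k x] group_simps[OF grp])
    show "K i (r \<odot>\<^bsub>Cmod T i\<^esub> x) = r \<odot>\<^bsub>Cmod ?D (i + m - 1)\<^esub> K i x" if "r \<in> carrier R" for r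
      using that x by (auto simp: K_def direct_sum_simps fun_eq_iff hom_smult[OF k] smult_zero_right[OF rm])
    show "K i (x \<oplus>\<^bsub>Cmod T i\<^esub> y) = K i x \<oplus>\<^bsub>Cmod ?D (i + m - 1)\<^esub> K i y" if "y \<in> carrier (Cmod T i)" for y
      using that x by (auto simp: K_def direct_sum_simps fun_eq_iff hom_add[OF k] group_simps[OF grp])
  qed
  moreover have "E i x = Cdiff ?D (i + m - 1) (K i x) \<oplus>\<^bsub>Cmod ?D (i + m)\<^esub> K (i + 1) (Cdiff T i x)"
    if x: "x \<in> carrier (Cmod T i)" for i x
  proof
    fix p
    have d0: "Cdiff T (i + m - 1) \<zero>\<^bsub>Cmod T (i + m - 1)\<^esub> = \<zero>\<^bsub>Cmod T (i + m)\<^esub>"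
      using hom_zero[OF module_complexD(3)[OF Tc] grp grp, of "i + m - 1"] by simp
    show "E i x p = (Cdiff ?D (i + m - 1) (K i x) \<oplus>\<^bsub>Cmod ?D (i + m)\<^esub> K (i + 1) (Cdiff T i x)) p"
    proof (cases "p \<in> J")
      case True
      show ?thesis
      proof (cases "p \<in> J0")
        case False
        then have "E i x p = \<zero>\<^bsub>Cmod T (i + m)\<^esub>" using True x by (auto simp: J0_def)
        then show ?thesis using True False by (simp add: direct_sum_simps K_def d0 group_simps[OF grp])
      qed (use True Ek[OF True x] in \<open>simp add: direct_sum_simps K_def\<close>)
    next
      case False
      then show ?thesis using hom_closed[OF E x] by (auto simp: direct_sum_simps PiE_iff extensional_def)
    qed
  qed
  ultimately show "\<exists>k. (\<forall>i. k i \<in> rmod_hom R (Cmod T i) (Cmod ?D (i + m - 1))) \<and>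
       (\<forall>i. \<forall>x\<in>carrier (Cmod T i).
          E i x = Cdiff ?D (i + m - 1) (k i x) \<oplus>\<^bsub>Cmod ?D (i + m)\<^esub> k (i + 1) (Cdiff T i x))"
    by blast
qed

lemma copies_diff:
  assumes T: "T \<in> module_complexes R"
  shows "Cdiff (cpx_copies I T) i \<in> rmod_hom R (Cmod (cpx_copies I T) i) (Cmod (cpx_copies I T) (i + 1))"
proof (rule homI)
  note grp = module_complexD(2)[OF T] and d = module_complexD(3)[OF T]
  fix x assume x: "x \<in> carrier (Cmod (cpx_copies I T) i)"
  have "{k\<in>I. (\<lambda>k\<in>I. Cdiff T i (x k)) k \<noteq> \<zero>\<^bsub>Cmod T (i + 1)\<^esub>} \<subseteq> {k\<in>I. x k \<noteq> \<zero>\<^bsub>Cmod T i\<^esub>}"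
    using hom_zero[OF d grp grp] by auto
  moreover have "finite {k\<in>I. x k \<noteq> \<zero>\<^bsub>Cmod T i\<^esub>}" using x by (simp add: direct_sum_simps)
  ultimately have "finite {k\<in>I. (\<lambda>k\<in>I. Cdiff T i (x k)) k \<noteq> \<zero>\<^bsub>Cmod T (i + 1)\<^esub>}" by (rule finite_subset)
  moreover have xk: "x k \<in> carrier (Cmod T i)" if "k \<in> I" for k using x that by (auto simp: direct_sum_simps)
  ultimately show "Cdiff (cpx_copies I T) i x \<in> carrier (Cmod (cpx_copies I T) (i + 1))"
    by (auto simp: direct_sum_simps hom_closed[OF d])
  show "Cdiff (cpx_copies I T) i (r \<odot>\<^bsub>Cmod (cpx_copies I T) i\<^esub> x) =
      r \<odot>\<^bsub>Cmod (cpx_copies I T) (i + 1)\<^esub> Cdiff (cpx_copies I T) i x" if "r \<in> carrier R" for r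
    using that xk by (auto simp: direct_sum_simps fun_eq_iff hom_smult[OF d])
  fix y assume y: "y \<in> carrier (Cmod (cpx_copies I T) i)"
  have yk: "y k \<in> carrier (Cmod T i)" if "k \<in> I" for k using y that by (auto simp: direct_sum_simps)
  show "Cdiff (cpx_copies I T) i (x \<oplus>\<^bsub>Cmod (cpx_copies I T) i\<^esub> y) =
      Cdiff (cpx_copies I T) i x \<oplus>\<^bsub>Cmod (cpx_copies I T) (i + 1)\<^esub> Cdiff (cpx_copies I T) i y"
    using xk yk by (auto simp: direct_sum_simps fun_eq_iff hom_add[OF d])
qed

lemma null_in_degree_copies_left:
  assumes T: "T \<in> module_complexes R" and D: "D \<in> module_complexes R" and null: "null_in_degree R m T D"
  shows "null_in_degree R m (cpx_copies I T) D"
proof (rule null_in_degreeI)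
  let ?C = "cpx_copies I T"
  fix E assume E: "\<And>i. E i \<in> rmod_hom R (Cmod ?C i) (Cmod D (i + m))"
    and Ed: "\<And>i x. x \<in> carrier (Cmod ?C i) \<Longrightarrow> E (i + 1) (Cdiff ?C i x) = Cdiff D (i + m) (E i x)"
  note grp = module_complexD(2)[OF T] and rm = module_complexD(1)[OF T] and d = module_complexD(3)[OF T]
  have R: "ring R" using rm by (rule right_module_ring)
  let ?s = "\<lambda>i p. single I (\<lambda>_. Cmod T i) p"
  have s: "?s i p \<in> rmod_hom R (Cmod T i) (direct_sum I (\<lambda>_. Cmod T i))" if "p \<in> I" for i p
    using that by (intro single_hom_direct_sum[where M = "\<lambda>_. Cmod T i"] rm)
  have ds: "Cdiff ?C i (?s i p x) = ?s (i + 1) p (Cdiff T i x)" for i p x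
    using hom_zero[OF d grp grp] by (auto simp: single_def fun_eq_iff)
  have Ep: "(\<lambda>x. E i (?s i p x)) \<in> rmod_hom R (Cmod T i) (Cmod D (i + m))" if "p \<in> I" for i p
    using hom_comp[OF s[OF that] E[unfolded copies_simps]] .
  have "\<exists>k. (\<forall>i. k i \<in> rmod_hom R (Cmod T i) (Cmod D (i + m - 1))) \<and>
       (\<forall>i. \<forall>x\<in>carrier (Cmod T i).
          E i (?s i p x) = Cdiff D (i + m - 1) (k i x) \<oplus>\<^bsub>Cmod D (i + m)\<^esub> k (i + 1) (Cdiff T i x))" if p: "p \<in> I" for p
  proof -
    have "E (i + 1) (?s (i + 1) p (Cdiff T i x)) = Cdiff D (i + m) (E i (?s i p x))" if "x \<in> carrier (Cmod T i)" for i x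
      using Ed[of "?s i p x" i] hom_closed[OF s[OF p] that] by (simp add: ds[simplified])
    then show ?thesis
      using null_in_degreeE[where E = "\<lambda>i x. E i (?s i p x)", OF null Ep[OF p]] by metis
  qed
  then have "\<forall>p. \<exists>k. p \<in> I \<longrightarrow> (\<forall>i. k i \<in> rmod_hom R (Cmod T i) (Cmod D (i + m - 1))) \<and>
       (\<forall>i. \<forall>x\<in>carrier (Cmod T i).
          E i (?s i p x) = Cdiff D (i + m - 1) (k i x) \<oplus>\<^bsub>Cmod D (i + m)\<^esub> k (i + 1) (Cdiff T i x))" by blast
  from choice[OF this] obtain k where k: "\<And>p i. p \<in> I \<Longrightarrow> k p i \<in> rmod_hom R (Cmod T i) (Cmod D (i + m - 1))"
    and Ek: "\<And>p i x. p \<in> I \<Longrightarrow> x \<in> carrier (Cmod T i) \<Longrightarrow>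
          E i (?s i p x) = Cdiff D (i + m - 1) (k p i x) \<oplus>\<^bsub>Cmod D (i + m)\<^esub> k p (i + 1) (Cdiff T i x)" by blast
  define K where "K i = sum_map I (\<lambda>_. Cmod T i) (Cmod D (i + m - 1)) (\<lambda>p. k p i)" for i
  have K: "K i \<in> rmod_hom R (Cmod ?C i) (Cmod D (i + m - 1))" for i
    unfolding K_def copies_simps by (rule sum_map_hom(1)[OF rm module_complexD(1)[OF D] k])
  have Ks: "K i (?s i p x) = k p i x" if "p \<in> I" "x \<in> carrier (Cmod T i)" for i p x
    unfolding K_def by (rule sum_map_hom(2)[OF rm module_complexD(1)[OF D] k that])
  have K1: "K (i + 1) \<in> rmod_hom R (Cmod ?C (i + 1)) (Cmod D (i + m))" for i
    using K[of "i + 1"] by (simp add: algebra_simps)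
  have dD: "Cdiff D (i + m - 1) \<in> rmod_hom R (Cmod D (i + m - 1)) (Cmod D (i + m))" for i
    using module_complexD(3)[OF D, of "i + m - 1"] by simp
  have "E i x = Cdiff D (i + m - 1) (K i x) \<oplus>\<^bsub>Cmod D (i + m)\<^esub> K (i + 1) (Cdiff ?C i x)"
    if x: "x \<in> carrier (Cmod ?C i)" for i x
  proof (rule direct_sum_hom_eqI[OF E[unfolded copies_simps] _ rm R module_complexD(1)[OF D] _ x[unfolded copies_simps]])
    show "(\<lambda>x. Cdiff D (i + m - 1) (K i x) \<oplus>\<^bsub>Cmod D (i + m)\<^esub> K (i + 1) (Cdiff ?C i x))
      \<in> rmod_hom R (direct_sum I (\<lambda>_. Cmod T i)) (Cmod D (i + m))"
      using hom_plus[OF hom_comp[OF K dD] hom_comp[OF copies_diff[OF T] K1] module_complexD(1)[OF D]] by simp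
    fix p x assume p: "p \<in> I" and x: "x \<in> carrier (Cmod T i)"
    show "E i (?s i p x) = Cdiff D (i + m - 1) (K i (?s i p x)) \<oplus>\<^bsub>Cmod D (i + m)\<^esub> K (i + 1) (Cdiff ?C i (?s i p x))"
      unfolding ds Ks[OF p x] Ks[OF p hom_closed[OF d x]] by (rule Ek[OF p x])
  qed
  then show "\<exists>k. (\<forall>i. k i \<in> rmod_hom R (Cmod ?C i) (Cmod D (i + m - 1))) \<and>
       (\<forall>i. \<forall>x\<in>carrier (Cmod ?C i).
          E i x = Cdiff D (i + m - 1) (k i x) \<oplus>\<^bsub>Cmod D (i + m)\<^esub> k (i + 1) (Cdiff ?C i x))"
    using K by blast
qed

lemma null_in_degree_iso:
  assumes Cc: "C \<in> module_complexes R" and Dc: "D \<in> module_complexes R"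
    and C: "cpx_isomorphic R C C'" and D: "cpx_isomorphic R D D'" and null: "null_in_degree R m C D"
  shows "null_in_degree R m C' D'"
proof (rule null_in_degreeI)
  fix E assume E: "\<And>i. E i \<in> rmod_hom R (Cmod C' i) (Cmod D' (i + m))"
    and Ed: "\<And>i x. x \<in> carrier (Cmod C' i) \<Longrightarrow> E (i + 1) (Cdiff C' i x) = Cdiff D' (i + m) (E i x)"
  obtain f g where f: "f \<in> chain_maps R C C'" and g: "g \<in> chain_maps R C' C"
    and fg: "\<And>i y. y \<in> carrier (Cmod C' i) \<Longrightarrow> f i (g i y) = y"
    using C unfolding cpx_isomorphic_def by blast
  obtain u v where u: "u \<in> chain_maps R D D'" and v: "v \<in> chain_maps R D' D"
    and uv: "\<And>i y. y \<in> carrier (Cmod D' i) \<Longrightarrow> u i (v i y) = y"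
    using D unfolding cpx_isomorphic_def by blast
  note fh = chain_mapD(1)[OF f] and gh = chain_mapD(1)[OF g] and uh = chain_mapD(1)[OF u] and vh = chain_mapD(1)[OF v]
  have 1: "(\<lambda>x. v (i + m) (E i (f i x))) \<in> rmod_hom R (Cmod C i) (Cmod D (i + m))" for i
    by (rule hom_comp[OF fh hom_comp[OF E vh]])
  have i1: "i + 1 + m = i + m + 1" for i by simp
  have 2: "v (i + 1 + m) (E (i + 1) (f (i + 1) (Cdiff C i x))) = Cdiff D (i + m) (v (i + m) (E i (f i x)))"
    if x: "x \<in> carrier (Cmod C i)" for i x
    unfolding chain_mapD(2)[OF f x] Ed[OF hom_closed[OF fh x]] i1
    by (rule chain_mapD(2)[OF v hom_closed[OF E hom_closed[OF fh x]]])
  obtain k where k: "\<And>i. k i \<in> rmod_hom R (Cmod C i) (Cmod D (i + m - 1))"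
    and Ek: "\<And>i x. x \<in> carrier (Cmod C i) \<Longrightarrow> v (i + m) (E i (f i x)) =
       Cdiff D (i + m - 1) (k i x) \<oplus>\<^bsub>Cmod D (i + m)\<^esub> k (i + 1) (Cdiff C i x)"
    using null_in_degreeE[where E = "\<lambda>i x. v (i + m) (E i (f i x))", OF null 1 2] by blast
  have k1: "k (i + 1) \<in> rmod_hom R (Cmod C (i + 1)) (Cmod D (i + m))" for i
    using k[of "i + 1"] by (simp add: algebra_simps)
  have "E i y = Cdiff D' (i + m - 1) (u (i + m - 1) (k i (g i y))) \<oplus>\<^bsub>Cmod D' (i + m)\<^esub>
      u (i + m) (k (i + 1) (g (i + 1) (Cdiff C' i y)))" if y: "y \<in> carrier (Cmod C' i)" for i y
  proof -
    have gy: "g i y \<in> carrier (Cmod C i)" by (rule hom_closed[OF gh y])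
    have kg: "k i (g i y) \<in> carrier (Cmod D (i + m - 1))" by (rule hom_closed[OF k gy])
    have "E i y = u (i + m) (v (i + m) (E i (f i (g i y))))"
      by (simp add: fg[OF y] uv[OF hom_closed[OF E y]])
    also have "\<dots> = u (i + m) (Cdiff D (i + m - 1) (k i (g i y)) \<oplus>\<^bsub>Cmod D (i + m)\<^esub> k (i + 1) (Cdiff C i (g i y)))"
      by (simp only: Ek[OF gy])
    also have "Cdiff C i (g i y) = g (i + 1) (Cdiff C' i y)" by (rule chain_mapD(2)[OF g y, symmetric])
    also have "u (i + m) (Cdiff D (i + m - 1) (k i (g i y)) \<oplus>\<^bsub>Cmod D (i + m)\<^esub> k (i + 1) (g (i + 1) (Cdiff C' i y))) =
       u (i + m) (Cdiff D (i + m - 1) (k i (g i y))) \<oplus>\<^bsub>Cmod D' (i + m)\<^esub> u (i + m) (k (i + 1) (g (i + 1) (Cdiff C' i y)))"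
    proof (rule hom_add[OF uh])
      show "k (i + 1) (g (i + 1) (Cdiff C' i y)) \<in> carrier (Cmod D (i + m))"
        unfolding chain_mapD(2)[OF g y] by (rule hom_closed[OF k1 hom_closed[OF module_complexD(3)[OF Cc] gy]])
      show "Cdiff D (i + m - 1) (k i (g i y)) \<in> carrier (Cmod D (i + m))"
        using hom_closed[OF module_complexD(3)[OF Dc] kg] by simp
    qed
    also have "u (i + m) (Cdiff D (i + m - 1) (k i (g i y))) = Cdiff D' (i + m - 1) (u (i + m - 1) (k i (g i y)))"
      by (rule chain_mapD(3)[OF u kg])
    finally show ?thesis .
  qed
  moreover have "(\<lambda>y. u (i + m - 1) (k i (g i y))) \<in> rmod_hom R (Cmod C' i) (Cmod D' (i + m - 1))" for i
    by (rule hom_comp[OF gh hom_comp[OF k uh]])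
  ultimately show "\<exists>k. (\<forall>i. k i \<in> rmod_hom R (Cmod C' i) (Cmod D' (i + m - 1))) \<and>
       (\<forall>i. \<forall>x\<in>carrier (Cmod C' i).
          E i x = Cdiff D' (i + m - 1) (k i x) \<oplus>\<^bsub>Cmod D' (i + m)\<^esub> k (i + 1) (Cdiff C' i x))"
    by (intro exI[of _ "\<lambda>i y. u (i + m - 1) (k i (g i y))"]) (simp add: algebra_simps)
qed

lemma copies_module_complex:
  assumes T: "T \<in> module_complexes R"
  shows "cpx_copies I T \<in> module_complexes R"
proof -
  note rm = module_complexD(1)[OF T]
  have R: "ring R" using rm by (rule right_module_ring)
  have "Cdiff (cpx_copies I T) (i + 1) (Cdiff (cpx_copies I T) i x) = \<zero>\<^bsub>Cmod (cpx_copies I T) (i + 2)\<^esub>"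
    if "x \<in> carrier (Cmod (cpx_copies I T) i)" for i x
    using that module_complexD(5)[OF T] by (auto simp: direct_sum_simps fun_eq_iff PiE_iff)
  then show ?thesis
    using copies_diff[OF T, of I] right_module_direct_sum[OF R, of I "\<lambda>_. Cmod T _"] rm
    unfolding module_complexes_def by simp
qed

lemma null_in_degree_Sum_T:
  fixes C D :: "('r, 'x) cpx"
  assumes T: "tilting_complex R T" and m: "m \<noteq> 0" and C: "C \<in> Sum_T R T" and D: "D \<in> Sum_T R T"
  shows "null_in_degree R m C D"
proof -
  have Tp: "T \<in> perfect_complexes R" using T by (simp add: tilting_complex_def)
  then have Tc: "T \<in> module_complexes R" by (auto simp: perfect_complexes_def intro: proj_module_complex)
  obtain I :: "'x set" where I: "cpx_isomorphic R (cpx_copies I T) C" using C by (auto simp: Sum_T_def)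
  obtain J :: "'x set" where J: "cpx_isomorphic R (cpx_copies J T) D" using D by (auto simp: Sum_T_def)
  note cI = copies_module_complex[OF Tc, of I] and cJ = copies_module_complex[OF Tc, of J]
  show ?thesis
    by (rule null_in_degree_iso[OF cI cJ I J null_in_degree_copies_left[OF Tc cJ
        null_in_degree_copies_right[OF Tp null_in_degree_tilting[OF T m]]]])
qed

section \<open>Lifting homotopies along the filtration\<close>

context
  fixes R :: "('r, 'q) ring_scheme" and M :: "int \<Rightarrow> ('r, 'x) module" and N :: "int \<Rightarrow> ('r, 'y) module"
  assumes R: "ring R" and M: "module_family R M" and N: "module_family R N"
begin

lemma laurent_split_first:
  assumes x: "x \<in> carrier (laurent M)" and b: "starts_at M b x"
  shows "x(b := \<zero>\<^bsub>M b\<^esub>) \<in> carrier (laurent M)" and "starts_at M (b + 1) (x(b := \<zero>\<^bsub>M b\<^esub>))"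
    and "x = single\<^sub>Z M b (x b) \<oplus>\<^bsub>laurent M\<^esub> x(b := \<zero>\<^bsub>M b\<^esub>)"
proof -
  note grp = right_module_group[OF module_familyD[OF M]]
  have xj: "x j \<in> carrier (M j)" for j using x by (rule laurent_closed)
  have s: "starts_at M (b + 1) (x(b := \<zero>\<^bsub>M b\<^esub>))"
    using b by (auto simp: starts_at_def)
  then show "starts_at M (b + 1) (x(b := \<zero>\<^bsub>M b\<^esub>))" .
  have "(x(b := \<zero>\<^bsub>M b\<^esub>)) j \<in> carrier (M j)" for j using xj by (simp add: group_simps[OF grp])
  with s show "x(b := \<zero>\<^bsub>M b\<^esub>) \<in> carrier (laurent M)" unfolding laurent_simps starts_at_def by blast
  show "x = single\<^sub>Z M b (x b) \<oplus>\<^bsub>laurent M\<^esub> x(b := \<zero>\<^bsub>M b\<^esub>)"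
    using xj by (auto simp: laurent_simps single_def fun_eq_iff group_simps[OF grp])
qed

lemma filtered_map_split_first:
  assumes F: "F \<in> filtered_maps R L M N" and x: "x \<in> carrier (laurent M)" and b: "starts_at M b x"
  shows "F x k = F (single\<^sub>Z M b (x b)) k \<oplus>\<^bsub>N k\<^esub> F (x(b := \<zero>\<^bsub>M b\<^esub>)) k"
proof -
  note s = laurent_split_first[OF x b]
  have "F x = F (single\<^sub>Z M b (x b)) \<oplus>\<^bsub>laurent N\<^esub> F (x(b := \<zero>\<^bsub>M b\<^esub>))"
    using hom_add[OF filtered_mapD(1)[OF F] hom_closed[OF single_laurent[OF M] laurent_closed[OF x]] s(1), of b] s(3) by simp
  then show ?thesis by (simp add: laurent_simps)
qed

text \<open>On leading entries a filtered map acts through the diagonal of its matrix.\<close>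

lemma filtered_map_leading:
  assumes F: "F \<in> filtered_maps R L M N" and x: "x \<in> carrier (laurent M)" and b: "starts_at M b x"
  shows "F x (b + L) = F (single\<^sub>Z M b (x b)) (b + L)"
proof -
  note s = laurent_split_first[OF x b]
  have "F (x(b := \<zero>\<^bsub>M b\<^esub>)) (b + L) = \<zero>\<^bsub>N (b + L)\<^esub>"
    using filtered_mapD(2)[OF F s(1,2)] by (simp add: starts_at_def)
  moreover have "F (single\<^sub>Z M b (x b)) (b + L) \<in> carrier (N (b + L))"
    by (rule laurent_closed[OF hom_closed[OF filtered_mapD(1)[OF F] hom_closed[OF single_laurent[OF M] laurent_closed[OF x]]]])
  ultimately show ?thesis
    using filtered_map_split_first[OF F x b, of "b + L"] group_simps(5)[OF right_module_group[OF module_familyD[OF N]]]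
    by simp
qed

lemma filtered_map_local:
  assumes F: "F \<in> filtered_maps R L M N" and x: "x \<in> carrier (laurent M)" and y: "y \<in> carrier (laurent M)"
    and eq: "\<And>j. j < c \<Longrightarrow> x j = y j" and k: "k < c + L"
  shows "F x k = F y k"
proof -
  interpret Nk: abelian_group "N k" by (rule right_module_group[OF module_familyD[OF N]])
  note Mgrp = right_module_group[OF laurent_module(1)[OF R M]] and Ngrp = right_module_group[OF laurent_module(1)[OF R N]]
  let ?z = "x \<oplus>\<^bsub>laurent M\<^esub> \<ominus>\<^bsub>laurent M\<^esub> y"
  have z: "?z \<in> carrier (laurent M)" using x y by (simp add: group_simps[OF Mgrp])
  have "starts_at M c ?z"
    using eq laurent_closed[OF y] right_module_group[OF module_familyD[OF M]]
    by (simp add: starts_at_def laurent_simps(3) laurent_module(2)[OF R M y] abelian_group.r_neg)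
  from filtered_mapD(2)[OF F z this] have "F ?z k = \<zero>\<^bsub>N k\<^esub>" using k by (simp add: starts_at_def)
  moreover have Fx: "F x \<in> carrier (laurent N)" and Fy: "F y \<in> carrier (laurent N)"
    by (rule hom_closed[OF filtered_mapD(1)[OF F] x] hom_closed[OF filtered_mapD(1)[OF F] y])+
  moreover have "F ?z = F x \<oplus>\<^bsub>laurent N\<^esub> \<ominus>\<^bsub>laurent N\<^esub> F y"
    using x y by (simp add: hom_add[OF filtered_mapD(1)[OF F]] hom_minus[OF filtered_mapD(1)[OF F] Mgrp Ngrp] group_simps[OF Mgrp])
  ultimately have "F x k \<oplus>\<^bsub>N k\<^esub> \<ominus>\<^bsub>N k\<^esub> F y k = \<zero>\<^bsub>N k\<^esub>"
    by (simp add: laurent_simps(3) laurent_module(2)[OF R N Fy])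
  then show ?thesis using Nk.eq_iff_diff_zero[OF laurent_closed[OF Fx] laurent_closed[OF Fy]] by simp
qed

end

lemma starts_at_single: "starts_at M j (single\<^sub>Z M j x)"
  by (simp add: starts_at_def single_def)

text \<open>The \<open>j\<close>-th graded piece of the filtration of \<open>hat_cpx X\<close>.\<close>

definition Z_column :: "('r, 'x) bigraded \<Rightarrow> int \<Rightarrow> ('r, 'x) cpx" where
  "Z_column X j = \<lparr>Cmod = (\<lambda>i. Bmod X i j), Cdiff = (\<lambda>i. Bdiff X 0 i j)\<rparr>"

lemma Z_column_simps [simp]: "Cmod (Z_column X j) i = Bmod X i j" "Cdiff (Z_column X j) i = Bdiff X 0 i j"
  by (simp_all add: Z_column_def)

definition boundary_maps ::
  "('r, 'x) bigraded \<Rightarrow> ('r, 'y) bigraded \<Rightarrow> (int \<Rightarrow> (int \<Rightarrow> 'x) \<Rightarrow> (int \<Rightarrow> 'y)) \<Rightarrow>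
   int \<Rightarrow> (int \<Rightarrow> 'x) \<Rightarrow> (int \<Rightarrow> 'y)" where
  "boundary_maps P Q S i x =
     Cdiff (hat_cpx Q) (i - 1) (S i x) \<oplus>\<^bsub>laurent (Bmod Q i)\<^esub> S (i + 1) (Cdiff (hat_cpx P) i x)"

text \<open>What is missing for \<open>S\<close> to be a null-homotopy of the chain map \<open>W\<close>.\<close>

definition defect_maps ::
  "('r, 'x) bigraded \<Rightarrow> ('r, 'y) bigraded \<Rightarrow> (int \<Rightarrow> (int \<Rightarrow> 'x) \<Rightarrow> (int \<Rightarrow> 'y)) \<Rightarrow>
   (int \<Rightarrow> (int \<Rightarrow> 'x) \<Rightarrow> (int \<Rightarrow> 'y)) \<Rightarrow> int \<Rightarrow> (int \<Rightarrow> 'x) \<Rightarrow> (int \<Rightarrow> 'y)" where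
  "defect_maps P Q W S i x =
     W i x \<oplus>\<^bsub>laurent (Bmod Q i)\<^esub> \<ominus>\<^bsub>laurent (Bmod Q i)\<^esub> boundary_maps P Q S i x"

context
  fixes R :: "('r, 'q) ring_scheme" and P Q :: "('r, 'x) bigraded"
    and W :: "int \<Rightarrow> (int \<Rightarrow> 'x) \<Rightarrow> (int \<Rightarrow> 'x)"
  assumes R: "ring R" and P: "P \<in> Z_complexes R" and Q: "Q \<in> Z_complexes R"
    and W: "\<And>i. W i \<in> filtered_maps R 0 (Bmod P i) (Bmod Q i)"
    and Wd: "\<And>i x. x \<in> carrier (laurent (Bmod P i)) \<Longrightarrow> W (i + 1) (Cdiff (hat_cpx P) i x) = Cdiff (hat_cpx Q) i (W i x)"
begin

abbreviation "dP \<equiv> Cdiff (hat_cpx P)"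
abbreviation "dQ \<equiv> Cdiff (hat_cpx Q)"

abbreviation "boundary \<equiv> boundary_maps P Q"
abbreviation "defect \<equiv> defect_maps P Q W"

lemmas famP = Z_complexD(2)[OF R P]
lemmas famQ = Z_complexD(2)[OF R Q]
lemmas grpP = hat_group[OF R P]
lemmas grpQ = hat_group[OF R Q]
lemmas grpQ1 = right_module_group[OF module_familyD[OF famQ]]

lemma boundary_filtered:
  assumes S: "\<And>i. S i \<in> filtered_maps R L (Bmod P i) (Bmod Q (i - 1))"
  shows "boundary S i \<in> filtered_maps R L (Bmod P i) (Bmod Q i)"
proof -
  have d: "dQ (i - 1) \<in> filtered_maps R 0 (Bmod Q (i - 1)) (Bmod Q i)"
    using Z_complexD(3)[OF R Q, of "i - 1"] by simp
  have S1: "S (i + 1) \<in> filtered_maps R L (Bmod P (i + 1)) (Bmod Q i)" using S[of "i + 1"] by simp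
  show ?thesis
    using filtered_map_plus[OF R famP famQ filtered_map_comp[OF S d, simplified]
        filtered_map_comp[OF Z_complexD(3)[OF R P] S1, simplified]]
    by (simp add: boundary_maps_def[abs_def])
qed

lemma boundary_chain:
  assumes S: "\<And>i. S i \<in> filtered_maps R L (Bmod P i) (Bmod Q (i - 1))" and x: "x \<in> carrier (laurent (Bmod P i))"
  shows "boundary S (i + 1) (dP i x) = dQ i (boundary S i x)"
proof -
  have S1: "S (i + 1) \<in> filtered_maps R L (Bmod P (i + 1)) (Bmod Q i)" for i using S[of "i + 1"] by simp
  have dx: "dP i x \<in> carrier (laurent (Bmod P (i + 1)))" by (rule hat_diff_closed(1)[OF R P x])
  have Sx: "S i x \<in> carrier (laurent (Bmod Q (i - 1)))" by (rule hom_closed[OF filtered_mapD(1)[OF S] x])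
  have Sdx: "S (i + 1) (dP i x) \<in> carrier (laurent (Bmod Q i))" by (rule hom_closed[OF filtered_mapD(1)[OF S1] dx])
  have dSx: "dQ (i - 1) (S i x) \<in> carrier (laurent (Bmod Q i))" by (rule hom_closed[OF hat_diff_hom(3)[OF R Q] Sx])
  have ddS: "dQ i (dQ (i - 1) (S i x)) = \<zero>\<^bsub>laurent (Bmod Q (i + 1))\<^esub>"
    using hat_diff_diff[OF R Q Sx] by (simp add: algebra_simps)
  have S0: "S (i + 2) \<zero>\<^bsub>laurent (Bmod P (i + 2))\<^esub> = \<zero>\<^bsub>laurent (Bmod Q (i + 1))\<^esub>"
    using hom_zero[OF filtered_mapD(1)[OF S1[of "i + 1"]] grpP grpQ] by (simp add: algebra_simps)
  have c: "dQ i (S (i + 1) (dP i x)) \<in> carrier (laurent (Bmod Q (i + 1)))"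
    by (rule hat_diff_closed(1)[OF R Q Sdx])
  have "boundary S (i + 1) (dP i x) = dQ i (S (i + 1) (dP i x)) \<oplus>\<^bsub>laurent (Bmod Q (i + 1))\<^esub> S (i + 2) (dP (i + 1) (dP i x))"
    by (simp add: boundary_maps_def add.assoc)
  also have "\<dots> = dQ i (S (i + 1) (dP i x))"
    unfolding hat_diff_diff[OF R P x] S0 using c by (simp add: group_simps[OF grpQ])
  also have "\<dots> = dQ i (boundary S i x)"
    unfolding boundary_maps_def hom_add[OF hat_diff_hom(1)[OF R Q] dSx Sdx] ddS using c by (simp add: group_simps[OF grpQ])
  finally show ?thesis .
qed

lemma defect_filtered:
  assumes S: "S \<in> Z_homotopies R P Q"
  shows "defect S i \<in> filtered_maps R (- 1) (Bmod P i) (Bmod Q i)"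
  unfolding defect_maps_def[abs_def]
  by (intro filtered_map_plus[OF R famP famQ filtered_map_weaken[OF W]]
      filtered_map_minus[OF R famP famQ] boundary_filtered Z_homotopyD(1)[OF S]) simp_all

lemma defect_chain:
  assumes S: "S \<in> Z_homotopies R P Q" and x: "x \<in> carrier (laurent (Bmod P i))"
  shows "defect S (i + 1) (dP i x) = dQ i (defect S i x)"
proof -
  have b: "boundary S i x \<in> carrier (laurent (Bmod Q i))"
    by (rule hom_closed[OF filtered_mapD(1)[OF boundary_filtered[OF Z_homotopyD(1)[OF S]]] x])
  have w: "W i x \<in> carrier (laurent (Bmod Q i))" by (rule hom_closed[OF filtered_mapD(1)[OF W] x])
  have mb: "\<ominus>\<^bsub>laurent (Bmod Q i)\<^esub> boundary S i x \<in> carrier (laurent (Bmod Q i))" using b by (simp add: group_simps[OF grpQ])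
  show ?thesis
    unfolding defect_maps_def boundary_chain[OF Z_homotopyD(1)[OF S] x] Wd[OF x]
      hom_add[OF hat_diff_hom(1)[OF R Q] w mb] hom_minus[OF hat_diff_hom(1)[OF R Q] grpQ grpQ b] ..
qed

text \<open>The leading part of the defect, at level \<open>N\<close>, is a chain map between graded pieces. A null-homotopy of it,
  regarded as a map of level \<open>N\<close>, is added to \<open>S\<close> and removes that part. The change is invisible below
  level \<open>N\<close>, so that infinitely many corrections can be made.\<close>

lemma raise_defect:
  assumes S: "S \<in> Z_homotopies R P Q" and D: "\<And>i. defect S i \<in> filtered_maps R N (Bmod P i) (Bmod Q i)"
    and N: "N \<ge> 0" and null: "\<And>j. null_in_degree R 0 (Z_column P j) (Z_column Q (j + N))"
  shows "\<exists>S'\<in>Z_homotopies R P Q. (\<forall>i. defect S' i \<in> filtered_maps R (N + 1) (Bmod P i) (Bmod Q i)) \<and>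
     (\<forall>i b x k. x \<in> carrier (laurent (Bmod P i)) \<longrightarrow> starts_at (Bmod P i) b x \<longrightarrow> k < b + N \<longrightarrow> S' i x k = S i x k)"
proof -
  define e where "e j i x = defect S i (single\<^sub>Z (Bmod P i) j x) (j + N)" for j i x
  have sP: "single\<^sub>Z (Bmod P i) j x \<in> carrier (laurent (Bmod P i))" if "x \<in> carrier (Bmod P i j)" for i j x
    by (rule hom_closed[OF single_laurent[OF famP] that])
  have e: "e j i \<in> rmod_hom R (Bmod P i j) (Bmod Q i (j + N))" for i j
    unfolding e_def[abs_def] using family_of_filtered[OF R famP famQ D, of i j 0] by simp
  have dP_start: "starts_at (Bmod P (i + 1)) j (dP i (single\<^sub>Z (Bmod P i) j x))"
      and dP_lead: "dP i (single\<^sub>Z (Bmod P i) j x) j = Bdiff P 0 i j x" if "x \<in> carrier (Bmod P i j)" for i j x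
    using filtered_mapD(2)[OF Z_complexD(3)[OF R P] sP[OF that] starts_at_single] Z_complexD(4)[OF R P that, of 0] by simp_all
  have dQ_lead: "dQ i y b = Bdiff Q 0 i b (y b)" if y: "y \<in> carrier (laurent (Bmod Q i))" and b: "starts_at (Bmod Q i) b y" for i y b
    using filtered_map_leading[OF R famQ famQ Z_complexD(3)[OF R Q] y b] Z_complexD(4)[OF R Q laurent_closed[OF y], of b 0] by simp
  have ed: "e j (i + 1) (Bdiff P 0 i j x) = Bdiff Q 0 i (j + N) (e j i x)" if x: "x \<in> carrier (Bmod P i j)" for i j x
  proof -
    have dx: "dP i (single\<^sub>Z (Bmod P i) j x) \<in> carrier (laurent (Bmod P (i + 1)))"
      by (rule hat_diff_closed(1)[OF R P sP[OF x]])
    have "e j (i + 1) (Bdiff P 0 i j x) = defect S (i + 1) (dP i (single\<^sub>Z (Bmod P i) j x)) (j + N)"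
      unfolding e_def filtered_map_leading[OF R famP famQ D dx dP_start[OF x]] dP_lead[OF x] ..
    also have "\<dots> = dQ i (defect S i (single\<^sub>Z (Bmod P i) j x)) (j + N)"
      by (simp only: defect_chain[OF S sP[OF x]])
    also have "\<dots> = Bdiff Q 0 i (j + N) (e j i x)"
      unfolding e_def
      by (rule dQ_lead[OF hom_closed[OF filtered_mapD(1)[OF D] sP[OF x]] filtered_mapD(2)[OF D sP[OF x] starts_at_single]])
    finally show ?thesis .
  qed
  have "\<exists>k. (\<forall>i. k i \<in> rmod_hom R (Bmod P i j) (Bmod Q (i - 1) (j + N))) \<and>
      (\<forall>i. \<forall>x\<in>carrier (Bmod P i j). e j i x =
         Bdiff Q 0 (i - 1) (j + N) (k i x) \<oplus>\<^bsub>Bmod Q i (j + N)\<^esub> k (i + 1) (Bdiff P 0 i j x))" for j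
    using null_in_degreeE[OF null[of j], of "e j"] e[of j] ed[of _ _ j] by simp metis
  then obtain k where k: "\<And>j i. k j i \<in> rmod_hom R (Bmod P i j) (Bmod Q (i - 1) (j + N))"
    and ek: "\<And>j i x. x \<in> carrier (Bmod P i j) \<Longrightarrow> e j i x =
         Bdiff Q 0 (i - 1) (j + N) (k j i x) \<oplus>\<^bsub>Bmod Q i (j + N)\<^esub> k j (i + 1) (Bdiff P 0 i j x)"
    by metis
  define \<kappa> where "\<kappa> i n j = (if n = 0 then k j i else (\<lambda>x. \<zero>\<^bsub>Bmod Q (i - 1) (j + N + int n)\<^esub>))" for i and n :: nat and j
  have \<kappa>: "\<kappa> i \<in> filtered_families R N (Bmod P i) (Bmod Q (i - 1))" for i
    using k by (auto simp: filtered_families_def \<kappa>_def intro: hom_const_zero module_familyD[OF famQ])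
  define K where "K i = apply_family (Bmod P i) (Bmod Q (i - 1)) N (\<kappa> i)" for i
  have K: "K i \<in> filtered_maps R N (Bmod P i) (Bmod Q (i - 1))" for i
    unfolding K_def by (rule apply_family_filtered[OF R famP famQ \<kappa>])
  have K_lead: "K i (single\<^sub>Z (Bmod P i) j x) (j + N) = k j i x" if "x \<in> carrier (Bmod P i j)" for i j x
    using apply_family_single[OF R famP famQ \<kappa> that, of 0] by (simp add: K_def \<kappa>_def)
  have K1: "K (i + 1) \<in> filtered_maps R N (Bmod P (i + 1)) (Bmod Q i)" for i using K[of "i + 1"] by simp
  define S' where "S' i x = S i x \<oplus>\<^bsub>laurent (Bmod Q (i - 1))\<^esub> K i x" for i x
  have S': "S' \<in> Z_homotopies R P Q"
    unfolding Z_homotopies_def S'_def[abs_def] using N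
    by (auto intro!: filtered_map_plus[OF R famP famQ] Z_homotopyD(1)[OF S] filtered_map_weaken[OF K])
  have S1: "S (i + 1) \<in> filtered_maps R (- 1) (Bmod P (i + 1)) (Bmod Q i)" for i by (rule Z_homotopyD(2)[OF S])
  have defect': "defect S' i x = defect S i x \<oplus>\<^bsub>laurent (Bmod Q i)\<^esub> \<ominus>\<^bsub>laurent (Bmod Q i)\<^esub> boundary K i x"
    if x: "x \<in> carrier (laurent (Bmod P i))" for i x
  proof -
    interpret G: abelian_group "laurent (Bmod Q i)" by (rule grpQ)
    have dx: "dP i x \<in> carrier (laurent (Bmod P (i + 1)))" by (rule hat_diff_closed(1)[OF R P x])
    have Sx: "S i x \<in> carrier (laurent (Bmod Q (i - 1)))" and Kx: "K i x \<in> carrier (laurent (Bmod Q (i - 1)))"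
      by (rule hom_closed[OF filtered_mapD(1)[OF Z_homotopyD(1)[OF S]] x] hom_closed[OF filtered_mapD(1)[OF K] x])+
    have cl: "dQ (i - 1) (S i x) \<in> carrier (laurent (Bmod Q i))" "dQ (i - 1) (K i x) \<in> carrier (laurent (Bmod Q i))"
      "S (i + 1) (dP i x) \<in> carrier (laurent (Bmod Q i))" "K (i + 1) (dP i x) \<in> carrier (laurent (Bmod Q i))"
      "W i x \<in> carrier (laurent (Bmod Q i))"
      by (rule hom_closed[OF hat_diff_hom(3)[OF R Q] Sx] hom_closed[OF hat_diff_hom(3)[OF R Q] Kx]
          hom_closed[OF filtered_mapD(1)[OF S1] dx] hom_closed[OF filtered_mapD(1)[OF K1] dx]
          hom_closed[OF filtered_mapD(1)[OF W] x])+
    have "boundary S' i x = boundary S i x \<oplus>\<^bsub>laurent (Bmod Q i)\<^esub> boundary K i x"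
      using cl by (simp add: boundary_maps_def S'_def hom_add[OF hat_diff_hom(3)[OF R Q] Sx Kx] G.a_ac)
    then show ?thesis using cl by (simp add: defect_maps_def boundary_maps_def G.minus_add G.a_assoc)
  qed
  have D': "defect S' i \<in> filtered_maps R (N + 1) (Bmod P i) (Bmod Q i)" for i
  proof (rule filtered_map_raise[OF R famP famQ])
    show "defect S' i \<in> filtered_maps R N (Bmod P i) (Bmod Q i)"
      by (rule filtered_map_cong[OF filtered_map_plus[OF R famP famQ D
            filtered_map_minus[OF R famP famQ boundary_filtered[OF K]]] laurent_module(1)[OF R famP] defect'])
    fix j x n assume x: "x \<in> carrier (Bmod P i j)" and "int n < 1"
    then have n: "n = 0" by simp
    let ?s = "single\<^sub>Z (Bmod P i) j x"
    interpret G: abelian_group "Bmod Q i (j + N)" by (rule grpQ1)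
    have dx: "dP i ?s \<in> carrier (laurent (Bmod P (i + 1)))" by (rule hat_diff_closed(1)[OF R P sP[OF x]])
    have "boundary K i ?s (j + N) = dQ (i - 1) (K i ?s) (j + N) \<oplus>\<^bsub>Bmod Q i (j + N)\<^esub> K (i + 1) (dP i ?s) (j + N)"
      by (simp add: boundary_maps_def laurent_simps)
    also have "dQ (i - 1) (K i ?s) (j + N) = Bdiff Q 0 (i - 1) (j + N) (k j i x)"
      using dQ_lead[OF hom_closed[OF filtered_mapD(1)[OF K] sP[OF x]] filtered_mapD(2)[OF K sP[OF x] starts_at_single]]
        K_lead[OF x] by simp
    also have "K (i + 1) (dP i ?s) (j + N) = k j (i + 1) (Bdiff P 0 i j x)"
      unfolding filtered_map_leading[OF R famP famQ K1 dx dP_start[OF x]] dP_lead[OF x]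
      by (rule K_lead) (use laurent_closed[OF dx, of j] dP_lead[OF x] in simp)
    finally have b: "boundary K i ?s (j + N) = e j i x" by (simp only: ek[OF x])
    have bc: "boundary K i ?s \<in> carrier (laurent (Bmod Q i))"
      by (rule hom_closed[OF filtered_mapD(1)[OF boundary_filtered[OF K]] sP[OF x]])
    have "defect S' i ?s (j + N) = e j i x \<oplus>\<^bsub>Bmod Q i (j + N)\<^esub> \<ominus>\<^bsub>Bmod Q i (j + N)\<^esub> e j i x"
      using defect'[OF sP[OF x]] b by (simp add: laurent_simps(3) laurent_module(2)[OF R famQ bc] e_def)
    also have "\<dots> = \<zero>\<^bsub>Bmod Q i (j + N)\<^esub>" using hom_closed[OF e x] by (simp add: G.r_neg)
    finally show "defect S' i ?s (j + N + int n) = \<zero>\<^bsub>Bmod Q i (j + N + int n)\<^esub>" using n by simp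
  qed
  have "S' i x l = S i x l" if "x \<in> carrier (laurent (Bmod P i))" "starts_at (Bmod P i) b x" "l < b + N" for i b x l
  proof -
    have "K i x l = \<zero>\<^bsub>Bmod Q (i - 1) l\<^esub>"
      using filtered_mapD(2)[OF K that(1,2)] that(3) by (simp add: starts_at_def)
    moreover have "S i x l \<in> carrier (Bmod Q (i - 1) l)"
      by (rule laurent_closed[OF hom_closed[OF filtered_mapD(1)[OF Z_homotopyD(1)[OF S]] that(1)]])
    ultimately show ?thesis by (simp add: S'_def laurent_simps(3) group_simps[OF grpQ1])
  qed
  then show ?thesis using S' D' by blast
qed

text \<open>The limit \<open>L\<close> of the corrected homotopies \<open>T n\<close> takes its component of index \<open>n\<close> from \<open>T n\<close>, where later corrections
  do not change it. In each coordinate of the equation for a given family, \<open>L\<close> may be replaced by \<open>T n\<close> for some \<open>n\<close>, so the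
  defect of \<open>L\<close> vanishes.\<close>

lemma homotopy_by_successive_corrections:
  assumes S: "S \<in> Z_homotopies R P Q" and D: "\<And>i. defect S i \<in> filtered_maps R 1 (Bmod P i) (Bmod Q i)"
    and null: "\<And>j N. N \<ge> 1 \<Longrightarrow> null_in_degree R 0 (Z_column P j) (Z_column Q (j + N))"
  shows "\<exists>S\<in>Z_homotopies R P Q. homotopy_between (hat_cpx P) (hat_cpx Q) S W (zero_map (hat_cpx Q))"
proof -
  let ?lev = "\<lambda>n S. S \<in> Z_homotopies R P Q \<and> (\<forall>i. defect S i \<in> filtered_maps R (int n + 1) (Bmod P i) (Bmod Q i))"
  let ?step = "\<lambda>n S S'. \<forall>i b x k. x \<in> carrier (laurent (Bmod P i)) \<longrightarrow> starts_at (Bmod P i) b x \<longrightarrow>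
      k < b + (int n + 1) \<longrightarrow> S' i x k = S i x k"
  have "\<exists>T. \<forall>n. ?lev n (T n) \<and> ?step n (T n) (T (Suc n))"
  proof (rule dependent_nat_choice)
    show "\<exists>S. ?lev 0 S" using S D by auto
    fix S n assume "?lev n S"
    then have S: "S \<in> Z_homotopies R P Q" and D: "\<And>i. defect S i \<in> filtered_maps R (int n + 1) (Bmod P i) (Bmod Q i)"
      by auto
    have "0 \<le> int n + 1" "1 \<le> int n + 1" by simp_all
    from raise_defect[OF S D this(1) null[OF this(2)]]
    show "\<exists>S'. ?lev (Suc n) S' \<and> ?step n S S'" by (simp add: add_ac) blast
  qed
  then obtain T where T: "\<And>n. T n \<in> Z_homotopies R P Q"
    and DT: "\<And>n i. defect (T n) i \<in> filtered_maps R (int n + 1) (Bmod P i) (Bmod Q i)"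
    and Tstep: "\<And>n i b x k. x \<in> carrier (laurent (Bmod P i)) \<Longrightarrow> starts_at (Bmod P i) b x \<Longrightarrow>
      k < b + (int n + 1) \<Longrightarrow> T (Suc n) i x k = T n i x k" by blast
  have stable: "T n' i x k = T n i x k"
    if "n \<le> n'" "x \<in> carrier (laurent (Bmod P i))" "starts_at (Bmod P i) b x" "k < b + (int n + 1)" for n n' i x b k
    using that(1)
  proof (induction n' rule: dec_induct)
    case (step n')
    then show ?case using Tstep[OF that(2,3), of k n'] that(4) by simp
  qed simp
  have sP: "single\<^sub>Z (Bmod P i) j x \<in> carrier (laurent (Bmod P i))" if "x \<in> carrier (Bmod P i j)" for i j x
    by (rule hom_closed[OF single_laurent[OF famP] that])
  define \<sigma> where "\<sigma> i n j x = T n i (single\<^sub>Z (Bmod P i) j x) (j + - 1 + int n)" for i n j x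
  have \<sigma>: "\<sigma> i \<in> filtered_families R (- 1) (Bmod P i) (Bmod Q (i - 1))" for i
    using family_of_filtered[OF R famP famQ Z_homotopyD(1)[OF T]] by (simp add: filtered_families_def \<sigma>_def[abs_def])
  define L where "L i = apply_family (Bmod P i) (Bmod Q (i - 1)) (- 1) (\<sigma> i)" for i
  have Li: "L i \<in> filtered_maps R (- 1) (Bmod P i) (Bmod Q (i - 1))" for i
    unfolding L_def by (rule apply_family_filtered[OF R famP famQ \<sigma>])
  then have L: "L \<in> Z_homotopies R P Q" by (simp add: Z_homotopies_def)
  have agree: "L i x k = T n i x k"
    if x: "x \<in> carrier (laurent (Bmod P i))" and b: "starts_at (Bmod P i) b x" and k: "k < b + (int n + 1)" for n i x b k
  proof -
    let ?F = "\<lambda>x. L i x \<oplus>\<^bsub>laurent (Bmod Q (i - 1))\<^esub> \<ominus>\<^bsub>laurent (Bmod Q (i - 1))\<^esub> T n i x"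
    have Tcl: "T n i y \<in> carrier (laurent (Bmod Q (i - 1)))" and Lcl: "L i y \<in> carrier (laurent (Bmod Q (i - 1)))"
      if "y \<in> carrier (laurent (Bmod P i))" for y
      by (rule hom_closed[OF filtered_mapD(1)[OF Z_homotopyD(1)[OF T]] that] hom_closed[OF filtered_mapD(1)[OF Li] that])+
    have F: "?F y l = L i y l \<oplus>\<^bsub>Bmod Q (i - 1) l\<^esub> \<ominus>\<^bsub>Bmod Q (i - 1) l\<^esub> T n i y l"
      if "y \<in> carrier (laurent (Bmod P i))" for y l
      by (simp add: laurent_simps(3) laurent_module(2)[OF R famQ Tcl[OF that]])
    have "?F \<in> filtered_maps R (- 1 + (int n + 2)) (Bmod P i) (Bmod Q (i - 1))"
    proof (rule filtered_map_raise[OF R famP famQ])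
      show "?F \<in> filtered_maps R (- 1) (Bmod P i) (Bmod Q (i - 1))"
        by (intro filtered_map_plus[OF R famP famQ Li] filtered_map_minus[OF R famP famQ] Z_homotopyD(1)[OF T])
      fix j y n' assume y: "y \<in> carrier (Bmod P i j)" and n': "int n' < int n + 2"
      let ?l = "j + - 1 + int n'"
      have "L i (single\<^sub>Z (Bmod P i) j y) ?l = T n' i (single\<^sub>Z (Bmod P i) j y) ?l"
        unfolding L_def apply_family_single[OF R famP famQ \<sigma> y] by (simp add: \<sigma>_def)
      also have "\<dots> = T n i (single\<^sub>Z (Bmod P i) j y) ?l"
      proof (cases "n' \<le> n")
        case True
        then show ?thesis using stable[OF True sP[OF y] starts_at_single, of ?l] by simp
      next
        case False
        then show ?thesis using stable[of n n', OF _ sP[OF y] starts_at_single, of ?l] n' by simp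
      qed
      finally show "?F (single\<^sub>Z (Bmod P i) j y) ?l = \<zero>\<^bsub>Bmod Q (i - 1) ?l\<^esub>"
        unfolding F[OF sP[OF y]] using laurent_closed[OF Tcl[OF sP[OF y]], of ?l]
        by (simp add: abelian_group.r_neg[OF grpQ1])
    qed
    from filtered_mapD(2)[OF this x b] have "?F x k = \<zero>\<^bsub>Bmod Q (i - 1) k\<^esub>" using k by (simp add: starts_at_def)
    then show ?thesis
      unfolding F[OF x] using laurent_closed[OF Tcl[OF x], of k] laurent_closed[OF Lcl[OF x], of k]
        abelian_group.eq_iff_diff_zero[OF grpQ1] by simp
  qed
  have "W i x = boundary L i x" if x: "x \<in> carrier (laurent (Bmod P i))" for i x
  proof
    fix k
    obtain b where b: "starts_at (Bmod P i) b x" using x by (auto simp: laurent_simps starts_at_def)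
    define n where "n = nat (k - b)"
    have k: "k < b + (int n + 1)" by (simp add: n_def)
    have dx: "dP i x \<in> carrier (laurent (Bmod P (i + 1)))" by (rule hat_diff_closed(1)[OF R P x])
    have db: "starts_at (Bmod P (i + 1)) b (dP i x)"
      using filtered_mapD(2)[OF Z_complexD(3)[OF R P] x b] by simp
    have d1: "dQ (i - 1) \<in> filtered_maps R 0 (Bmod Q (i - 1)) (Bmod Q i)"
      using Z_complexD(3)[OF R Q, of "i - 1"] by simp
    have "dQ (i - 1) (L i x) k = dQ (i - 1) (T n i x) k"
      using k by (intro filtered_map_local[OF R famQ famQ d1, where c = "b + (int n + 1)"] agree[OF x b]
          hom_closed[OF filtered_mapD(1)[OF Li] x] hom_closed[OF filtered_mapD(1)[OF Z_homotopyD(1)[OF T]] x]) simp_all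
    moreover have "L (i + 1) (dP i x) k = T n (i + 1) (dP i x) k" by (rule agree[OF dx db k])
    ultimately have bk: "boundary L i x k = boundary (T n) i x k" by (simp add: boundary_maps_def laurent_simps)
    have bc: "boundary (T n) i x \<in> carrier (laurent (Bmod Q i))"
      by (rule hom_closed[OF filtered_mapD(1)[OF boundary_filtered[OF Z_homotopyD(1)[OF T]]] x])
    have "defect (T n) i x k = \<zero>\<^bsub>Bmod Q i k\<^esub>"
      using filtered_mapD(2)[OF DT x b] k by (simp add: starts_at_def)
    then have "W i x k = boundary (T n) i x k"
      using abelian_group.eq_iff_diff_zero[OF grpQ1 laurent_closed[OF hom_closed[OF filtered_mapD(1)[OF W] x]] laurent_closed[OF bc]]
      by (simp add: defect_maps_def laurent_simps(3) laurent_module(2)[OF R famQ bc])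
    then show "W i x k = boundary L i x k" by (simp add: bk)
  qed
  moreover have "boundary L i x \<in> carrier (laurent (Bmod Q i))" if "x \<in> carrier (laurent (Bmod P i))" for i x
    by (rule hom_closed[OF filtered_mapD(1)[OF boundary_filtered[OF Li]] that])
  ultimately have "homotopy_between (hat_cpx P) (hat_cpx Q) L W (zero_map (hat_cpx Q))"
    unfolding homotopy_between_def zero_map_def by (simp add: boundary_maps_def[symmetric] group_simps[OF grpQ])
  then show ?thesis using L by blast
qed

end

section \<open>Uniqueness of lifts to \<open>\<int>\<^sub>+ Proj\<close> up to homotopy\<close>

lemma Bmod_Psi [simp]: "Bmod (Psi_obj X) i j = Bmod X (i - j) j"
  by (simp add: Psi_obj_def)

lemma Bdiff_Psi [simp]: "Bdiff (Psi_obj X) n i j = Bdiff X n (i - j) j"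
  by (simp add: Psi_obj_def)

lemma Psi_obj_complex:
  assumes "X \<in> G_objects R"
  shows "Psi_obj X \<in> Z_complexes R"
proof -
  have i: "i + 1 - (j + int n) = i - j + 1 - int n" "i + 2 - (j + int n) = i - j + 2 - int n" for i j n
    by simp_all
  show ?thesis
    using assms unfolding G_objects_def Z_complexes_def by (simp add: i)
qed

lemma Psi_map_Z_map:
  assumes "\<alpha> \<in> G_maps R X Y"
  shows "Psi_map \<alpha> \<in> Z_maps R (Psi_obj X) (Psi_obj Y)"
proof -
  have i: "i - (j + int n) = i - j - int n" "i + 1 - j = i - j + 1" for i j n
    by simp_all
  show ?thesis
    using assms unfolding G_maps_def Z_maps_def by (simp add: i Psi_map_def)
qed

context
  fixes R :: "('r, 'q) ring_scheme" and T :: "('r, 'm) cpx"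
    and X Y :: "('r, 'x) sumT_cpx" and LX LY :: "('r, 'x) bigraded"
  assumes R: "ring R" and T: "tilting_complex R T"
    and X: "X \<in> SumT_complexes R T" and Y: "Y \<in> SumT_complexes R T"
    and LX: "LX \<in> G_objects R" and LY: "LY \<in> G_objects R"
    and BX: "Bmod LX = Smod X" and BY: "Bmod LY = Smod Y"
    and X0: "\<And>i j x. x \<in> carrier (Smod X i j) \<Longrightarrow> Bdiff LX 0 i j x = S0 X i j x"
    and X1: "\<And>i j x. x \<in> carrier (Smod X i j) \<Longrightarrow> Bdiff LX 1 i j x =
      (if even (i + j) then S1 X i j x else \<ominus>\<^bsub>Smod X i (j + 1)\<^esub> S1 X i j x)"
    and Y0: "\<And>i j x. x \<in> carrier (Smod Y i j) \<Longrightarrow> Bdiff LY 0 i j x = S0 Y i j x"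
    and Y1: "\<And>i j x. x \<in> carrier (Smod Y i j) \<Longrightarrow> Bdiff LY 1 i j x =
      (if even (i + j) then S1 Y i j x else \<ominus>\<^bsub>Smod Y i (j + 1)\<^esub> S1 Y i j x)"
begin

text \<open>The \<open>j\<close>-th column of \<open>\<Psi>(X\<^sup>*\<^sup>*)\<close> is the \<open>j\<close>-th column of \<open>X\<close> shifted by \<open>-j\<close>, so a map from column \<open>j\<close> to column \<open>j + N\<close>
  has degree \<open>-N\<close> as a map between direct sums of copies of \<open>T\<close>.\<close>

lemma null_in_degree_Psi:
  assumes N: "N \<noteq> 0"
  shows "null_in_degree R 0 (Z_column (Psi_obj LX) j) (Z_column (Psi_obj LY) (j + N))"
proof (rule null_in_degreeI)
  fix E assume "\<And>i. E i \<in> rmod_hom R (Cmod (Z_column (Psi_obj LX) j) i) (Cmod (Z_column (Psi_obj LY) (j + N)) (i + 0))"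
    and "\<And>i x. x \<in> carrier (Cmod (Z_column (Psi_obj LX) j) i) \<Longrightarrow>
      E (i + 1) (Cdiff (Z_column (Psi_obj LX) j) i x) = Cdiff (Z_column (Psi_obj LY) (j + N)) (i + 0) (E i x)"
  then have E: "\<And>i. E i \<in> rmod_hom R (Smod X (i - j) j) (Smod Y (i - (j + N)) (j + N))"
    and Ed: "\<And>i x. x \<in> carrier (Smod X (i - j) j) \<Longrightarrow>
      E (i + 1) (Bdiff LX 0 (i - j) j x) = Bdiff LY 0 (i - (j + N)) (j + N) (E i x)"
    by (simp_all add: BX BY)
  have null: "null_in_degree R (- N) (col X j) (col Y (j + N))"
    using N by (intro null_in_degree_Sum_T[OF T _ SumT_complexD(1)[OF X] SumT_complexD(1)[OF Y]]) simp
  have 1: "E (p + j) \<in> rmod_hom R (Cmod (col X j) p) (Cmod (col Y (j + N)) (p + - N))" for p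
    using E[of "p + j"] by simp
  have 2: "E (p + 1 + j) (Cdiff (col X j) p x) = Cdiff (col Y (j + N)) (p + - N) (E (p + j) x)"
    if x: "x \<in> carrier (Cmod (col X j) p)" for p x
    using x Ed[of x "p + j"] hom_closed[OF 1 x] by (simp add: X0 Y0 add_ac)
  obtain k where k: "\<And>p. k p \<in> rmod_hom R (Smod X p j) (Smod Y (p + - N - 1) (j + N))"
    and Ek: "\<And>p x. x \<in> carrier (Smod X p j) \<Longrightarrow>
       E (p + j) x = S0 Y (p + - N - 1) (j + N) (k p x) \<oplus>\<^bsub>Smod Y (p + - N) (j + N)\<^esub> k (p + 1) (S0 X p j x)"
    using null_in_degreeE[where E = "\<lambda>p. E (p + j)", OF null 1 2] by (simp only: col_simps) blast
  have k': "k (i - j) \<in> rmod_hom R (Smod X (i - j) j) (Smod Y (i - 1 - (j + N)) (j + N))" for i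
  proof -
    have "i - 1 - (j + N) = i - j + - N - 1" by simp
    then show ?thesis using k[of "i - j"] by (simp only:)
  qed
  moreover have "E i x = Bdiff LY 0 (i - 1 - (j + N)) (j + N) (k (i - j) x) \<oplus>\<^bsub>Smod Y (i - (j + N)) (j + N)\<^esub>
      k (i + 1 - j) (Bdiff LX 0 (i - j) j x)" if x: "x \<in> carrier (Smod X (i - j) j)" for i x
  proof -
    have i: "i - 1 - (j + N) = i - j + - N - 1" "i - (j + N) = i - j + - N" "i + 1 - j = i - j + 1" "i - j + j = i"
      by simp_all
    have "Bdiff LY 0 (i - j + - N - 1) (j + N) (k (i - j) x) = S0 Y (i - j + - N - 1) (j + N) (k (i - j) x)"
      by (rule Y0[OF hom_closed[OF k x]])
    then show ?thesis using Ek[OF x] unfolding i X0[OF x] by (simp only:)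
  qed
  ultimately show "\<exists>k. (\<forall>i. k i \<in> rmod_hom R (Cmod (Z_column (Psi_obj LX) j) i) (Cmod (Z_column (Psi_obj LY) (j + N)) (i + 0 - 1))) \<and>
       (\<forall>i. \<forall>x\<in>carrier (Cmod (Z_column (Psi_obj LX) j) i).
          E i x = Cdiff (Z_column (Psi_obj LY) (j + N)) (i + 0 - 1) (k i x)
            \<oplus>\<^bsub>Cmod (Z_column (Psi_obj LY) (j + N)) (i + 0)\<^esub> k (i + 1) (Cdiff (Z_column (Psi_obj LX) j) i x))"
    by (intro exI[of _ "\<lambda>i. k (i - j)"]) (simp add: BX BY)
qed

text \<open>A homotopy \<open>h\<close> between \<open>\<alpha>\<close> and \<open>\<beta>\<close> over \<open>Sum-T\<close>, together with the chain homotopies \<open>\<kappa>\<close> in the columns, provides the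
  components of index \<open>0\<close> and \<open>1\<close> of the required homotopy. They leave a defect of level \<open>1\<close>, which is then
  removed by successive corrections.\<close>

lemma Psi_maps_homotopic:
  assumes f: "f \<in> Z_maps R (Psi_obj LX) (Psi_obj LY)" and g: "g \<in> Z_maps R (Psi_obj LX) (Psi_obj LY)"
    and f0: "\<And>i j x. x \<in> carrier (Smod X (i - j) j) \<Longrightarrow> f 0 i j x = \<alpha> (i - j) j x"
    and g0: "\<And>i j x. x \<in> carrier (Smod X (i - j) j) \<Longrightarrow> g 0 i j x = \<beta> (i - j) j x"
    and \<alpha>\<beta>: "(\<alpha>, \<beta>) \<in> SumT_rel R X Y"
  shows "(f, g) \<in> eta_homotopy_rel R (Psi_obj LX) (Psi_obj LY)"
proof -
  let ?P = "Psi_obj LX" and ?Q = "Psi_obj LY"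
  have P: "?P \<in> Z_complexes R" and Q: "?Q \<in> Z_complexes R" by (rule Psi_obj_complex[OF LX] Psi_obj_complex[OF LY])+
  note famP = Z_complexD(2)[OF R P] and famQ = Z_complexD(2)[OF R Q]
  note grpQ1 = right_module_group[OF module_familyD[OF famQ]]
  define W where "W i x = hat_map ?P ?Q f i x \<oplus>\<^bsub>laurent (Bmod ?Q i)\<^esub> \<ominus>\<^bsub>laurent (Bmod ?Q i)\<^esub> hat_map ?P ?Q g i x" for i x
  have Wc: "W \<in> chain_maps R (hat_cpx ?P) (hat_cpx ?Q)"
    using chain_map_plus[OF Z_complexD(5)[OF R P] Z_complexD(5)[OF R Q] Z_mapD(3)[OF R P Q f]
        chain_map_minus[OF Z_complexD(5)[OF R P] Z_complexD(5)[OF R Q] Z_mapD(3)[OF R P Q g]]]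
    by (simp add: plus_maps_def W_def[abs_def])
  have Wf: "W i \<in> filtered_maps R 0 (Bmod ?P i) (Bmod ?Q i)" for i
    using filtered_map_plus[OF R famP famQ Z_mapD(1)[OF R P Q f]
        filtered_map_minus[OF R famP famQ Z_mapD(1)[OF R P Q g]]]
    by (simp add: W_def[abs_def])
  have Wd: "W (i + 1) (Cdiff (hat_cpx ?P) i x) = Cdiff (hat_cpx ?Q) i (W i x)"
    if "x \<in> carrier (laurent (Bmod ?P i))" for i x
    using chain_mapD(2)[OF Wc, of x i] that by simp
  obtain h where \<alpha>: "\<alpha> \<in> SumT_maps R X Y" and \<beta>: "\<beta> \<in> SumT_maps R X Y" and h: "h \<in> SumT_homotopies R X Y"
    and hrel: "\<And>j. (\<lambda>i. \<alpha> i j, plus_maps (col Y j) (\<lambda>i. \<beta> i j) (SumT_boundary X Y h j))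
       \<in> homotopy_rel R (col X j) (col Y j)"
    using \<alpha>\<beta> unfolding SumT_rel_iff[OF X Y] by blast
  have "\<exists>\<kappa>. (\<forall>p. \<kappa> p \<in> rmod_hom R (Smod X p j) (Smod Y (p - 1) j)) \<and> (\<forall>p. \<forall>x\<in>carrier (Smod X p j).
     \<alpha> p j x = (\<beta> p j x \<oplus>\<^bsub>Smod Y p j\<^esub> (S1 Y p (j - 1) (h p j x) \<oplus>\<^bsub>Smod Y p j\<^esub> h p (j + 1) (S1 X p j x)))
       \<oplus>\<^bsub>Smod Y p j\<^esub> (S0 Y (p - 1) j (\<kappa> p x) \<oplus>\<^bsub>Smod Y p j\<^esub> \<kappa> (p + 1) (S0 X p j x)))" for j
    using homotopy_relD(3)[OF hrel[of j]]
    by (auto simp: degree_maps_def homotopy_between_def plus_maps_def SumT_boundary_def)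
  then obtain \<kappa> where \<kappa>: "\<And>j p. \<kappa> j p \<in> rmod_hom R (Smod X p j) (Smod Y (p - 1) j)"
    and \<alpha>_eq: "\<And>j p x. x \<in> carrier (Smod X p j) \<Longrightarrow>
     \<alpha> p j x = (\<beta> p j x \<oplus>\<^bsub>Smod Y p j\<^esub> (S1 Y p (j - 1) (h p j x) \<oplus>\<^bsub>Smod Y p j\<^esub> h p (j + 1) (S1 X p j x)))
       \<oplus>\<^bsub>Smod Y p j\<^esub> (S0 Y (p - 1) j (\<kappa> j p x) \<oplus>\<^bsub>Smod Y p j\<^esub> \<kappa> j (p + 1) (S0 X p j x))"
    by metis
  note hD = SumT_homotopyD[OF X Y h]
  have hh: "h p j \<in> rmod_hom R (Smod X p j) (Smod Y p (j - 1))" for p j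
    using chain_mapD(1)[OF hD(1)[of j], of p] by simp
  have h1: "h p (j + 1) \<in> rmod_hom R (Smod X p (j + 1)) (Smod Y p j)" for p j
    using hh[of p "j + 1"] by simp
  have hd: "h (p + 1) j (S0 X p j x) = S0 Y p (j - 1) (h p j x)" if "x \<in> carrier (Smod X p j)" for p j x
    using chain_mapD(2)[OF hD(1)[of j], of x p] that by simp
  have Ygrp: "abelian_group (Smod Y p j)" for p j
    using module_complexD(2)[OF SumT_complexD(2)[OF Y, of j], of p] by simp
  have Yrm: "right_module R (Smod Y p j)" for p j
    using module_complexD(1)[OF SumT_complexD(2)[OF Y, of j], of p] by simp
  have Xgrp: "abelian_group (Smod X p j)" for p j
    using module_complexD(2)[OF SumT_complexD(2)[OF X, of j], of p] by simp
  have S0X: "S0 X p j \<in> rmod_hom R (Smod X p j) (Smod X (p + 1) j)" for p j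
    using module_complexD(3)[OF SumT_complexD(2)[OF X, of j], of p] by simp
  have S0Y: "S0 Y p j \<in> rmod_hom R (Smod Y p j) (Smod Y (p + 1) j)" for p j
    using module_complexD(3)[OF SumT_complexD(2)[OF Y, of j], of p] by simp
  have S1X: "S1 X p j \<in> rmod_hom R (Smod X p j) (Smod X p (j + 1))" for p j
    using chain_mapD(1)[OF SumT_complexD(3)[OF X], of p j] by simp
  have S1Y: "S1 Y p j \<in> rmod_hom R (Smod Y p j) (Smod Y p (j + 1))" for p j
    using chain_mapD(1)[OF SumT_complexD(3)[OF Y], of p j] by simp
  have S1Y': "S1 Y p (j - 1) \<in> rmod_hom R (Smod Y p (j - 1)) (Smod Y p j)" for p j
    using S1Y[of p "j - 1"] by simp
  (* With d_1 = (-1)^i delta_1 in total degree i, the sign -(-1)^i makes d_1 s0 + s0 d_1 equal to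
     delta_1 h + h delta_1, while the two terms of d_0 s0 + s0 d_0 cancel, because h commutes with delta_0. *)
  define s0 where "s0 i j x = (if even i then \<ominus>\<^bsub>Smod Y (i - j) (j - 1)\<^esub> h (i - j) j x else h (i - j) j x)" for i j x
  have s0: "s0 i j \<in> rmod_hom R (Smod X (i - j) j) (Smod Y (i - j) (j - 1))" for i j
  proof -
    have "s0 i j = (if even i then (\<lambda>x. \<ominus>\<^bsub>Smod Y (i - j) (j - 1)\<^esub> h (i - j) j x) else h (i - j) j)"
      by (auto simp: s0_def)
    then show ?thesis using hh[of "i - j" j] hom_uminus[OF hh[of "i - j" j] Yrm] by simp
  qed
  (* Components of index 2 and higher are left to the corrections. *)
  define \<sigma> where "\<sigma> i n j = (if n = 0 then s0 i j else if n = 1 then \<kappa> j (i - j)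
      else (\<lambda>x. \<zero>\<^bsub>Bmod ?Q (i - 1) (j + - 1 + int n)\<^esub>))" for i and n :: nat and j
  have \<sigma>: "\<sigma> i \<in> filtered_families R (- 1) (Bmod ?P i) (Bmod ?Q (i - 1))" for i
  proof -
    have "\<sigma> i n j \<in> rmod_hom R (Bmod ?P i j) (Bmod ?Q (i - 1) (j + - 1 + int n))" for n j
    proof -
      consider "n = 0" | "n = 1" | "n \<noteq> 0" "n \<noteq> 1" by blast
      then show ?thesis
      proof cases
        case 1
        have e: "i - 1 - (j + - 1 + int 0) = i - j" "j + - 1 + int 0 = j - 1" by simp_all
        show ?thesis unfolding 1 Bmod_Psi BX BY e using s0[of i j] by (simp add: \<sigma>_def)
      next
        case 2
        have e: "i - 1 - j = i - j - 1" "j + - 1 + int 1 = j" by simp_all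
        show ?thesis unfolding 2 Bmod_Psi BX BY e using \<kappa>[of j "i - j"] by (simp add: \<sigma>_def)
      next
        case 3
        then have "\<sigma> i n j = (\<lambda>x. \<zero>\<^bsub>Bmod ?Q (i - 1) (j + - 1 + int n)\<^esub>)" unfolding \<sigma>_def by (simp only: if_False)
        then show ?thesis by (simp only: hom_const_zero[OF module_familyD[OF famQ]])
      qed
    qed
    then show ?thesis by (simp add: filtered_families_def)
  qed
  define S where "S i = apply_family (Bmod ?P i) (Bmod ?Q (i - 1)) (- 1) (\<sigma> i)" for i
  have Si: "S i \<in> filtered_maps R (- 1) (Bmod ?P i) (Bmod ?Q (i - 1))" for i
    unfolding S_def by (rule apply_family_filtered[OF R famP famQ \<sigma>])
  then have S: "S \<in> Z_homotopies R ?P ?Q" by (simp add: Z_homotopies_def)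
  have Si1: "S (i + 1) \<in> filtered_maps R (- 1) (Bmod ?P (i + 1)) (Bmod ?Q i)" for i by (rule Z_homotopyD(2)[OF S])
  have S_single: "S i (single\<^sub>Z (Bmod ?P i) j x) (j - 1) = s0 i j x"
    "S i (single\<^sub>Z (Bmod ?P i) j x) j = \<kappa> j (i - j) x" if "x \<in> carrier (Smod X (i - j) j)" for i j x
    using apply_family_single[OF R famP famQ \<sigma>[of i], of x j 0] apply_family_single[OF R famP famQ \<sigma>[of i], of x j 1] that
    by (simp_all add: S_def \<sigma>_def BX)
  have D: "defect_maps ?P ?Q W S i \<in> filtered_maps R 1 (Bmod ?P i) (Bmod ?Q i)" for i
  proof -
    have "defect_maps ?P ?Q W S i \<in> filtered_maps R (- 1 + 2) (Bmod ?P i) (Bmod ?Q i)"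
    proof (rule filtered_map_raise[OF R famP famQ defect_filtered[OF R P Q Wf Wd S]])
      fix j x n assume "x \<in> carrier (Bmod ?P i j)" and n: "int n < 2"
      then have x: "x \<in> carrier (Smod X (i - j) j)" by (simp add: BX)
      let ?p = "i - j" and ?s = "single\<^sub>Z (Bmod ?P i) j x"
      have xP: "x \<in> carrier (Bmod ?P i j)" using x by (simp add: BX)
      have sP: "?s \<in> carrier (laurent (Bmod ?P i))" by (rule hom_closed[OF single_laurent[OF famP] xP])
      have Ws: "W i ?s (j - 1) = \<zero>\<^bsub>Bmod ?Q i (j - 1)\<^esub>"
        using filtered_mapD(2)[OF Wf sP starts_at_single] by (simp add: starts_at_def)
      have gs: "hat_map ?P ?Q g i ?s \<in> carrier (laurent (Bmod ?Q i))" by (rule hat_map_closed[OF R P Q g sP])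
      have W0: "W i ?s j = \<alpha> ?p j x \<oplus>\<^bsub>Smod Y ?p j\<^esub> \<ominus>\<^bsub>Smod Y ?p j\<^esub> \<beta> ?p j x"
        using Z_mapD(2)[OF R P Q f xP, of 0] Z_mapD(2)[OF R P Q g xP, of 0] f0[OF x] g0[OF x]
        by (simp add: W_def laurent_simps(3) laurent_module(2)[OF R famQ gs] BY)
      define y z where "y = S i ?s" and "z = Cdiff (hat_cpx ?P) i ?s"
      have y: "y \<in> carrier (laurent (Bmod ?Q (i - 1)))" and z: "z \<in> carrier (laurent (Bmod ?P (i + 1)))"
        unfolding y_def z_def by (rule hom_closed[OF filtered_mapD(1)[OF Si] sP] hat_diff_closed(1)[OF R P sP])+
      have ys: "starts_at (Bmod ?Q (i - 1)) (j - 1) y"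
        using filtered_mapD(2)[OF Si sP starts_at_single] by (simp add: y_def)
      have zs: "starts_at (Bmod ?P (i + 1)) j z"
        using filtered_mapD(2)[OF Z_complexD(3)[OF R P] sP starts_at_single] by (simp add: z_def)
      have y0: "y (j - 1) = s0 i j x" and y1: "y j = \<kappa> j ?p x" by (simp_all add: y_def S_single[OF x])
      have z0: "z j = S0 X ?p j x"
        using Z_complexD(4)[OF R P xP, of 0] by (simp add: z_def X0[OF x])
      have z1: "z (j + 1) = (if even i then S1 X ?p j x else \<ominus>\<^bsub>Smod X ?p (j + 1)\<^esub> S1 X ?p j x)"
        using Z_complexD(4)[OF R P xP, of 1] X1[OF x] by (simp add: z_def)
      have e: "i - 1 - (j - 1) = ?p" "i + 1 - j = ?p + 1" "i + 1 - (j + 1) = ?p" "i - 1 - j = ?p - 1" by simp_all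
      have dQ1: "Cdiff (hat_cpx ?Q) (i - 1) \<in> filtered_maps R 0 (Bmod ?Q (i - 1)) (Bmod ?Q i)"
        using Z_complexD(3)[OF R Q, of "i - 1"] by simp
      have s0x: "s0 i j x \<in> carrier (Smod Y ?p (j - 1))" by (rule hom_closed[OF s0 x])
      have \<kappa>x: "\<kappa> j ?p x \<in> carrier (Smod Y (?p - 1) j)" by (rule hom_closed[OF \<kappa> x])
      have hx: "h ?p j x \<in> carrier (Smod Y ?p (j - 1))" by (rule hom_closed[OF hh x])
      have S0x: "S0 X ?p j x \<in> carrier (Smod X (?p + 1) j)" by (rule hom_closed[OF S0X x])
      have S1x: "S1 X ?p j x \<in> carrier (Smod X ?p (j + 1))" by (rule hom_closed[OF S1X x])
      have S1h: "S1 Y ?p (j - 1) (h ?p j x) \<in> carrier (Smod Y ?p j)" by (rule hom_closed[OF S1Y' hx])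
      have hS1: "h ?p (j + 1) (S1 X ?p j x) \<in> carrier (Smod Y ?p j)" by (rule hom_closed[OF h1 S1x])
      have S0\<kappa>: "S0 Y (?p - 1) j (\<kappa> j ?p x) \<in> carrier (Smod Y ?p j)"
        using hom_closed[OF S0Y \<kappa>x] by simp
      have \<kappa>S0: "\<kappa> j (?p + 1) (S0 X ?p j x) \<in> carrier (Smod Y ?p j)"
        using hom_closed[OF \<kappa> S0x] by simp
      have S0h: "S0 Y ?p (j - 1) (h ?p j x) \<in> carrier (Smod Y (?p + 1) (j - 1))" by (rule hom_closed[OF S0Y hx])
      have \<beta>x: "\<beta> ?p j x \<in> carrier (Smod Y ?p j)"
        using hom_closed[OF chain_mapD(1)[OF SumT_mapD(1)[OF \<beta> X Y, of j]], of x ?p] x by simp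
      have bc: "boundary_maps ?P ?Q S i ?s \<in> carrier (laurent (Bmod ?Q i))"
        by (rule hom_closed[OF filtered_mapD(1)[OF boundary_filtered[OF R P Q Wf Wd Si]] sP])
      have b_eq: "boundary_maps ?P ?Q S i ?s l =
          Cdiff (hat_cpx ?Q) (i - 1) y l \<oplus>\<^bsub>Bmod ?Q i l\<^esub> S (i + 1) z l" for l
        by (simp add: boundary_maps_def laurent_simps y_def z_def)
      have d_eq: "defect_maps ?P ?Q W S i ?s l = W i ?s l \<oplus>\<^bsub>Bmod ?Q i l\<^esub> \<ominus>\<^bsub>Bmod ?Q i l\<^esub> boundary_maps ?P ?Q S i ?s l" for l
        by (simp add: defect_maps_def laurent_simps(3) laurent_module(2)[OF R famQ bc])
      have "n = 0 \<or> n = 1" using n by auto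
      then show "defect_maps ?P ?Q W S i ?s (j + - 1 + int n) = \<zero>\<^bsub>Bmod ?Q i (j + - 1 + int n)\<^esub>"
      proof
        (* Degree j - 1, to which W does not contribute: d_0 s0 + s0 d_0 = 0. *)
        assume "n = 0"
        have "Cdiff (hat_cpx ?Q) (i - 1) y (j - 1) = Bdiff LY 0 ?p (j - 1) (s0 i j x)"
          using filtered_map_leading[OF R famQ famQ dQ1 y ys]
            Z_complexD(4)[OF R Q laurent_closed[OF y], of "j - 1" 0] by (simp add: y0)
        then have 1: "Cdiff (hat_cpx ?Q) (i - 1) y (j - 1) = S0 Y ?p (j - 1) (s0 i j x)"
          by (simp only: Y0[OF s0x])
        have "S (i + 1) z (j - 1) = S (i + 1) (single\<^sub>Z (Bmod ?P (i + 1)) j (z j)) (j - 1)"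
          using filtered_map_leading[OF R famP famQ Si1 z zs] by simp
        also have "\<dots> = s0 (i + 1) j (z j)"
          by (rule S_single(1)) (use S0x in \<open>simp only: z0 e\<close>)
        finally have 2: "S (i + 1) z (j - 1) = s0 (i + 1) j (S0 X ?p j x)" by (simp only: z0)
        have p1: "Smod Y (i - (j - 1)) (j - 1) = Smod Y (?p + 1) (j - 1)" by (simp add: algebra_simps)
        interpret G: abelian_group "Smod Y (?p + 1) (j - 1)" by (rule Ygrp)
        have "boundary_maps ?P ?Q S i ?s (j - 1) = \<zero>\<^bsub>Smod Y (?p + 1) (j - 1)\<^esub>"
          unfolding b_eq 1 2 Bmod_Psi BY p1 s0_def e
          using S0h hd[OF x] hom_minus[OF S0Y Ygrp Ygrp hx] by (simp add: G.l_neg G.r_neg)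
        then show ?thesis
          using Ws unfolding d_eq by (simp add: \<open>n = 0\<close> BY p1 G.neg_zero)
      next
        (* Degree j: alpha - beta = (d_1 s0 + s0 d_1) + (d_0 kappa + kappa d_0). *)
        assume "n = 1"
        note ysp = laurent_split_first[OF R famQ famQ[of i] y ys] and zsp = laurent_split_first[OF R famP famP[of i] z zs]
        interpret G: abelian_group "Smod Y ?p j" by (rule Ygrp)
        have "Cdiff (hat_cpx ?Q) (i - 1) y j =
            Cdiff (hat_cpx ?Q) (i - 1) (single\<^sub>Z (Bmod ?Q (i - 1)) (j - 1) (y (j - 1))) j \<oplus>\<^bsub>Bmod ?Q i j\<^esub>
            Cdiff (hat_cpx ?Q) (i - 1) (y(j - 1 := \<zero>\<^bsub>Bmod ?Q (i - 1) (j - 1)\<^esub>)) j"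
          by (rule filtered_map_split_first[OF R famQ famQ dQ1 y ys])
        also have "Cdiff (hat_cpx ?Q) (i - 1) (single\<^sub>Z (Bmod ?Q (i - 1)) (j - 1) (y (j - 1))) j = Bdiff LY 1 ?p (j - 1) (s0 i j x)"
          using Z_complexD(4)[OF R Q laurent_closed[OF y], of "j - 1" 1] by (simp add: y0)
        also have "\<dots> = S1 Y ?p (j - 1) (h ?p j x)"
          unfolding Y1[OF s0x] using hx S1h hom_minus[OF S1Y' Ygrp Ygrp hx] by (simp add: s0_def)
        also have "Cdiff (hat_cpx ?Q) (i - 1) (y(j - 1 := \<zero>\<^bsub>Bmod ?Q (i - 1) (j - 1)\<^esub>)) j = Bdiff ?Q 0 (i - 1) j (y j)"
          using filtered_map_leading[OF R famQ famQ dQ1 ysp(1,2)]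
            Z_complexD(4)[OF R Q laurent_closed[OF y], of j 0] by simp
        also have "\<dots> = S0 Y (?p - 1) j (\<kappa> j ?p x)"
          unfolding Bdiff_Psi e y1 by (rule Y0[OF \<kappa>x])
        finally have 1: "Cdiff (hat_cpx ?Q) (i - 1) y j =
            S1 Y ?p (j - 1) (h ?p j x) \<oplus>\<^bsub>Smod Y ?p j\<^esub> S0 Y (?p - 1) j (\<kappa> j ?p x)" by (simp add: BY)
        have "S (i + 1) z j = S (i + 1) (single\<^sub>Z (Bmod ?P (i + 1)) j (z j)) j \<oplus>\<^bsub>Bmod ?Q i j\<^esub>
            S (i + 1) (z(j := \<zero>\<^bsub>Bmod ?P (i + 1) j\<^esub>)) j"
          by (rule filtered_map_split_first[OF R famP famQ Si1 z zs])
        also have "S (i + 1) (single\<^sub>Z (Bmod ?P (i + 1)) j (z j)) j = \<kappa> j (i + 1 - j) (z j)"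
          by (rule S_single(2)) (use S0x in \<open>simp only: z0 e\<close>)
        also have "S (i + 1) (z(j := \<zero>\<^bsub>Bmod ?P (i + 1) j\<^esub>)) j = S (i + 1) (single\<^sub>Z (Bmod ?P (i + 1)) (j + 1) (z (j + 1))) j"
          using filtered_map_leading[OF R famP famQ Si1 zsp(1,2)] by simp
        also have "\<dots> = s0 (i + 1) (j + 1) (z (j + 1))"
          using S_single(1)[of "z (j + 1)" "i + 1" "j + 1"] laurent_closed[OF z, of "j + 1"] by (simp add: BX)
        also have "\<dots> = h ?p (j + 1) (S1 X ?p j x)"
          unfolding s0_def z1 e using S1x hS1 hom_minus[OF h1 Xgrp Ygrp S1x] by simp
        finally have 2: "S (i + 1) z j = \<kappa> j (?p + 1) (S0 X ?p j x) \<oplus>\<^bsub>Smod Y ?p j\<^esub> h ?p (j + 1) (S1 X ?p j x)"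
          unfolding z0 e Bmod_Psi BY .
        have "W i ?s j = boundary_maps ?P ?Q S i ?s j"
          unfolding W0 \<alpha>_eq[OF x] b_eq 1 2 Bmod_Psi BY
          using \<beta>x S1h hS1 S0\<kappa> \<kappa>S0 G.add_neg_cancel[OF \<beta>x, of "(S1 Y ?p (j - 1) (h ?p j x) \<oplus>\<^bsub>Smod Y ?p j\<^esub> h ?p (j + 1) (S1 X ?p j x))
            \<oplus>\<^bsub>Smod Y ?p j\<^esub> (S0 Y (?p - 1) j (\<kappa> j ?p x) \<oplus>\<^bsub>Smod Y ?p j\<^esub> \<kappa> j (?p + 1) (S0 X ?p j x))"]
          by (simp add: G.a_ac)
        moreover have "boundary_maps ?P ?Q S i ?s j \<in> carrier (Smod Y ?p j)"
          using laurent_closed[OF bc, of j] by (simp add: BY)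
        ultimately show ?thesis unfolding d_eq by (simp add: \<open>n = 1\<close> BY G.r_neg)
      qed
    qed
    then show ?thesis by simp
  qed
  obtain H where H: "H \<in> Z_homotopies R ?P ?Q" and hb: "homotopy_between (hat_cpx ?P) (hat_cpx ?Q) H W (zero_map (hat_cpx ?Q))"
    using homotopy_by_successive_corrections[OF R P Q Wf Wd S D null_in_degree_Psi] by auto
  have "homotopy_between (hat_cpx ?P) (hat_cpx ?Q) H (hat_map ?P ?Q f) (hat_map ?P ?Q g)"
    unfolding homotopy_between_def Cmod_hat
  proof (intro allI ballI)
    fix i x assume x: "x \<in> carrier (laurent (Bmod ?P i))"
    interpret G: abelian_group "laurent (Bmod ?Q i)" by (rule hat_group[OF R Q])
    have cl: "Cdiff (hat_cpx ?Q) (i - 1) (H i x) \<in> carrier (laurent (Bmod ?Q i))"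
      "H (i + 1) (Cdiff (hat_cpx ?P) i x) \<in> carrier (laurent (Bmod ?Q i))"
      by (rule hom_closed[OF hat_diff_hom(3)[OF R Q] hom_closed[OF filtered_mapD(1)[OF Z_homotopyD(1)[OF H]] x]]
          hom_closed[OF filtered_mapD(1)[OF Z_homotopyD(2)[OF H]] hat_diff_closed(1)[OF R P x]])+
    have "W i x = zero_map (hat_cpx ?Q) i x \<oplus>\<^bsub>laurent (Bmod ?Q i)\<^esub>
        (Cdiff (hat_cpx ?Q) (i - 1) (H i x) \<oplus>\<^bsub>laurent (Bmod ?Q i)\<^esub> H (i + 1) (Cdiff (hat_cpx ?P) i x))"
      using hb x unfolding homotopy_between_def Cmod_hat by blast
    then have "W i x = Cdiff (hat_cpx ?Q) (i - 1) (H i x) \<oplus>\<^bsub>laurent (Bmod ?Q i)\<^esub> H (i + 1) (Cdiff (hat_cpx ?P) i x)"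
      using cl by (simp add: zero_map_def)
    moreover have "hat_map ?P ?Q f i x = hat_map ?P ?Q g i x \<oplus>\<^bsub>laurent (Bmod ?Q i)\<^esub> W i x"
      using hat_map_closed[OF R P Q f x] hat_map_closed[OF R P Q g x] by (simp add: W_def G.add_neg_cancel)
    ultimately show "hat_map ?P ?Q f i x = hat_map ?P ?Q g i x \<oplus>\<^bsub>laurent (Bmod ?Q i)\<^esub>
        (Cdiff (hat_cpx ?Q) (i - 1) (H i x) \<oplus>\<^bsub>laurent (Bmod ?Q i)\<^esub> H (i + 1) (Cdiff (hat_cpx ?P) i x))"
      by simp
  qed
  then show ?thesis by (rule eta_homotopy_relI[OF R f g H])
qed

end

section \<open>The total complex as \<open>\<Xi> \<circ> \<Psi>\<close>\<close>

text \<open>The entry of the triangular matrix from degree \<open>j\<close> to degree \<open>k\<close> belongs to the homogeneous part of index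
  \<open>n = k - j\<close>, so one sum arises from the other by reindexing.\<close>

lemma homogeneous_sum_eq_triangular_map:
  assumes N: "\<And>k. abelian_group (N k)" and f: "\<And>n j. f n j \<in> rmod_hom R (M j) (N (j + int n))"
  shows "homogeneous_sum M N f = triangular_map M N f"
  unfolding homogeneous_sum_def triangular_map_def
proof (rule restrict_ext, rule ext)
  fix x k assume x: "x \<in> carrier (direct_sum UNIV M)"
  interpret N: abelian_group "N k" by (rule N)
  have xj: "x j \<in> carrier (M j)" for j using x by (auto simp: direct_sum_simps)
  have fin: "finite {j. x j \<noteq> \<zero>\<^bsub>M j\<^esub>}" using x by (simp add: direct_sum_simps)
  let ?g = "\<lambda>j. if j \<le> k then f (nat (k - j)) j (x j) else \<zero>\<^bsub>N k\<^esub>"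
  let ?A = "{n. x (k - int n) \<noteq> \<zero>\<^bsub>M (k - int n)\<^esub>}"
  have g: "?g j \<in> carrier (N k)" for j
    using hom_closed[OF f xj, of "nat (k - j)" j] by (cases "j \<le> k") simp_all
  have image: "(\<lambda>n. k - int n) ` ?A = {j. x j \<noteq> \<zero>\<^bsub>M j\<^esub> \<and> j \<le> k}"
  proof (intro equalityI subsetI)
    fix j assume "j \<in> {j. x j \<noteq> \<zero>\<^bsub>M j\<^esub> \<and> j \<le> k}"
    then show "j \<in> (\<lambda>n. k - int n) ` ?A" by (intro image_eqI[of _ _ "nat (k - j)"]) auto
  qed auto
  have "(\<Oplus>\<^bsub>N k\<^esub>n\<in>?A. f n (k - int n) (x (k - int n))) = (\<Oplus>\<^bsub>N k\<^esub>n\<in>?A. ?g (k - int n))"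
  proof (intro N.finsum_cong')
    fix n show "f n (k - int n) (x (k - int n)) = ?g (k - int n)" by simp
  qed (use g in \<open>simp_all only: Pi_def mem_Collect_eq, simp_all\<close>)
  also have "\<dots> = (\<Oplus>\<^bsub>N k\<^esub>j\<in>{j. x j \<noteq> \<zero>\<^bsub>M j\<^esub> \<and> j \<le> k}. ?g j)"
    unfolding image[symmetric] by (rule N.finsum_reindex[symmetric]) (use g in \<open>auto simp: inj_on_def\<close>)
  also have "\<dots> = (\<Oplus>\<^bsub>N k\<^esub>j\<in>{j. x j \<noteq> \<zero>\<^bsub>M j\<^esub>}. ?g j)"
    by (intro N.finsum_superset fin) (use g in auto)
  finally show "(\<Oplus>\<^bsub>N k\<^esub>n\<in>?A. f n (k - int n) (x (k - int n))) = (\<Oplus>\<^bsub>N k\<^esub>j\<in>{j. x j \<noteq> \<zero>\<^bsub>M j\<^esub>}. ?g j)" .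
qed

lemma projective_group: "projective_module R M \<Longrightarrow> abelian_group M"
  by (auto simp: projective_module_def intro: right_module_group)

lemma Tot_obj_eq_Xi_Psi:
  assumes "X \<in> G_objects R"
  shows "Tot_obj X = Xi_obj (Psi_obj X)"
proof -
  have "homogeneous_sum (\<lambda>q. Bmod X (m - q) q) (\<lambda>q. Bmod X (m + 1 - q) q) (\<lambda>n q. Bdiff X n (m - q) q) =
      triangular_map (\<lambda>q. Bmod X (m - q) q) (\<lambda>q. Bmod X (m + 1 - q) q) (\<lambda>n q. Bdiff X n (m - q) q)" for m
  proof (rule homogeneous_sum_eq_triangular_map)
    show "abelian_group (Bmod X (m + 1 - k) k)" for k using assms by (auto simp: G_objects_def intro: projective_group)
    have "m + 1 - (j + int n) = m - j + 1 - int n" for j and n :: nat by simp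
    then show "Bdiff X n (m - j) j \<in> rmod_hom R (Bmod X (m - j) j) (Bmod X (m + 1 - (j + int n)) (j + int n))" for n j
      using assms by (simp only: G_objects_def mem_Collect_eq)
  qed
  then show ?thesis by (simp add: Tot_obj_def Xi_obj_def Psi_obj_def)
qed

lemma Tot_map_eq_Xi_Psi:
  assumes Y: "Y \<in> G_objects R" and \<alpha>: "\<alpha> \<in> G_maps R X Y"
  shows "Tot_map X Y \<alpha> = Xi_map (Psi_obj X) (Psi_obj Y) (Psi_map \<alpha>)"
proof
  fix m
  have "homogeneous_sum (\<lambda>q. Bmod X (m - q) q) (\<lambda>q. Bmod Y (m - q) q) (\<lambda>n q. \<alpha> n (m - q) q) =
      triangular_map (\<lambda>q. Bmod X (m - q) q) (\<lambda>q. Bmod Y (m - q) q) (\<lambda>n q. \<alpha> n (m - q) q)"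
  proof (rule homogeneous_sum_eq_triangular_map)
    show "abelian_group (Bmod Y (m - k) k)" for k using Y by (auto simp: G_objects_def intro: projective_group)
    have "m - (j + int n) = m - j - int n" for j and n :: nat by simp
    then show "\<alpha> n (m - j) j \<in> rmod_hom R (Bmod X (m - j) j) (Bmod Y (m - (j + int n)) (j + int n))" for n j
      using \<alpha> by (simp only: G_maps_def mem_Collect_eq)
  qed
  then show "Tot_map X Y \<alpha> m = Xi_map (Psi_obj X) (Psi_obj Y) (Psi_map \<alpha>) m"
    by (simp add: Tot_map_def Xi_map_def Psi_obj_def Psi_map_def)
qed

section \<open>\<open>\<Theta>\<close> as a functor\<close>

text \<open>Where \<open>T\<close> is zero, so are the direct sums of copies of \<open>T\<close>; the bounds of \<open>T\<close> therefore apply to all columns at once.\<close>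

lemma SumT_complex_bounded:
  assumes T: "tilting_complex R T"
  obtains a b where "\<And>X :: ('r, 'x) sumT_cpx. \<And>i j. \<lbrakk>X \<in> SumT_complexes R T; i < a \<or> b < i\<rbrakk> \<Longrightarrow> zero_module (Smod X i j)"
proof -
  have Tp: "T \<in> perfect_complexes R" using T by (simp add: tilting_complex_def)
  then have Tc: "T \<in> module_complexes R" by (auto simp: perfect_complexes_def intro: proj_module_complex)
  obtain a b where ab: "\<And>i. i < a \<or> b < i \<Longrightarrow> zero_module (Cmod T i)"
    using Tp by (auto simp: perfect_complexes_def bounded_cpx_def)
  have "zero_module (Smod X i j)" if X: "X \<in> SumT_complexes R T" and i: "i < a \<or> b < i" for X :: "('r, 'x) sumT_cpx" and i j
  proof -
    obtain I :: "'x set" where "cpx_isomorphic R (cpx_copies I T) (col X j)"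
      using SumT_complexD(1)[OF X, of j] by (auto simp: Sum_T_def)
    then obtain f g where f: "f \<in> chain_maps R (cpx_copies I T) (col X j)" and g: "g \<in> chain_maps R (col X j) (cpx_copies I T)"
      and fg: "\<And>i y. y \<in> carrier (Smod X i j) \<Longrightarrow> f i (g i y) = y"
      unfolding cpx_isomorphic_def by (auto simp del: copies_simps)
    interpret G: abelian_group "Smod X i j"
      using module_complexD(2)[OF SumT_complexD(2)[OF X, of j], of i] by simp
    have f0: "f i \<zero>\<^bsub>direct_sum I (\<lambda>_. Cmod T i)\<^esub> = \<zero>\<^bsub>Smod X i j\<^esub>"
      using hom_zero[OF chain_mapD(1)[OF f] module_complexD(2)[OF copies_module_complex[OF Tc]]] G.abelian_group_axioms by simp
    have "y = \<zero>\<^bsub>Smod X i j\<^esub>" if y: "y \<in> carrier (Smod X i j)" for y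
    proof -
      have "g i y \<in> carrier (direct_sum I (\<lambda>_. Cmod T i))"
        using hom_closed[OF chain_mapD(1)[OF g, of i], of y] y by simp
      then have "g i y = \<zero>\<^bsub>direct_sum I (\<lambda>_. Cmod T i)\<^esub>"
        using ab[OF i] by (auto simp: direct_sum_simps zero_module_def PiE_iff fun_eq_iff extensional_def)
      then show ?thesis using fg[OF y] f0 by simp
    qed
    then show ?thesis by (auto simp: zero_module_def)
  qed
  then show thesis by (rule that)
qed

text \<open>In total degree \<open>i\<close> the component of index \<open>j\<close> lies in degree \<open>i - j\<close> of a column, which is nonzero only for \<open>a \<le> i - j \<le> b\<close>.\<close>

lemma locally_finite_Psi:
  assumes T: "tilting_complex R T" and X: "X \<in> SumT_complexes R T" and LX: "Bmod LX = Smod X"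
  shows "locally_finite (Psi_obj LX)"
  unfolding locally_finite_def
proof
  fix i
  obtain a b where ab: "\<And>i j. i < a \<or> b < i \<Longrightarrow> zero_module (Smod X i j)"
    using SumT_complex_bounded[OF T] X by metis
  have "{j. \<not> zero_module (Bmod (Psi_obj LX) i j)} \<subseteq> {i - b..i - a}"
    using ab[of "i - _"] by (force simp: LX not_le)
  then show "finite {j. \<not> zero_module (Bmod (Psi_obj LX) i j)}" by (rule finite_subset) simp
qed

lemma Rickard_choiceD:
  assumes "Rickard_choice R T LO LM" and "X \<in> SumT_complexes R T"
  shows "LO X \<in> G_objects R" "Bmod (LO X) = Smod X"
    "x \<in> carrier (Smod X i j) \<Longrightarrow> Bdiff (LO X) 0 i j x = S0 X i j x"
    "x \<in> carrier (Smod X i j) \<Longrightarrow> Bdiff (LO X) 1 i j x =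
      (if even (i + j) then S1 X i j x else \<ominus>\<^bsub>Smod X i (j + 1)\<^esub> S1 X i j x)"
  using assms unfolding Rickard_choice_def by blast+

lemma Rickard_choice_mapD:
  assumes "Rickard_choice R T LO LM" and "X \<in> SumT_complexes R T" "Y \<in> SumT_complexes R T" "\<alpha> \<in> SumT_maps R X Y"
  shows "LM X Y \<alpha> \<in> G_maps R (LO X) (LO Y)"
    "x \<in> carrier (Smod X i j) \<Longrightarrow> LM X Y \<alpha> 0 i j x = \<alpha> i j x"
  using assms unfolding Rickard_choice_def by blast+

text \<open>Compatibility with the relations, identities and composites are three instances of the uniqueness of lifts:
  in each case two maps are compared whose components of index \<open>0\<close> represent homotopic (in the last two cases equal) morphisms.\<close>

lemma quotient_functor_Theta:
  assumes R: "ring R" and T: "tilting_complex R T" and ch: "Rickard_choice R T LO LM"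
  shows "quotient_functor (SumT_complexes R T) (SumT_maps R) (SumT_rel R)
     (\<lambda>X i j x. x) (\<lambda>X Y Z \<beta> \<alpha> i j x. \<beta> i j (\<alpha> i j x))
     (Z_complexes R) (Z_maps R) (eta_stable_rel R :: ('r, 'x) bigraded \<Rightarrow> _) Z_id (\<lambda>X Y Z. Z_comp Z)
     (\<lambda>X. Psi_obj (LO X)) (\<lambda>X Y \<alpha>. Psi_map (LM X Y \<alpha>))"
proof -
  note LO = Rickard_choiceD[OF ch] and LM = Rickard_choice_mapD[OF ch]
  have PO: "Psi_obj (LO X) \<in> Z_complexes R" if "X \<in> SumT_complexes R T" for X
    by (rule Psi_obj_complex[OF LO(1)[OF that]])
  have PM: "Psi_map (LM X Y \<alpha>) \<in> Z_maps R (Psi_obj (LO X)) (Psi_obj (LO Y))"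
    if "X \<in> SumT_complexes R T" "Y \<in> SumT_complexes R T" "\<alpha> \<in> SumT_maps R X Y" for X Y \<alpha>
    by (rule Psi_map_Z_map[OF LM(1)[OF that]])
  have PM0: "Psi_map (LM X Y \<alpha>) 0 i j x = \<alpha> (i - j) j x"
    if "X \<in> SumT_complexes R T" "Y \<in> SumT_complexes R T" "\<alpha> \<in> SumT_maps R X Y" "x \<in> carrier (Smod X (i - j) j)"
    for X Y \<alpha> i j x
    using LM(2)[OF that] by (simp add: Psi_map_def)
  have lift: "(f, g) \<in> eta_stable_rel R (Psi_obj (LO X)) (Psi_obj (LO Y))"
    if X: "X \<in> SumT_complexes R T" and Y: "Y \<in> SumT_complexes R T"
      and fg: "f \<in> Z_maps R (Psi_obj (LO X)) (Psi_obj (LO Y))" "g \<in> Z_maps R (Psi_obj (LO X)) (Psi_obj (LO Y))"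
      "\<And>i j x. x \<in> carrier (Smod X (i - j) j) \<Longrightarrow> f 0 i j x = \<alpha> (i - j) j x"
      "\<And>i j x. x \<in> carrier (Smod X (i - j) j) \<Longrightarrow> g 0 i j x = \<beta> (i - j) j x"
      "(\<alpha>, \<beta>) \<in> SumT_rel R X Y" for X Y f g \<alpha> \<beta>
    unfolding eta_stable_rel_iff[OF R PO[OF X] PO[OF Y]]
    by (rule Psi_maps_homotopic[OF R T X Y LO(1)[OF X] LO(1)[OF Y] LO(2)[OF X] LO(2)[OF Y] LO(3,4)[OF X] LO(3,4)[OF Y] fg])
  show ?thesis
  proof (intro quotient_functor.intro quotient_functor_axioms.intro quotient_category_K_SumT quotient_category_K_eta[OF R], goal_cases)
    case (1 X)
    then show ?case by (rule PO)
  next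
    case (2 X Y \<alpha>)
    then show ?case by (rule PM)
  next
    case (3 X Y \<alpha> \<beta>)
    then have ab: "\<alpha> \<in> SumT_maps R X Y" "\<beta> \<in> SumT_maps R X Y" by (simp_all add: SumT_rel_def)
    show ?case
      by (rule lift[OF 3(1,2) PM[OF 3(1,2) ab(1)] PM[OF 3(1,2) ab(2)] PM0[OF 3(1,2) ab(1)] PM0[OF 3(1,2) ab(2)] 3(3)])
  next
    case (4 X)
    note id = SumT_map_id[OF 4]
    show ?case
      by (rule lift[OF 4 4 PM[OF 4 4 id] hat_map_id(1)[OF R PO[OF 4]] PM0[OF 4 4 id] _ SumT_rel_refl[OF 4 4 id]])
        (simp_all add: Z_id_def)
  next
    case (5 X Y Z \<alpha> \<beta>)
    note X = 5(1) and Y = 5(2) and Z = 5(3) and \<alpha> = 5(4) and \<beta> = 5(5)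
    note \<beta>\<alpha> = SumT_map_comp[OF X Y Z \<alpha> \<beta>]
    have "Z_comp (Psi_obj (LO Z)) (Psi_map (LM Y Z \<beta>)) (Psi_map (LM X Y \<alpha>)) 0 i j x = \<beta> (i - j) j (\<alpha> (i - j) j x)"
      if x: "x \<in> carrier (Smod X (i - j) j)" for i j x
    proof -
      have \<alpha>x: "\<alpha> (i - j) j x \<in> carrier (Smod Y (i - j) j)"
        using hom_closed[OF chain_mapD(1)[OF SumT_mapD(1)[OF \<alpha> X Y, of j]], of x "i - j"] x by simp
      interpret G: abelian_group "Smod Z (i - j) j"
        using module_complexD(2)[OF SumT_complexD(2)[OF Z, of j], of "i - j"] by simp
      have "\<beta> (i - j) j (\<alpha> (i - j) j x) \<in> carrier (Smod Z (i - j) j)"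
        using hom_closed[OF chain_mapD(1)[OF SumT_mapD(1)[OF \<beta> Y Z, of j]], of _ "i - j"] \<alpha>x by simp
      then show ?thesis
        by (simp add: Z_comp_def PM0[OF X Y \<alpha> x] PM0[OF Y Z \<beta> \<alpha>x] LO(2)[OF Z])
    qed
    then show ?case
      by (intro lift[OF X Z PM[OF X Z \<beta>\<alpha>] hat_map_comp(1)[OF R PO[OF X] PO[OF Y] PO[OF Z] PM[OF X Y \<alpha>] PM[OF Y Z \<beta>]]
          PM0[OF X Z \<beta>\<alpha>] _ SumT_rel_refl[OF X Z \<beta>\<alpha>]])
  qed
qed

theorem theorem4p9:
  fixes R :: "('r, 'q) ring_scheme"
    and T :: "('r, 'm) cpx"
    and LO :: "('r, 'x) sumT_cpx \<Rightarrow> ('r, 'x) bigraded"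
    and LM :: "('r, 'x) sumT_cpx \<Rightarrow> ('r, 'x) sumT_cpx \<Rightarrow> (int \<Rightarrow> int \<Rightarrow> 'x \<Rightarrow> 'x) \<Rightarrow> ('x, 'x) gmap"
  assumes "ring R"
    and "tilting_complex R T"
    and "Rickard_choice R T LO LM"
  shows "is_functor (K_SumT R T) (K_Proj R) (Phi_functor R LO LM)
    \<and> is_functor (K_SumT R T) (K_eta R) (Theta_functor R LO LM)
    \<and> (\<forall>X\<in>Obj (K_SumT R T). fobj (Theta_functor R LO LM) X \<in> Obj (K_eta_fin R))
    \<and> is_functor (K_eta_fin R :: (('r, 'x) bigraded, ('x, 'x) gmap set) cat) (K_Proj R)
        (Xi_functor R)
    \<and> functor_eq (K_SumT R T) (Phi_functor R LO LM)
        (functor_comp (Xi_functor R) (Theta_functor R LO LM))"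
proof -
  note R = assms(1) and T = assms(2) and LO = Rickard_choiceD[OF assms(3)] and LM = Rickard_choice_mapD[OF assms(3)]
  note Theta = quotient_functor_Theta[OF R T assms(3)]
  have fin: "locally_finite (Psi_obj (LO X))" if "X \<in> SumT_complexes R T" for X
    by (rule locally_finite_Psi[OF T that LO(2)[OF that]])
  note Theta_fin = quotient_functor.restrict_codomain[OF Theta, of locally_finite, OF fin]
  have F: "is_functor (K_SumT R T) (K_eta_fin R) (Theta_functor R LO LM)"
    unfolding K_SumT_def K_eta_fin_quotient Theta_functor_def
    by (rule quotient_functor.is_functor_induced[OF Theta_fin])
  have Xi: "is_functor (K_eta_fin R :: (('r, 'x) bigraded, ('x, 'x) gmap set) cat) (K_Proj R) (Xi_functor R)"
    by (rule is_functor_Xi[OF R])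
  have eq: "functor_eq (K_SumT R T) (Phi_functor R LO LM) (functor_comp (Xi_functor R) (Theta_functor R LO LM))"
    unfolding K_SumT_def Phi_functor_def Xi_functor_def Theta_functor_def
    by (rule quotient_functor.functor_comp_induced[OF Theta_fin quotient_functor_Xi[OF R]])
      (simp_all add: Tot_obj_eq_Xi_Psi[OF LO(1)] Tot_map_eq_Xi_Psi[OF LO(1) LM(1)])
  have "is_functor (K_SumT R T) (K_eta R) (Theta_functor R LO LM)"
    unfolding K_SumT_def K_eta_def Theta_functor_def
    by (rule quotient_functor.is_functor_induced[OF Theta])
  moreover have "\<forall>X\<in>Obj (K_SumT R T). fobj (Theta_functor R LO LM) X \<in> Obj (K_eta_fin R)"
    using F unfolding is_functor_def by blast
  ultimately show ?thesis
    using is_functor_cong[OF is_functor_comp[OF F Xi] eq] Xi eq by blast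
qed

end
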